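(* Let $R$ be a commutative ring with unity, let $p$ be a prime, let $G$ be a finite $p$-group and let $\mathcal{A}_p(G)$ be the Quillen category of $G$ over all nontrivial elementary abelian $p$-subgroups of $G$. Then for every destriction functor or biset functor $F$ for $G$ over $R$ there is an isomorphism $$\widetilde{H}^*(\mathcal{D}_G^*;F)\cong\widetilde{H}^*(\mathcal{A}_p(G);\overline{F}).$$ In particular, $\mathrm{Obs}(F(G))\cong\widetilde{H}^0(\mathcal{A}_p(G);\overline{F})$.
   Context: Sections. A section of $G$ is a pair $(U,V)$ with $V\trianglelefteq U\le G$. Write $(U,V)\preceq(M,L)$ if $L\le V\le U\le M$. A collection $\mathcal{C}$ is a conjugation-closed set of sections. The category $\mathcal{D}_G^{\mathcal{C}}$ has objects $\mathcal{C}$, morphisms $\mathrm{Hom}((U,V),(M,L))=\{Mg: g\in G,\ {}^g(U,V)\preceq(M,L)\}$ and composition $Nh\circ Mg=Nhg$. $\mathcal{D}_G$ uses all sections; $\mathcal{D}_G^*$ uses the sections with $V\ne1$. An $R\mathcal{D}_G^{\mathcal{C}}$-module is a contravariant functor to $R$-modules; $F(U/V):=F((U,V))$, $F(G):=F((G,1))$. Functors. The $R$-biset category has objects finite groups, morphisms $H\to K$ given by $R\otimes B(K,H)$ (Burnside group of $(K,H)$-bisets), composition induced by $X\times_HY$. A biset functor for $G$ over $R$ is an $R$-linear functor to $R$-modules from the $R$-biset category on the quotient groups $U/V$ indexed by sections of $G$. A destriction functor for $G$ over $R$ is equivalently an $R\mathcal{D}_G$-module. A biset functor is regarded as an $R\mathcal{D}_G$-module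 by letting $Mg:(U,V)\to(M,L)$ act as restriction from $M/L$ to ${}^gU/L$, then deflation to ${}^gU/{}^gV$, then the isomorphism to $U/V$ induced by conjugation by $g^{-1}$. $\mathrm{Defres}^{M/L}_{U/V}$ is the map induced by $M\cdot1$ (written $\mathrm{Res}$ if $V=L$). Reduced cohomology of $\mathcal{D}_G^{\mathcal{C}}$. For an $R\mathcal{D}_G$-module $F$: $\widetilde{H}^n(\mathcal{D}_G^{\mathcal{C}};F)=\mathrm{Ext}^n_{R\mathcal{D}_G^{\mathcal{C}}}(\underline{R},F)$ for $n\ge1$ ($\underline{R}$ the constant functor), while $\widetilde{H}^{-1}$ and $\widetilde{H}^0$ are the kernel and cokernel of $F(G)\to\varprojlim_{(U,V)\in\mathcal{D}_G^{\mathcal{C}}}F(U/V)$, $f\mapsto(\mathrm{Defres}^G_{U/V}f)$. Quillen category. $\mathcal{A}_p(G)$ has objects the nontrivial elementary abelian $p$-subgroups of $G$, and morphisms $E_1\to E_2$ the homomorphisms that are compositions of conjugations by elements of $G$ and inclusions. $\mathcal{A}_p'$ is the same with the trivial subgroup added. The covariant functor $\overline{F}$ on $\mathcal{A}_p'$ is $\overline{F}(E)=F(C_G(E)/E)$; the morphism $E_1\to E_2$, $x\mapsto gxg^{-1}$, acts by the map of $F$ induced by $C_G(E_1)g^{-1}:(C_G(E_2),E_2)\to(C_G(E_1),E_1)$. For a covariant $R\mathcal{A}_p'$-module $M$, $\widetilde{H}^i(\mathcal{A}_p(G);M)$ is the cohomology of the cochain complex obtained by applying $\mathrm{Hom}_{R\mathcal{A}_p'}(-,M)$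 to $\cdots\to P_1\to P_0\to\underline{R}\to0$ with $\underline{R}$ (constant functor on $\mathcal{A}_p'$) in degree $-1$, where $P_*$ is a projective resolution of the constant functor of $\mathcal{A}_p(G)$ extended by zero at the trivial subgroup, viewed as a subfunctor of $\underline{R}$. Obstruction group. With $N_G(H,K)=N_G(H)\cap N_G(K)$, a gluing data for $F(G)$ is a tuple $(f_H)_{1<H\le G}$, $f_H\in F(N_G(H)/H)$, with ${}^gf_H=f_{{}^gH}$ for all $g\in G$ and $\mathrm{Defres}^{N_G(K)/K}_{N_G(H,K)/H}f_K=\mathrm{Res}^{N_G(H)/H}_{N_G(H,K)/H}f_H$ for all $1<K\trianglelefteq H\le G$. $\mathrm{Obs}(F(G))$ is the cokernel of the map from $F(G)$ to the module of gluing data sending $f$ to $(\mathrm{Defres}^G_{N_G(H)/H}f)_H$. *)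

theory Defs
  imports "HOL-Algebra.Module" "HOL-Algebra.AbelCoset" "HOL-Algebra.Group_Action" "HOL-Computational_Algebra.Primes"
begin

section \<open>Modules\<close>

text \<open>
  Modules are those of \<^theory>\<open>HOL-Algebra.Module\<close>. The record type inherits the ring
  fields \<open>mult\<close> and \<open>one\<close>, which \<^const>\<open>module\<close> ignores; they are left undefined below.
\<close>

definition mod_hom :: "'r ring \<Rightarrow> ('r, 'a) module \<Rightarrow> ('r, 'b) module \<Rightarrow> ('a \<Rightarrow> 'b) set" where
  "mod_hom R M N = {h \<in> carrier M \<rightarrow> carrier N.
     (\<forall>a\<in>carrier M. \<forall>b\<in>carrier M. h (a \<oplus>\<^bsub>M\<^esub> b) = h a \<oplus>\<^bsub>N\<^esub> h b) \<and>
     (\<forall>r\<in>carrier R. \<forall>a\<in>carrier M. h (r \<odot>\<^bsub>M\<^esub> a) = r \<odot>\<^bsub>N\<^esub> h a)}"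

definition mod_iso :: "'r ring \<Rightarrow> ('r, 'a) module \<Rightarrow> ('r, 'b) module \<Rightarrow> bool" where
  "mod_iso R M N \<longleftrightarrow> (\<exists>h\<in>mod_hom R M N. bij_betw h (carrier M) (carrier N))"

definition mk_module :: "'a set \<Rightarrow> 'a \<Rightarrow> ('a \<Rightarrow> 'a \<Rightarrow> 'a) \<Rightarrow> ('r \<Rightarrow> 'a \<Rightarrow> 'a) \<Rightarrow> ('r, 'a) module" where
  "mk_module A z p s = \<lparr>carrier = A, monoid.mult = undefined, one = undefined,
     ring.zero = z, ring.add = p, smult = s\<rparr>"

definition quot_module :: "('r, 'a) module \<Rightarrow> 'a set \<Rightarrow> ('r, 'a set) module" where
  "quot_module M N = mk_module (a_rcosets\<^bsub>M\<^esub> N) N (set_add M)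
     (\<lambda>r A. \<Union>a\<in>A. N +>\<^bsub>M\<^esub> (r \<odot>\<^bsub>M\<^esub> a))"

definition prod_module :: "'i set \<Rightarrow> ('i \<Rightarrow> ('r, 'a) module) \<Rightarrow> ('r, 'i \<Rightarrow> 'a) module" where
  "prod_module I M = mk_module (\<Pi>\<^sub>E i\<in>I. carrier (M i)) (\<lambda>i\<in>I. \<zero>\<^bsub>M i\<^esub>)
     (\<lambda>f g. \<lambda>i\<in>I. f i \<oplus>\<^bsub>M i\<^esub> g i) (\<lambda>r f. \<lambda>i\<in>I. r \<odot>\<^bsub>M i\<^esub> f i)"

definition free_module :: "'r ring \<Rightarrow> 's set \<Rightarrow> ('r, 's \<Rightarrow> 'r) module" where
  "free_module R S = mk_module
     {f. (\<forall>s\<in>S. f s \<in> carrier R) \<and> (\<forall>s. s \<notin> S \<longrightarrow> f s = \<zero>\<^bsub>R\<^esub>) \<and> finite {s. f s \<noteq> \<zero>\<^bsub>R\<^esub>}}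
     (\<lambda>_. \<zero>\<^bsub>R\<^esub>) (\<lambda>f g s. f s \<oplus>\<^bsub>R\<^esub> g s) (\<lambda>r f s. r \<otimes>\<^bsub>R\<^esub> f s)"

definition free_gen :: "'r ring \<Rightarrow> 's \<Rightarrow> 's \<Rightarrow> 'r" where
  "free_gen R s = (\<lambda>t. if t = s then \<one>\<^bsub>R\<^esub> else \<zero>\<^bsub>R\<^esub>)"

definition submodule_span :: "'r ring \<Rightarrow> ('r, 'a) module \<Rightarrow> 'a set \<Rightarrow> 'a set" where
  "submodule_span R M X = \<Inter>{N. submodule N R M \<and> X \<subseteq> N}"

definition ring_module :: "'r ring \<Rightarrow> ('r, 'r) module" where
  "ring_module R = mk_module (carrier R) \<zero>\<^bsub>R\<^esub> (\<lambda>a b. a \<oplus>\<^bsub>R\<^esub> b) (\<lambda>r a. r \<otimes>\<^bsub>R\<^esub> a)"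


section \<open>Modules over a category\<close>

text \<open>
  Morphisms do not carry their source and target: the same element may lie in several
  hom-sets. Composition and functors therefore take the objects as arguments;
  \<open>Comp C x y z g f\<close> is the composite of \<open>f : x \<rightarrow> y\<close> and \<open>g : y \<rightarrow> z\<close>.
\<close>

record ('o, 'm) cat =
  Obj :: "'o set"
  Hom :: "'o \<Rightarrow> 'o \<Rightarrow> 'm set"
  Id :: "'o \<Rightarrow> 'm"
  Comp :: "'o \<Rightarrow> 'o \<Rightarrow> 'o \<Rightarrow> 'm \<Rightarrow> 'm \<Rightarrow> 'm"

definition op_cat :: "('o, 'm) cat \<Rightarrow> ('o, 'm) cat" where
  "op_cat C = \<lparr>Obj = Obj C, Hom = (\<lambda>x y. Hom C y x), Id = Id C,
     Comp = (\<lambda>x y z g f. Comp C z y x f g)\<rparr>"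

record ('o, 'm, 'r, 'a) rmod_functor =
  ob :: "'o \<Rightarrow> ('r, 'a) module"
  act :: "'o \<Rightarrow> 'o \<Rightarrow> 'm \<Rightarrow> 'a \<Rightarrow> 'a"

text \<open>Covariant functors from \<open>C\<close> to \<open>R\<close>-modules; contravariant ones are functors on \<open>op_cat C\<close>.\<close>

definition is_rmod_functor :: "'r ring \<Rightarrow> ('o, 'm) cat \<Rightarrow> ('o, 'm, 'r, 'a) rmod_functor \<Rightarrow> bool" where
  "is_rmod_functor R C F \<longleftrightarrow>
     (\<forall>x\<in>Obj C. module R (ob F x)) \<and>
     (\<forall>x\<in>Obj C. \<forall>y\<in>Obj C. \<forall>f\<in>Hom C x y. act F x y f \<in> mod_hom R (ob F x) (ob F y)) \<and>
     (\<forall>x\<in>Obj C. \<forall>a\<in>carrier (ob F x). act F x x (Id C x) a = a) \<and>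
     (\<forall>x\<in>Obj C. \<forall>y\<in>Obj C. \<forall>z\<in>Obj C. \<forall>f\<in>Hom C x y. \<forall>g\<in>Hom C y z. \<forall>a\<in>carrier (ob F x).
        act F x z (Comp C x y z g f) a = act F y z g (act F x y f a))"

definition const_functor :: "'r ring \<Rightarrow> ('o, 'm, 'r, 'r) rmod_functor" where
  "const_functor R = \<lparr>ob = (\<lambda>_. ring_module R), act = (\<lambda>_ _ _ a. a)\<rparr>"

text \<open>Transformations are extensional, so that each one is represented by a single function.\<close>

definition nat_trans :: "'r ring \<Rightarrow> ('o, 'm) cat \<Rightarrow> ('o, 'm, 'r, 'a) rmod_functor \<Rightarrow>
    ('o, 'm, 'r, 'b) rmod_functor \<Rightarrow> ('o \<Rightarrow> 'a \<Rightarrow> 'b) set" where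
  "nat_trans R C M N = {\<eta> \<in> extensional (Obj C).
     (\<forall>x\<in>Obj C. \<eta> x \<in> mod_hom R (ob M x) (ob N x) \<inter> extensional (carrier (ob M x))) \<and>
     (\<forall>x\<in>Obj C. \<forall>y\<in>Obj C. \<forall>f\<in>Hom C x y. \<forall>a\<in>carrier (ob M x).
        \<eta> y (act M x y f a) = act N x y f (\<eta> x a))}"

definition hom_module :: "'r ring \<Rightarrow> ('o, 'm) cat \<Rightarrow> ('o, 'm, 'r, 'a) rmod_functor \<Rightarrow>
    ('o, 'm, 'r, 'b) rmod_functor \<Rightarrow> ('r, 'o \<Rightarrow> 'a \<Rightarrow> 'b) module" where
  "hom_module R C M N = mk_module (nat_trans R C M N)
     (\<lambda>x\<in>Obj C. \<lambda>a\<in>carrier (ob M x). \<zero>\<^bsub>ob N x\<^esub>)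
     (\<lambda>\<eta> \<theta>. \<lambda>x\<in>Obj C. \<lambda>a\<in>carrier (ob M x). \<eta> x a \<oplus>\<^bsub>ob N x\<^esub> \<theta> x a)
     (\<lambda>r \<eta>. \<lambda>x\<in>Obj C. \<lambda>a\<in>carrier (ob M x). r \<odot>\<^bsub>ob N x\<^esub> \<eta> x a)"

definition trans_comp :: "('o, 'm) cat \<Rightarrow> ('o, 'm, 'r, 'a) rmod_functor \<Rightarrow>
    ('o \<Rightarrow> 'b \<Rightarrow> 'c) \<Rightarrow> ('o \<Rightarrow> 'a \<Rightarrow> 'b) \<Rightarrow> 'o \<Rightarrow> 'a \<Rightarrow> 'c" where
  "trans_comp C M \<theta> \<eta> = (\<lambda>x\<in>Obj C. \<lambda>a\<in>carrier (ob M x). \<theta> x (\<eta> x a))"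

definition epi_trans :: "('o, 'm) cat \<Rightarrow> ('o, 'm, 'r, 'a) rmod_functor \<Rightarrow>
    ('o, 'm, 'r, 'b) rmod_functor \<Rightarrow> ('o \<Rightarrow> 'a \<Rightarrow> 'b) \<Rightarrow> bool" where
  "epi_trans C M N \<eta> \<longleftrightarrow> (\<forall>x\<in>Obj C. \<eta> x ` carrier (ob M x) = carrier (ob N x))"

text \<open>
  The lifting property. A formula cannot quantify over types, so the test functors \<open>M\<close> and \<open>N\<close>
  take their elements in two fixed types. These are large enough: \<open>N\<close> may be \<open>P\<close> itself, and
  \<open>M\<close> may be the free functor on the elements of \<open>P\<close>, whose value at \<open>c\<close> consists of the
  finitely supported functions on the triples \<open>(x, f, e)\<close> with \<open>f : x \<rightarrow> c\<close> and \<open>e \<in> P(x)\<close>.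
  So \<open>P\<close> is a retract of a free functor, and has the lifting property against epimorphisms
  between functors with elements in arbitrary types.
\<close>

definition projective_functor :: "'r ring \<Rightarrow> ('o, 'm) cat \<Rightarrow> ('o, 'm, 'r, 'p) rmod_functor \<Rightarrow> bool"
  where
  "projective_functor R C P \<longleftrightarrow> is_rmod_functor R C P \<and>
     (\<forall>(M :: ('o, 'm, 'r, 'o \<times> 'm \<times> 'p \<Rightarrow> 'r) rmod_functor) (N :: ('o, 'm, 'r, 'p) rmod_functor) \<pi> \<phi>.
        is_rmod_functor R C M \<and> is_rmod_functor R C N \<and>
        \<pi> \<in> nat_trans R C M N \<and> epi_trans C M N \<pi> \<and> \<phi> \<in> nat_trans R C P N \<longrightarrow>
        (\<exists>\<psi>\<in>nat_trans R C P M. trans_comp C P \<pi> \<psi> = \<phi>))"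

text \<open>\<open>\<dots> \<rightarrow> P 1 \<rightarrow> P 0 \<rightarrow> M \<rightarrow> 0\<close> with differentials \<open>d n : P (n + 1) \<rightarrow> P n\<close> and augmentation \<open>\<epsilon>\<close>.\<close>

definition projective_resolution :: "'r ring \<Rightarrow> ('o, 'm) cat \<Rightarrow> ('o, 'm, 'r, 'a) rmod_functor \<Rightarrow>
    (nat \<Rightarrow> ('o, 'm, 'r, 'p) rmod_functor) \<Rightarrow> (nat \<Rightarrow> 'o \<Rightarrow> 'p \<Rightarrow> 'p) \<Rightarrow> ('o \<Rightarrow> 'p \<Rightarrow> 'a) \<Rightarrow> bool" where
  "projective_resolution R C M P d \<epsilon> \<longleftrightarrow>
     (\<forall>n. projective_functor R C (P n)) \<and>
     (\<forall>n. d n \<in> nat_trans R C (P (Suc n)) (P n)) \<and>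
     \<epsilon> \<in> nat_trans R C (P 0) M \<and>
     epi_trans C (P 0) M \<epsilon> \<and>
     (\<forall>x\<in>Obj C. {a \<in> carrier (ob (P 0) x). \<epsilon> x a = \<zero>\<^bsub>ob M x\<^esub>}
        = d 0 x ` carrier (ob (P 1) x)) \<and>
     (\<forall>n. \<forall>x\<in>Obj C. {a \<in> carrier (ob (P (Suc n)) x). d n x a = \<zero>\<^bsub>ob (P n) x\<^esub>}
        = d (Suc n) x ` carrier (ob (P (Suc (Suc n))) x))"

text \<open>The cochain complex \<open>Hom(P n, N)\<close>: the cocycles and coboundaries coming from \<open>d\<close>.\<close>

definition cocycles :: "'r ring \<Rightarrow> ('o, 'm) cat \<Rightarrow> (nat \<Rightarrow> ('o, 'm, 'r, 'p) rmod_functor) \<Rightarrow>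
    (nat \<Rightarrow> 'o \<Rightarrow> 'p \<Rightarrow> 'p) \<Rightarrow> ('o, 'm, 'r, 'b) rmod_functor \<Rightarrow> nat \<Rightarrow> ('r, 'o \<Rightarrow> 'p \<Rightarrow> 'b) module" where
  "cocycles R C P d N n = (hom_module R C (P n) N)\<lparr>carrier :=
     {\<eta> \<in> nat_trans R C (P n) N.
        trans_comp C (P (Suc n)) \<eta> (d n) = \<zero>\<^bsub>hom_module R C (P (Suc n)) N\<^esub>}\<rparr>"

definition coboundaries :: "'r ring \<Rightarrow> ('o, 'm) cat \<Rightarrow> (nat \<Rightarrow> ('o, 'm, 'r, 'p) rmod_functor) \<Rightarrow>
    (nat \<Rightarrow> 'o \<Rightarrow> 'p \<Rightarrow> 'p) \<Rightarrow> ('o, 'm, 'r, 'b) rmod_functor \<Rightarrow> nat \<Rightarrow> ('o \<Rightarrow> 'p \<Rightarrow> 'b) set" where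
  "coboundaries R C P d N n = (case n of
       0 \<Rightarrow> {\<zero>\<^bsub>hom_module R C (P 0) N\<^esub>}
     | Suc k \<Rightarrow> (\<lambda>\<eta>. trans_comp C (P (Suc k)) \<eta> (d k)) ` nat_trans R C (P k) N)"

text \<open>\<open>Ext\<^sup>n(M, N)\<close>, computed from a projective resolution \<open>(P, d)\<close> of \<open>M\<close>.\<close>

definition Ext_module :: "'r ring \<Rightarrow> ('o, 'm) cat \<Rightarrow> (nat \<Rightarrow> ('o, 'm, 'r, 'p) rmod_functor) \<Rightarrow>
    (nat \<Rightarrow> 'o \<Rightarrow> 'p \<Rightarrow> 'p) \<Rightarrow> ('o, 'm, 'r, 'b) rmod_functor \<Rightarrow> nat \<Rightarrow>
    ('r, ('o \<Rightarrow> 'p \<Rightarrow> 'b) set) module" where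
  "Ext_module R C P d N n = quot_module (cocycles R C P d N n) (coboundaries R C P d N n)"

definition lim_module :: "('o, 'm) cat \<Rightarrow> ('o, 'm, 'r, 'a) rmod_functor \<Rightarrow> ('r, 'o \<Rightarrow> 'a) module" where
  "lim_module C M = (prod_module (Obj C) (ob M))\<lparr>carrier :=
     {f \<in> carrier (prod_module (Obj C) (ob M)).
        \<forall>x\<in>Obj C. \<forall>y\<in>Obj C. \<forall>\<phi>\<in>Hom C x y. act M x y \<phi> (f x) = f y}\<rparr>"


section \<open>Sections and destriction functors\<close>

definition conj_set :: "'g monoid \<Rightarrow> 'g \<Rightarrow> 'g set \<Rightarrow> 'g set" where
  "conj_set G g A = g <#\<^bsub>G\<^esub> A #>\<^bsub>G\<^esub> inv\<^bsub>G\<^esub> g"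

type_synonym 'g sect = "'g set \<times> 'g set"

definition sections :: "'g monoid \<Rightarrow> 'g sect set" where
  "sections G = {(U, V). subgroup U G \<and> V \<lhd> (G\<lparr>carrier := U\<rparr>)}"

definition sections_star :: "'g monoid \<Rightarrow> 'g sect set" where
  "sections_star G = {(U, V) \<in> sections G. V \<noteq> {\<one>\<^bsub>G\<^esub>}}"

definition sect_quot :: "'g monoid \<Rightarrow> 'g sect \<Rightarrow> 'g set monoid" where
  "sect_quot G s = (G\<lparr>carrier := fst s\<rparr>) Mod (snd s)"

definition sect_conj :: "'g monoid \<Rightarrow> 'g \<Rightarrow> 'g sect \<Rightarrow> 'g sect" where
  "sect_conj G g s = (conj_set G g (fst s), conj_set G g (snd s))"

definition sect_le :: "'g sect \<Rightarrow> 'g sect \<Rightarrow> bool" where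
  "sect_le s t \<longleftrightarrow> snd t \<subseteq> snd s \<and> snd s \<subseteq> fst s \<and> fst s \<subseteq> fst t"

text \<open>
  The composite \<open>Nh \<circ> Mg = Nhg\<close> is the product of the two cosets as subsets of \<open>G\<close>, because
  \<open>h M h\<^sup>-\<^sup>1 \<subseteq> N\<close> whenever \<open>Nh\<close> is a morphism out of a section \<open>(M, L)\<close>.
\<close>

definition destr_cat :: "'g monoid \<Rightarrow> 'g sect set \<Rightarrow> ('g sect, 'g set) cat" where
  "destr_cat G \<C> = \<lparr>Obj = \<C>,
     Hom = (\<lambda>s t. {fst t #>\<^bsub>G\<^esub> g | g. g \<in> carrier G \<and> sect_le (sect_conj G g s) t}),
     Id = (\<lambda>s. fst s #>\<^bsub>G\<^esub> \<one>\<^bsub>G\<^esub>),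
     Comp = (\<lambda>_ _ _ \<psi> \<phi>. \<psi> <#>\<^bsub>G\<^esub> \<phi>)\<rparr>"

lemma destr_cat_comp:
  fixes G :: "'g monoid" (structure)
  assumes "group G"
    and "subgroup M G" "subgroup N G" "g \<in> carrier G" "h \<in> carrier G" "conj_set G h M \<subseteq> N"
  shows "(N #> h) <#> (M #> g) = N #> (h \<otimes> g)"
proof -
  interpret group G by fact
  have M: "M \<subseteq> carrier G" and N: "N \<subseteq> carrier G"
    using assms(2,3) by (auto dest: subgroup.mem_carrier)
  have conj: "h \<otimes> m \<otimes> inv h \<in> N" if "m \<in> M" for m
    using assms(6) that unfolding conj_set_def l_coset_def r_coset_def by auto
  show ?thesis
  proof (intro equalityI subsetI)
    fix x assume "x \<in> (N #> h) <#> (M #> g)"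
    then obtain n m where nm: "n \<in> N" "m \<in> M" "x = (n \<otimes> h) \<otimes> (m \<otimes> g)"
      unfolding set_mult_def r_coset_def by auto
    have c: "n \<in> carrier G" "m \<in> carrier G" using nm M N by auto
    have "n \<otimes> (h \<otimes> m \<otimes> inv h) \<otimes> (h \<otimes> g) = n \<otimes> h \<otimes> m \<otimes> (inv h \<otimes> h) \<otimes> g"
      using c assms(4,5) by (simp only: m_assoc m_closed inv_closed)
    then have "x = n \<otimes> (h \<otimes> m \<otimes> inv h) \<otimes> (h \<otimes> g)"
      using c assms(4,5) nm by (simp add: m_assoc)
    moreover have "n \<otimes> (h \<otimes> m \<otimes> inv h) \<in> N"
      using nm conj assms(3) by (simp add: subgroup.m_closed)
    ultimately show "x \<in> N #> (h \<otimes> g)"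
      unfolding r_coset_def by blast
  next
    fix x assume "x \<in> N #> (h \<otimes> g)"
    then obtain n where n: "n \<in> N" "x = n \<otimes> (h \<otimes> g)"
      unfolding r_coset_def by auto
    have "x = (n \<otimes> h) \<otimes> (\<one> \<otimes> g)"
      using n N assms(4,5) by (simp add: m_assoc subset_iff)
    then show "x \<in> (N #> h) <#> (M #> g)"
      using n(1) subgroup.one_closed[OF assms(2)] unfolding set_mult_def r_coset_def by blast
  qed
qed

definition destriction_functor :: "'r ring \<Rightarrow> 'g monoid \<Rightarrow> ('g sect, 'g set, 'r, 'a) rmod_functor \<Rightarrow> bool"
  where "destriction_functor R G F \<longleftrightarrow> is_rmod_functor R (op_cat (destr_cat G (sections G))) F"

definition defres :: "'g monoid \<Rightarrow> ('g sect, 'g set, 'r, 'a) rmod_functor \<Rightarrow> 'g sect \<Rightarrow> 'g sect \<Rightarrow> 'a \<Rightarrow> 'a"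
  where "defres G F t s = act F t s (fst t #>\<^bsub>G\<^esub> \<one>\<^bsub>G\<^esub>)"

definition top_section :: "'g monoid \<Rightarrow> 'g sect" where
  "top_section G = (carrier G, {\<one>\<^bsub>G\<^esub>})"


section \<open>Biset functors\<close>

text \<open>\<open>(K, H)\<close>-bisets have commuting actions of \<open>K\<close> on the left and of \<open>H\<close> on the right.\<close>

record ('k, 'h, 'x) biset =
  pts :: "'x set"
  lact :: "'k \<Rightarrow> 'x \<Rightarrow> 'x"
  ract :: "'x \<Rightarrow> 'h \<Rightarrow> 'x"

definition finite_biset :: "'k monoid \<Rightarrow> 'h monoid \<Rightarrow> ('k, 'h, 'x) biset \<Rightarrow> bool" where
  "finite_biset K H X \<longleftrightarrow> finite (pts X) \<and>
     (\<forall>k\<in>carrier K. \<forall>x\<in>pts X. lact X k x \<in> pts X) \<and>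
     (\<forall>h\<in>carrier H. \<forall>x\<in>pts X. ract X x h \<in> pts X) \<and>
     (\<forall>x\<in>pts X. lact X \<one>\<^bsub>K\<^esub> x = x \<and> ract X x \<one>\<^bsub>H\<^esub> = x) \<and>
     (\<forall>k\<in>carrier K. \<forall>k'\<in>carrier K. \<forall>x\<in>pts X. lact X (k \<otimes>\<^bsub>K\<^esub> k') x = lact X k (lact X k' x)) \<and>
     (\<forall>h\<in>carrier H. \<forall>h'\<in>carrier H. \<forall>x\<in>pts X. ract X x (h \<otimes>\<^bsub>H\<^esub> h') = ract X (ract X x h) h') \<and>
     (\<forall>k\<in>carrier K. \<forall>h\<in>carrier H. \<forall>x\<in>pts X. ract X (lact X k x) h = lact X k (ract X x h))"

definition biset_iso :: "'k monoid \<Rightarrow> 'h monoid \<Rightarrow> ('k, 'h, 'x) biset \<Rightarrow> ('k, 'h, 'y) biset \<Rightarrow> bool" where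
  "biset_iso K H X Y \<longleftrightarrow> (\<exists>f. bij_betw f (pts X) (pts Y) \<and>
     (\<forall>k\<in>carrier K. \<forall>x\<in>pts X. f (lact X k x) = lact Y k (f x)) \<and>
     (\<forall>h\<in>carrier H. \<forall>x\<in>pts X. f (ract X x h) = ract Y (f x) h))"

text \<open>
  Every finite biset is isomorphic to one whose points are natural numbers, and an isomorphism
  class is represented by the set of these.
\<close>

type_synonym ('k, 'h) biset_class = "('k, 'h, nat) biset set"

definition biset_class :: "'k monoid \<Rightarrow> 'h monoid \<Rightarrow> ('k, 'h, 'x) biset \<Rightarrow> ('k, 'h) biset_class" where
  "biset_class K H X = {Y. finite_biset K H Y \<and> biset_iso K H X Y}"

definition biset_classes :: "'k monoid \<Rightarrow> 'h monoid \<Rightarrow> ('k, 'h) biset_class set" where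
  "biset_classes K H = {biset_class K H X | X :: ('k, 'h, nat) biset. finite_biset K H X}"

definition biset_sum :: "('k, 'h, 'x) biset \<Rightarrow> ('k, 'h, 'y) biset \<Rightarrow> ('k, 'h, 'x + 'y) biset" where
  "biset_sum X Y = \<lparr>pts = Inl ` pts X \<union> Inr ` pts Y,
     lact = (\<lambda>k. map_sum (lact X k) (lact Y k)),
     ract = (\<lambda>z h. map_sum (\<lambda>x. ract X x h) (\<lambda>y. ract Y y h) z)\<rparr>"

text \<open>\<open>X \<times>\<^sub>H Y\<close>: the orbits of \<open>H\<close> acting on \<open>X \<times> Y\<close> by \<open>h (x, y) = (x h, h\<^sup>-\<^sup>1 y)\<close>.\<close>

definition biset_tensor :: "'h monoid \<Rightarrow> ('k, 'h, 'x) biset \<Rightarrow> ('h, 'j, 'y) biset \<Rightarrow>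
    ('k, 'j, ('x \<times> 'y) set) biset" where
  "biset_tensor H X Y =
     \<lparr>pts = {{(ract X x h, lact Y (inv\<^bsub>H\<^esub> h) y) | h. h \<in> carrier H} | x y. x \<in> pts X \<and> y \<in> pts Y},
      lact = (\<lambda>k T. (\<lambda>(x, y). (lact X k x, y)) ` T),
      ract = (\<lambda>T j. (\<lambda>(x, y). (x, ract Y y j)) ` T)\<rparr>"

text \<open>
  \<open>R \<otimes> B(K, H)\<close>, presented as the free \<open>R\<close>-module on the isomorphism classes of finite
  \<open>(K, H)\<close>-bisets modulo the relations \<open>[X \<squnion> Y] = [X] + [Y]\<close> of the Burnside group.
\<close>

definition burnside_relations :: "'r ring \<Rightarrow> 'k monoid \<Rightarrow> 'h monoid \<Rightarrow> (('k, 'h) biset_class \<Rightarrow> 'r) set" where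
  "burnside_relations R K H =
     (let M = free_module R (biset_classes K H);
          gen = (\<lambda>C. free_gen R C) in
      submodule_span R M
        {gen (biset_class K H (biset_sum X Y)) \<ominus>\<^bsub>M\<^esub>
           (gen (biset_class K H X) \<oplus>\<^bsub>M\<^esub> gen (biset_class K H Y))
         | (X :: ('k, 'h, nat) biset) (Y :: ('k, 'h, nat) biset).
             finite_biset K H X \<and> finite_biset K H Y})"

definition burnside_module :: "'r ring \<Rightarrow> 'k monoid \<Rightarrow> 'h monoid \<Rightarrow>
    ('r, (('k, 'h) biset_class \<Rightarrow> 'r) set) module" where
  "burnside_module R K H =
     quot_module (free_module R (biset_classes K H)) (burnside_relations R K H)"

definition burnside_coset :: "'r ring \<Rightarrow> 'k monoid \<Rightarrow> 'h monoid \<Rightarrow>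
    (('k, 'h) biset_class \<Rightarrow> 'r) \<Rightarrow> (('k, 'h) biset_class \<Rightarrow> 'r) set" where
  "burnside_coset R K H f = burnside_relations R K H +>\<^bsub>free_module R (biset_classes K H)\<^esub> f"

definition burnside_elem :: "'r ring \<Rightarrow> 'k monoid \<Rightarrow> 'h monoid \<Rightarrow> ('k, 'h, 'x) biset \<Rightarrow>
    (('k, 'h) biset_class \<Rightarrow> 'r) set" where
  "burnside_elem R K H X = burnside_coset R K H (free_gen R (biset_class K H X))"

text \<open>
  The \<open>R\<close>-bilinear composition \<open>R \<otimes> B(K, H) \<times> R \<otimes> B(H, J) \<rightarrow> R \<otimes> B(K, J)\<close> with
  \<open>[X] \<circ> [Y] = [X \<times>\<^sub>H Y]\<close>, first on the free modules. On the quotients the union is over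
  representatives, all of which give the same coset.
\<close>

definition free_comp :: "'r ring \<Rightarrow> 'k monoid \<Rightarrow> 'h monoid \<Rightarrow> 'j monoid \<Rightarrow>
    (('k, 'h) biset_class \<Rightarrow> 'r) \<Rightarrow> (('h, 'j) biset_class \<Rightarrow> 'r) \<Rightarrow> (('k, 'j) biset_class \<Rightarrow> 'r)" where
  "free_comp R K H J f g =
     (let M = free_module R (biset_classes K J) in
      \<Oplus>\<^bsub>M\<^esub>A\<in>{A. f A \<noteq> \<zero>\<^bsub>R\<^esub>}. \<Oplus>\<^bsub>M\<^esub>B\<in>{B. g B \<noteq> \<zero>\<^bsub>R\<^esub>}.
        (f A \<otimes>\<^bsub>R\<^esub> g B) \<odot>\<^bsub>M\<^esub>
          free_gen R (biset_class K J (biset_tensor H (SOME X. X \<in> A) (SOME Y. Y \<in> B))))"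

definition burnside_comp :: "'r ring \<Rightarrow> 'k monoid \<Rightarrow> 'h monoid \<Rightarrow> 'j monoid \<Rightarrow>
    (('k, 'h) biset_class \<Rightarrow> 'r) set \<Rightarrow> (('h, 'j) biset_class \<Rightarrow> 'r) set \<Rightarrow>
    (('k, 'j) biset_class \<Rightarrow> 'r) set" where
  "burnside_comp R K H J \<beta> \<alpha> = (\<Union>f\<in>\<beta>. \<Union>g\<in>\<alpha>. burnside_coset R K J (free_comp R K H J f g))"

text \<open>
  For a homomorphism \<open>\<phi> : H \<rightarrow> K\<close>, the set \<open>K\<close> as a \<open>(K, H)\<close>-biset with \<open>H\<close> acting through \<open>\<phi>\<close>:
  the identity for \<open>\<phi> = id\<close>, a deflation for \<open>\<phi>\<close> a quotient map, an isomorphism for \<open>\<phi>\<close> bijective.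
\<close>

definition hom_biset :: "'k monoid \<Rightarrow> ('h \<Rightarrow> 'k) \<Rightarrow> ('k, 'h, 'k) biset" where
  "hom_biset K \<phi> = \<lparr>pts = carrier K, lact = monoid.mult K, ract = (\<lambda>x h. x \<otimes>\<^bsub>K\<^esub> \<phi> h)\<rparr>"

text \<open>The restriction biset: \<open>H\<close> as a \<open>(K, H)\<close>-biset for a subgroup \<open>K\<close> of \<open>H\<close>.\<close>

definition res_biset :: "'h monoid \<Rightarrow> ('h, 'h, 'h) biset" where
  "res_biset H = \<lparr>pts = carrier H, lact = monoid.mult H, ract = monoid.mult H\<rparr>"

type_synonym ('g, 'r) biset_mor = "(('g set, 'g set) biset_class \<Rightarrow> 'r) set"

definition biset_cat :: "'r ring \<Rightarrow> 'g monoid \<Rightarrow> ('g sect, ('g, 'r) biset_mor) cat" where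
  "biset_cat R G = \<lparr>Obj = sections G,
     Hom = (\<lambda>s t. carrier (burnside_module R (sect_quot G t) (sect_quot G s))),
     Id = (\<lambda>s. burnside_elem R (sect_quot G s) (sect_quot G s) (hom_biset (sect_quot G s) (\<lambda>x. x))),
     Comp = (\<lambda>s t u. burnside_comp R (sect_quot G u) (sect_quot G t) (sect_quot G s))\<rparr>"

definition biset_functor :: "'r ring \<Rightarrow> 'g monoid \<Rightarrow>
    ('g sect, ('g, 'r) biset_mor, 'r, 'a) rmod_functor \<Rightarrow> bool" where
  "biset_functor R G B \<longleftrightarrow> is_rmod_functor R (biset_cat R G) B \<and>
     (\<forall>s\<in>sections G. \<forall>t\<in>sections G. \<forall>a\<in>carrier (ob B s).
        let H = burnside_module R (sect_quot G t) (sect_quot G s) in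
        (\<forall>\<alpha>\<in>carrier H. \<forall>\<beta>\<in>carrier H.
           act B s t (\<alpha> \<oplus>\<^bsub>H\<^esub> \<beta>) a = act B s t \<alpha> a \<oplus>\<^bsub>ob B t\<^esub> act B s t \<beta> a) \<and>
        (\<forall>r\<in>carrier R. \<forall>\<alpha>\<in>carrier H.
           act B s t (r \<odot>\<^bsub>H\<^esub> \<alpha>) a = r \<odot>\<^bsub>ob B t\<^esub> act B s t \<alpha> a))"

text \<open>
  For \<open>Mg : (U, V) \<rightarrow> (M, L)\<close>: restriction from \<open>M/L\<close> to \<open>\<^sup>gU/L\<close>, deflation to \<open>\<^sup>gU/\<^sup>gV\<close>
  (where a coset \<open>A\<close> of \<open>L\<close> goes to the coset \<open>\<^sup>gV A\<close>), and the isomorphism to \<open>U/V\<close> induced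
  by conjugation by \<open>g\<^sup>-\<^sup>1\<close>. The result does not depend on the representative \<open>g\<close>.
\<close>

definition biset_act :: "'r ring \<Rightarrow> 'g monoid \<Rightarrow> ('g sect, ('g, 'r) biset_mor, 'r, 'a) rmod_functor \<Rightarrow>
    'g sect \<Rightarrow> 'g sect \<Rightarrow> 'g \<Rightarrow> 'a \<Rightarrow> 'a" where
  "biset_act R G B t s g =
     (let s' = sect_conj G g s; r = (fst s', snd t);
          Q = sect_quot G;
          elem = (\<lambda>v u X. burnside_elem R (Q v) (Q u) X) in
      act B s' s (elem s s' (hom_biset (Q s) (conj_set G (inv\<^bsub>G\<^esub> g)))) \<circ>
      act B r s' (elem s' r (hom_biset (Q s') (\<lambda>A. snd s' <#>\<^bsub>G\<^esub> A))) \<circ>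
      act B t r (elem r t (res_biset (Q t))))"

definition biset_to_destriction :: "'r ring \<Rightarrow> 'g monoid \<Rightarrow>
    ('g sect, ('g, 'r) biset_mor, 'r, 'a) rmod_functor \<Rightarrow> ('g sect, 'g set, 'r, 'a) rmod_functor" where
  "biset_to_destriction R G B = \<lparr>ob = ob B,
     act = (\<lambda>t s \<phi>. biset_act R G B t s
       (SOME g. g \<in> carrier G \<and> sect_le (sect_conj G g s) t \<and> \<phi> = fst t #>\<^bsub>G\<^esub> g))\<rparr>"


section \<open>Reduced cohomology of the category of sections\<close>

definition to_lim :: "'g monoid \<Rightarrow> 'g sect set \<Rightarrow> ('g sect, 'g set, 'r, 'a) rmod_functor \<Rightarrow>
    'a \<Rightarrow> 'g sect \<Rightarrow> 'a" where
  "to_lim G \<C> F a = (\<lambda>s\<in>\<C>. defres G F (top_section G) s a)"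

text \<open>Degrees \<open>-1\<close>, \<open>0\<close> and \<open>n \<ge> 1\<close>, the last in terms of a projective resolution of the constant functor.\<close>

definition destr_cohom_m1 :: "'g monoid \<Rightarrow> 'g sect set \<Rightarrow> ('g sect, 'g set, 'r, 'a) rmod_functor \<Rightarrow>
    ('r, 'a) module" where
  "destr_cohom_m1 G \<C> F = (ob F (top_section G))\<lparr>carrier :=
     {a \<in> carrier (ob F (top_section G)).
        to_lim G \<C> F a = \<zero>\<^bsub>lim_module (op_cat (destr_cat G \<C>)) F\<^esub>}\<rparr>"

definition destr_cohom_0 :: "'g monoid \<Rightarrow> 'g sect set \<Rightarrow> ('g sect, 'g set, 'r, 'a) rmod_functor \<Rightarrow>
    ('r, ('g sect \<Rightarrow> 'a) set) module" where
  "destr_cohom_0 G \<C> F = quot_module (lim_module (op_cat (destr_cat G \<C>)) F)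
     (to_lim G \<C> F ` carrier (ob F (top_section G)))"

definition destr_cohom :: "'r ring \<Rightarrow> 'g monoid \<Rightarrow> 'g sect set \<Rightarrow>
    (nat \<Rightarrow> ('g sect, 'g set, 'r, 'p) rmod_functor) \<Rightarrow> (nat \<Rightarrow> 'g sect \<Rightarrow> 'p \<Rightarrow> 'p) \<Rightarrow>
    ('g sect, 'g set, 'r, 'a) rmod_functor \<Rightarrow> nat \<Rightarrow> ('r, ('g sect \<Rightarrow> 'p \<Rightarrow> 'a) set) module" where
  "destr_cohom R G \<C> P d F n = Ext_module R (op_cat (destr_cat G \<C>)) P d F n"


section \<open>The Quillen category\<close>

definition elem_abelian :: "'g monoid \<Rightarrow> nat \<Rightarrow> 'g set set" where
  "elem_abelian G p = {E. subgroup E G \<and> (\<forall>x\<in>E. \<forall>y\<in>E. x \<otimes>\<^bsub>G\<^esub> y = y \<otimes>\<^bsub>G\<^esub> x) \<and>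
     (\<forall>x\<in>E. x [^]\<^bsub>G\<^esub> p = \<one>\<^bsub>G\<^esub>)}"

definition conj_map :: "'g monoid \<Rightarrow> 'g set \<Rightarrow> 'g \<Rightarrow> 'g \<Rightarrow> 'g" where
  "conj_map G E g = (\<lambda>x\<in>E. g \<otimes>\<^bsub>G\<^esub> x \<otimes>\<^bsub>G\<^esub> inv\<^bsub>G\<^esub> g)"

text \<open>
  A composite of conjugations by elements of \<open>G\<close> and inclusions is a conjugation map \<open>E\<^sub>1 \<rightarrow> E\<^sub>2\<close>
  by a single element.
\<close>

definition quillen_on :: "'g monoid \<Rightarrow> 'g set set \<Rightarrow> ('g set, 'g \<Rightarrow> 'g) cat" where
  "quillen_on G \<E> = \<lparr>Obj = \<E>,
     Hom = (\<lambda>E1 E2. {conj_map G E1 g | g. g \<in> carrier G \<and> conj_set G g E1 \<subseteq> E2}),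
     Id = (\<lambda>E. \<lambda>x\<in>E. x),
     Comp = (\<lambda>E1 _ _ \<psi> \<phi>. compose E1 \<psi> \<phi>)\<rparr>"

definition quillen_cat :: "'g monoid \<Rightarrow> nat \<Rightarrow> ('g set, 'g \<Rightarrow> 'g) cat" where
  "quillen_cat G p = quillen_on G (elem_abelian G p - {{\<one>\<^bsub>G\<^esub>}})"

definition quillen_cat' :: "'g monoid \<Rightarrow> nat \<Rightarrow> ('g set, 'g \<Rightarrow> 'g) cat" where
  "quillen_cat' G p = quillen_on G (elem_abelian G p)"

definition centralizer :: "'g monoid \<Rightarrow> 'g set \<Rightarrow> 'g set" where
  "centralizer G E = {g \<in> carrier G. \<forall>x\<in>E. g \<otimes>\<^bsub>G\<^esub> x = x \<otimes>\<^bsub>G\<^esub> g}"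

definition bar_functor :: "'g monoid \<Rightarrow> ('g sect, 'g set, 'r, 'a) rmod_functor \<Rightarrow>
    ('g set, 'g \<Rightarrow> 'g, 'r, 'a) rmod_functor" where
  "bar_functor G F = \<lparr>ob = (\<lambda>E. ob F (centralizer G E, E)),
     act = (\<lambda>E1 E2 \<phi>. act F (centralizer G E1, E1) (centralizer G E2, E2)
       (centralizer G E1 #>\<^bsub>G\<^esub> inv\<^bsub>G\<^esub> (SOME g. g \<in> carrier G \<and> conj_set G g E1 \<subseteq> E2 \<and> \<phi> = conj_map G E1 g)))\<rparr>"

text \<open>
  The constant functor on the Quillen category, extended by zero at the trivial subgroup. It is a
  subfunctor of \<^const>\<open>const_functor\<close> on the nose, so that a transformation into it is also one
  into the constant functor.
\<close>

definition const_ext_zero :: "'r ring \<Rightarrow> 'g monoid \<Rightarrow> nat \<Rightarrow> ('g set, 'g \<Rightarrow> 'g, 'r, 'r) rmod_functor" where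
  "const_ext_zero R G p = \<lparr>
     ob = (\<lambda>E. if E \<in> Obj (quillen_cat G p) then ring_module R
               else (ring_module R)\<lparr>carrier := {\<zero>\<^bsub>R\<^esub>}\<rparr>),
     act = (\<lambda>_ _ _ a. a)\<rparr>"

text \<open>
  The cohomology of \<open>0 \<rightarrow> Hom(R, M) \<rightarrow> Hom(P 0, M) \<rightarrow> Hom(P 1, M) \<rightarrow> \<dots>\<close> with \<open>Hom(R, M)\<close> in
  degree \<open>-1\<close>, where \<open>\<epsilon> : P 0 \<rightarrow> R\<close> is the augmentation followed by the inclusion.
\<close>

definition quillen_cohom_m1 :: "'r ring \<Rightarrow> 'g monoid \<Rightarrow> nat \<Rightarrow>
    (nat \<Rightarrow> ('g set, 'g \<Rightarrow> 'g, 'r, 'q) rmod_functor) \<Rightarrow> ('g set \<Rightarrow> 'q \<Rightarrow> 'r) \<Rightarrow>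
    ('g set, 'g \<Rightarrow> 'g, 'r, 'a) rmod_functor \<Rightarrow> ('r, 'g set \<Rightarrow> 'r \<Rightarrow> 'a) module" where
  "quillen_cohom_m1 R G p P \<epsilon> M =
     (let C = quillen_cat' G p in
      (hom_module R C (const_functor R) M)\<lparr>carrier :=
        {\<eta> \<in> nat_trans R C (const_functor R) M.
           trans_comp C (P 0) \<eta> \<epsilon> = \<zero>\<^bsub>hom_module R C (P 0) M\<^esub>}\<rparr>)"

definition quillen_cohom :: "'r ring \<Rightarrow> 'g monoid \<Rightarrow> nat \<Rightarrow>
    (nat \<Rightarrow> ('g set, 'g \<Rightarrow> 'g, 'r, 'q) rmod_functor) \<Rightarrow> (nat \<Rightarrow> 'g set \<Rightarrow> 'q \<Rightarrow> 'q) \<Rightarrow>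
    ('g set \<Rightarrow> 'q \<Rightarrow> 'r) \<Rightarrow> ('g set, 'g \<Rightarrow> 'g, 'r, 'a) rmod_functor \<Rightarrow> nat \<Rightarrow>
    ('r, ('g set \<Rightarrow> 'q \<Rightarrow> 'a) set) module" where
  "quillen_cohom R G p P d \<epsilon> M n =
     (let C = quillen_cat' G p in
      quot_module (cocycles R C P d M n)
        (if n = 0 then (\<lambda>\<eta>. trans_comp C (P 0) \<eta> \<epsilon>) ` nat_trans R C (const_functor R) M
         else coboundaries R C P d M n))"


section \<open>The obstruction group\<close>

definition nontrivial_subgroups :: "'g monoid \<Rightarrow> 'g set set" where
  "nontrivial_subgroups G = {H. subgroup H G \<and> H \<noteq> {\<one>\<^bsub>G\<^esub>}}"

definition norm_section :: "'g monoid \<Rightarrow> 'g set \<Rightarrow> 'g sect" where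
  "norm_section G H = (normalizer G H, H)"

text \<open>
  The conjugation map \<open>f \<mapsto> \<^sup>gf\<close> from \<open>F(N(H)/H)\<close> to \<open>F(N(\<^sup>gH)/\<^sup>gH)\<close> is the action of the
  morphism \<open>N(H) g\<^sup>-\<^sup>1\<close> from the section of \<open>\<^sup>gH\<close> to that of \<open>H\<close>.
\<close>

definition gluing_module :: "'g monoid \<Rightarrow> ('g sect, 'g set, 'r, 'a) rmod_functor \<Rightarrow>
    ('r, 'g set \<Rightarrow> 'a) module" where
  "gluing_module G F =
     (let M = prod_module (nontrivial_subgroups G) (\<lambda>H. ob F (norm_section G H)) in
      M\<lparr>carrier := {f \<in> carrier M.
        (\<forall>H\<in>nontrivial_subgroups G. \<forall>g\<in>carrier G.
           act F (norm_section G H) (norm_section G (conj_set G g H))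
             (normalizer G H #>\<^bsub>G\<^esub> inv\<^bsub>G\<^esub> g) (f H) = f (conj_set G g H)) \<and>
        (\<forall>H\<in>nontrivial_subgroups G. \<forall>K\<in>nontrivial_subgroups G. K \<lhd> (G\<lparr>carrier := H\<rparr>) \<longrightarrow>
           defres G F (norm_section G K) (normalizer G H \<inter> normalizer G K, H) (f K) =
           defres G F (norm_section G H) (normalizer G H \<inter> normalizer G K, H) (f H))}\<rparr>)"

definition Obs :: "'g monoid \<Rightarrow> ('g sect, 'g set, 'r, 'a) rmod_functor \<Rightarrow>
    ('r, ('g set \<Rightarrow> 'a) set) module" where
  "Obs G F = quot_module (gluing_module G F)
     ((\<lambda>a. \<lambda>H\<in>nontrivial_subgroups G. defres G F (top_section G) (norm_section G H) a)
        ` carrier (ob F (top_section G)))"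

end

theory Submission
  imports Defs
begin

text \<open>
  Write \<open>A\<close> for the category of all elementary abelian \<open>p\<close>-subgroups of \<open>G\<close>, \<open>S\<close> for its nontrivial
  objects, and \<open>C\<close> for the opposite of the category of sections \<open>(U, V)\<close> with \<open>V \<noteq> 1\<close>, on which \<open>F\<close> is
  covariant. There are two functors, \<open>i : S \<rightarrow> C\<close> with \<open>i E = (C\<^sub>G(E), E)\<close> and \<open>r : C \<rightarrow> S\<close>
  with \<open>r (U, V) = \<Omega>\<^sub>1(V \<inter> Z(U))\<close>.
  The second one is defined because \<open>G\<close> is a \<open>p\<close>-group: the nontrivial normal subgroup \<open>V\<close> of the
  \<open>p\<close>-group \<open>U\<close> meets the centre of \<open>U\<close> nontrivially (\<open>core_nontrivial\<close>). Since \<open>U\<close> centralises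
  \<open>E = r(U, V)\<close> and \<open>E \<le> V\<close>, the section \<open>(U, V)\<close> lies below \<open>(C\<^sub>G(E), E)\<close>. This gives a natural map
  \<open>i r \<rightarrow> 1\<close>, and \<open>r i = 1\<close>; so \<open>i\<close> embeds \<open>S\<close> into \<open>C\<close> as a coreflective subcategory with
  coreflector \<open>r\<close> (\<open>sections_coreflection\<close>). On \<open>S\<close> the functor \<open>bar_functor G F\<close> is
  the composite \<open>F i\<close>.

  An adjoint pair compares cohomology, as follows. Let \<open>P\<close> and \<open>Q\<close> resolve the two coefficient functors, over \<open>C\<close> and \<open>A\<close>.
  Composition with \<open>r\<close> turns \<open>Q\<close> into an exact complex over \<open>C\<close>, and composition with \<open>i\<close>, followed by
  extension by zero to \<open>A\<close>, turns \<open>P\<close> into an exact complex over \<open>A\<close>. As \<open>P\<close> and \<open>Q\<close> are projective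
  there are chain maps \<open>\<alpha> : P \<rightarrow> Q r\<close> and \<open>\<beta> : Q \<rightarrow> P i\<close>. Through \<open>\<beta>\<close> a cochain on \<open>P\<close> with values in \<open>F\<close>
  goes down to a cochain on \<open>Q\<close>; through \<open>\<alpha>\<close> and the map \<open>i r \<rightarrow> 1\<close> a cochain on \<open>Q\<close> goes up. The two
  composites are composition with endomorphisms of \<open>P\<close> and of \<open>Q\<close> over the identity, which are homotopic
  to the identity (\<open>chain_endo_cocycle\<close>). This settles the degrees \<open>n \<ge> 1\<close>
  (\<open>cohomology_iso_pos\<close>). In degree \<open>0\<close> both sides are computed by hand as compatible families on \<open>S\<close>
  modulo those that come from \<open>F(G)\<close>, and in degree \<open>-1\<close> as the elements of \<open>F(G)\<close> that vanish on \<open>S\<close>;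
  here the trivial subgroup, an initial object of \<open>A\<close>, accounts for \<open>F(G)\<close>
  (\<open>cohomology_iso_0\<close>, \<open>cohomology_iso_m1\<close>).

  The obstruction group is the same cokernel in degree \<open>0\<close>. The section \<open>(N\<^sub>G(V), V)\<close> lies
  above every section with bottom \<open>V\<close>, so a compatible family is determined by its values on these, and
  the relations between these values are those of a gluing data (\<open>Obs_iso_cohom_0\<close>).

  For a biset functor it remains to see that the composites of a restriction, a deflation and a
  conjugation form a functor on sections. Each composite is the action of one biset, the set of
  cosets \<open>V x\<close> with \<open>x \<in> a\<^sup>-\<^sup>1 M\<close>, and tensoring two such bisets multiplies their labels \<open>a\<close>
  (\<open>sbiset_tensor\<close>). That a biset functor sees this requires the composition on the Burnside modules
  to be well defined and to be given by the tensor product of bisets (\<open>burnside_comp_elem\<close>).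
\<close>


section \<open>Modules\<close>

lemma mk_module_simps [simp]:
  "carrier (mk_module A z p s) = A" "\<zero>\<^bsub>mk_module A z p s\<^esub> = z"
  "x \<oplus>\<^bsub>mk_module A z p s\<^esub> y = p x y" "r \<odot>\<^bsub>mk_module A z p s\<^esub> x = s r x"
  by (simp_all add: mk_module_def)

lemma mod_homI:
  assumes "\<And>a. a \<in> carrier M \<Longrightarrow> h a \<in> carrier N"
    and "\<And>a b. a \<in> carrier M \<Longrightarrow> b \<in> carrier M \<Longrightarrow> h (a \<oplus>\<^bsub>M\<^esub> b) = h a \<oplus>\<^bsub>N\<^esub> h b"
    and "\<And>r a. r \<in> carrier R \<Longrightarrow> a \<in> carrier M \<Longrightarrow> h (r \<odot>\<^bsub>M\<^esub> a) = r \<odot>\<^bsub>N\<^esub> h a"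
  shows "h \<in> mod_hom R M N"
  using assms by (auto simp: mod_hom_def)

lemma mod_homD:
  assumes "h \<in> mod_hom R M N"
  shows "a \<in> carrier M \<Longrightarrow> h a \<in> carrier N"
    and "a \<in> carrier M \<Longrightarrow> b \<in> carrier M \<Longrightarrow> h (a \<oplus>\<^bsub>M\<^esub> b) = h a \<oplus>\<^bsub>N\<^esub> h b"
    and "r \<in> carrier R \<Longrightarrow> a \<in> carrier M \<Longrightarrow> h (r \<odot>\<^bsub>M\<^esub> a) = r \<odot>\<^bsub>N\<^esub> h a"
  using assms by (auto simp: mod_hom_def)

lemma mod_hom_comp:
  assumes "h \<in> mod_hom R M N" "k \<in> mod_hom R N L"
  shows "(\<lambda>x. k (h x)) \<in> mod_hom R M L"
  by (rule mod_homI) (simp_all add: mod_homD[OF assms(1)] mod_homD[OF assms(2)])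

lemma mod_hom_cong:
  assumes "h \<in> mod_hom R M N" "\<And>x. x \<in> carrier M \<Longrightarrow> k x = h x" "module R M"
  shows "k \<in> mod_hom R M N"
proof -
  interpret module R M by fact
  show ?thesis using assms(1,2) by (auto simp: mod_hom_def Pi_def)
qed

lemma mod_hom_zero:
  assumes "h \<in> mod_hom R M N" "module R M" "module R N"
  shows "h \<zero>\<^bsub>M\<^esub> = \<zero>\<^bsub>N\<^esub>"
proof -
  interpret M: module R M by fact
  interpret N: module R N by fact
  have "h (\<zero>\<^bsub>R\<^esub> \<odot>\<^bsub>M\<^esub> \<zero>\<^bsub>M\<^esub>) = \<zero>\<^bsub>R\<^esub> \<odot>\<^bsub>N\<^esub> h \<zero>\<^bsub>M\<^esub>"
    by (rule mod_homD(3)[OF assms(1)]) simp_all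
  then show ?thesis using mod_homD(1)[OF assms(1) M.M.zero_closed] by simp
qed

lemma module_minus:
  assumes "module R M" "a \<in> carrier M"
  shows "\<ominus>\<^bsub>M\<^esub> a = (\<ominus>\<^bsub>R\<^esub> \<one>\<^bsub>R\<^esub>) \<odot>\<^bsub>M\<^esub> a"
proof -
  interpret M: module R M by fact
  show ?thesis using assms(2) by (simp add: M.smult_l_minus)
qed

lemma module_diff_alt:
  assumes "module R M" "a \<in> carrier M" "b \<in> carrier M"
  shows "a \<ominus>\<^bsub>M\<^esub> b = a \<oplus>\<^bsub>M\<^esub> (\<ominus>\<^bsub>R\<^esub> \<one>\<^bsub>R\<^esub>) \<odot>\<^bsub>M\<^esub> b"
  using assms by (simp add: a_minus_def module_minus[of R M b])

lemma mod_hom_diff: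
  assumes "h \<in> mod_hom R M N" "module R M" "module R N" "a \<in> carrier M" "b \<in> carrier M"
  shows "h (a \<ominus>\<^bsub>M\<^esub> b) = h a \<ominus>\<^bsub>N\<^esub> h b"
proof -
  interpret M: module R M by fact
  interpret N: module R N by fact
  show ?thesis using assms
    by (simp add: module_diff_alt[of R M] module_diff_alt[of R N] mod_homD)
qed

lemma submodule_crit:
  assumes "module R M" "H \<subseteq> carrier M" "\<zero>\<^bsub>M\<^esub> \<in> H"
    and "\<And>a b. a \<in> H \<Longrightarrow> b \<in> H \<Longrightarrow> a \<oplus>\<^bsub>M\<^esub> b \<in> H"
    and "\<And>r a. r \<in> carrier R \<Longrightarrow> a \<in> H \<Longrightarrow> r \<odot>\<^bsub>M\<^esub> a \<in> H"
  shows "submodule H R M"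
proof -
  interpret M: module R M by fact
  show ?thesis
  proof (rule M.submoduleI)
    fix a assume "a \<in> H"
    then show "\<ominus>\<^bsub>M\<^esub> a \<in> H"
      using assms(2,5) module_minus[OF assms(1), of a] by auto
  qed (use assms in auto)
qed

lemma submodule_simps:
  assumes "module R M" "submodule H R M"
  shows "H \<subseteq> carrier M" "\<zero>\<^bsub>M\<^esub> \<in> H"
    and "\<And>a b. a \<in> H \<Longrightarrow> b \<in> H \<Longrightarrow> a \<oplus>\<^bsub>M\<^esub> b \<in> H"
    and "\<And>r a. r \<in> carrier R \<Longrightarrow> a \<in> H \<Longrightarrow> r \<odot>\<^bsub>M\<^esub> a \<in> H"
    and "\<And>a b. a \<in> H \<Longrightarrow> b \<in> H \<Longrightarrow> a \<ominus>\<^bsub>M\<^esub> b \<in> H"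
proof -
  interpret M: module R M by fact
  interpret H: submodule H R M by fact
  show "H \<subseteq> carrier M" "\<zero>\<^bsub>M\<^esub> \<in> H"
    using M.submoduleE(1)[OF assms(2)] H.one_closed by auto
  show "\<And>a b. a \<in> H \<Longrightarrow> b \<in> H \<Longrightarrow> a \<oplus>\<^bsub>M\<^esub> b \<in> H"
    and "\<And>r a. r \<in> carrier R \<Longrightarrow> a \<in> H \<Longrightarrow> r \<odot>\<^bsub>M\<^esub> a \<in> H"
    and "\<And>a b. a \<in> H \<Longrightarrow> b \<in> H \<Longrightarrow> a \<ominus>\<^bsub>M\<^esub> b \<in> H"
    using M.submoduleE[OF assms(2)] by (auto simp: a_minus_def)
qed

lemma mod_hom_image_submodule:
  assumes "h \<in> mod_hom R M N" "module R M" "module R N"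
  shows "submodule (h ` carrier M) R N"
proof (rule submodule_crit[OF assms(3)])
  interpret M: module R M by fact
  show "h ` carrier M \<subseteq> carrier N" using assms(1) by (auto simp: mod_homD)
  show "\<zero>\<^bsub>N\<^esub> \<in> h ` carrier M" using mod_hom_zero[OF assms] M.M.zero_closed by (metis imageI)
  fix a b assume "a \<in> h ` carrier M" "b \<in> h ` carrier M"
  then obtain x y where "x \<in> carrier M" "y \<in> carrier M" "a = h x" "b = h y" by auto
  then show "a \<oplus>\<^bsub>N\<^esub> b \<in> h ` carrier M"
    using mod_homD(2)[OF assms(1)] by (metis M.M.a_closed imageI)
next
  interpret M: module R M by fact
  fix r a assume "r \<in> carrier R" "a \<in> h ` carrier M"
  then obtain x where "x \<in> carrier M" "a = h x" by auto
  then show "r \<odot>\<^bsub>N\<^esub> a \<in> h ` carrier M"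
    using mod_homD(3)[OF assms(1)] \<open>r \<in> carrier R\<close> by (metis M.smult_closed imageI)
qed

lemma mod_hom_kernel_submodule:
  assumes "h \<in> mod_hom R M N" "module R M" "module R N"
  shows "submodule {a \<in> carrier M. h a = \<zero>\<^bsub>N\<^esub>} R M"
proof (rule submodule_crit[OF assms(2)])
  interpret M: module R M by fact
  interpret N: module R N by fact
  show "\<zero>\<^bsub>M\<^esub> \<in> {a \<in> carrier M. h a = \<zero>\<^bsub>N\<^esub>}" using mod_hom_zero[OF assms] by simp
  show "\<And>a b. a \<in> {a \<in> carrier M. h a = \<zero>\<^bsub>N\<^esub>} \<Longrightarrow> b \<in> {a \<in> carrier M. h a = \<zero>\<^bsub>N\<^esub>}
    \<Longrightarrow> a \<oplus>\<^bsub>M\<^esub> b \<in> {a \<in> carrier M. h a = \<zero>\<^bsub>N\<^esub>}"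
    using mod_homD[OF assms(1)] by simp
  show "\<And>r a. r \<in> carrier R \<Longrightarrow> a \<in> {a \<in> carrier M. h a = \<zero>\<^bsub>N\<^esub>}
    \<Longrightarrow> r \<odot>\<^bsub>M\<^esub> a \<in> {a \<in> carrier M. h a = \<zero>\<^bsub>N\<^esub>}"
    using mod_homD[OF assms(1)] by simp
qed auto

lemma mod_hom_carrier_update:
  "h \<in> mod_hom R M N \<Longrightarrow> A \<subseteq> carrier M \<Longrightarrow> h ` A \<subseteq> B \<Longrightarrow>
    h \<in> mod_hom R (M\<lparr>carrier := A\<rparr>) (N\<lparr>carrier := B\<rparr>)"
  by (auto simp: mod_hom_def subset_iff)

lemma ring_module_module:
  assumes "cring R" shows "module R (ring_module R)"
proof -
  interpret cring R by fact
  show ?thesis unfolding ring_module_def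
  proof (rule moduleI[OF assms]; (rule abelian_groupI)?)
    fix x assume "x \<in> carrier (mk_module (carrier R) \<zero>\<^bsub>R\<^esub> (\<lambda>a b. a \<oplus>\<^bsub>R\<^esub> b) (\<lambda>r a. r \<otimes>\<^bsub>R\<^esub> a))"
    then show "\<exists>y\<in>carrier (mk_module (carrier R) \<zero>\<^bsub>R\<^esub> (\<lambda>a b. a \<oplus>\<^bsub>R\<^esub> b) (\<lambda>r a. r \<otimes>\<^bsub>R\<^esub> a)).
        y \<oplus>\<^bsub>mk_module (carrier R) \<zero>\<^bsub>R\<^esub> (\<lambda>a b. a \<oplus>\<^bsub>R\<^esub> b) (\<lambda>r a. r \<otimes>\<^bsub>R\<^esub> a)\<^esub> x =
        \<zero>\<^bsub>mk_module (carrier R) \<zero>\<^bsub>R\<^esub> (\<lambda>a b. a \<oplus>\<^bsub>R\<^esub> b) (\<lambda>r a. r \<otimes>\<^bsub>R\<^esub> a)\<^esub>"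
      by (auto intro!: bexI[of _ "\<ominus>\<^bsub>R\<^esub> x"] l_neg)
  qed (simp_all add: l_distr r_distr m_assoc a_ac)
qed

lemma ring_module_simps [simp]:
  "carrier (ring_module R) = carrier R" "\<zero>\<^bsub>ring_module R\<^esub> = \<zero>\<^bsub>R\<^esub>"
  "a \<oplus>\<^bsub>ring_module R\<^esub> b = a \<oplus>\<^bsub>R\<^esub> b" "a \<odot>\<^bsub>ring_module R\<^esub> b = a \<otimes>\<^bsub>R\<^esub> b"
  by (simp_all add: ring_module_def)

lemma prod_module_simps [simp]:
  "carrier (prod_module I M) = (\<Pi>\<^sub>E i\<in>I. carrier (M i))" "\<zero>\<^bsub>prod_module I M\<^esub> = (\<lambda>i\<in>I. \<zero>\<^bsub>M i\<^esub>)"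
  "f \<oplus>\<^bsub>prod_module I M\<^esub> g = (\<lambda>i\<in>I. f i \<oplus>\<^bsub>M i\<^esub> g i)"
  "r \<odot>\<^bsub>prod_module I M\<^esub> f = (\<lambda>i\<in>I. r \<odot>\<^bsub>M i\<^esub> f i)"
  by (simp_all add: prod_module_def)

lemma prod_module_module:
  assumes R: "cring R" and M: "\<And>i. i \<in> I \<Longrightarrow> module R (M i)"
  shows "module R (prod_module I M)"
proof -
  interpret cring R by fact
  have ab: "abelian_group (M i)" if "i \<in> I" for i using M[OF that] by (simp add: module_def)
  have abm: "abelian_monoid (M i)" if "i \<in> I" for i using ab[OF that] by (simp add: abelian_group_def)
  show ?thesis
  proof (rule moduleI[OF R]; (rule abelian_groupI)?)
    fix x assume x: "x \<in> carrier (prod_module I M)"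
    have "(\<lambda>i\<in>I. \<ominus>\<^bsub>M i\<^esub> x i) \<in> carrier (prod_module I M)"
      using x ab by (auto intro!: abelian_group.a_inv_closed)
    moreover have "(\<lambda>i\<in>I. \<ominus>\<^bsub>M i\<^esub> x i) \<oplus>\<^bsub>prod_module I M\<^esub> x = \<zero>\<^bsub>prod_module I M\<^esub>"
      using x ab by (auto simp: fun_eq_iff restrict_def PiE_def Pi_def abelian_group.l_neg)
    ultimately show "\<exists>y\<in>carrier (prod_module I M). y \<oplus>\<^bsub>prod_module I M\<^esub> x = \<zero>\<^bsub>prod_module I M\<^esub>"
      by blast
  qed (auto simp: fun_eq_iff PiE_def Pi_def extensional_def restrict_def
      intro!: abelian_monoid.a_closed[OF abm] abelian_monoid.zero_closed[OF abm]
        abelian_monoid.a_assoc[OF abm] abelian_monoid.a_comm[OF abm] abelian_monoid.l_zero[OF abm]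
        module.smult_closed[OF M] module.smult_l_distr[OF M] module.smult_r_distr[OF M]
        module.smult_assoc1[OF M] module.smult_one[OF M])
qed


subsection \<open>Quotients\<close>

lemma quot_module_simps [simp]:
  "carrier (quot_module M N) = a_rcosets\<^bsub>M\<^esub> N" "\<zero>\<^bsub>quot_module M N\<^esub> = N"
  "A \<oplus>\<^bsub>quot_module M N\<^esub> B = A <+>\<^bsub>M\<^esub> B"
  "r \<odot>\<^bsub>quot_module M N\<^esub> A = (\<Union>a\<in>A. N +>\<^bsub>M\<^esub> (r \<odot>\<^bsub>M\<^esub> a))"
  by (simp_all add: quot_module_def)

locale quotient = module R M + submodule N R M for R :: "'r ring" and M :: "('r, 'a) module" and N
begin

sublocale abelian_subgroup N M
  by (rule abelian_subgroupI3)
    (simp_all add: additive_subgroup_def subgroup_axioms M.abelian_group_axioms)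

lemma sub_closed: "a \<in> N \<Longrightarrow> a \<in> carrier M"
  using submodule_simps(1)[OF module_axioms submodule_axioms] by auto

lemma coset_eq_iff:
  assumes "a \<in> carrier M" "b \<in> carrier M"
  shows "N +>\<^bsub>M\<^esub> a = N +>\<^bsub>M\<^esub> b \<longleftrightarrow> a \<ominus>\<^bsub>M\<^esub> b \<in> N"
proof
  assume "N +>\<^bsub>M\<^esub> a = N +>\<^bsub>M\<^esub> b"
  then have "a \<in> N +>\<^bsub>M\<^esub> b" using a_rcos_self[OF assms(1)] by simp
  then obtain n where "n \<in> N" "a = n \<oplus>\<^bsub>M\<^esub> b" by (auto simp: a_r_coset_def')
  then show "a \<ominus>\<^bsub>M\<^esub> b \<in> N" using assms sub_closed[of n]
    by (simp add: a_minus_def M.a_assoc M.r_neg)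
next
  assume "a \<ominus>\<^bsub>M\<^esub> b \<in> N"
  moreover have "a = (a \<ominus>\<^bsub>M\<^esub> b) \<oplus>\<^bsub>M\<^esub> b"
    using assms by (simp add: a_minus_def M.a_assoc M.l_neg)
  ultimately have "a \<in> N +>\<^bsub>M\<^esub> b" by (auto simp: a_r_coset_def')
  then show "N +>\<^bsub>M\<^esub> a = N +>\<^bsub>M\<^esub> b"
    using M.a_repr_independence assms subgroup_axioms by metis
qed

lemma cosets_iff: "A \<in> a_rcosets\<^bsub>M\<^esub> N \<longleftrightarrow> (\<exists>a\<in>carrier M. A = N +>\<^bsub>M\<^esub> a)"
  by (auto simp: A_RCOSETS_def')

lemma coset_elem: "a \<in> carrier M \<Longrightarrow> b \<in> N +>\<^bsub>M\<^esub> a \<Longrightarrow> b \<in> carrier M \<and> N +>\<^bsub>M\<^esub> b = N +>\<^bsub>M\<^esub> a"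
  using M.a_repr_independence[of b N a] subgroup_axioms M.a_r_coset_subset_G[of N a] sub_closed
  by (metis subsetD subsetI)

lemma coset_smult:
  assumes "r \<in> carrier R" "a \<in> carrier M"
  shows "(\<Union>b\<in>N +>\<^bsub>M\<^esub> a. N +>\<^bsub>M\<^esub> (r \<odot>\<^bsub>M\<^esub> b)) = N +>\<^bsub>M\<^esub> (r \<odot>\<^bsub>M\<^esub> a)"
proof -
  have "N +>\<^bsub>M\<^esub> (r \<odot>\<^bsub>M\<^esub> b) = N +>\<^bsub>M\<^esub> (r \<odot>\<^bsub>M\<^esub> a)" if "b \<in> N +>\<^bsub>M\<^esub> a" for b
  proof -
    have b: "b \<in> carrier M" "N +>\<^bsub>M\<^esub> b = N +>\<^bsub>M\<^esub> a" using coset_elem[OF assms(2) that] by auto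
    then have "b \<ominus>\<^bsub>M\<^esub> a \<in> N" using coset_eq_iff assms by simp
    then have "r \<odot>\<^bsub>M\<^esub> (b \<ominus>\<^bsub>M\<^esub> a) \<in> N" using assms by simp
    moreover have "r \<odot>\<^bsub>M\<^esub> (b \<ominus>\<^bsub>M\<^esub> a) = r \<odot>\<^bsub>M\<^esub> b \<ominus>\<^bsub>M\<^esub> r \<odot>\<^bsub>M\<^esub> a"
      using assms b by (simp add: a_minus_def smult_r_distr smult_r_minus)
    ultimately show ?thesis using coset_eq_iff assms b by simp
  qed
  moreover have "a \<in> N +>\<^bsub>M\<^esub> a" by (rule a_rcos_self[OF assms(2)])
  ultimately show ?thesis by blast
qed

end

lemma quotientI: "module R M \<Longrightarrow> submodule N R M \<Longrightarrow> quotient R M N"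
  by (simp add: quotient_def)

text \<open>The isomorphism theorem for a map between quotients: \<open>ker\<close> makes the induced map injective and
  \<open>sur\<close> makes it surjective, even where \<open>h\<close> itself is neither.\<close>

lemma quot_mod_iso:
  assumes M: "module R M" and N: "submodule N R M" and M': "module R M'" and N': "submodule N' R M'"
    and h: "h \<in> mod_hom R M M'"
    and ker: "\<And>a. a \<in> carrier M \<Longrightarrow> h a \<in> N' \<longleftrightarrow> a \<in> N"
    and sur: "\<And>b. b \<in> carrier M' \<Longrightarrow> \<exists>a\<in>carrier M. b \<ominus>\<^bsub>M'\<^esub> h a \<in> N'"
  shows "mod_iso R (quot_module M N) (quot_module M' N')"
proof -
  interpret A: quotient R M N by (rule quotientI[OF M N])
  interpret B: quotient R M' N' by (rule quotientI[OF M' N'])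
  define k where "k A = (\<Union>a\<in>A. N' +>\<^bsub>M'\<^esub> h a)" for A
  have eq: "N' +>\<^bsub>M'\<^esub> h a = N' +>\<^bsub>M'\<^esub> h b \<longleftrightarrow> N +>\<^bsub>M\<^esub> a = N +>\<^bsub>M\<^esub> b"
    if "a \<in> carrier M" "b \<in> carrier M" for a b
    using that ker[of "a \<ominus>\<^bsub>M\<^esub> b"] by (simp add: A.coset_eq_iff B.coset_eq_iff mod_homD(1)[OF h]
        mod_hom_diff[OF h M M'])
  have k: "k (N +>\<^bsub>M\<^esub> a) = N' +>\<^bsub>M'\<^esub> h a" if a: "a \<in> carrier M" for a
  proof -
    have "N' +>\<^bsub>M'\<^esub> h b = N' +>\<^bsub>M'\<^esub> h a" if "b \<in> N +>\<^bsub>M\<^esub> a" for b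
      using A.coset_elem[OF a that] eq a by blast
    then show ?thesis using A.a_rcos_self[OF a] unfolding k_def by blast
  qed
  have "k \<in> mod_hom R (quot_module M N) (quot_module M' N')"
  proof (rule mod_homI)
    fix X Y assume "X \<in> carrier (quot_module M N)" "Y \<in> carrier (quot_module M N)"
    then show "k (X \<oplus>\<^bsub>quot_module M N\<^esub> Y) = k X \<oplus>\<^bsub>quot_module M' N'\<^esub> k Y"
      by (auto simp: A.cosets_iff A.a_rcos_sum k mod_homD[OF h] B.a_rcos_sum)
  next
    fix r X assume "r \<in> carrier R" "X \<in> carrier (quot_module M N)"
    moreover from this obtain a where "a \<in> carrier M" "X = N +>\<^bsub>M\<^esub> a" by (auto simp: A.cosets_iff)
    ultimately show "k (r \<odot>\<^bsub>quot_module M N\<^esub> X) = r \<odot>\<^bsub>quot_module M' N'\<^esub> k X"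
      by (simp add: k A.coset_smult B.coset_smult mod_homD[OF h])
  qed (auto simp: A.cosets_iff B.cosets_iff k mod_homD[OF h])
  moreover have "bij_betw k (carrier (quot_module M N)) (carrier (quot_module M' N'))"
  proof (rule bij_betwI')
    fix X Y assume "X \<in> carrier (quot_module M N)" "Y \<in> carrier (quot_module M N)"
    then show "k X = k Y \<longleftrightarrow> X = Y" by (auto simp: A.cosets_iff k eq)
  next
    fix Y assume "Y \<in> carrier (quot_module M' N')"
    then obtain b where b: "b \<in> carrier M'" "Y = N' +>\<^bsub>M'\<^esub> b" by (auto simp: B.cosets_iff)
    from sur[OF b(1)] obtain a where a: "a \<in> carrier M" "b \<ominus>\<^bsub>M'\<^esub> h a \<in> N'" by auto
    then have "Y = k (N +>\<^bsub>M\<^esub> a)" using b by (simp add: k B.coset_eq_iff mod_homD[OF h])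
    moreover have "N +>\<^bsub>M\<^esub> a \<in> carrier (quot_module M N)" using a by (auto simp: A.cosets_iff)
    ultimately show "\<exists>X\<in>carrier (quot_module M N). Y = k X" by blast
  qed (auto simp: A.cosets_iff B.cosets_iff k mod_homD[OF h])
  ultimately show ?thesis unfolding mod_iso_def by blast
qed

lemma mod_iso_trans:
  assumes "mod_iso R M N" "mod_iso R N L"
  shows "mod_iso R M L"
proof -
  obtain h k where "h \<in> mod_hom R M N" "bij_betw h (carrier M) (carrier N)"
    "k \<in> mod_hom R N L" "bij_betw k (carrier N) (carrier L)"
    using assms unfolding mod_iso_def by blast
  then show ?thesis unfolding mod_iso_def
    using mod_hom_comp bij_betw_trans[of h _ _ k] by (fastforce simp: o_def)
qed


subsection \<open>Free modules\<close>

lemma free_module_simps [simp]: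
  "\<zero>\<^bsub>free_module R S\<^esub> = (\<lambda>_. \<zero>\<^bsub>R\<^esub>)"
  "f \<oplus>\<^bsub>free_module R S\<^esub> g = (\<lambda>s. f s \<oplus>\<^bsub>R\<^esub> g s)"
  "r \<odot>\<^bsub>free_module R S\<^esub> f = (\<lambda>s. r \<otimes>\<^bsub>R\<^esub> f s)"
  by (simp_all add: free_module_def)

lemma free_module_carrier:
  "f \<in> carrier (free_module R S) \<longleftrightarrow> (\<forall>s\<in>S. f s \<in> carrier R) \<and> (\<forall>s. s \<notin> S \<longrightarrow> f s = \<zero>\<^bsub>R\<^esub>) \<and>
     finite {s. f s \<noteq> \<zero>\<^bsub>R\<^esub>}"
  by (simp add: free_module_def)

lemma free_module_module:
  assumes "cring R" shows "module R (free_module R S)"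
proof -
  interpret cring R by fact
  have cl: "f s \<in> carrier R" if "f \<in> carrier (free_module R S)" for f :: "'b \<Rightarrow> 'a" and s
    using that by (cases "s \<in> S") (auto simp: free_module_carrier)
  have fin: "finite {s. f s \<oplus>\<^bsub>R\<^esub> g s \<noteq> \<zero>\<^bsub>R\<^esub>}"
    if "f \<in> carrier (free_module R S)" "g \<in> carrier (free_module R S)" for f g :: "'b \<Rightarrow> 'a"
    by (rule finite_subset[of _ "{s. f s \<noteq> \<zero>\<^bsub>R\<^esub>} \<union> {s. g s \<noteq> \<zero>\<^bsub>R\<^esub>}"])
      (use that in \<open>auto simp: free_module_carrier\<close>)
  have fin': "finite {s. r \<otimes>\<^bsub>R\<^esub> g s \<noteq> \<zero>\<^bsub>R\<^esub>}"
    if "r \<in> carrier R" "g \<in> carrier (free_module R S)" for r and g :: "'b \<Rightarrow> 'a"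
    by (rule finite_subset[of _ "{s. g s \<noteq> \<zero>\<^bsub>R\<^esub>}"])
      (use that in \<open>auto simp: free_module_carrier\<close>)
  have inv: "\<exists>y\<in>carrier (free_module R S). y \<oplus>\<^bsub>free_module R S\<^esub> x = \<zero>\<^bsub>free_module R S\<^esub>"
    if x: "x \<in> carrier (free_module R S)" for x
  proof (rule bexI)
    show "(\<lambda>s. \<ominus>\<^bsub>R\<^esub> \<one>\<^bsub>R\<^esub> \<otimes>\<^bsub>R\<^esub> x s) \<in> carrier (free_module R S)"
      using x fin'[of "\<ominus>\<^bsub>R\<^esub> \<one>\<^bsub>R\<^esub>" x] by (auto simp: free_module_carrier)
    show "(\<lambda>s. \<ominus>\<^bsub>R\<^esub> \<one>\<^bsub>R\<^esub> \<otimes>\<^bsub>R\<^esub> x s) \<oplus>\<^bsub>free_module R S\<^esub> x = \<zero>\<^bsub>free_module R S\<^esub>"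
      using cl[OF x] by (simp add: l_minus l_neg)
  qed
  show ?thesis
  proof (rule moduleI[OF assms]; (rule abelian_groupI)?)
    show "\<And>x y. x \<in> carrier (free_module R S) \<Longrightarrow> y \<in> carrier (free_module R S) \<Longrightarrow>
       x \<oplus>\<^bsub>free_module R S\<^esub> y \<in> carrier (free_module R S)"
      using fin by (auto simp: free_module_carrier)
    show "\<And>r y. r \<in> carrier R \<Longrightarrow> y \<in> carrier (free_module R S) \<Longrightarrow>
       r \<odot>\<^bsub>free_module R S\<^esub> y \<in> carrier (free_module R S)"
      using fin' by (auto simp: free_module_carrier)
    show "\<zero>\<^bsub>free_module R S\<^esub> \<in> carrier (free_module R S)" by (auto simp: free_module_carrier)
  qed (use inv in \<open>auto simp: cl fun_eq_iff a_ac l_distr r_distr m_assoc\<close>)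
qed

lemma free_gen_closed: "cring R \<Longrightarrow> s \<in> S \<Longrightarrow> free_gen R s \<in> carrier (free_module R S)"
proof -
  assume "cring R" "s \<in> S"
  interpret cring R by fact
  have "finite {t. free_gen R s t \<noteq> \<zero>\<^bsub>R\<^esub>}"
    by (rule finite_subset[of _ "{s}"]) (auto simp: free_gen_def)
  then show ?thesis using \<open>s \<in> S\<close> by (auto simp: free_module_carrier free_gen_def)
qed

text \<open>Holds by induction on the size of the finite support.\<close>

lemma free_module_induct [consumes 2, case_names zero add]:
  assumes R: "cring R" and f: "f \<in> carrier (free_module R S)"
    and zero: "Q (\<lambda>_. \<zero>\<^bsub>R\<^esub>)"
    and add: "\<And>f r s. f \<in> carrier (free_module R S) \<Longrightarrow> Q f \<Longrightarrow> r \<in> carrier R \<Longrightarrow> s \<in> S \<Longrightarrow>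
       Q (f \<oplus>\<^bsub>free_module R S\<^esub> (r \<odot>\<^bsub>free_module R S\<^esub> free_gen R s))"
  shows "Q f"
proof -
  interpret cring R by fact
  have "finite {s. f s \<noteq> \<zero>\<^bsub>R\<^esub>}" using f by (simp add: free_module_carrier)
  then obtain A where "finite A" "{s. f s \<noteq> \<zero>\<^bsub>R\<^esub>} \<subseteq> A" by blast
  then show ?thesis using f
  proof (induct A arbitrary: f rule: finite_induct)
    case empty
    then have "f = (\<lambda>_. \<zero>\<^bsub>R\<^esub>)" by auto
    then show ?case using zero by simp
  next
    case (insert s A)
    show ?case
    proof (cases "s \<in> S")
      case False
      then show ?thesis using insert by (auto simp: free_module_carrier subset_iff)
    next
      case True
      define g where "g = f(s := \<zero>\<^bsub>R\<^esub>)"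
      have "finite {t. g t \<noteq> \<zero>\<^bsub>R\<^esub>}"
        by (rule finite_subset[of _ "{s. f s \<noteq> \<zero>\<^bsub>R\<^esub>}"])
          (use insert in \<open>auto simp: free_module_carrier g_def\<close>)
      then have g: "g \<in> carrier (free_module R S)"
        using insert by (auto simp: free_module_carrier g_def)
      moreover have "{t. g t \<noteq> \<zero>\<^bsub>R\<^esub>} \<subseteq> A" using insert by (auto simp: g_def)
      ultimately have "Q g" using insert by blast
      moreover have "f s \<in> carrier R" using insert True by (auto simp: free_module_carrier)
      moreover have "f t \<in> carrier R" for t
        using insert by (cases "t \<in> S") (auto simp: free_module_carrier)
      then have "f = g \<oplus>\<^bsub>free_module R S\<^esub> (f s \<odot>\<^bsub>free_module R S\<^esub> free_gen R s)"
        by (auto simp: g_def free_gen_def fun_eq_iff)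
      ultimately show ?thesis using add[OF g _ _ True] by metis
    qed
  qed
qed

lemma free_module_hom_eq:
  assumes R: "cring R" and N: "module R N"
    and h: "h \<in> mod_hom R (free_module R S) N" and k: "k \<in> mod_hom R (free_module R S) N"
    and eq: "\<And>s. s \<in> S \<Longrightarrow> h (free_gen R s) = k (free_gen R s)"
    and f: "f \<in> carrier (free_module R S)"
  shows "h f = k f"
  using R f
proof (induct rule: free_module_induct)
  case zero
  show ?case using mod_hom_zero[OF h free_module_module[OF R] N] mod_hom_zero[OF k free_module_module[OF R] N] by simp
next
  case (add f r s)
  note F = module.smult_closed[OF free_module_module[OF R]]
  show ?case using add free_gen_closed[OF R add(4)] F[OF add(3) free_gen_closed[OF R add(4)]] eq[OF add(4)]
    by (simp add: mod_homD(2,3)[OF h] mod_homD(2,3)[OF k] del: free_module_simps)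
qed

text \<open>The linear extension of \<open>\<phi>\<close> from the generators to the free module, by the universal property.\<close>

definition lin_ext :: "'r ring \<Rightarrow> ('r, 'a) module \<Rightarrow> ('s \<Rightarrow> 'a) \<Rightarrow> ('s \<Rightarrow> 'r) \<Rightarrow> 'a" where
  "lin_ext R N \<phi> f = (\<Oplus>\<^bsub>N\<^esub>s\<in>{s. f s \<noteq> \<zero>\<^bsub>R\<^esub>}. f s \<odot>\<^bsub>N\<^esub> \<phi> s)"

text \<open>Enlarging the index set allows two elements with different supports to be summed over one set, as
  additivity needs.\<close>

lemma lin_ext_superset:
  assumes N: "module R N" and "\<phi> \<in> S \<rightarrow> carrier N" and f: "f \<in> carrier (free_module R S)"
    and "finite A" "{s. f s \<noteq> \<zero>\<^bsub>R\<^esub>} \<subseteq> A" "A \<subseteq> S"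
  shows "lin_ext R N \<phi> f = (\<Oplus>\<^bsub>N\<^esub>s\<in>A. f s \<odot>\<^bsub>N\<^esub> \<phi> s)"
proof -
  interpret module R N by fact
  have "f s \<odot>\<^bsub>N\<^esub> \<phi> s \<in> carrier N" if "s \<in> A" for s
    using that assms by (auto simp: free_module_carrier intro!: smult_closed)
  moreover have "\<phi> s \<in> carrier N" if "s \<in> A" for s using that assms by blast
  ultimately show ?thesis unfolding lin_ext_def using assms
    by (intro M.add.finprod_mono_neutral_cong_left[folded finsum_def, simplified])
       (auto simp: subset_iff)
qed

lemma lin_ext_hom:
  assumes R: "cring R" and N: "module R N" and \<phi>: "\<phi> \<in> S \<rightarrow> carrier N"
  shows "lin_ext R N \<phi> \<in> mod_hom R (free_module R S) N"
proof -
  interpret N: module R N by fact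
  interpret F: module R "free_module R S" by (rule free_module_module[OF R])
  have cl: "f s \<odot>\<^bsub>N\<^esub> \<phi> s \<in> carrier N" if "s \<in> S" "f \<in> carrier (free_module R S)" for s f
    using that \<phi> by (auto simp: free_module_carrier)
  have sup: "finite {s. f s \<noteq> \<zero>\<^bsub>R\<^esub>}" "{s. f s \<noteq> \<zero>\<^bsub>R\<^esub>} \<subseteq> S" if "f \<in> carrier (free_module R S)" for f
    using that by (auto simp: free_module_carrier)
  show ?thesis
  proof (rule mod_homI)
    fix f assume f: "f \<in> carrier (free_module R S)"
    show "lin_ext R N \<phi> f \<in> carrier N"
      unfolding lin_ext_def by (rule N.M.finsum_closed) (use cl sup f in blast)
  next
    fix f g assume f: "f \<in> carrier (free_module R S)" and g: "g \<in> carrier (free_module R S)"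
    let ?A = "{s. f s \<noteq> \<zero>\<^bsub>R\<^esub>} \<union> {s. g s \<noteq> \<zero>\<^bsub>R\<^esub>}"
    have A: "finite ?A" "?A \<subseteq> S" using sup[OF f] sup[OF g] by auto
    have fg: "f \<oplus>\<^bsub>free_module R S\<^esub> g \<in> carrier (free_module R S)" using f g by (rule F.M.a_closed)
    have "lin_ext R N \<phi> (f \<oplus>\<^bsub>free_module R S\<^esub> g) = (\<Oplus>\<^bsub>N\<^esub>s\<in>?A. (f s \<oplus>\<^bsub>R\<^esub> g s) \<odot>\<^bsub>N\<^esub> \<phi> s)"
      by (subst lin_ext_superset[OF N \<phi> fg A(1) _ A(2)]) auto
    also have "\<dots> = (\<Oplus>\<^bsub>N\<^esub>s\<in>?A. f s \<odot>\<^bsub>N\<^esub> \<phi> s \<oplus>\<^bsub>N\<^esub> g s \<odot>\<^bsub>N\<^esub> \<phi> s)"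
    proof (rule N.M.finsum_cong')
      fix s assume s: "s \<in> ?A"
      then have "s \<in> S" using A by blast
      then show "(f s \<oplus>\<^bsub>R\<^esub> g s) \<odot>\<^bsub>N\<^esub> \<phi> s = f s \<odot>\<^bsub>N\<^esub> \<phi> s \<oplus>\<^bsub>N\<^esub> g s \<odot>\<^bsub>N\<^esub> \<phi> s"
        using f g \<phi> by (intro N.smult_l_distr) (auto simp: free_module_carrier)
    next
      show "(\<lambda>s. f s \<odot>\<^bsub>N\<^esub> \<phi> s \<oplus>\<^bsub>N\<^esub> g s \<odot>\<^bsub>N\<^esub> \<phi> s) \<in> ?A \<rightarrow> carrier N"
        using cl f g A by (auto intro!: N.M.a_closed)
    qed simp
    also have "\<dots> = (\<Oplus>\<^bsub>N\<^esub>s\<in>?A. f s \<odot>\<^bsub>N\<^esub> \<phi> s) \<oplus>\<^bsub>N\<^esub> (\<Oplus>\<^bsub>N\<^esub>s\<in>?A. g s \<odot>\<^bsub>N\<^esub> \<phi> s)"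
      by (rule N.M.finsum_addf) (use cl f g A in blast)+
    also have "\<dots> = lin_ext R N \<phi> f \<oplus>\<^bsub>N\<^esub> lin_ext R N \<phi> g"
      using lin_ext_superset[OF N \<phi> f A(1) _ A(2)] lin_ext_superset[OF N \<phi> g A(1) _ A(2)] by simp
    finally show "lin_ext R N \<phi> (f \<oplus>\<^bsub>free_module R S\<^esub> g) = lin_ext R N \<phi> f \<oplus>\<^bsub>N\<^esub> lin_ext R N \<phi> g" .
  next
    fix r f assume r: "r \<in> carrier R" and f: "f \<in> carrier (free_module R S)"
    let ?A = "{s. f s \<noteq> \<zero>\<^bsub>R\<^esub>}"
    note A = sup[OF f]
    have fg: "r \<odot>\<^bsub>free_module R S\<^esub> f \<in> carrier (free_module R S)" using r f by (rule F.smult_closed)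
    have "lin_ext R N \<phi> (r \<odot>\<^bsub>free_module R S\<^esub> f) = (\<Oplus>\<^bsub>N\<^esub>s\<in>?A. (r \<otimes>\<^bsub>R\<^esub> f s) \<odot>\<^bsub>N\<^esub> \<phi> s)"
      by (subst lin_ext_superset[OF N \<phi> fg A(1) _ A(2)]) (use r in auto)
    also have "\<dots> = (\<Oplus>\<^bsub>N\<^esub>s\<in>?A. r \<odot>\<^bsub>N\<^esub> (f s \<odot>\<^bsub>N\<^esub> \<phi> s))"
    proof (rule N.M.finsum_cong')
      fix s assume s: "s \<in> ?A"
      then have "s \<in> S" using A by blast
      then show "(r \<otimes>\<^bsub>R\<^esub> f s) \<odot>\<^bsub>N\<^esub> \<phi> s = r \<odot>\<^bsub>N\<^esub> (f s \<odot>\<^bsub>N\<^esub> \<phi> s)"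
        using f r \<phi> by (intro N.smult_assoc1) (auto simp: free_module_carrier)
    next
      show "(\<lambda>s. r \<odot>\<^bsub>N\<^esub> (f s \<odot>\<^bsub>N\<^esub> \<phi> s)) \<in> ?A \<rightarrow> carrier N"
        by (rule Pi_I, rule N.smult_closed[OF r], rule cl[OF _ f]) (use A in blast)
    qed simp
    also have "\<dots> = r \<odot>\<^bsub>N\<^esub> (\<Oplus>\<^bsub>N\<^esub>s\<in>?A. f s \<odot>\<^bsub>N\<^esub> \<phi> s)"
      by (rule N.finsum_smult_ldistr[symmetric]) (use cl f A r in blast)+
    finally show "lin_ext R N \<phi> (r \<odot>\<^bsub>free_module R S\<^esub> f) = r \<odot>\<^bsub>N\<^esub> lin_ext R N \<phi> f"
      unfolding lin_ext_def .
  qed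
qed

lemma lin_ext_gen:
  assumes R: "cring R" and N: "module R N" and \<phi>: "\<phi> \<in> S \<rightarrow> carrier N" and s: "s \<in> S"
  shows "lin_ext R N \<phi> (free_gen R s) = \<phi> s"
proof -
  interpret N: module R N by fact
  have "lin_ext R N \<phi> (free_gen R s) = (\<Oplus>\<^bsub>N\<^esub>t\<in>{s}. free_gen R s t \<odot>\<^bsub>N\<^esub> \<phi> t)"
    by (rule lin_ext_superset[OF N \<phi> free_gen_closed[OF R s]]) (use s in \<open>auto simp: free_gen_def\<close>)
  also have "\<dots> = \<phi> s"
  proof -
    have "\<phi> s \<in> carrier N" using \<phi> s by blast
    then show ?thesis by (subst N.M.finsum_insert) (auto simp: free_gen_def)
  qed
  finally show ?thesis .
qed


section \<open>Functors and natural transformations\<close>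

definition is_cat :: "('o, 'm) cat \<Rightarrow> bool" where
  "is_cat C \<longleftrightarrow> (\<forall>x\<in>Obj C. Id C x \<in> Hom C x x) \<and>
     (\<forall>x\<in>Obj C. \<forall>y\<in>Obj C. \<forall>z\<in>Obj C. \<forall>f\<in>Hom C x y. \<forall>g\<in>Hom C y z. Comp C x y z g f \<in> Hom C x z) \<and>
     (\<forall>x\<in>Obj C. \<forall>y\<in>Obj C. \<forall>f\<in>Hom C x y. Comp C x x y f (Id C x) = f \<and> Comp C x y y (Id C y) f = f) \<and>
     (\<forall>w\<in>Obj C. \<forall>x\<in>Obj C. \<forall>y\<in>Obj C. \<forall>z\<in>Obj C. \<forall>f\<in>Hom C w x. \<forall>g\<in>Hom C x y. \<forall>h\<in>Hom C y z.
        Comp C w x z (Comp C x y z h g) f = Comp C w y z h (Comp C w x y g f))"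

lemma is_catD:
  assumes "is_cat C"
  shows "x \<in> Obj C \<Longrightarrow> Id C x \<in> Hom C x x"
    and "x \<in> Obj C \<Longrightarrow> y \<in> Obj C \<Longrightarrow> z \<in> Obj C \<Longrightarrow> f \<in> Hom C x y \<Longrightarrow> g \<in> Hom C y z \<Longrightarrow>
      Comp C x y z g f \<in> Hom C x z"
    and "x \<in> Obj C \<Longrightarrow> y \<in> Obj C \<Longrightarrow> f \<in> Hom C x y \<Longrightarrow> Comp C x x y f (Id C x) = f"
    and "x \<in> Obj C \<Longrightarrow> y \<in> Obj C \<Longrightarrow> f \<in> Hom C x y \<Longrightarrow> Comp C x y y (Id C y) f = f"
    and "w \<in> Obj C \<Longrightarrow> x \<in> Obj C \<Longrightarrow> y \<in> Obj C \<Longrightarrow> z \<in> Obj C \<Longrightarrow> f \<in> Hom C w x \<Longrightarrow> g \<in> Hom C x y \<Longrightarrow>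
      h \<in> Hom C y z \<Longrightarrow> Comp C w x z (Comp C x y z h g) f = Comp C w y z h (Comp C w x y g f)"
  using assms unfolding is_cat_def by simp_all

lemma op_cat_simps [simp]:
  "Obj (op_cat C) = Obj C" "Hom (op_cat C) x y = Hom C y x" "Id (op_cat C) = Id C"
  "Comp (op_cat C) x y z g f = Comp C z y x f g"
  by (simp_all add: op_cat_def)

lemma is_cat_op: "is_cat C \<Longrightarrow> is_cat (op_cat C)"
  by (simp add: is_cat_def)

lemma functorD:
  assumes "is_rmod_functor R C F"
  shows "x \<in> Obj C \<Longrightarrow> module R (ob F x)"
    and "x \<in> Obj C \<Longrightarrow> y \<in> Obj C \<Longrightarrow> f \<in> Hom C x y \<Longrightarrow> act F x y f \<in> mod_hom R (ob F x) (ob F y)"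
    and "x \<in> Obj C \<Longrightarrow> y \<in> Obj C \<Longrightarrow> f \<in> Hom C x y \<Longrightarrow> a \<in> carrier (ob F x) \<Longrightarrow>
      act F x y f a \<in> carrier (ob F y)"
    and "x \<in> Obj C \<Longrightarrow> a \<in> carrier (ob F x) \<Longrightarrow> act F x x (Id C x) a = a"
    and "x \<in> Obj C \<Longrightarrow> y \<in> Obj C \<Longrightarrow> z \<in> Obj C \<Longrightarrow> f \<in> Hom C x y \<Longrightarrow> g \<in> Hom C y z \<Longrightarrow>
      a \<in> carrier (ob F x) \<Longrightarrow> act F x z (Comp C x y z g f) a = act F y z g (act F x y f a)"
proof -
  show *: "x \<in> Obj C \<Longrightarrow> y \<in> Obj C \<Longrightarrow> f \<in> Hom C x y \<Longrightarrow> act F x y f \<in> mod_hom R (ob F x) (ob F y)" for f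
    using assms unfolding is_rmod_functor_def by blast
  show "x \<in> Obj C \<Longrightarrow> y \<in> Obj C \<Longrightarrow> f \<in> Hom C x y \<Longrightarrow> a \<in> carrier (ob F x) \<Longrightarrow>
      act F x y f a \<in> carrier (ob F y)"
    using mod_homD(1)[OF *] .
qed (use assms in \<open>simp_all add: is_rmod_functor_def\<close>)

text \<open>The extensional representative of a family of maps, which is the form that \<open>nat_trans\<close> demands.\<close>

definition mk_trans :: "('o, 'm) cat \<Rightarrow> ('o, 'm, 'r, 'a) rmod_functor \<Rightarrow> ('o \<Rightarrow> 'a \<Rightarrow> 'b) \<Rightarrow> 'o \<Rightarrow> 'a \<Rightarrow> 'b"
  where "mk_trans C M h = (\<lambda>x\<in>Obj C. \<lambda>a\<in>carrier (ob M x). h x a)"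

lemma mk_trans_app [simp]:
  "x \<in> Obj C \<Longrightarrow> a \<in> carrier (ob M x) \<Longrightarrow> mk_trans C M h x a = h x a"
  by (simp add: mk_trans_def)

lemma mk_trans_nat_trans:
  assumes M: "is_rmod_functor R C M"
    and "\<And>x. x \<in> Obj C \<Longrightarrow> h x \<in> mod_hom R (ob M x) (ob N x)"
    and "\<And>x y f a. x \<in> Obj C \<Longrightarrow> y \<in> Obj C \<Longrightarrow> f \<in> Hom C x y \<Longrightarrow> a \<in> carrier (ob M x) \<Longrightarrow>
      h y (act M x y f a) = act N x y f (h x a)"
  shows "mk_trans C M h \<in> nat_trans R C M N"
proof -
  have "mk_trans C M h x \<in> mod_hom R (ob M x) (ob N x)" if "x \<in> Obj C" for x
    by (rule mod_hom_cong[OF assms(2)[OF that] _ functorD(1)[OF M that]]) (simp add: that)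
  moreover have "mk_trans C M h \<in> extensional (Obj C)"
    "\<And>x. x \<in> Obj C \<Longrightarrow> mk_trans C M h x \<in> extensional (carrier (ob M x))"
    by (simp_all add: mk_trans_def)
  moreover have "mk_trans C M h y (act M x y f a) = act N x y f (mk_trans C M h x a)"
    if "x \<in> Obj C" "y \<in> Obj C" "f \<in> Hom C x y" "a \<in> carrier (ob M x)" for x y f a
    using that functorD(3)[OF M that] assms(3)[OF that] by simp
  ultimately show ?thesis unfolding nat_trans_def
    by (intro CollectI conjI ballI IntI) assumption+
qed

lemma nat_transD:
  assumes "\<eta> \<in> nat_trans R C M N"
  shows "x \<in> Obj C \<Longrightarrow> \<eta> x \<in> mod_hom R (ob M x) (ob N x)"
    and "x \<in> Obj C \<Longrightarrow> a \<in> carrier (ob M x) \<Longrightarrow> \<eta> x a \<in> carrier (ob N x)"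
    and "x \<in> Obj C \<Longrightarrow> y \<in> Obj C \<Longrightarrow> f \<in> Hom C x y \<Longrightarrow> a \<in> carrier (ob M x) \<Longrightarrow>
      \<eta> y (act M x y f a) = act N x y f (\<eta> x a)"
proof -
  show *: "x \<in> Obj C \<Longrightarrow> \<eta> x \<in> mod_hom R (ob M x) (ob N x)" for x
    using assms unfolding nat_trans_def by blast
  show "x \<in> Obj C \<Longrightarrow> a \<in> carrier (ob M x) \<Longrightarrow> \<eta> x a \<in> carrier (ob N x)"
    using mod_homD(1)[OF *] .
qed (use assms in \<open>simp_all add: nat_trans_def\<close>)

lemma nat_trans_eqI:
  assumes "\<eta> \<in> nat_trans R C M N" "\<theta> \<in> nat_trans R C M N'"
    and "\<And>x a. x \<in> Obj C \<Longrightarrow> a \<in> carrier (ob M x) \<Longrightarrow> \<eta> x a = \<theta> x a"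
  shows "\<eta> = \<theta>"
proof
  fix x
  show "\<eta> x = \<theta> x"
  proof (cases "x \<in> Obj C")
    case True
    then show ?thesis using assms unfolding nat_trans_def by (auto intro: extensionalityI)
  next
    case False
    then show ?thesis using assms unfolding nat_trans_def by (auto simp: extensional_def)
  qed
qed

lemma mk_trans_eq:
  assumes "\<eta> \<in> nat_trans R C M N" "\<And>x a. x \<in> Obj C \<Longrightarrow> a \<in> carrier (ob M x) \<Longrightarrow> h x a = \<eta> x a"
  shows "mk_trans C M h = \<eta>"
proof
  fix x
  show "mk_trans C M h x = \<eta> x"
  proof (cases "x \<in> Obj C")
    case True
    then show ?thesis using assms unfolding nat_trans_def
      by (auto simp: mk_trans_def intro: extensionalityI)
  next
    case False
    then show ?thesis using assms unfolding nat_trans_def by (auto simp: mk_trans_def extensional_def)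
  qed
qed

lemma nat_trans_zero:
  assumes "\<eta> \<in> nat_trans R C M N" "is_rmod_functor R C M" "is_rmod_functor R C N" "x \<in> Obj C"
  shows "\<eta> x \<zero>\<^bsub>ob M x\<^esub> = \<zero>\<^bsub>ob N x\<^esub>"
  using mod_hom_zero[OF nat_transD(1)[OF assms(1,4)] functorD(1)[OF assms(2,4)] functorD(1)[OF assms(3,4)]] .

lemma trans_comp_mk: "trans_comp C M \<theta> \<eta> = mk_trans C M (\<lambda>x a. \<theta> x (\<eta> x a))"
  by (simp add: trans_comp_def mk_trans_def)

lemma trans_comp_app [simp]:
  "x \<in> Obj C \<Longrightarrow> a \<in> carrier (ob M x) \<Longrightarrow> trans_comp C M \<theta> \<eta> x a = \<theta> x (\<eta> x a)"
  by (simp add: trans_comp_mk)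

lemma trans_comp_closed:
  assumes "is_rmod_functor R C M" "\<eta> \<in> nat_trans R C M N" "\<theta> \<in> nat_trans R C N L"
  shows "trans_comp C M \<theta> \<eta> \<in> nat_trans R C M L"
  unfolding trans_comp_mk
proof (rule mk_trans_nat_trans[OF assms(1)])
  fix x assume "x \<in> Obj C"
  then show "(\<lambda>a. \<theta> x (\<eta> x a)) \<in> mod_hom R (ob M x) (ob L x)"
    using mod_hom_comp[OF nat_transD(1)[OF assms(2)] nat_transD(1)[OF assms(3)]] by simp
qed (simp add: nat_transD[OF assms(2)] nat_transD[OF assms(3)])

lemma hom_module_simps [simp]:
  "carrier (hom_module R C M N) = nat_trans R C M N"
  "\<zero>\<^bsub>hom_module R C M N\<^esub> = mk_trans C M (\<lambda>x a. \<zero>\<^bsub>ob N x\<^esub>)"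
  "\<eta> \<oplus>\<^bsub>hom_module R C M N\<^esub> \<theta> = mk_trans C M (\<lambda>x a. \<eta> x a \<oplus>\<^bsub>ob N x\<^esub> \<theta> x a)"
  "r \<odot>\<^bsub>hom_module R C M N\<^esub> \<eta> = mk_trans C M (\<lambda>x a. r \<odot>\<^bsub>ob N x\<^esub> \<eta> x a)"
  by (simp_all add: hom_module_def mk_trans_def)

lemma hom_module_module:
  assumes R: "cring R" and M: "is_rmod_functor R C M" and N: "is_rmod_functor R C N"
  shows "module R (hom_module R C M N)"
proof -
  interpret R: cring R by fact
  have mN: "module R (ob N x)" if "x \<in> Obj C" for x using functorD(1)[OF N that] .
  have mM: "module R (ob M x)" if "x \<in> Obj C" for x using functorD(1)[OF M that] .
  have abN: "abelian_group (ob N x)" if "x \<in> Obj C" for x using mN[OF that] by (simp add: module_def)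
  have amN: "abelian_monoid (ob N x)" if "x \<in> Obj C" for x
    using abN[OF that] by (simp add: abelian_group_def)
  have amM: "abelian_monoid (ob M x)" if "x \<in> Obj C" for x
    using mM[OF that] by (simp add: module_def abelian_group_def)
  have zero: "mk_trans C M (\<lambda>x a. \<zero>\<^bsub>ob N x\<^esub>) \<in> nat_trans R C M N"
  proof (rule mk_trans_nat_trans[OF M])
    fix x assume x: "x \<in> Obj C"
    interpret N: module R "ob N x" by (rule mN[OF x])
    show "(\<lambda>a. \<zero>\<^bsub>ob N x\<^esub>) \<in> mod_hom R (ob M x) (ob N x)" by (rule mod_homI) auto
  next
    fix x y f assume "x \<in> Obj C" "y \<in> Obj C" "f \<in> Hom C x y"
    then show "\<zero>\<^bsub>ob N y\<^esub> = act N x y f \<zero>\<^bsub>ob N x\<^esub>"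
      using mod_hom_zero[OF functorD(2)[OF N]] mN by metis
  qed
  have add: "mk_trans C M (\<lambda>x a. \<eta> x a \<oplus>\<^bsub>ob N x\<^esub> \<theta> x a) \<in> nat_trans R C M N"
    if \<eta>: "\<eta> \<in> nat_trans R C M N" and \<theta>: "\<theta> \<in> nat_trans R C M N" for \<eta> \<theta>
  proof (rule mk_trans_nat_trans[OF M])
    fix x assume x: "x \<in> Obj C"
    interpret N: module R "ob N x" by (rule mN[OF x])
    note h = mod_homD[OF nat_transD(1)[OF \<eta> x]] mod_homD[OF nat_transD(1)[OF \<theta> x]]
    show "(\<lambda>a. \<eta> x a \<oplus>\<^bsub>ob N x\<^esub> \<theta> x a) \<in> mod_hom R (ob M x) (ob N x)"
      by (rule mod_homI) (simp_all add: h N.M.a_ac N.smult_r_distr)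
  next
    fix x y f a assume xy: "x \<in> Obj C" "y \<in> Obj C" "f \<in> Hom C x y" "a \<in> carrier (ob M x)"
    then show "\<eta> y (act M x y f a) \<oplus>\<^bsub>ob N y\<^esub> \<theta> y (act M x y f a) =
      act N x y f (\<eta> x a \<oplus>\<^bsub>ob N x\<^esub> \<theta> x a)"
      by (simp add: nat_transD[OF \<eta>] nat_transD[OF \<theta>] mod_homD(2)[OF functorD(2)[OF N]])
  qed
  have sm: "mk_trans C M (\<lambda>x a. r \<odot>\<^bsub>ob N x\<^esub> \<eta> x a) \<in> nat_trans R C M N"
    if \<eta>: "\<eta> \<in> nat_trans R C M N" and r: "r \<in> carrier R" for \<eta> r
  proof (rule mk_trans_nat_trans[OF M])
    fix x assume x: "x \<in> Obj C"
    interpret N: module R "ob N x" by (rule mN[OF x])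
    note h = mod_homD[OF nat_transD(1)[OF \<eta> x]]
    show "(\<lambda>a. r \<odot>\<^bsub>ob N x\<^esub> \<eta> x a) \<in> mod_hom R (ob M x) (ob N x)"
      by (rule mod_homI) (simp_all add: h r N.smult_r_distr N.smult_assoc1[symmetric] R.m_comm)
  next
    fix x y f a assume xy: "x \<in> Obj C" "y \<in> Obj C" "f \<in> Hom C x y" "a \<in> carrier (ob M x)"
    then show "r \<odot>\<^bsub>ob N y\<^esub> \<eta> y (act M x y f a) = act N x y f (r \<odot>\<^bsub>ob N x\<^esub> \<eta> x a)"
      using r by (simp add: nat_transD[OF \<eta>] mod_homD(3)[OF functorD(2)[OF N]])
  qed
  note ab = abelian_monoid.a_closed[OF amN] abelian_monoid.zero_closed[OF amN]
     module.smult_closed[OF mN]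
  show ?thesis
  proof (rule moduleI[OF R]; (rule abelian_groupI)?)
    fix \<eta> assume \<eta>: "\<eta> \<in> carrier (hom_module R C M N)"
    let ?m = "\<ominus>\<^bsub>R\<^esub> \<one>\<^bsub>R\<^esub> \<odot>\<^bsub>hom_module R C M N\<^esub> \<eta>"
    have m: "?m \<in> nat_trans R C M N" using sm \<eta> by simp
    moreover have "?m \<oplus>\<^bsub>hom_module R C M N\<^esub> \<eta> = \<zero>\<^bsub>hom_module R C M N\<^esub>"
      unfolding hom_module_simps(2,3)
    proof (rule nat_trans_eqI[OF add[OF m] zero])
      fix x a assume x: "x \<in> Obj C" "a \<in> carrier (ob M x)"
      then have "\<eta> x a \<in> carrier (ob N x)" using \<eta> by (simp add: nat_transD)
      then show "mk_trans C M (\<lambda>x a. ?m x a \<oplus>\<^bsub>ob N x\<^esub> \<eta> x a) x a = mk_trans C M (\<lambda>x a. \<zero>\<^bsub>ob N x\<^esub>) x a"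
        using x by (simp add: module_minus[OF mN, symmetric] abelian_group.l_neg[OF abN])
    qed (use \<eta> in simp)
    ultimately show "\<exists>\<theta>\<in>carrier (hom_module R C M N). \<theta> \<oplus>\<^bsub>hom_module R C M N\<^esub> \<eta> = \<zero>\<^bsub>hom_module R C M N\<^esub>"
      by auto
  qed (auto simp: zero add sm nat_transD(2) ab abelian_monoid.a_assoc[OF amN] abelian_monoid.l_zero[OF amN]
      module.smult_one[OF mN] module.smult_l_distr[OF mN]
      module.smult_r_distr[OF mN] module.smult_assoc1[OF mN]
      intro!: nat_trans_eqI[of _ R C M N _ N] add sm zero abelian_monoid.a_comm[OF amN])
qed

lemma precomp_hom:
  assumes M: "is_rmod_functor R C M" and M': "is_rmod_functor R C M'" and N: "is_rmod_functor R C N"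
    and R: "cring R" and \<eta>: "\<eta> \<in> nat_trans R C M M'"
  shows "(\<lambda>\<theta>. trans_comp C M \<theta> \<eta>) \<in> mod_hom R (hom_module R C M' N) (hom_module R C M N)"
proof -
  interpret H': module R "hom_module R C M' N" by (rule hom_module_module[OF R M' N])
  interpret H: module R "hom_module R C M N" by (rule hom_module_module[OF R M N])
  show ?thesis
  proof (rule mod_homI)
    fix \<theta> \<kappa> assume c: "\<theta> \<in> carrier (hom_module R C M' N)" "\<kappa> \<in> carrier (hom_module R C M' N)"
    have "trans_comp C M (\<theta> \<oplus>\<^bsub>hom_module R C M' N\<^esub> \<kappa>) \<eta> \<in> nat_trans R C M N"
      by (rule trans_comp_closed[OF M \<eta>]) (use H'.M.a_closed[OF c] in simp)
    moreover have "trans_comp C M \<theta> \<eta> \<oplus>\<^bsub>hom_module R C M N\<^esub> trans_comp C M \<kappa> \<eta> \<in> carrier (hom_module R C M N)"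
      by (rule H.M.a_closed) (use c trans_comp_closed[OF M \<eta>] in auto)
    ultimately show "trans_comp C M (\<theta> \<oplus>\<^bsub>hom_module R C M' N\<^esub> \<kappa>) \<eta> =
      trans_comp C M \<theta> \<eta> \<oplus>\<^bsub>hom_module R C M N\<^esub> trans_comp C M \<kappa> \<eta>"
      by (intro nat_trans_eqI[of _ R C M N _ N]) (auto simp: nat_transD[OF \<eta>])
  next
    fix r \<theta> assume c: "r \<in> carrier R" "\<theta> \<in> carrier (hom_module R C M' N)"
    have "trans_comp C M (r \<odot>\<^bsub>hom_module R C M' N\<^esub> \<theta>) \<eta> \<in> nat_trans R C M N"
      by (rule trans_comp_closed[OF M \<eta>]) (use H'.smult_closed[OF c] in simp)
    moreover have "r \<odot>\<^bsub>hom_module R C M N\<^esub> trans_comp C M \<theta> \<eta> \<in> carrier (hom_module R C M N)"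
      by (rule H.smult_closed) (use c trans_comp_closed[OF M \<eta>] in auto)
    ultimately show "trans_comp C M (r \<odot>\<^bsub>hom_module R C M' N\<^esub> \<theta>) \<eta> =
      r \<odot>\<^bsub>hom_module R C M N\<^esub> trans_comp C M \<theta> \<eta>"
      by (intro nat_trans_eqI[of _ R C M N _ N]) (auto simp: nat_transD[OF \<eta>])
  qed (use trans_comp_closed[OF M \<eta>] in auto)
qed

lemma hom_module_eq_zero_iff:
  assumes "\<eta> \<in> nat_trans R C M N"
  shows "\<eta> = \<zero>\<^bsub>hom_module R C M N\<^esub> \<longleftrightarrow> (\<forall>x\<in>Obj C. \<forall>a\<in>carrier (ob M x). \<eta> x a = \<zero>\<^bsub>ob N x\<^esub>)"
  using mk_trans_eq[OF assms, of "\<lambda>x a. \<zero>\<^bsub>ob N x\<^esub>"] by auto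

lemma const_functor_functor: "cring R \<Longrightarrow> is_rmod_functor R C (const_functor R)"
  unfolding is_rmod_functor_def const_functor_def
  by (auto simp: ring_module_module intro!: mod_homI)


section \<open>Projective functors\<close>

text \<open>The free functor has value at \<open>c\<close> the free module on all pairs of a morphism \<open>f : x \<rightarrow> c\<close> and an
  element \<open>e\<close> of \<open>P x\<close>. It is the sum of the representable functors indexed by the elements of \<open>P\<close>.\<close>

definition free_triples :: "('o, 'm) cat \<Rightarrow> ('o, 'm, 'r, 'p) rmod_functor \<Rightarrow> 'o \<Rightarrow> ('o \<times> 'm \<times> 'p) set" where
  "free_triples C P c = {(x, f, e). x \<in> Obj C \<and> f \<in> Hom C x c \<and> e \<in> carrier (ob P x)}"

definition free_functor :: "'r ring \<Rightarrow> ('o, 'm) cat \<Rightarrow> ('o, 'm, 'r, 'p) rmod_functor \<Rightarrow>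
    ('o, 'm, 'r, 'o \<times> 'm \<times> 'p \<Rightarrow> 'r) rmod_functor" where
  "free_functor R C P = \<lparr>ob = (\<lambda>c. free_module R (free_triples C P c)),
     act = (\<lambda>c c' g. lin_ext R (free_module R (free_triples C P c'))
       (\<lambda>(x, f, e). free_gen R (x, Comp C x c c' g f, e)))\<rparr>"

lemma free_functor_act:
  assumes R: "cring R" and C: "is_cat C" and c: "c \<in> Obj C" "c' \<in> Obj C" "g \<in> Hom C c c'"
  shows "act (free_functor R C P) c c' g \<in> mod_hom R (ob (free_functor R C P) c) (ob (free_functor R C P) c')"
    and "t \<in> free_triples C P c \<Longrightarrow> act (free_functor R C P) c c' g (free_gen R t) =
      free_gen R (fst t, Comp C (fst t) c c' g (fst (snd t)), snd (snd t))"
proof -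
  have *: "(\<lambda>(x, f, e). free_gen R (x, Comp C x c c' g f, e)) \<in>
      free_triples C P c \<rightarrow> carrier (free_module R (free_triples C P c'))"
    using c is_catD(2)[OF C] by (auto simp: free_triples_def intro!: free_gen_closed[OF R])
  show "act (free_functor R C P) c c' g \<in> mod_hom R (ob (free_functor R C P) c) (ob (free_functor R C P) c')"
    using lin_ext_hom[OF R free_module_module[OF R] *] by (simp add: free_functor_def)
  show "t \<in> free_triples C P c \<Longrightarrow> act (free_functor R C P) c c' g (free_gen R t) =
      free_gen R (fst t, Comp C (fst t) c c' g (fst (snd t)), snd (snd t))"
    using lin_ext_gen[OF R free_module_module[OF R] *] by (auto simp: free_functor_def split: prod.splits)
qed

lemma free_functor_functor:
  fixes P :: "('o, 'm, 'r, 'p) rmod_functor"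
  assumes R: "cring R" and C: "is_cat C"
  shows "is_rmod_functor R C (free_functor R C P)"
proof -
  let ?F = "free_functor R C P"
  have ob: "ob ?F c = free_module R (free_triples C P c)" for c by (simp add: free_functor_def)
  have m: "module R (ob ?F c)" for c by (simp add: ob free_module_module[OF R])
  have id: "act ?F c c (Id C c) a = a" if c: "c \<in> Obj C" and a: "a \<in> carrier (ob ?F c)" for c a
  proof (rule free_module_hom_eq[OF R m[of c], of _ "free_triples C P c"])
    show "act ?F c c (Id C c) \<in> mod_hom R (free_module R (free_triples C P c)) (ob ?F c)"
      using free_functor_act(1)[OF R C c c is_catD(1)[OF C c], of P] by (simp add: ob)
    show "(\<lambda>x. x) \<in> mod_hom R (free_module R (free_triples C P c)) (ob ?F c)"
      by (rule mod_homI) (simp_all add: ob)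
    show "a \<in> carrier (free_module R (free_triples C P c))" using a by (simp add: ob)
    fix t assume t: "t \<in> free_triples C P c"
    then show "act ?F c c (Id C c) (free_gen R t) = free_gen R t"
      using free_functor_act(2)[OF R C c c is_catD(1)[OF C c] t] is_catD(4)[OF C] c
      by (auto simp: free_triples_def)
  qed
  have comp: "act ?F x z (Comp C x y z g f) a = act ?F y z g (act ?F x y f a)"
    if x: "x \<in> Obj C" and y: "y \<in> Obj C" and z: "z \<in> Obj C" and f: "f \<in> Hom C x y" and g: "g \<in> Hom C y z"
      and a: "a \<in> carrier (ob ?F x)" for x y z f g a
  proof (rule free_module_hom_eq[OF R m[of z], where S = "free_triples C P x" and
        k = "\<lambda>a. act ?F y z g (act ?F x y f a)" and f = a])
    note gf = is_catD(2)[OF C x y z f g]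
    show "act ?F x z (Comp C x y z g f) \<in> mod_hom R (free_module R (free_triples C P x)) (ob ?F z)"
      using free_functor_act(1)[OF R C x z gf, of P] by (simp add: ob)
    show "(\<lambda>a. act ?F y z g (act ?F x y f a)) \<in> mod_hom R (free_module R (free_triples C P x)) (ob ?F z)"
      using mod_hom_comp[OF free_functor_act(1)[OF R C x y f, of P] free_functor_act(1)[OF R C y z g, of P]]
      by (simp add: ob)
    show "a \<in> carrier (free_module R (free_triples C P x))" using a by (simp add: ob)
    fix t assume t: "t \<in> free_triples C P x"
    obtain w h e where t': "t = (w, h, e)" by (cases t) auto
    with t have w: "w \<in> Obj C" "h \<in> Hom C w x" "e \<in> carrier (ob P w)" by (auto simp: free_triples_def)
    have t2: "(w, Comp C w x y f h, e) \<in> free_triples C P y"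
      using w is_catD(2)[OF C w(1) x y w(2) f] by (simp add: free_triples_def)
    show "act ?F x z (Comp C x y z g f) (free_gen R t) = act ?F y z g (act ?F x y f (free_gen R t))"
      using free_functor_act(2)[OF R C x z gf t] free_functor_act(2)[OF R C x y f t]
        free_functor_act(2)[OF R C y z g t2] is_catD(5)[OF C w(1) x y z w(2) f g] by (simp add: t')
  qed
  show ?thesis unfolding is_rmod_functor_def
    using m id comp free_functor_act(1)[OF R C] by blast
qed

text \<open>By the Yoneda lemma a transformation out of a sum of representable functors may be prescribed
  arbitrarily on the universal elements.\<close>

lemma free_functor_extend:
  fixes P :: "('o, 'm, 'r, 'p) rmod_functor"
  assumes R: "cring R" and C: "is_cat C" and N: "is_rmod_functor R C N"
    and u: "\<And>x e. x \<in> Obj C \<Longrightarrow> e \<in> carrier (ob P x) \<Longrightarrow> u x e \<in> carrier (ob N x)"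
  obtains \<tau> where "\<tau> \<in> nat_trans R C (free_functor R C P) N"
    and "\<And>c x f e. c \<in> Obj C \<Longrightarrow> (x, f, e) \<in> free_triples C P c \<Longrightarrow>
      \<tau> c (free_gen R (x, f, e)) = act N x c f (u x e)"
proof -
  let ?F = "free_functor R C P"
  define v where "v c = (\<lambda>(x, f, e). act N x c f (u x e))" for c
  have ob: "ob ?F c = free_module R (free_triples C P c)" for c by (simp add: free_functor_def)
  have v: "v c \<in> free_triples C P c \<rightarrow> carrier (ob N c)" if "c \<in> Obj C" for c
    using that u functorD(3)[OF N] by (auto simp: v_def free_triples_def)
  have h: "lin_ext R (ob N c) (v c) \<in> mod_hom R (ob ?F c) (ob N c)" if "c \<in> Obj C" for c
    unfolding ob by (rule lin_ext_hom[OF R functorD(1)[OF N that] v[OF that]])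
  have g: "lin_ext R (ob N c) (v c) (free_gen R t) = v c t"
    if "c \<in> Obj C" "t \<in> free_triples C P c" for c t
    by (rule lin_ext_gen[OF R functorD(1)[OF N that(1)] v[OF that(1)] that(2)])
  define \<tau> where "\<tau> = mk_trans C ?F (\<lambda>c. lin_ext R (ob N c) (v c))"
  have "\<tau> \<in> nat_trans R C ?F N" unfolding \<tau>_def
  proof (rule mk_trans_nat_trans[OF free_functor_functor[OF R C] h])
    fix x y f a assume x: "x \<in> Obj C" and y: "y \<in> Obj C" and f: "f \<in> Hom C x y" and a: "a \<in> carrier (ob ?F x)"
    show "lin_ext R (ob N y) (v y) (act ?F x y f a) = act N x y f (lin_ext R (ob N x) (v x) a)"
    proof (rule free_module_hom_eq[OF R functorD(1)[OF N y], of _ "free_triples C P x"])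
      show "(\<lambda>a. lin_ext R (ob N y) (v y) (act ?F x y f a)) \<in> mod_hom R (free_module R (free_triples C P x)) (ob N y)"
        using mod_hom_comp[OF free_functor_act(1)[OF R C x y f] h[OF y]] by (simp add: ob)
      show "(\<lambda>a. act N x y f (lin_ext R (ob N x) (v x) a)) \<in> mod_hom R (free_module R (free_triples C P x)) (ob N y)"
        using mod_hom_comp[OF h[OF x] functorD(2)[OF N x y f]] by (simp add: ob)
      show "a \<in> carrier (free_module R (free_triples C P x))" using a by (simp add: ob)
      fix t assume t: "t \<in> free_triples C P x"
      obtain w k e where t': "t = (w, k, e)" by (cases t) auto
      with t have w: "w \<in> Obj C" "k \<in> Hom C w x" "e \<in> carrier (ob P w)" by (auto simp: free_triples_def)
      have t2: "(w, Comp C w x y f k, e) \<in> free_triples C P y"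
        using w is_catD(2)[OF C w(1) x y w(2) f] by (simp add: free_triples_def)
      show "lin_ext R (ob N y) (v y) (act ?F x y f (free_gen R t)) = act N x y f (lin_ext R (ob N x) (v x) (free_gen R t))"
        using free_functor_act(2)[OF R C x y f t] g[OF x t] g[OF y t2]
          functorD(5)[OF N w(1) x y w(2) f] u w by (simp add: t' v_def)
    qed
  qed
  moreover have "\<tau> c (free_gen R (x, f, e)) = act N x c f (u x e)"
    if "c \<in> Obj C" "(x, f, e) \<in> free_triples C P c" for c x f e
    using that g[OF that] free_gen_closed[OF R that(2)] by (simp add: \<tau>_def v_def ob)
  ultimately show ?thesis using that by blast
qed

text \<open>The definition of a projective functor tests the lifting property only against functors of two
  fixed value types. The free functor on \<open>P\<close> has the first of these, so the definition splits its
  projection onto \<open>P\<close>. Being a retract of a free functor, \<open>P\<close> has the lifting property against functors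
  of all value types.\<close>

theorem projective_lift:
  fixes P :: "('o, 'm, 'r, 'p) rmod_functor"
  assumes R: "cring R" and C: "is_cat C" and P: "projective_functor R C P"
    and M: "is_rmod_functor R C M" and N: "is_rmod_functor R C N"
    and \<pi>: "\<pi> \<in> nat_trans R C M N" and epi: "epi_trans C M N \<pi>" and \<phi>: "\<phi> \<in> nat_trans R C P N"
  shows "\<exists>\<psi>\<in>nat_trans R C P M. \<forall>x\<in>Obj C. \<forall>a\<in>carrier (ob P x). \<pi> x (\<psi> x a) = \<phi> x a"
proof -
  let ?F = "free_functor R C P"
  have Pf: "is_rmod_functor R C P" using P by (simp add: projective_functor_def)
  have Ff: "is_rmod_functor R C ?F" by (rule free_functor_functor[OF R C])
  have ob: "ob ?F c = free_module R (free_triples C P c)" for c by (simp add: free_functor_def)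
  \<comment> \<open>the projection of the free functor onto \<open>P\<close>, and below its section \<open>\<sigma>\<close>\<close>
  obtain \<epsilon> where \<epsilon>: "\<epsilon> \<in> nat_trans R C ?F P" "\<And>c x f e. c \<in> Obj C \<Longrightarrow> (x, f, e) \<in> free_triples C P c \<Longrightarrow>
      \<epsilon> c (free_gen R (x, f, e)) = act P x c f e"
    using free_functor_extend[OF R C Pf, of P "\<lambda>x e. e"] by blast
  have "epi_trans C ?F P \<epsilon>" unfolding epi_trans_def
  proof (intro ballI equalityI subsetI)
    fix c e assume c: "c \<in> Obj C" and e: "e \<in> carrier (ob P c)"
    have t: "(c, Id C c, e) \<in> free_triples C P c" using c e is_catD(1)[OF C] by (simp add: free_triples_def)
    then have "e = \<epsilon> c (free_gen R (c, Id C c, e))" using \<epsilon>(2)[OF c t] functorD(4)[OF Pf c e] by simp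
    then show "e \<in> \<epsilon> c ` carrier (ob ?F c)" using free_gen_closed[OF R t] by (auto simp: ob)
  qed (use nat_transD(2)[OF \<epsilon>(1)] in blast)
  moreover have "mk_trans C P (\<lambda>x a. a) \<in> nat_trans R C P P"
    by (rule mk_trans_nat_trans[OF Pf]) (auto intro: mod_homI)
  ultimately obtain \<sigma> where \<sigma>: "\<sigma> \<in> nat_trans R C P ?F" "trans_comp C P \<epsilon> \<sigma> = mk_trans C P (\<lambda>x a. a)"
    using P Ff Pf \<epsilon>(1) unfolding projective_functor_def by blast
  have sec: "\<epsilon> x (\<sigma> x a) = a" if "x \<in> Obj C" "a \<in> carrier (ob P x)" for x a
    using fun_cong[OF fun_cong[OF \<sigma>(2), of x], of a] that by simp
  have "\<exists>m\<in>carrier (ob M x). \<pi> x m = \<phi> x e" if "x \<in> Obj C" "e \<in> carrier (ob P x)" for x e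
    using nat_transD(2)[OF \<phi> that] epi that(1) unfolding epi_trans_def by (metis imageE)
  then obtain u where u: "\<And>x e. x \<in> Obj C \<Longrightarrow> e \<in> carrier (ob P x) \<Longrightarrow> u x e \<in> carrier (ob M x)"
    "\<And>x e. x \<in> Obj C \<Longrightarrow> e \<in> carrier (ob P x) \<Longrightarrow> \<pi> x (u x e) = \<phi> x e" by metis
  obtain \<tau> where \<tau>: "\<tau> \<in> nat_trans R C ?F M" "\<And>c x f e. c \<in> Obj C \<Longrightarrow> (x, f, e) \<in> free_triples C P c \<Longrightarrow>
      \<tau> c (free_gen R (x, f, e)) = act M x c f (u x e)"
    using free_functor_extend[OF R C M, of P u] u(1) by blast
  have eq: "\<pi> c (\<tau> c a) = \<phi> c (\<epsilon> c a)" if c: "c \<in> Obj C" and a: "a \<in> carrier (ob ?F c)" for c a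
  proof (rule free_module_hom_eq[OF R functorD(1)[OF N c], of _ "free_triples C P c"])
    show "(\<lambda>a. \<pi> c (\<tau> c a)) \<in> mod_hom R (free_module R (free_triples C P c)) (ob N c)"
      using mod_hom_comp[OF nat_transD(1)[OF \<tau>(1) c] nat_transD(1)[OF \<pi> c]] by (simp add: ob)
    show "(\<lambda>a. \<phi> c (\<epsilon> c a)) \<in> mod_hom R (free_module R (free_triples C P c)) (ob N c)"
      using mod_hom_comp[OF nat_transD(1)[OF \<epsilon>(1) c] nat_transD(1)[OF \<phi> c]] by (simp add: ob)
    show "a \<in> carrier (free_module R (free_triples C P c))" using a by (simp add: ob)
    fix t assume t: "t \<in> free_triples C P c"
    obtain w k e where t': "t = (w, k, e)" by (cases t) auto
    with t have w: "w \<in> Obj C" "k \<in> Hom C w c" "e \<in> carrier (ob P w)" by (auto simp: free_triples_def)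
    show "\<pi> c (\<tau> c (free_gen R t)) = \<phi> c (\<epsilon> c (free_gen R t))"
      using \<tau>(2)[OF c] \<epsilon>(2)[OF c] t w c u nat_transD(3)[OF \<pi> w(1) c w(2)] nat_transD(3)[OF \<phi> w(1) c w(2)]
      by (simp add: t')
  qed
  show ?thesis
  proof (intro bexI[of _ "trans_comp C P \<tau> \<sigma>"] ballI)
    show "trans_comp C P \<tau> \<sigma> \<in> nat_trans R C P M" by (rule trans_comp_closed[OF Pf \<sigma>(1) \<tau>(1)])
    fix x a assume "x \<in> Obj C" "a \<in> carrier (ob P x)"
    then show "\<pi> x (trans_comp C P \<tau> \<sigma> x a) = \<phi> x a"
      using eq nat_transD(2)[OF \<sigma>(1)] sec by simp
  qed
qed


section \<open>Resolutions\<close>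

definition sub_functor :: "('o, 'm, 'r, 'a) rmod_functor \<Rightarrow> ('o \<Rightarrow> 'a set) \<Rightarrow> ('o, 'm, 'r, 'a) rmod_functor" where
  "sub_functor F H = \<lparr>ob = (\<lambda>x. (ob F x)\<lparr>carrier := H x\<rparr>), act = act F\<rparr>"

lemma sub_functor_functor:
  assumes F: "is_rmod_functor R C F" and H: "\<And>x. x \<in> Obj C \<Longrightarrow> submodule (H x) R (ob F x)"
    and act: "\<And>x y f a. x \<in> Obj C \<Longrightarrow> y \<in> Obj C \<Longrightarrow> f \<in> Hom C x y \<Longrightarrow> a \<in> H x \<Longrightarrow> act F x y f a \<in> H y"
  shows "is_rmod_functor R C (sub_functor F H)"
proof -
  have sub: "H x \<subseteq> carrier (ob F x)" if "x \<in> Obj C" for x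
    using submodule_simps(1)[OF functorD(1)[OF F that] H[OF that]] .
  have "module R (ob (sub_functor F H) x)" if "x \<in> Obj C" for x
    using submodule.submodule_is_module[OF H[OF that] functorD(1)[OF F that]] by (simp add: sub_functor_def)
  moreover have "act (sub_functor F H) x y f \<in> mod_hom R (ob (sub_functor F H) x) (ob (sub_functor F H) y)"
    if "x \<in> Obj C" "y \<in> Obj C" "f \<in> Hom C x y" for x y f
    using mod_hom_carrier_update[OF functorD(2)[OF F that] sub[OF that(1)], of "H y"] act[OF that]
    by (auto simp: sub_functor_def)
  ultimately show ?thesis
    using functorD(4,5)[OF F] sub unfolding is_rmod_functor_def by (simp add: sub_functor_def subset_iff)
qed

lemma nat_trans_into_sub:
  assumes "\<eta> \<in> nat_trans R C M F" "\<And>x a. x \<in> Obj C \<Longrightarrow> a \<in> carrier (ob M x) \<Longrightarrow> \<eta> x a \<in> H x"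
  shows "\<eta> \<in> nat_trans R C M (sub_functor F H)"
proof -
  have "\<eta> x \<in> mod_hom R (ob M x) (ob (sub_functor F H) x)" if "x \<in> Obj C" for x
    using nat_transD(1)[OF assms(1) that] assms(2)[OF that] by (auto simp: mod_hom_def sub_functor_def)
  moreover have "act (sub_functor F H) = act F" by (simp add: sub_functor_def)
  ultimately show ?thesis using assms(1) unfolding nat_trans_def by simp
qed

text \<open>Lifting along the surjection of \<open>X\<close> onto the kernel functor of \<open>d\<close>.\<close>

lemma projective_exact_lift:
  assumes R: "cring R" and C: "is_cat C" and P: "projective_functor R C P"
    and X: "is_rmod_functor R C X" and Y: "is_rmod_functor R C Y" and Z: "is_rmod_functor R C Z"
    and d': "d' \<in> nat_trans R C X Y" and d: "d \<in> nat_trans R C Y Z"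
    and ex: "\<forall>x\<in>Obj C. {a \<in> carrier (ob Y x). d x a = \<zero>\<^bsub>ob Z x\<^esub>} = d' x ` carrier (ob X x)"
    and \<phi>: "\<phi> \<in> nat_trans R C P Y"
    and d\<phi>: "\<forall>x\<in>Obj C. \<forall>a\<in>carrier (ob P x). d x (\<phi> x a) = \<zero>\<^bsub>ob Z x\<^esub>"
  shows "\<exists>\<psi>\<in>nat_trans R C P X. \<forall>x\<in>Obj C. \<forall>a\<in>carrier (ob P x). d' x (\<psi> x a) = \<phi> x a"
proof -
  define H where "H x = {a \<in> carrier (ob Y x). d x a = \<zero>\<^bsub>ob Z x\<^esub>}" for x
  have K: "is_rmod_functor R C (sub_functor Y H)"
  proof (rule sub_functor_functor[OF Y])
    fix x assume x: "x \<in> Obj C"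
    show "submodule (H x) R (ob Y x)" unfolding H_def
      by (rule mod_hom_kernel_submodule[OF nat_transD(1)[OF d x] functorD(1)[OF Y x] functorD(1)[OF Z x]])
  next
    fix x y f a assume xy: "x \<in> Obj C" "y \<in> Obj C" "f \<in> Hom C x y" and a: "a \<in> H x"
    then show "act Y x y f a \<in> H y"
      using mod_hom_zero[OF functorD(2)[OF Z xy] functorD(1)[OF Z xy(1)] functorD(1)[OF Z xy(2)]]
      by (simp add: H_def functorD(3)[OF Y] nat_transD(3)[OF d])
  qed
  have H: "H x = d' x ` carrier (ob X x)" if "x \<in> Obj C" for x using bspec[OF ex that] by (simp only: H_def)
  have "d' \<in> nat_trans R C X (sub_functor Y H)" by (rule nat_trans_into_sub[OF d']) (simp add: H)
  moreover have "epi_trans C X (sub_functor Y H) d'" by (simp add: epi_trans_def H sub_functor_def)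
  moreover have "\<phi> \<in> nat_trans R C P (sub_functor Y H)"
    by (rule nat_trans_into_sub[OF \<phi>]) (simp add: H_def d\<phi> nat_transD(2)[OF \<phi>])
  ultimately show ?thesis by (rule projective_lift[OF R C P X K])
qed

text \<open>A resolution whose terms may fail to be projective. Restricting a projective resolution along a
  functor gives one of these.\<close>

definition exact_complex :: "'r ring \<Rightarrow> ('o, 'm) cat \<Rightarrow> ('o, 'm, 'r, 'a) rmod_functor \<Rightarrow>
    (nat \<Rightarrow> ('o, 'm, 'r, 'p) rmod_functor) \<Rightarrow> (nat \<Rightarrow> 'o \<Rightarrow> 'p \<Rightarrow> 'p) \<Rightarrow> ('o \<Rightarrow> 'p \<Rightarrow> 'a) \<Rightarrow> bool" where
  "exact_complex R C M P d \<epsilon> \<longleftrightarrow>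
     (\<forall>n. is_rmod_functor R C (P n)) \<and>
     (\<forall>n. d n \<in> nat_trans R C (P (Suc n)) (P n)) \<and>
     \<epsilon> \<in> nat_trans R C (P 0) M \<and>
     epi_trans C (P 0) M \<epsilon> \<and>
     (\<forall>x\<in>Obj C. {a \<in> carrier (ob (P 0) x). \<epsilon> x a = \<zero>\<^bsub>ob M x\<^esub>} = d 0 x ` carrier (ob (P 1) x)) \<and>
     (\<forall>n. \<forall>x\<in>Obj C. {a \<in> carrier (ob (P (Suc n)) x). d n x a = \<zero>\<^bsub>ob (P n) x\<^esub>}
        = d (Suc n) x ` carrier (ob (P (Suc (Suc n))) x))"

lemma projective_resolution_iff:
  "projective_resolution R C M P d \<epsilon> \<longleftrightarrow>
     exact_complex R C M P d \<epsilon> \<and> (\<forall>n. projective_functor R C (P n))"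
proof -
  have "projective_functor R C (P n) \<Longrightarrow> is_rmod_functor R C (P n)" for n
    by (simp add: projective_functor_def)
  then have "(\<forall>n. projective_functor R C (P n)) \<longleftrightarrow>
      (\<forall>n. is_rmod_functor R C (P n)) \<and> (\<forall>n. projective_functor R C (P n))" by blast
  then show ?thesis unfolding projective_resolution_def exact_complex_def by argo
qed

lemma exact_complexD:
  assumes "exact_complex R C M P d \<epsilon>"
  shows "is_rmod_functor R C (P n)" "d n \<in> nat_trans R C (P (Suc n)) (P n)"
    "\<epsilon> \<in> nat_trans R C (P 0) M" "epi_trans C (P 0) M \<epsilon>"
    "\<forall>x\<in>Obj C. {a \<in> carrier (ob (P 0) x). \<epsilon> x a = \<zero>\<^bsub>ob M x\<^esub>} = d 0 x ` carrier (ob (P (Suc 0)) x)"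
    "\<forall>x\<in>Obj C. {a \<in> carrier (ob (P (Suc n)) x). d n x a = \<zero>\<^bsub>ob (P n) x\<^esub>}
        = d (Suc n) x ` carrier (ob (P (Suc (Suc n))) x)"
    "x \<in> Obj C \<Longrightarrow> b \<in> carrier (ob (P (Suc 0)) x) \<Longrightarrow> \<epsilon> x (d 0 x b) = \<zero>\<^bsub>ob M x\<^esub>"
    "x \<in> Obj C \<Longrightarrow> b' \<in> carrier (ob (P (Suc (Suc n))) x) \<Longrightarrow> d n x (d (Suc n) x b') = \<zero>\<^bsub>ob (P n) x\<^esub>"
proof -
  note D = assms[unfolded exact_complex_def]
  show "is_rmod_functor R C (P n)" using D by (elim conjE) (erule spec)
  show "d n \<in> nat_trans R C (P (Suc n)) (P n)" using D by (elim conjE) (erule spec)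
  show "\<epsilon> \<in> nat_trans R C (P 0) M" using D by (elim conjE)
  show "epi_trans C (P 0) M \<epsilon>" using D by (elim conjE)
  show 0: "\<forall>x\<in>Obj C. {a \<in> carrier (ob (P 0) x). \<epsilon> x a = \<zero>\<^bsub>ob M x\<^esub>} = d 0 x ` carrier (ob (P (Suc 0)) x)"
    using D unfolding One_nat_def by (elim conjE)
  show n: "\<forall>x\<in>Obj C. {a \<in> carrier (ob (P (Suc n)) x). d n x a = \<zero>\<^bsub>ob (P n) x\<^esub>}
        = d (Suc n) x ` carrier (ob (P (Suc (Suc n))) x)"
    using D by (elim conjE) (erule spec)
  show "\<epsilon> x (d 0 x b) = \<zero>\<^bsub>ob M x\<^esub>" if x: "x \<in> Obj C" and b: "b \<in> carrier (ob (P (Suc 0)) x)"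
    using imageI[OF b, of "d 0 x"] unfolding bspec[OF 0 x, symmetric] by simp
  show "d n x (d (Suc n) x b') = \<zero>\<^bsub>ob (P n) x\<^esub>"
    if x: "x \<in> Obj C" and b: "b' \<in> carrier (ob (P (Suc (Suc n))) x)"
    using imageI[OF b, of "d (Suc n) x"] unfolding bspec[OF n x, symmetric] by simp
qed

text \<open>The comparison theorem. The maps are built degree by degree; the predicate \<open>ok\<close> records what the
  next step needs, namely that \<open>\<alpha> n\<close> maps boundaries to cycles.\<close>

theorem chain_map_exists:
  fixes P :: "nat \<Rightarrow> ('o, 'm, 'r, 'p) rmod_functor" and X :: "nat \<Rightarrow> ('o, 'm, 'r, 'q) rmod_functor"
  assumes R: "cring R" and C: "is_cat C" and M: "is_rmod_functor R C M"
    and P: "projective_resolution R C M P dP \<epsilon>P" and X: "exact_complex R C M X dX \<epsilon>X"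
  obtains \<alpha> where "\<And>n. \<alpha> n \<in> nat_trans R C (P n) (X n)"
    and "\<And>x a. x \<in> Obj C \<Longrightarrow> a \<in> carrier (ob (P 0) x) \<Longrightarrow> \<epsilon>X x (\<alpha> 0 x a) = \<epsilon>P x a"
    and "\<And>n x a. x \<in> Obj C \<Longrightarrow> a \<in> carrier (ob (P (Suc n)) x) \<Longrightarrow>
      dX n x (\<alpha> (Suc n) x a) = \<alpha> n x (dP n x a)"
proof -
  have pr: "projective_functor R C (P n)" for n using P by (simp add: projective_resolution_iff)
  have P: "exact_complex R C M P dP \<epsilon>P" using P by (simp add: projective_resolution_iff)
  note PD = exact_complexD[OF P] and XD = exact_complexD[OF X]
  define ok where "ok n \<alpha> \<longleftrightarrow> \<alpha> \<in> nat_trans R C (P n) (X n) \<and>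
    (n = 0 \<longrightarrow> (\<forall>x\<in>Obj C. \<forall>a\<in>carrier (ob (P 0) x). \<epsilon>X x (\<alpha> x a) = \<epsilon>P x a)) \<and>
    (\<forall>m. n = Suc m \<longrightarrow> (\<forall>x\<in>Obj C. \<forall>a\<in>carrier (ob (P (Suc n)) x). dX m x (\<alpha> x (dP n x a)) = \<zero>\<^bsub>ob (X m) x\<^esub>))"
    for n \<alpha>
  have "\<exists>\<alpha>. \<forall>n. ok n (\<alpha> n) \<and> (\<forall>x\<in>Obj C. \<forall>a\<in>carrier (ob (P (Suc n)) x).
      dX n x (\<alpha> (Suc n) x a) = \<alpha> n x (dP n x a))"
  proof (rule dependent_nat_choice[where P = ok and Q = "\<lambda>n \<alpha> \<beta>. \<forall>x\<in>Obj C. \<forall>a\<in>carrier (ob (P (Suc n)) x).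
      dX n x (\<beta> x a) = \<alpha> x (dP n x a)"])
    have "\<exists>\<alpha>\<in>nat_trans R C (P 0) (X 0). \<forall>x\<in>Obj C. \<forall>a\<in>carrier (ob (P 0) x). \<epsilon>X x (\<alpha> x a) = \<epsilon>P x a"
      by (rule projective_lift[OF R C pr[of 0] XD(1)[of 0] M XD(3,4) PD(3)])
    then show "\<exists>\<alpha>. ok 0 \<alpha>" unfolding ok_def by blast
  next
    fix \<alpha> n assume ok: "ok n \<alpha>"
    then have \<alpha>: "\<alpha> \<in> nat_trans R C (P n) (X n)" by (simp add: ok_def)
    have cl: "trans_comp C (P (Suc n)) \<alpha> (dP n) \<in> nat_trans R C (P (Suc n)) (X n)"
      by (rule trans_comp_closed[OF PD(1,2) \<alpha>])
    have "\<exists>\<beta>\<in>nat_trans R C (P (Suc n)) (X (Suc n)). \<forall>x\<in>Obj C. \<forall>a\<in>carrier (ob (P (Suc n)) x).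
        dX n x (\<beta> x a) = trans_comp C (P (Suc n)) \<alpha> (dP n) x a"
    proof (cases n)
      case 0
      have "\<forall>x\<in>Obj C. \<forall>a\<in>carrier (ob (P (Suc 0)) x). \<epsilon>X x (trans_comp C (P (Suc 0)) \<alpha> (dP 0) x a) = \<zero>\<^bsub>ob M x\<^esub>"
        using ok PD(7) nat_transD(2)[OF PD(2)] unfolding ok_def by (simp add: 0)
      then show ?thesis
        using projective_exact_lift[OF R C pr[of "Suc 0"] XD(1)[of "Suc 0"] XD(1)[of 0] M XD(2)[of 0] XD(3) XD(5) cl[unfolded 0]] by (simp only: 0)
    next
      case (Suc m)
      have "\<forall>x\<in>Obj C. \<forall>a\<in>carrier (ob (P (Suc (Suc m))) x). dX m x (trans_comp C (P (Suc (Suc m))) \<alpha> (dP (Suc m)) x a) = \<zero>\<^bsub>ob (X m) x\<^esub>"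
        using ok unfolding ok_def by (simp add: Suc)
      then show ?thesis
        using projective_exact_lift[OF R C pr[of "Suc (Suc m)"] XD(1)[of "Suc (Suc m)"] XD(1)[of "Suc m"] XD(1)[of m] XD(2)[of "Suc m"] XD(2)[of m] XD(6)[of m] cl[unfolded Suc]] by (simp only: Suc)
    qed
    then obtain \<beta> where \<beta>: "\<beta> \<in> nat_trans R C (P (Suc n)) (X (Suc n))"
      "\<And>x a. x \<in> Obj C \<Longrightarrow> a \<in> carrier (ob (P (Suc n)) x) \<Longrightarrow> dX n x (\<beta> x a) = trans_comp C (P (Suc n)) \<alpha> (dP n) x a"
      by blast
    have "ok (Suc n) \<beta>" unfolding ok_def
    proof (intro conjI allI impI ballI)
      fix m x a assume "Suc n = Suc m" "x \<in> Obj C" "a \<in> carrier (ob (P (Suc (Suc n))) x)"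
      then show "dX m x (\<beta> x (dP (Suc n) x a)) = \<zero>\<^bsub>ob (X m) x\<^esub>"
        using \<beta>(2)[of x "dP (Suc n) x a"] nat_transD(2)[OF PD(2)[of "Suc n"]] PD(8)
          nat_trans_zero[OF \<alpha> PD(1) XD(1)] by simp
    qed (simp_all add: \<beta>(1))
    moreover have "\<forall>x\<in>Obj C. \<forall>a\<in>carrier (ob (P (Suc n)) x). dX n x (\<beta> x a) = \<alpha> x (dP n x a)"
      using \<beta>(2) by simp
    ultimately show "\<exists>\<beta>. ok (Suc n) \<beta> \<and> (\<forall>x\<in>Obj C. \<forall>a\<in>carrier (ob (P (Suc n)) x). dX n x (\<beta> x a) = \<alpha> x (dP n x a))"
      by blast
  qed
  then obtain \<alpha> where \<alpha>: "\<forall>n. ok n (\<alpha> n) \<and> (\<forall>x\<in>Obj C. \<forall>a\<in>carrier (ob (P (Suc n)) x).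
      dX n x (\<alpha> (Suc n) x a) = \<alpha> n x (dP n x a))"
    by (rule exE)
  show ?thesis
  proof (rule that[of \<alpha>])
    show "\<alpha> n \<in> nat_trans R C (P n) (X n)" for n using \<alpha> by (simp add: ok_def)
    show "\<epsilon>X x (\<alpha> 0 x a) = \<epsilon>P x a" if "x \<in> Obj C" "a \<in> carrier (ob (P 0) x)" for x a
      using spec[OF \<alpha>, of 0] that by (simp add: ok_def)
    show "dX n x (\<alpha> (Suc n) x a) = \<alpha> n x (dP n x a)"
      if "x \<in> Obj C" "a \<in> carrier (ob (P (Suc n)) x)" for n x a
      using spec[OF \<alpha>, of n] that by simp
  qed
qed

lemma nat_trans_diff:
  assumes R: "cring R" and M: "is_rmod_functor R C M" and N: "is_rmod_functor R C N"
    and \<eta>: "\<eta> \<in> nat_trans R C M N" and \<theta>: "\<theta> \<in> nat_trans R C M N"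
  shows "mk_trans C M (\<lambda>x a. \<eta> x a \<ominus>\<^bsub>ob N x\<^esub> \<theta> x a) \<in> nat_trans R C M N"
proof -
  interpret H: module R "hom_module R C M N" by (rule hom_module_module[OF R M N])
  interpret cring R by fact
  have s: "\<ominus>\<^bsub>R\<^esub> \<one>\<^bsub>R\<^esub> \<odot>\<^bsub>hom_module R C M N\<^esub> \<theta> \<in> carrier (hom_module R C M N)"
    by (rule H.smult_closed) (use \<theta> in auto)
  have "\<eta> \<oplus>\<^bsub>hom_module R C M N\<^esub> (\<ominus>\<^bsub>R\<^esub> \<one>\<^bsub>R\<^esub> \<odot>\<^bsub>hom_module R C M N\<^esub> \<theta>) \<in> carrier (hom_module R C M N)"
    by (rule H.M.a_closed) (use \<eta> s in auto)
  moreover have "mk_trans C M (\<lambda>x a. \<eta> x a \<ominus>\<^bsub>ob N x\<^esub> \<theta> x a) =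
    \<eta> \<oplus>\<^bsub>hom_module R C M N\<^esub> (\<ominus>\<^bsub>R\<^esub> \<one>\<^bsub>R\<^esub> \<odot>\<^bsub>hom_module R C M N\<^esub> \<theta>)"
    by (rule mk_trans_eq[of _ R C M N])
      (use calculation in \<open>auto simp: module_diff_alt[OF functorD(1)[OF N]] nat_transD(2)[OF \<eta>] nat_transD(2)[OF \<theta>]\<close>)
  ultimately show ?thesis by simp
qed

lemma (in abelian_group) diff_solve:
  "a \<in> carrier G \<Longrightarrow> b \<in> carrier G \<Longrightarrow> c \<in> carrier G \<Longrightarrow> a \<ominus> b = c \<Longrightarrow> a = b \<oplus> c"
  by (auto simp: a_minus_def a_ac r_neg)

text \<open>The endomorphism \<open>\<delta>\<close> of the projective resolution lies over the identity and is therefore homotopic to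
  it, by a homotopy \<open>s\<close>: the difference \<open>D = \<delta> - 1\<close> equals \<open>d s + s d\<close>. Applying a cocycle \<open>\<psi>\<close> kills the
  first term, so that \<open>\<theta> = \<psi> s\<close> bounds the difference. Hence \<open>\<delta>\<close> acts trivially on cohomology.\<close>

theorem chain_endo_cocycle:
  fixes P :: "nat \<Rightarrow> ('o, 'm, 'r, 'p) rmod_functor"
  assumes R: "cring R" and C: "is_cat C" and M: "is_rmod_functor R C M" and N: "is_rmod_functor R C N"
    and P: "projective_resolution R C M P d \<epsilon>"
    and \<delta>: "\<And>n. \<delta> n \<in> nat_trans R C (P n) (P n)"
    and \<delta>0: "\<And>x a. x \<in> Obj C \<Longrightarrow> a \<in> carrier (ob (P 0) x) \<Longrightarrow> \<epsilon> x (\<delta> 0 x a) = \<epsilon> x a"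
    and \<delta>d: "\<And>n x a. x \<in> Obj C \<Longrightarrow> a \<in> carrier (ob (P (Suc n)) x) \<Longrightarrow>
      d n x (\<delta> (Suc n) x a) = \<delta> n x (d n x a)"
    and \<psi>: "\<psi> \<in> nat_trans R C (P (Suc n)) N"
    and \<psi>d: "\<And>x a. x \<in> Obj C \<Longrightarrow> a \<in> carrier (ob (P (Suc (Suc n))) x) \<Longrightarrow> \<psi> x (d (Suc n) x a) = \<zero>\<^bsub>ob N x\<^esub>"
  shows "\<exists>\<theta>\<in>nat_trans R C (P n) N. \<forall>x\<in>Obj C. \<forall>a\<in>carrier (ob (P (Suc n)) x).
      \<psi> x (\<delta> (Suc n) x a) = \<psi> x a \<oplus>\<^bsub>ob N x\<^esub> \<theta> x (d n x a)"
proof -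
  have pr: "projective_functor R C (P n)" for n using P by (simp add: projective_resolution_iff)
  have P: "exact_complex R C M P d \<epsilon>" using P by (simp add: projective_resolution_iff)
  note PD = exact_complexD[OF P]
  have mP: "module R (ob (P n) x)" if "x \<in> Obj C" for n x using functorD(1)[OF PD(1) that] .
  have agP: "abelian_group (ob (P n) x)" if "x \<in> Obj C" for n x using mP[OF that] by (simp add: module_def)
  note dcl = nat_transD(2)[OF PD(2)] and \<delta>cl = nat_transD(2)[OF \<delta>]
  note mcl = abelian_group.minus_closed[OF agP]
  have dd: "d n x (a \<ominus>\<^bsub>ob (P (Suc n)) x\<^esub> b) = d n x a \<ominus>\<^bsub>ob (P n) x\<^esub> d n x b"
    if "x \<in> Obj C" "a \<in> carrier (ob (P (Suc n)) x)" "b \<in> carrier (ob (P (Suc n)) x)" for n x a b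
    using mod_hom_diff[OF nat_transD(1)[OF PD(2) that(1)] mP mP] that by blast
  have self: "a \<ominus>\<^bsub>ob (P n) x\<^esub> a = \<zero>\<^bsub>ob (P n) x\<^esub>" if "x \<in> Obj C" "a \<in> carrier (ob (P n) x)" for n x a
    using abelian_group.r_neg[OF agP] that by (simp add: a_minus_def)
  define D where "D n = mk_trans C (P n) (\<lambda>x a. \<delta> n x a \<ominus>\<^bsub>ob (P n) x\<^esub> a)" for n
  have id: "mk_trans C (P n) (\<lambda>x a. a) \<in> nat_trans R C (P n) (P n)" for n
    by (rule mk_trans_nat_trans[OF PD(1)]) (auto intro: mod_homI)
  have D: "D n \<in> nat_trans R C (P n) (P n)" for n
  proof -
    have "D n = mk_trans C (P n) (\<lambda>x a. \<delta> n x a \<ominus>\<^bsub>ob (P n) x\<^esub> mk_trans C (P n) (\<lambda>x a. a) x a)"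
      by (auto simp: D_def mk_trans_def fun_eq_iff)
    then show ?thesis using nat_trans_diff[OF R PD(1) PD(1) \<delta> id] by simp
  qed
  have Dd: "d n x (D (Suc n) x a) = D n x (d n x a)" if "x \<in> Obj C" "a \<in> carrier (ob (P (Suc n)) x)" for n x a
    using that by (simp add: D_def dd \<delta>cl dcl \<delta>d)
  \<comment> \<open>the next homotopy exists because \<open>D - s d\<close> has values in cycles; on boundaries this says \<open>d s d = D d\<close>\<close>
  define ok where "ok n s \<longleftrightarrow> s \<in> nat_trans R C (P n) (P (Suc n)) \<and>
    (\<forall>x\<in>Obj C. \<forall>a\<in>carrier (ob (P (Suc n)) x). d n x (s x (d n x a)) = D n x (d n x a))" for n s
  have "\<exists>s. \<forall>n. ok n (s n) \<and> (\<forall>x\<in>Obj C. \<forall>a\<in>carrier (ob (P (Suc n)) x).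
      d (Suc n) x (s (Suc n) x a) = D (Suc n) x a \<ominus>\<^bsub>ob (P (Suc n)) x\<^esub> s n x (d n x a))"
  proof (rule dependent_nat_choice[where P = ok and Q = "\<lambda>n s t. \<forall>x\<in>Obj C. \<forall>a\<in>carrier (ob (P (Suc n)) x).
      d (Suc n) x (t x a) = D (Suc n) x a \<ominus>\<^bsub>ob (P (Suc n)) x\<^esub> s x (d n x a)"])
    have e0: "\<epsilon> x (D 0 x a) = \<zero>\<^bsub>ob M x\<^esub>" if x: "x \<in> Obj C" and a: "a \<in> carrier (ob (P 0) x)" for x a
    proof -
      interpret Mx: module R "ob M x" by (rule functorD(1)[OF M x])
      show ?thesis using x a mod_hom_diff[OF nat_transD(1)[OF PD(3) x] mP[OF x] functorD(1)[OF M x] \<delta>cl[OF x a] a]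
        by (simp add: D_def \<delta>0 nat_transD(2)[OF PD(3)] a_minus_def Mx.M.r_neg)
    qed
    have "\<exists>s\<in>nat_trans R C (P 0) (P (Suc 0)). \<forall>x\<in>Obj C. \<forall>a\<in>carrier (ob (P 0) x). d 0 x (s x a) = D 0 x a"
      by (rule projective_exact_lift[OF R C pr[of 0] PD(1)[of "Suc 0"] PD(1)[of 0] M PD(2)[of 0] PD(3) PD(5) D[of 0]]) (simp add: e0)
    then show "\<exists>s. ok 0 s" using dcl[of _ _ 0] by (auto simp: ok_def)
  next
    fix s n assume ok: "ok n s"
    then have s: "s \<in> nat_trans R C (P n) (P (Suc n))" by (simp add: ok_def)
    let ?\<phi> = "mk_trans C (P (Suc n)) (\<lambda>x a. D (Suc n) x a \<ominus>\<^bsub>ob (P (Suc n)) x\<^esub> trans_comp C (P (Suc n)) s (d n) x a)"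
    have \<phi>: "?\<phi> \<in> nat_trans R C (P (Suc n)) (P (Suc n))"
      by (rule nat_trans_diff[OF R PD(1) PD(1) D trans_comp_closed[OF PD(1,2) s]])
    have "\<forall>x\<in>Obj C. \<forall>a\<in>carrier (ob (P (Suc n)) x). d n x (?\<phi> x a) = \<zero>\<^bsub>ob (P n) x\<^esub>"
      using ok by (simp add: dd nat_transD(2)[OF D] nat_transD(2)[OF s] dcl Dd ok_def self)
    then obtain t where t: "t \<in> nat_trans R C (P (Suc n)) (P (Suc (Suc n)))"
      "\<And>x a. x \<in> Obj C \<Longrightarrow> a \<in> carrier (ob (P (Suc n)) x) \<Longrightarrow> d (Suc n) x (t x a) = ?\<phi> x a"
      using projective_exact_lift[OF R C pr[of "Suc n"] PD(1)[of "Suc (Suc n)"] PD(1)[of "Suc n"] PD(1)[of n]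
        PD(2)[of "Suc n"] PD(2)[of n] PD(6)[of n] \<phi>] by blast
    have "ok (Suc n) t" unfolding ok_def
    proof (intro conjI ballI)
      fix x a assume x: "x \<in> Obj C" and a: "a \<in> carrier (ob (P (Suc (Suc n))) x)"
      interpret X: module R "ob (P (Suc n)) x" by (rule mP[OF x])
      have "d (Suc n) x a \<in> carrier (ob (P (Suc n)) x)" using dcl[OF x a] .
      then show "d (Suc n) x (t x (d (Suc n) x a)) = D (Suc n) x (d (Suc n) x a)"
        using x a t(2)[OF x, of "d (Suc n) x a"] PD(8)[OF x a] nat_trans_zero[OF s PD(1) PD(1) x]
          nat_transD(2)[OF D x]
        by (simp add: a_minus_def)
    qed (rule t(1))
    then show "\<exists>t. ok (Suc n) t \<and> (\<forall>x\<in>Obj C. \<forall>a\<in>carrier (ob (P (Suc n)) x).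
      d (Suc n) x (t x a) = D (Suc n) x a \<ominus>\<^bsub>ob (P (Suc n)) x\<^esub> s x (d n x a))"
      using t(2) by (intro exI[of _ t]) simp
  qed
  then obtain s where s': "\<forall>n. ok n (s n) \<and> (\<forall>x\<in>Obj C. \<forall>a\<in>carrier (ob (P (Suc n)) x).
      d (Suc n) x (s (Suc n) x a) = D (Suc n) x a \<ominus>\<^bsub>ob (P (Suc n)) x\<^esub> s n x (d n x a))"
    by (rule exE)
  have s: "s n \<in> nat_trans R C (P n) (P (Suc n))" for n using s' by (simp add: ok_def)
  have seq: "d (Suc n) x (s (Suc n) x a) = D (Suc n) x a \<ominus>\<^bsub>ob (P (Suc n)) x\<^esub> s n x (d n x a)"
    if "x \<in> Obj C" "a \<in> carrier (ob (P (Suc n)) x)" for n x a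
    using spec[OF s', of n] that by simp
  show ?thesis
  proof (intro bexI[of _ "trans_comp C (P n) \<psi> (s n)"] ballI)
    show "trans_comp C (P n) \<psi> (s n) \<in> nat_trans R C (P n) N" by (rule trans_comp_closed[OF PD(1) s \<psi>])
    fix x a assume x: "x \<in> Obj C" and a: "a \<in> carrier (ob (P (Suc n)) x)"
    interpret X: module R "ob (P (Suc n)) x" by (rule mP[OF x])
    interpret Nx: module R "ob N x" by (rule functorD(1)[OF N x])
    let ?u = "s n x (d n x a)" and ?v = "s (Suc n) x a"
    have cl: "d n x a \<in> carrier (ob (P n) x)" "?u \<in> carrier (ob (P (Suc n)) x)" "?v \<in> carrier (ob (P (Suc (Suc n))) x)"
      "\<delta> (Suc n) x a \<in> carrier (ob (P (Suc n)) x)"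
      using dcl[OF x a] nat_transD(2)[OF s x] a \<delta>cl[OF x a] by auto
    have "d (Suc n) x ?v = (\<delta> (Suc n) x a \<ominus>\<^bsub>ob (P (Suc n)) x\<^esub> a) \<ominus>\<^bsub>ob (P (Suc n)) x\<^esub> ?u"
      using seq[OF x a] x a by (simp add: D_def)
    then have "\<delta> (Suc n) x a = a \<oplus>\<^bsub>ob (P (Suc n)) x\<^esub> (?u \<oplus>\<^bsub>ob (P (Suc n)) x\<^esub> d (Suc n) x ?v)"
      using X.M.diff_solve cl a dcl[OF x cl(3)] by (metis X.M.a_closed X.M.minus_closed)
    then have "\<psi> x (\<delta> (Suc n) x a) = \<psi> x a \<oplus>\<^bsub>ob N x\<^esub> (\<psi> x ?u \<oplus>\<^bsub>ob N x\<^esub> \<psi> x (d (Suc n) x ?v))"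
      using mod_homD(2)[OF nat_transD(1)[OF \<psi> x]] cl a dcl[OF x cl(3)] by simp
    then show "\<psi> x (\<delta> (Suc n) x a) = \<psi> x a \<oplus>\<^bsub>ob N x\<^esub> trans_comp C (P n) \<psi> (s n) x (d n x a)"
      using \<psi>d[OF x cl(3)] nat_transD(2)[OF \<psi> x cl(2)] x cl(1) by simp
  qed
qed


section \<open>Cohomology modules\<close>

lemma cocycles_carrier:
  assumes "exact_complex R C M P d \<epsilon>"
  shows "\<eta> \<in> carrier (cocycles R C P d N n) \<longleftrightarrow> \<eta> \<in> nat_trans R C (P n) N \<and>
    (\<forall>x\<in>Obj C. \<forall>a\<in>carrier (ob (P (Suc n)) x). \<eta> x (d n x a) = \<zero>\<^bsub>ob N x\<^esub>)"
proof (cases "\<eta> \<in> nat_trans R C (P n) N")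
  case True
  show ?thesis
    using hom_module_eq_zero_iff[OF trans_comp_closed[OF exact_complexD(1,2)[OF assms] True]] True
    by (simp add: cocycles_def)
qed (simp add: cocycles_def)

lemma cocycles_simps [simp]:
  "\<zero>\<^bsub>cocycles R C P d N n\<^esub> = mk_trans C (P n) (\<lambda>x a. \<zero>\<^bsub>ob N x\<^esub>)"
  "\<eta> \<oplus>\<^bsub>cocycles R C P d N n\<^esub> \<theta> = mk_trans C (P n) (\<lambda>x a. \<eta> x a \<oplus>\<^bsub>ob N x\<^esub> \<theta> x a)"
  "r \<odot>\<^bsub>cocycles R C P d N n\<^esub> \<eta> = mk_trans C (P n) (\<lambda>x a. r \<odot>\<^bsub>ob N x\<^esub> \<eta> x a)"
  by (simp_all add: cocycles_def del: hom_module_simps(1) add: hom_module_simps[of R C "P n" N])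

lemma cocycles_submodule:
  assumes R: "cring R" and N: "is_rmod_functor R C N" and P: "exact_complex R C M P d \<epsilon>"
  shows "submodule (carrier (cocycles R C P d N n)) R (hom_module R C (P n) N)"
proof -
  note PD = exact_complexD[OF P]
  have "carrier (cocycles R C P d N n) = {\<eta> \<in> carrier (hom_module R C (P n) N).
      trans_comp C (P (Suc n)) \<eta> (d n) = \<zero>\<^bsub>hom_module R C (P (Suc n)) N\<^esub>}"
    by (simp add: cocycles_def)
  then show ?thesis
    using mod_hom_kernel_submodule[OF precomp_hom[OF PD(1) PD(1) N R PD(2)]
        hom_module_module[OF R PD(1) N] hom_module_module[OF R PD(1) N]]
    by simp
qed

lemma cocycles_module:
  assumes R: "cring R" and N: "is_rmod_functor R C N" and P: "exact_complex R C M P d \<epsilon>"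
  shows "module R (cocycles R C P d N n)"
proof -
  have eq: "cocycles R C P d N n = (hom_module R C (P n) N)\<lparr>carrier := carrier (cocycles R C P d N n)\<rparr>"
    by (simp add: cocycles_def)
  show ?thesis
    by (subst eq) (rule submodule.submodule_is_module[OF cocycles_submodule[OF assms]
          hom_module_module[OF R exact_complexD(1)[OF P] N]])
qed

lemma submodule_restrict:
  assumes "module R M" "submodule H R M" "submodule K R M" "K \<subseteq> H"
  shows "submodule K R (M\<lparr>carrier := H\<rparr>)"
  by (rule submodule_crit[OF submodule.submodule_is_module[OF assms(2,1)]])
    (use submodule_simps[OF assms(1,3)] assms(4) in auto)

lemma coboundaries_submodule:
  assumes R: "cring R" and N: "is_rmod_functor R C N" and P: "exact_complex R C M P d \<epsilon>"
  shows "submodule (coboundaries R C P d N (Suc n)) R (cocycles R C P d N (Suc n))"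
proof -
  note PD = exact_complexD[OF P]
  have eq: "cocycles R C P d N (Suc n) = (hom_module R C (P (Suc n)) N)\<lparr>carrier := carrier (cocycles R C P d N (Suc n))\<rparr>"
    by (simp add: cocycles_def)
  have "submodule (coboundaries R C P d N (Suc n)) R (hom_module R C (P (Suc n)) N)"
    using mod_hom_image_submodule[OF precomp_hom[OF PD(1) PD(1) N R PD(2)]
        hom_module_module[OF R PD(1) N] hom_module_module[OF R PD(1) N]]
    by (simp add: coboundaries_def)
  moreover have "coboundaries R C P d N (Suc n) \<subseteq> carrier (cocycles R C P d N (Suc n))"
  proof
    fix \<theta> assume "\<theta> \<in> coboundaries R C P d N (Suc n)"
    then obtain \<eta> where \<eta>: "\<eta> \<in> nat_trans R C (P n) N" "\<theta> = trans_comp C (P (Suc n)) \<eta> (d n)"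
      by (auto simp: coboundaries_def)
    then show "\<theta> \<in> carrier (cocycles R C P d N (Suc n))"
      using trans_comp_closed[OF PD(1,2) \<eta>(1)] PD(8) nat_trans_zero[OF \<eta>(1) PD(1) N]
      by (simp add: cocycles_carrier[OF P] nat_transD(2)[OF PD(2)])
  qed
  ultimately show ?thesis
    using submodule_restrict[OF hom_module_module[OF R PD(1) N] cocycles_submodule[OF assms]] eq by metis
qed

lemma coboundariesI:
  assumes "\<theta> \<in> nat_trans R C (P n) N" "exact_complex R C M P d \<epsilon>" "\<eta> \<in> nat_trans R C (P (Suc n)) N"
    and "\<And>x a. x \<in> Obj C \<Longrightarrow> a \<in> carrier (ob (P (Suc n)) x) \<Longrightarrow> \<eta> x a = \<theta> x (d n x a)"
  shows "\<eta> \<in> coboundaries R C P d N (Suc n)"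
proof -
  have "\<eta> = trans_comp C (P (Suc n)) \<theta> (d n)"
    by (rule nat_trans_eqI[OF assms(3) trans_comp_closed[OF exact_complexD(1,2)[OF assms(2)] assms(1)]])
      (simp add: assms(4))
  then show ?thesis using assms(1) by (auto simp: coboundaries_def)
qed

lemma coboundariesE:
  assumes "\<eta> \<in> coboundaries R C P d N (Suc n)"
  obtains \<theta> where "\<theta> \<in> nat_trans R C (P n) N" "\<eta> = trans_comp C (P (Suc n)) \<theta> (d n)"
  using assms by (auto simp: coboundaries_def)


section \<open>Restriction along a coreflection\<close>

text \<open>The constant functor on \<open>S\<close>, zero elsewhere. On the zero part the module keeps the operations of
  \<open>R\<close>, so that it is a subfunctor of the constant functor.\<close>

definition const_on :: "'r ring \<Rightarrow> 'x set \<Rightarrow> ('x, 'y, 'r, 'r) rmod_functor" where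
  "const_on R S = \<lparr>ob = (\<lambda>E. if E \<in> S then ring_module R else (ring_module R)\<lparr>carrier := {\<zero>\<^bsub>R\<^esub>}\<rparr>),
     act = (\<lambda>_ _ _ a. a)\<rparr>"

text \<open>A zero module over every value type; \<open>undefined\<close> serves as its only element, since an arbitrary type has
  no other named one.\<close>

definition zero_module :: "('r, 'a) module" where
  "zero_module = mk_module {undefined} undefined (\<lambda>_ _. undefined) (\<lambda>_ _. undefined)"

lemma zero_module_simps [simp]:
  "carrier zero_module = {undefined}" "\<zero>\<^bsub>zero_module\<^esub> = undefined"
  "a \<oplus>\<^bsub>zero_module\<^esub> b = undefined" "r \<odot>\<^bsub>zero_module\<^esub> b = undefined"
  by (simp_all add: zero_module_def)

lemma zero_module_module: "cring R \<Longrightarrow> module R zero_module"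
  by (rule moduleI; (rule abelian_groupI)?; auto)

lemma mod_hom_into_zero:
  "module R M \<Longrightarrow> module R N \<Longrightarrow> (\<lambda>_. \<zero>\<^bsub>N\<^esub>) \<in> mod_hom R M N"
proof -
  assume "module R M" "module R N"
  then interpret N: module R N by simp
  show ?thesis by (rule mod_homI) auto
qed

text \<open>The surjectivity condition in the form in which a homotopy provides it: \<open>h a\<close> and \<open>b\<close> differ by a
  coboundary \<open>c\<close>.\<close>

lemma quot_mod_iso':
  assumes M: "module R M" and N: "submodule N R M" and M': "module R M'" and N': "submodule N' R M'"
    and h: "h \<in> mod_hom R M M'"
    and ker: "\<And>a. a \<in> carrier M \<Longrightarrow> h a \<in> N' \<longleftrightarrow> a \<in> N"
    and sur: "\<And>b. b \<in> carrier M' \<Longrightarrow> \<exists>a\<in>carrier M. \<exists>c\<in>N'. h a = b \<oplus>\<^bsub>M'\<^esub> c"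
  shows "mod_iso R (quot_module M N) (quot_module M' N')"
proof (rule quot_mod_iso[OF M N M' N' h ker])
  fix b assume b: "b \<in> carrier M'"
  then obtain a c where ac: "a \<in> carrier M" "c \<in> N'" "h a = b \<oplus>\<^bsub>M'\<^esub> c" using sur by blast
  interpret M': module R M' by (rule M')
  have c: "c \<in> carrier M'" using ac submodule_simps(1)[OF M' N'] by auto
  have "b \<ominus>\<^bsub>M'\<^esub> h a = \<ominus>\<^bsub>M'\<^esub> c"
    using b c by (simp add: ac(3) a_minus_def M'.M.minus_add M'.M.a_assoc[symmetric] M'.M.r_neg)
  also have "\<dots> \<in> N'" using M'.submoduleE(3)[OF N'] ac(2) by simp
  finally show "\<exists>a\<in>carrier M. b \<ominus>\<^bsub>M'\<^esub> h a \<in> N'" using ac(1) by blast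
qed

text \<open>Zero is carried into \<open>R\<close> but nothing of \<open>R\<close> has to be carried into zero, because no morphism leaves
  \<open>S\<close>.\<close>

lemma const_on_functor:
  assumes R: "cring R" and cos: "\<And>E E' f. E \<in> S \<Longrightarrow> E' \<in> Obj A \<Longrightarrow> f \<in> Hom A E E' \<Longrightarrow> E' \<in> S"
  shows "is_rmod_functor R A (const_on R S)"
proof -
  interpret cring R by fact
  have "module R (ob (const_on R S) E)" for E
  proof (cases "E \<in> S")
    case False
    have "submodule {\<zero>\<^bsub>R\<^esub>} R (ring_module R)"
      by (rule submodule_crit[OF ring_module_module[OF R]]) auto
    then show ?thesis using False submodule.submodule_is_module[OF _ ring_module_module[OF R]]
      by (simp add: const_on_def)
  qed (simp add: const_on_def ring_module_module[OF R])
  moreover have "act (const_on R S) E E' f \<in> mod_hom R (ob (const_on R S) E) (ob (const_on R S) E')"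
    if "E \<in> Obj A" "E' \<in> Obj A" "f \<in> Hom A E E'" for E E' f
  proof (cases "E \<in> S")
    case True
    then show ?thesis using cos[OF True that(2,3)] by (intro mod_homI) (auto simp: const_on_def)
  next
    case False
    then show ?thesis by (intro mod_homI) (auto simp: const_on_def)
  qed
  ultimately show ?thesis unfolding is_rmod_functor_def by (simp add: const_on_def)
qed

text \<open>The full subcategory \<open>S\<close> of \<open>A\<close>, closed under outgoing morphisms, is embedded into \<open>C\<close> by the functor
  \<open>i = (io, im)\<close>. The functor \<open>r = (ro, rm)\<close> retracts \<open>C\<close> onto it, and \<open>cu : i r \<rightarrow> 1\<close> is natural and the
  identity on the image of \<open>i\<close>. This describes a coreflective subcategory with coreflector \<open>r\<close> and counit
  \<open>cu\<close>, by the part of the adjunction that the comparison of cohomology uses.\<close>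

locale coreflection =
  fixes R :: "'r ring" and A :: "('x, 'y) cat" and S :: "'x set" and C :: "('o, 'm) cat"
    and io :: "'x \<Rightarrow> 'o" and im :: "'x \<Rightarrow> 'x \<Rightarrow> 'y \<Rightarrow> 'm"
    and ro :: "'o \<Rightarrow> 'x" and rm :: "'o \<Rightarrow> 'o \<Rightarrow> 'm \<Rightarrow> 'y" and cu :: "'o \<Rightarrow> 'm"
  assumes R: "cring R" and A: "is_cat A" and C: "is_cat C" and S: "S \<subseteq> Obj A"
    and cosieve: "\<And>E E' f. E \<in> S \<Longrightarrow> E' \<in> Obj A \<Longrightarrow> f \<in> Hom A E E' \<Longrightarrow> E' \<in> S"
    and io: "\<And>E. E \<in> S \<Longrightarrow> io E \<in> Obj C"
    and im: "\<And>E E' f. E \<in> S \<Longrightarrow> E' \<in> S \<Longrightarrow> f \<in> Hom A E E' \<Longrightarrow> im E E' f \<in> Hom C (io E) (io E')"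
    and im_id: "\<And>E. E \<in> S \<Longrightarrow> im E E (Id A E) = Id C (io E)"
    and im_comp: "\<And>E E' E'' f g. E \<in> S \<Longrightarrow> E' \<in> S \<Longrightarrow> E'' \<in> S \<Longrightarrow> f \<in> Hom A E E' \<Longrightarrow> g \<in> Hom A E' E'' \<Longrightarrow>
      im E E'' (Comp A E E' E'' g f) = Comp C (io E) (io E') (io E'') (im E' E'' g) (im E E' f)"
    and ro: "\<And>s. s \<in> Obj C \<Longrightarrow> ro s \<in> S"
    and rm: "\<And>s t f. s \<in> Obj C \<Longrightarrow> t \<in> Obj C \<Longrightarrow> f \<in> Hom C s t \<Longrightarrow> rm s t f \<in> Hom A (ro s) (ro t)"
    and rm_id: "\<And>s. s \<in> Obj C \<Longrightarrow> rm s s (Id C s) = Id A (ro s)"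
    and rm_comp: "\<And>s t u f g. s \<in> Obj C \<Longrightarrow> t \<in> Obj C \<Longrightarrow> u \<in> Obj C \<Longrightarrow> f \<in> Hom C s t \<Longrightarrow> g \<in> Hom C t u \<Longrightarrow>
      rm s u (Comp C s t u g f) = Comp A (ro s) (ro t) (ro u) (rm t u g) (rm s t f)"
    and ro_io: "\<And>E. E \<in> S \<Longrightarrow> ro (io E) = E"
    and rm_im: "\<And>E E' f. E \<in> S \<Longrightarrow> E' \<in> S \<Longrightarrow> f \<in> Hom A E E' \<Longrightarrow> rm (io E) (io E') (im E E' f) = f"
    and cu: "\<And>s. s \<in> Obj C \<Longrightarrow> cu s \<in> Hom C (io (ro s)) s"
    and cu_nat: "\<And>s t f. s \<in> Obj C \<Longrightarrow> t \<in> Obj C \<Longrightarrow> f \<in> Hom C s t \<Longrightarrow>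
      Comp C (io (ro s)) s t f (cu s) =
      Comp C (io (ro s)) (io (ro t)) t (cu t) (im (ro s) (ro t) (rm s t f))"
    and cu_io: "\<And>E. E \<in> S \<Longrightarrow> cu (io E) = Id C (io E)"
begin

abbreviation "KA \<equiv> (const_on R S :: ('x, 'y, 'r, 'r) rmod_functor)"
abbreviation "KC \<equiv> (const_functor R :: ('o, 'm, 'r, 'r) rmod_functor)"

lemma S_Obj: "E \<in> S \<Longrightarrow> E \<in> Obj A" using S by auto

lemma KA: "is_rmod_functor R A KA" by (rule const_on_functor[OF R cosieve])
lemma KC: "is_rmod_functor R C KC" by (rule const_functor_functor[OF R])

definition restricts :: "('x, 'y, 'r, 'a) rmod_functor \<Rightarrow> ('o, 'm, 'r, 'a) rmod_functor \<Rightarrow> bool" where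
  "restricts B F \<longleftrightarrow> (\<forall>E\<in>S. ob B E = ob F (io E)) \<and>
     (\<forall>E\<in>S. \<forall>E'\<in>S. \<forall>f\<in>Hom A E E'. \<forall>a\<in>carrier (ob B E). act B E E' f a = act F (io E) (io E') (im E E' f) a)"

lemma restrictsD:
  assumes "restricts B F"
  shows "E \<in> S \<Longrightarrow> ob B E = ob F (io E)"
    and "E \<in> S \<Longrightarrow> E' \<in> S \<Longrightarrow> f \<in> Hom A E E' \<Longrightarrow> a \<in> carrier (ob F (io E)) \<Longrightarrow>
      act B E E' f a = act F (io E) (io E') (im E E' f) a"
  using assms by (simp_all add: restricts_def)


subsection \<open>Pullback along the coreflector, and restriction extended by zero\<close>

definition pull :: "('x, 'y, 'r, 'a) rmod_functor \<Rightarrow> ('o, 'm, 'r, 'a) rmod_functor" where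
  "pull Q = \<lparr>ob = (\<lambda>s. ob Q (ro s)), act = (\<lambda>s t f. act Q (ro s) (ro t) (rm s t f))\<rparr>"

lemma pull_simps [simp]: "ob (pull Q) s = ob Q (ro s)" "act (pull Q) s t f = act Q (ro s) (ro t) (rm s t f)"
  by (simp_all add: pull_def)

lemma pull_functor:
  assumes Q: "is_rmod_functor R A Q"
  shows "is_rmod_functor R C (pull Q)"
  unfolding is_rmod_functor_def
  using S_Obj[OF ro] functorD[OF Q] rm rm_id rm_comp by simp

text \<open>Restriction to \<open>S\<close>, extended by zero. On a morphism from outside \<open>S\<close> it is the zero map, whose value
  outside \<open>S\<close> is the unique element \<open>undefined\<close> of the zero module.\<close>

definition ext :: "('o, 'm, 'r, 'a) rmod_functor \<Rightarrow> ('x, 'y, 'r, 'a) rmod_functor" where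
  "ext P = \<lparr>ob = (\<lambda>E. if E \<in> S then ob P (io E) else zero_module),
     act = (\<lambda>E E' f a. if E \<in> S then act P (io E) (io E') (im E E' f) a
       else if E' \<in> S then \<zero>\<^bsub>ob P (io E')\<^esub> else undefined)\<rparr>"

lemma ext_simps [simp]:
  "E \<in> S \<Longrightarrow> ob (ext P) E = ob P (io E)" "E \<notin> S \<Longrightarrow> ob (ext P) E = zero_module"
  "E \<in> S \<Longrightarrow> act (ext P) E E' f a = act P (io E) (io E') (im E E' f) a"
  "E \<notin> S \<Longrightarrow> act (ext P) E E' f a = \<zero>\<^bsub>ob (ext P) E'\<^esub>"
  by (simp_all add: ext_def)

lemma restricts_ext: "restricts (ext P) P"
  by (simp add: restricts_def)

lemma restricts_pull: "restricts Q (pull Q)"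
  by (simp add: restricts_def ro_io rm_im)

lemma ext_functor:
  assumes P: "is_rmod_functor R C P"
  shows "is_rmod_functor R A (ext P)"
proof -
  have m: "module R (ob (ext P) E)" for E
    using functorD(1)[OF P io] zero_module_module[OF R] by (cases "E \<in> S") simp_all
  have h: "act (ext P) E E' f \<in> mod_hom R (ob (ext P) E) (ob (ext P) E')"
    if "E \<in> Obj A" "E' \<in> Obj A" "f \<in> Hom A E E'" for E E' f
  proof (cases "E \<in> S")
    case True
    then have E': "E' \<in> S" using cosieve that by blast
    have "act (ext P) E E' f = act P (io E) (io E') (im E E' f)" using True by (simp add: fun_eq_iff)
    then show ?thesis using functorD(2)[OF P io[OF True] io[OF E'] im[OF True E' that(3)]] True E' by simp
  next
    case False
    have "act (ext P) E E' f = (\<lambda>_. \<zero>\<^bsub>ob (ext P) E'\<^esub>)" using False by (simp add: fun_eq_iff)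
    then show ?thesis using mod_hom_into_zero[OF m m] by simp
  qed
  have i: "act (ext P) E E (Id A E) a = a" if "E \<in> Obj A" "a \<in> carrier (ob (ext P) E)" for E a
    using that functorD(4)[OF P io] by (cases "E \<in> S") (simp_all add: im_id)
  have c: "act (ext P) E E'' (Comp A E E' E'' g f) a = act (ext P) E' E'' g (act (ext P) E E' f a)"
    if o: "E \<in> Obj A" "E' \<in> Obj A" "E'' \<in> Obj A" and f: "f \<in> Hom A E E'" and g: "g \<in> Hom A E' E''"
      and a: "a \<in> carrier (ob (ext P) E)" for E E' E'' f g a
  proof (cases "E \<in> S")
    case True
    then have E': "E' \<in> S" using cosieve o f by blast
    then have E'': "E'' \<in> S" using cosieve o g by blast
    show ?thesis using a functorD(5)[OF P io[OF True] io[OF E'] io[OF E''] im[OF True E' f] im[OF E' E'' g]]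
      by (simp add: True E' im_comp[OF True E' E'' f g])
  next
    case False
    then show ?thesis using mod_hom_zero[OF h[OF o(2,3) g] m m] by simp
  qed
  show ?thesis unfolding is_rmod_functor_def using m h i c by blast
qed

definition pull_trans :: "('x, 'y, 'r, 'a) rmod_functor \<Rightarrow> ('x \<Rightarrow> 'a \<Rightarrow> 'b) \<Rightarrow> 'o \<Rightarrow> 'a \<Rightarrow> 'b" where
  "pull_trans Q \<eta> = mk_trans C (pull Q) (\<lambda>s. \<eta> (ro s))"

text \<open>The parameter \<open>z\<close> is the zero of the target functor, which a bare transformation does not determine.\<close>

definition ext_trans :: "('o, 'm, 'r, 'a) rmod_functor \<Rightarrow> ('x \<Rightarrow> 'b) \<Rightarrow> ('o \<Rightarrow> 'a \<Rightarrow> 'b) \<Rightarrow> 'x \<Rightarrow> 'a \<Rightarrow> 'b" where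
  "ext_trans P z \<eta> = mk_trans A (ext P) (\<lambda>E a. if E \<in> S then \<eta> (io E) a else z E)"

lemma pull_trans_app [simp]: "s \<in> Obj C \<Longrightarrow> a \<in> carrier (ob Q (ro s)) \<Longrightarrow> pull_trans Q \<eta> s a = \<eta> (ro s) a"
  by (simp add: pull_trans_def)

lemma ext_trans_app [simp]:
  "E \<in> S \<Longrightarrow> a \<in> carrier (ob P (io E)) \<Longrightarrow> ext_trans P z \<eta> E a = \<eta> (io E) a"
  "E \<in> Obj A \<Longrightarrow> E \<notin> S \<Longrightarrow> ext_trans P z \<eta> E undefined = z E"
  by (simp_all add: ext_trans_def S_Obj)

lemma pull_trans_nat:
  assumes Q: "is_rmod_functor R A Q" and \<eta>: "\<eta> \<in> nat_trans R A Q Q'"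
    and ob: "\<And>s. s \<in> Obj C \<Longrightarrow> ob Q' (ro s) = ob N s"
    and act: "\<And>s t f a. s \<in> Obj C \<Longrightarrow> t \<in> Obj C \<Longrightarrow> f \<in> Hom C s t \<Longrightarrow> a \<in> carrier (ob N s) \<Longrightarrow>
      act Q' (ro s) (ro t) (rm s t f) a = act N s t f a"
  shows "pull_trans Q \<eta> \<in> nat_trans R C (pull Q) N"
  unfolding pull_trans_def
proof (rule mk_trans_nat_trans[OF pull_functor[OF Q]])
  fix s assume "s \<in> Obj C"
  then show "\<eta> (ro s) \<in> mod_hom R (ob (pull Q) s) (ob N s)"
    using nat_transD(1)[OF \<eta> S_Obj[OF ro]] ob by simp
next
  fix s t f a assume *: "s \<in> Obj C" "t \<in> Obj C" "f \<in> Hom C s t" "a \<in> carrier (ob (pull Q) s)"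
  then have "\<eta> (ro s) a \<in> carrier (ob N s)" using nat_transD(2)[OF \<eta> S_Obj[OF ro]] ob by simp
  then show "\<eta> (ro t) (act (pull Q) s t f a) = act N s t f (\<eta> (ro s) a)"
    using * nat_transD(3)[OF \<eta> S_Obj[OF ro] S_Obj[OF ro] rm] act by simp
qed

lemma ext_trans_nat:
  assumes P: "is_rmod_functor R C P" and \<eta>: "\<eta> \<in> nat_trans R C P N" and B: "is_rmod_functor R A B"
    and res: "restricts B N"
  shows "ext_trans P (\<lambda>E. \<zero>\<^bsub>ob B E\<^esub>) \<eta> \<in> nat_trans R A (ext P) B"
  unfolding ext_trans_def
proof (rule mk_trans_nat_trans[OF ext_functor[OF P]])
  fix E assume E: "E \<in> Obj A"
  show "(\<lambda>a. if E \<in> S then \<eta> (io E) a else \<zero>\<^bsub>ob B E\<^esub>) \<in> mod_hom R (ob (ext P) E) (ob B E)"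
  proof (cases "E \<in> S")
    case True
    then show ?thesis using nat_transD(1)[OF \<eta> io[OF True]] restrictsD(1)[OF res True] by simp
  next
    case False
    then show ?thesis using mod_hom_into_zero[OF functorD(1)[OF ext_functor[OF P] E] functorD(1)[OF B E]] by simp
  qed
next
  fix E E' f a assume o: "E \<in> Obj A" "E' \<in> Obj A" and f: "f \<in> Hom A E E'" and a: "a \<in> carrier (ob (ext P) E)"
  show "(if E' \<in> S then \<eta> (io E') (act (ext P) E E' f a) else \<zero>\<^bsub>ob B E'\<^esub>) =
    act B E E' f (if E \<in> S then \<eta> (io E) a else \<zero>\<^bsub>ob B E\<^esub>)"
  proof (cases "E \<in> S")
    case True
    then have E': "E' \<in> S" using cosieve o f by blast
    have "\<eta> (io E) a \<in> carrier (ob N (io E))" using nat_transD(2)[OF \<eta> io[OF True]] a True by simp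
    then show ?thesis using True E' a nat_transD(3)[OF \<eta> io[OF True] io[OF E'] im[OF True E' f]]
        restrictsD(2)[OF res True E' f] by simp
  next
    case False
    have "act B E E' f \<zero>\<^bsub>ob B E\<^esub> = \<zero>\<^bsub>ob B E'\<^esub>"
      by (rule mod_hom_zero[OF functorD(2)[OF B o f] functorD(1)[OF B o(1)] functorD(1)[OF B o(2)]])
    moreover have "\<eta> (io E') \<zero>\<^bsub>ob P (io E')\<^esub> = \<zero>\<^bsub>ob B E'\<^esub>" if E': "E' \<in> S"
      using mod_hom_zero[OF nat_transD(1)[OF \<eta> io[OF E']] functorD(1)[OF P io[OF E']]]
        functorD(1)[OF B o(2)] restrictsD(1)[OF res E'] by simp
    ultimately show ?thesis using False by simp
  qed
qed

text \<open>Exactness is pointwise, and each value of the pulled back complex is a value of \<open>Q\<close> at an object of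
  \<open>S\<close>, where the coefficient functor is \<open>R\<close>.\<close>

lemma pull_exact:
  assumes Q: "exact_complex R A KA Q d \<epsilon>"
  shows "exact_complex R C KC (\<lambda>n. pull (Q n)) (\<lambda>n. pull_trans (Q (Suc n)) (d n)) (pull_trans (Q 0) \<epsilon>)"
proof -
  note QD = exact_complexD[OF Q]
  have K: "ob KA (ro s) = ob KC s" if "s \<in> Obj C" for s
    using ro[OF that] by (simp add: const_on_def const_functor_def)
  have e: "pull_trans (Q 0) \<epsilon> \<in> nat_trans R C (pull (Q 0)) KC"
    by (rule pull_trans_nat[OF QD(1) QD(3) K]) (simp_all add: const_on_def const_functor_def)
  have dn: "pull_trans (Q (Suc n)) (d n) \<in> nat_trans R C (pull (Q (Suc n))) (pull (Q n))" for n
    by (rule pull_trans_nat[OF QD(1) QD(2)]) simp_all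
  have img: "pull_trans M \<eta> s ` carrier (ob (pull M) s) = \<eta> (ro s) ` carrier (ob M (ro s))"
    if "s \<in> Obj C" for M :: "('x, 'y, 'r, 'z) rmod_functor" and \<eta> :: "'x \<Rightarrow> 'z \<Rightarrow> 'w" and s
    by (rule image_cong) (simp_all add: that)
  have ker: "{a \<in> carrier (ob (pull M) s). pull_trans M \<eta> s a = z} = {a \<in> carrier (ob M (ro s)). \<eta> (ro s) a = z}"
    if "s \<in> Obj C" for M :: "('x, 'y, 'r, 'z) rmod_functor" and \<eta> :: "'x \<Rightarrow> 'z \<Rightarrow> 'w" and s z
    using that by auto
  have "\<epsilon> (ro s) ` carrier (ob (Q 0) (ro s)) = carrier (ob KA (ro s))" if "s \<in> Obj C" for s
    using QD(4) S_Obj[OF ro[OF that]] unfolding epi_trans_def by blast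
  then have epi: "epi_trans C (pull (Q 0)) KC (pull_trans (Q 0) \<epsilon>)"
    unfolding epi_trans_def using img K by metis
  have x0: "{a \<in> carrier (ob (pull (Q 0)) s). pull_trans (Q 0) \<epsilon> s a = \<zero>\<^bsub>ob KC s\<^esub>} =
      pull_trans (Q (Suc 0)) (d 0) s ` carrier (ob (pull (Q 1)) s)" if s: "s \<in> Obj C" for s
    unfolding One_nat_def img[OF s] ker[OF s] K[OF s, symmetric] using bspec[OF QD(5) S_Obj[OF ro[OF s]]] .
  have xn: "{a \<in> carrier (ob (pull (Q (Suc n))) s). pull_trans (Q (Suc n)) (d n) s a = \<zero>\<^bsub>ob (pull (Q n)) s\<^esub>} =
      pull_trans (Q (Suc (Suc n))) (d (Suc n)) s ` carrier (ob (pull (Q (Suc (Suc n)))) s)" if s: "s \<in> Obj C" for s n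
    unfolding img[OF s] ker[OF s] unfolding pull_simps using bspec[OF QD(6) S_Obj[OF ro[OF s]]] .
  show ?thesis unfolding exact_complex_def
    by (intro conjI allI ballI pull_functor QD(1) dn e epi x0 xn)
qed

lemma ext_exact:
  assumes P: "exact_complex R C KC P d \<epsilon>"
  shows "exact_complex R A KA (\<lambda>n. ext (P n))
    (\<lambda>n. ext_trans (P (Suc n)) (\<lambda>E. \<zero>\<^bsub>ob (ext (P n)) E\<^esub>) (d n)) (ext_trans (P 0) (\<lambda>E. \<zero>\<^bsub>ob KA E\<^esub>) \<epsilon>)"
proof -
  note PD = exact_complexD[OF P]
  have rK: "restricts KA KC" by (simp add: restricts_def const_on_def const_functor_def)
  have K: "ob KA E = ob KC (io E)" if "E \<in> S" for E by (rule restrictsD(1)[OF rK that])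
  have e: "ext_trans (P 0) (\<lambda>E. \<zero>\<^bsub>ob KA E\<^esub>) \<epsilon> \<in> nat_trans R A (ext (P 0)) KA"
    by (rule ext_trans_nat[OF PD(1) PD(3) KA rK])
  have dn: "ext_trans (P (Suc n)) (\<lambda>E. \<zero>\<^bsub>ob (ext (P n)) E\<^esub>) (d n) \<in> nat_trans R A (ext (P (Suc n))) (ext (P n))" for n
    by (rule ext_trans_nat[OF PD(1) PD(2) ext_functor[OF PD(1)] restricts_ext])
  have img: "ext_trans M z \<eta> E ` carrier (ob (ext M) E) = \<eta> (io E) ` carrier (ob M (io E))"
    if "E \<in> S" for M :: "('o, 'm, 'r, 'z) rmod_functor" and \<eta> :: "'o \<Rightarrow> 'z \<Rightarrow> 'w" and E z
    by (rule image_cong) (simp_all add: that)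
  have ker: "{a \<in> carrier (ob (ext M) E). ext_trans M z \<eta> E a = v} = {a \<in> carrier (ob M (io E)). \<eta> (io E) a = v}"
    if "E \<in> S" for M :: "('o, 'm, 'r, 'z) rmod_functor" and \<eta> :: "'o \<Rightarrow> 'z \<Rightarrow> 'w" and E z v
    using that by auto
  have img': "ext_trans M z \<eta> E ` carrier (ob (ext M) E) = {z E}"
    if "E \<in> Obj A" "E \<notin> S" for M :: "('o, 'm, 'r, 'z) rmod_functor" and \<eta> :: "'o \<Rightarrow> 'z \<Rightarrow> 'w" and E z
    using that by simp
  have epi: "epi_trans A (ext (P 0)) KA (ext_trans (P 0) (\<lambda>E. \<zero>\<^bsub>ob KA E\<^esub>) \<epsilon>)"
    unfolding epi_trans_def
  proof
    fix E assume E: "E \<in> Obj A"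
    show "ext_trans (P 0) (\<lambda>E. \<zero>\<^bsub>ob KA E\<^esub>) \<epsilon> E ` carrier (ob (ext (P 0)) E) = carrier (ob KA E)"
    proof (cases "E \<in> S")
      case True
      then show ?thesis using PD(4) io[OF True] unfolding epi_trans_def img[OF True] K[OF True] by blast
    next
      case False
      show ?thesis unfolding img'[OF E False] using False by (simp add: const_on_def)
    qed
  qed
  have x0: "{a \<in> carrier (ob (ext (P 0)) E). ext_trans (P 0) (\<lambda>E. \<zero>\<^bsub>ob KA E\<^esub>) \<epsilon> E a = \<zero>\<^bsub>ob KA E\<^esub>} =
      ext_trans (P (Suc 0)) (\<lambda>E. \<zero>\<^bsub>ob (ext (P 0)) E\<^esub>) (d 0) E ` carrier (ob (ext (P 1)) E)" if E: "E \<in> Obj A" for E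
  proof (cases "E \<in> S")
    case True
    show ?thesis unfolding One_nat_def img[OF True] ker[OF True] K[OF True] using bspec[OF PD(5) io[OF True]] .
  next
    case False
    show ?thesis using E False by auto
  qed
  have xn: "{a \<in> carrier (ob (ext (P (Suc n))) E). ext_trans (P (Suc n)) (\<lambda>E. \<zero>\<^bsub>ob (ext (P n)) E\<^esub>) (d n) E a = \<zero>\<^bsub>ob (ext (P n)) E\<^esub>} =
      ext_trans (P (Suc (Suc n))) (\<lambda>E. \<zero>\<^bsub>ob (ext (P (Suc n))) E\<^esub>) (d (Suc n)) E ` carrier (ob (ext (P (Suc (Suc n)))) E)"
    if E: "E \<in> Obj A" for E n
  proof (cases "E \<in> S")
    case True
    show ?thesis unfolding img[OF True] ker[OF True] unfolding ext_simps(1)[OF True] using bspec[OF PD(6) io[OF True]] .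
  next
    case False
    show ?thesis using E False by auto
  qed
  show ?thesis unfolding exact_complex_def
    by (intro conjI allI ballI ext_functor PD(1) dn e epi x0 xn)
qed


subsection \<open>Transporting transformations\<close>

text \<open>Through \<open>\<beta> : Q \<rightarrow> ext P\<close> a transformation \<open>P \<rightarrow> F\<close> gives one from \<open>Q\<close> to the restriction \<open>B\<close> of \<open>F\<close>.
  Outside \<open>S\<close> there is only the zero map. Conversely \<open>\<alpha> : P \<rightarrow> pull Q\<close> and the counit turn
  \<open>Q \<rightarrow> B\<close> into \<open>P s \<rightarrow> Q (r s) \<rightarrow> B (r s) = F (i r s) \<rightarrow> F s\<close>.\<close>

definition down :: "('x, 'y, 'r, 'q) rmod_functor \<Rightarrow> ('x \<Rightarrow> 'q \<Rightarrow> 'p) \<Rightarrow> ('x, 'y, 'r, 'a) rmod_functor \<Rightarrow>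
    ('o \<Rightarrow> 'p \<Rightarrow> 'a) \<Rightarrow> 'x \<Rightarrow> 'q \<Rightarrow> 'a" where
  "down Q \<beta> B \<phi> = mk_trans A Q (\<lambda>E q. if E \<in> S then \<phi> (io E) (\<beta> E q) else \<zero>\<^bsub>ob B E\<^esub>)"

definition up :: "('o, 'm, 'r, 'p) rmod_functor \<Rightarrow> ('o \<Rightarrow> 'p \<Rightarrow> 'q) \<Rightarrow> ('o, 'm, 'r, 'a) rmod_functor \<Rightarrow>
    ('x \<Rightarrow> 'q \<Rightarrow> 'a) \<Rightarrow> 'o \<Rightarrow> 'p \<Rightarrow> 'a" where
  "up P \<alpha> F \<psi> = mk_trans C P (\<lambda>s x. act F (io (ro s)) s (cu s) (\<psi> (ro s) (\<alpha> s x)))"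

lemma down_app:
  "E \<in> S \<Longrightarrow> q \<in> carrier (ob Q E) \<Longrightarrow> down Q \<beta> B \<phi> E q = \<phi> (io E) (\<beta> E q)"
  "E \<in> Obj A \<Longrightarrow> E \<notin> S \<Longrightarrow> q \<in> carrier (ob Q E) \<Longrightarrow> down Q \<beta> B \<phi> E q = \<zero>\<^bsub>ob B E\<^esub>"
  by (simp_all add: down_def S_Obj)

lemma up_app:
  "s \<in> Obj C \<Longrightarrow> x \<in> carrier (ob P s) \<Longrightarrow> up P \<alpha> F \<psi> s x = act F (io (ro s)) s (cu s) (\<psi> (ro s) (\<alpha> s x))"
  by (simp add: up_def)

lemma down_nat:
  assumes Q: "is_rmod_functor R A Q" and P: "is_rmod_functor R C P" and B: "is_rmod_functor R A B"
    and res: "restricts B F" and \<beta>: "\<beta> \<in> nat_trans R A Q (ext P)" and \<phi>: "\<phi> \<in> nat_trans R C P F"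
  shows "down Q \<beta> B \<phi> \<in> nat_trans R A Q B"
proof -
  have e: "ext_trans P (\<lambda>E. \<zero>\<^bsub>ob B E\<^esub>) \<phi> \<in> nat_trans R A (ext P) B"
    by (rule ext_trans_nat[OF P \<phi> B res])
  have "down Q \<beta> B \<phi> = trans_comp A Q (ext_trans P (\<lambda>E. \<zero>\<^bsub>ob B E\<^esub>) \<phi>) \<beta>"
    unfolding down_def
  proof (rule mk_trans_eq[OF trans_comp_closed[OF Q \<beta> e]])
    fix E q assume E: "E \<in> Obj A" and q: "q \<in> carrier (ob Q E)"
    then show "(if E \<in> S then \<phi> (io E) (\<beta> E q) else \<zero>\<^bsub>ob B E\<^esub>) =
        trans_comp A Q (ext_trans P (\<lambda>E. \<zero>\<^bsub>ob B E\<^esub>) \<phi>) \<beta> E q"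
      using nat_transD(2)[OF \<beta> E q] by (cases "E \<in> S") simp_all
  qed
  then show ?thesis using trans_comp_closed[OF Q \<beta> e] by simp
qed

lemma up_nat:
  assumes P: "is_rmod_functor R C P" and Q: "is_rmod_functor R A Q" and F: "is_rmod_functor R C F"
    and res: "restricts B F" and \<alpha>: "\<alpha> \<in> nat_trans R C P (pull Q)" and \<psi>: "\<psi> \<in> nat_trans R A Q B"
  shows "up P \<alpha> F \<psi> \<in> nat_trans R C P F"
  unfolding up_def
proof (rule mk_trans_nat_trans[OF P])
  fix s assume s: "s \<in> Obj C"
  have 1: "\<alpha> s \<in> mod_hom R (ob P s) (ob Q (ro s))" using nat_transD(1)[OF \<alpha> s] by simp
  have 2: "\<psi> (ro s) \<in> mod_hom R (ob Q (ro s)) (ob F (io (ro s)))"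
    using nat_transD(1)[OF \<psi> S_Obj[OF ro[OF s]]] restrictsD(1)[OF res ro[OF s]] by simp
  show "(\<lambda>x. act F (io (ro s)) s (cu s) (\<psi> (ro s) (\<alpha> s x))) \<in> mod_hom R (ob P s) (ob F s)"
    using mod_hom_comp[OF mod_hom_comp[OF 1 2] functorD(2)[OF F io[OF ro[OF s]] s cu[OF s]]] .
next
  fix s t f x assume s: "s \<in> Obj C" and t: "t \<in> Obj C" and f: "f \<in> Hom C s t" and x: "x \<in> carrier (ob P s)"
  have \<alpha>x: "\<alpha> s x \<in> carrier (ob Q (ro s))" using nat_transD(2)[OF \<alpha> s x] by simp
  have \<psi>x: "\<psi> (ro s) (\<alpha> s x) \<in> carrier (ob F (io (ro s)))" (is "?v \<in> _")
    using nat_transD(2)[OF \<psi> S_Obj[OF ro[OF s]] \<alpha>x] restrictsD(1)[OF res ro[OF s]] by simp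
  have "act F (io (ro t)) t (cu t) (\<psi> (ro t) (\<alpha> t (act P s t f x))) =
      act F (io (ro t)) t (cu t) (act F (io (ro s)) (io (ro t)) (im (ro s) (ro t) (rm s t f)) ?v)"
    using nat_transD(3)[OF \<alpha> s t f x] nat_transD(3)[OF \<psi> S_Obj[OF ro[OF s]] S_Obj[OF ro[OF t]] rm[OF s t f] \<alpha>x]
      restrictsD(2)[OF res ro[OF s] ro[OF t] rm[OF s t f] \<psi>x] by simp
  also have "\<dots> = act F (io (ro s)) t (Comp C (io (ro s)) s t f (cu s)) ?v"
    unfolding cu_nat[OF s t f]
    by (rule functorD(5)[OF F io[OF ro[OF s]] io[OF ro[OF t]] t im[OF ro[OF s] ro[OF t] rm[OF s t f]] cu[OF t] \<psi>x, symmetric])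
  also have "\<dots> = act F s t f (act F (io (ro s)) s (cu s) ?v)"
    by (rule functorD(5)[OF F io[OF ro[OF s]] s t cu[OF s] f \<psi>x])
  finally show "act F (io (ro t)) t (cu t) (\<psi> (ro t) (\<alpha> t (act P s t f x))) =
      act F s t f (act F (io (ro s)) s (cu s) ?v)" .
qed

lemma down_hom:
  assumes Q: "is_rmod_functor R A Q" and P: "is_rmod_functor R C P" and B: "is_rmod_functor R A B"
    and F: "is_rmod_functor R C F"
    and res: "restricts B F" and \<beta>: "\<beta> \<in> nat_trans R A Q (ext P)"
  shows "down Q \<beta> B \<in> mod_hom R (hom_module R C P F) (hom_module R A Q B)"
proof -
  interpret H: module R "hom_module R C P F" by (rule hom_module_module[OF R P F])
  interpret H': module R "hom_module R A Q B" by (rule hom_module_module[OF R Q B])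
  note dn = down_nat[OF Q P B res \<beta>]
  have \<beta>c: "\<beta> E q \<in> carrier (ob P (io E))" if "E \<in> S" "q \<in> carrier (ob Q E)" for E q
    using nat_transD(2)[OF \<beta> S_Obj[OF that(1)] that(2)] that by simp
  show ?thesis
  proof (rule mod_homI)
    fix \<phi> \<theta> assume c: "\<phi> \<in> carrier (hom_module R C P F)" "\<theta> \<in> carrier (hom_module R C P F)"
    have "down Q \<beta> B (\<phi> \<oplus>\<^bsub>hom_module R C P F\<^esub> \<theta>) \<in> nat_trans R A Q B"
      by (rule dn) (use H.M.a_closed[OF c] in simp)
    moreover have "down Q \<beta> B \<phi> \<oplus>\<^bsub>hom_module R A Q B\<^esub> down Q \<beta> B \<theta> \<in> carrier (hom_module R A Q B)"
      by (rule H'.M.a_closed) (use c dn in auto)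
    then have "down Q \<beta> B \<phi> \<oplus>\<^bsub>hom_module R A Q B\<^esub> down Q \<beta> B \<theta> \<in> nat_trans R A Q B"
      unfolding hom_module_simps(1) .
    ultimately show "down Q \<beta> B (\<phi> \<oplus>\<^bsub>hom_module R C P F\<^esub> \<theta>) =
      down Q \<beta> B \<phi> \<oplus>\<^bsub>hom_module R A Q B\<^esub> down Q \<beta> B \<theta>"
    proof (rule nat_trans_eqI)
      fix E q assume E: "E \<in> Obj A" and q: "q \<in> carrier (ob Q E)"
      interpret BE: module R "ob B E" by (rule functorD(1)[OF B E])
      show "down Q \<beta> B (\<phi> \<oplus>\<^bsub>hom_module R C P F\<^esub> \<theta>) E q =
        (down Q \<beta> B \<phi> \<oplus>\<^bsub>hom_module R A Q B\<^esub> down Q \<beta> B \<theta>) E q"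
        using E q \<beta>c[OF _ q] by (cases "E \<in> S") (simp_all add: down_app io restrictsD(1)[OF res])
    qed
  next
    fix r \<phi> assume c: "r \<in> carrier R" "\<phi> \<in> carrier (hom_module R C P F)"
    have "down Q \<beta> B (r \<odot>\<^bsub>hom_module R C P F\<^esub> \<phi>) \<in> nat_trans R A Q B"
      by (rule dn) (use H.smult_closed[OF c] in simp)
    moreover have "r \<odot>\<^bsub>hom_module R A Q B\<^esub> down Q \<beta> B \<phi> \<in> carrier (hom_module R A Q B)"
      by (rule H'.smult_closed) (use c dn in auto)
    then have "r \<odot>\<^bsub>hom_module R A Q B\<^esub> down Q \<beta> B \<phi> \<in> nat_trans R A Q B"
      unfolding hom_module_simps(1) .
    ultimately show "down Q \<beta> B (r \<odot>\<^bsub>hom_module R C P F\<^esub> \<phi>) = r \<odot>\<^bsub>hom_module R A Q B\<^esub> down Q \<beta> B \<phi>"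
    proof (rule nat_trans_eqI)
      fix E q assume E: "E \<in> Obj A" and q: "q \<in> carrier (ob Q E)"
      interpret BE: module R "ob B E" by (rule functorD(1)[OF B E])
      show "down Q \<beta> B (r \<odot>\<^bsub>hom_module R C P F\<^esub> \<phi>) E q = (r \<odot>\<^bsub>hom_module R A Q B\<^esub> down Q \<beta> B \<phi>) E q"
        using E q c(1) \<beta>c[OF _ q] by (cases "E \<in> S") (simp_all add: down_app io restrictsD(1)[OF res])
    qed
  qed (use dn in simp)
qed

text \<open>Going down and up again is composition with the endomorphism \<open>\<delta>\<close> of \<open>P\<close> obtained from \<open>\<alpha>\<close>, \<open>\<beta>\<close> and
  the counit (\<open>ud\<close>), and going up and down is composition with the endomorphism \<open>\<gamma>\<close> of \<open>Q\<close> (\<open>du\<close>). Both lie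
  over the identity of the coefficient functor, so they change a cocycle by a coboundary.\<close>

theorem cohomology_iso_pos:
  fixes P :: "nat \<Rightarrow> ('o, 'm, 'r, 'p) rmod_functor" and Q :: "nat \<Rightarrow> ('x, 'y, 'r, 'q) rmod_functor"
    and F :: "('o, 'm, 'r, 'a) rmod_functor" and B :: "('x, 'y, 'r, 'a) rmod_functor"
  assumes F: "is_rmod_functor R C F" and B: "is_rmod_functor R A B" and res: "restricts B F"
    and P: "projective_resolution R C KC P dP \<epsilon>P" and Q: "projective_resolution R A KA Q dQ \<epsilon>Q"
  shows "mod_iso R (quot_module (cocycles R C P dP F (Suc n)) (coboundaries R C P dP F (Suc n)))
    (quot_module (cocycles R A Q dQ B (Suc n)) (coboundaries R A Q dQ B (Suc n)))"
proof -
  have Pe: "exact_complex R C KC P dP \<epsilon>P" using P by (simp only: projective_resolution_iff)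
  have Qe: "exact_complex R A KA Q dQ \<epsilon>Q" using Q by (simp only: projective_resolution_iff)
  note PD = exact_complexD[OF Pe] and QD = exact_complexD[OF Qe]
  obtain \<alpha> where \<alpha>: "\<And>n. \<alpha> n \<in> nat_trans R C (P n) (pull (Q n))"
    and \<alpha>0: "\<And>x a. x \<in> Obj C \<Longrightarrow> a \<in> carrier (ob (P 0) x) \<Longrightarrow> pull_trans (Q 0) \<epsilon>Q x (\<alpha> 0 x a) = \<epsilon>P x a"
    and \<alpha>d: "\<And>n x a. x \<in> Obj C \<Longrightarrow> a \<in> carrier (ob (P (Suc n)) x) \<Longrightarrow>
      pull_trans (Q (Suc n)) (dQ n) x (\<alpha> (Suc n) x a) = \<alpha> n x (dP n x a)"
    using chain_map_exists[OF R C KC P pull_exact[OF Qe]] by metis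
  obtain \<beta> where \<beta>: "\<And>n. \<beta> n \<in> nat_trans R A (Q n) (ext (P n))"
    and \<beta>0: "\<And>x a. x \<in> Obj A \<Longrightarrow> a \<in> carrier (ob (Q 0) x) \<Longrightarrow>
      ext_trans (P 0) (\<lambda>E. \<zero>\<^bsub>ob KA E\<^esub>) \<epsilon>P x (\<beta> 0 x a) = \<epsilon>Q x a"
    and \<beta>d: "\<And>n x a. x \<in> Obj A \<Longrightarrow> a \<in> carrier (ob (Q (Suc n)) x) \<Longrightarrow>
      ext_trans (P (Suc n)) (\<lambda>E. \<zero>\<^bsub>ob (ext (P n)) E\<^esub>) (dP n) x (\<beta> (Suc n) x a) = \<beta> n x (dQ n x a)"
    using chain_map_exists[OF R A KA Q ext_exact[OF Pe]] by metis
  have \<alpha>c: "\<alpha> n s x \<in> carrier (ob (Q n) (ro s))" if "s \<in> Obj C" "x \<in> carrier (ob (P n) s)" for n s x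
    using nat_transD(2)[OF \<alpha> that] by simp
  have \<beta>c: "\<beta> n E q \<in> carrier (ob (P n) (io E))" if "E \<in> S" "q \<in> carrier (ob (Q n) E)" for n E q
    using nat_transD(2)[OF \<beta> S_Obj[OF that(1)] that(2)] that by simp
  note dPc = nat_transD(2)[OF PD(2)] and dQc = nat_transD(2)[OF QD(2)]
  have \<alpha>d': "\<alpha> n s (dP n s x) = dQ n (ro s) (\<alpha> (Suc n) s x)"
    if "s \<in> Obj C" "x \<in> carrier (ob (P (Suc n)) s)" for n s x
    using \<alpha>d[OF that] \<alpha>c[OF that] that by simp
  have \<beta>d': "\<beta> n E (dQ n E q) = dP n (io E) (\<beta> (Suc n) E q)"
    if "E \<in> S" "q \<in> carrier (ob (Q (Suc n)) E)" for n E q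
    using \<beta>d[OF S_Obj[OF that(1)] that(2)] \<beta>c[OF that] that by simp
  have \<alpha>0': "\<epsilon>Q (ro s) (\<alpha> 0 s x) = \<epsilon>P s x" if "s \<in> Obj C" "x \<in> carrier (ob (P 0) s)" for s x
    using \<alpha>0[OF that] \<alpha>c[OF that] that by simp
  have \<beta>0': "\<epsilon>P (io E) (\<beta> 0 E q) = \<epsilon>Q E q" if "E \<in> S" "q \<in> carrier (ob (Q 0) E)" for E q
    using \<beta>0[OF S_Obj[OF that(1)] that(2)] \<beta>c[OF that] that by simp
  have dn: "down (Q n) (\<beta> n) B \<phi> \<in> nat_trans R A (Q n) B" if "\<phi> \<in> nat_trans R C (P n) F" for n \<phi>
    by (rule down_nat[OF QD(1) PD(1) B res \<beta> that])
  have un: "up (P n) (\<alpha> n) F \<psi> \<in> nat_trans R C (P n) F" if "\<psi> \<in> nat_trans R A (Q n) B" for n \<psi>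
    by (rule up_nat[OF PD(1) QD(1) F res \<alpha> that])
  have z: "\<psi> E \<zero>\<^bsub>ob M E\<^esub> = \<zero>\<^bsub>ob N E\<^esub>" if "\<psi> \<in> nat_trans R A M N" "is_rmod_functor R A M" "is_rmod_functor R A N" "E \<in> Obj A"
    for \<psi> :: "'x \<Rightarrow> 'q \<Rightarrow> 'b" and E M N by (rule nat_trans_zero[OF that])
  \<comment> \<open>the endomorphisms arise by transporting \<open>\<alpha>\<close> down and \<open>\<beta>\<close> up\<close>
  define \<gamma> where "\<gamma> n = down (Q n) (\<beta> n) (Q n) (\<alpha> n)" for n
  define \<delta> where "\<delta> n = up (P n) (\<alpha> n) (P n) (\<beta> n)" for n
  have \<gamma>: "\<gamma> n \<in> nat_trans R A (Q n) (Q n)" for n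
    unfolding \<gamma>_def by (rule down_nat[OF QD(1) PD(1) QD(1) restricts_pull \<beta> \<alpha>])
  have \<delta>: "\<delta> n \<in> nat_trans R C (P n) (P n)" for n
    unfolding \<delta>_def by (rule up_nat[OF PD(1) QD(1) PD(1) restricts_ext \<alpha> \<beta>])
  have \<gamma>d: "dQ n E (\<gamma> (Suc n) E q) = \<gamma> n E (dQ n E q)"
    if E: "E \<in> Obj A" and q: "q \<in> carrier (ob (Q (Suc n)) E)" for n E q
  proof (cases "E \<in> S")
    case True
    then show ?thesis using E q dQc[OF E q] \<alpha>d'[OF io[OF True] \<beta>c[OF True q]]
      by (simp add: \<gamma>_def down_app \<beta>d' ro_io)
  next
    case False
    then show ?thesis using E q dQc[OF E q] z[OF QD(2) QD(1) QD(1) E] by (simp add: \<gamma>_def down_app)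
  qed
  have \<gamma>0: "\<epsilon>Q E (\<gamma> 0 E q) = \<epsilon>Q E q" if E: "E \<in> Obj A" and q: "q \<in> carrier (ob (Q 0) E)" for E q
  proof (cases "E \<in> S")
    case True
    then show ?thesis using E q \<alpha>0'[OF io[OF True] \<beta>c[OF True q]] by (simp add: \<gamma>_def down_app \<beta>0' ro_io)
  next
    case False
    then have "\<epsilon>Q E q = \<zero>\<^bsub>ob KA E\<^esub>" using nat_transD(2)[OF QD(3) E q] by (simp add: const_on_def)
    then show ?thesis using E q False z[OF QD(3) QD(1) KA E] by (simp add: \<gamma>_def down_app)
  qed
  have \<delta>d: "dP n s (\<delta> (Suc n) s x) = \<delta> n s (dP n s x)"
    if s: "s \<in> Obj C" and x: "x \<in> carrier (ob (P (Suc n)) s)" for n s x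
    using nat_transD(3)[OF PD(2) io[OF ro[OF s]] s cu[OF s] \<beta>c[OF ro[OF s] \<alpha>c[OF s x]]]
    by (simp add: \<delta>_def up_app s x dPc \<alpha>d' \<beta>d'[OF ro[OF s] \<alpha>c[OF s x]])
  have \<delta>0: "\<epsilon>P s (\<delta> 0 s x) = \<epsilon>P s x" if s: "s \<in> Obj C" and x: "x \<in> carrier (ob (P 0) s)" for s x
    using nat_transD(3)[OF PD(3) io[OF ro[OF s]] s cu[OF s] \<beta>c[OF ro[OF s] \<alpha>c[OF s x]]]
      \<beta>0'[OF ro[OF s] \<alpha>c[OF s x]] \<alpha>0'[OF s x]
    by (simp add: \<delta>_def up_app s x const_functor_def)
  have du: "down (Q n) (\<beta> n) B (up (P n) (\<alpha> n) F \<psi>) E q = \<psi> E (\<gamma> n E q)"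
    if \<psi>: "\<psi> \<in> nat_trans R A (Q n) B" and E: "E \<in> Obj A" and q: "q \<in> carrier (ob (Q n) E)" for n \<psi> E q
  proof (cases "E \<in> S")
    case True
    have "\<psi> E (\<alpha> n (io E) (\<beta> n E q)) \<in> carrier (ob F (io E))"
      using nat_transD(2)[OF \<psi> E, of "\<alpha> n (io E) (\<beta> n E q)"] \<alpha>c[OF io[OF True] \<beta>c[OF True q]]
      by (simp add: ro_io True restrictsD(1)[OF res])
    then show ?thesis using functorD(4)[OF F io[OF True]]
      by (simp add: down_app True q \<gamma>_def up_app io \<beta>c ro_io cu_io)
  next
    case False
    then show ?thesis using E q z[OF \<psi> QD(1) B E] by (simp add: down_app \<gamma>_def)
  qed
  have ud: "up (P n) (\<alpha> n) F (down (Q n) (\<beta> n) B \<phi>) s x = \<phi> s (\<delta> n s x)"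
    if \<phi>: "\<phi> \<in> nat_trans R C (P n) F" and s: "s \<in> Obj C" and x: "x \<in> carrier (ob (P n) s)" for n \<phi> s x
    using nat_transD(3)[OF \<phi> io[OF ro[OF s]] s cu[OF s] \<beta>c[OF ro[OF s] \<alpha>c[OF s x]]]
    by (simp add: up_app s x down_app ro \<alpha>c \<delta>_def)
  note Zc = cocycles_carrier[OF Pe] and Zq = cocycles_carrier[OF Qe]
  have mF: "module R (cocycles R C P dP F k)" for k by (rule cocycles_module[OF R F Pe])
  have mB: "module R (cocycles R A Q dQ B k)" for k by (rule cocycles_module[OF R B Qe])
  have down_coc: "down (Q k) (\<beta> k) B \<phi> \<in> carrier (cocycles R A Q dQ B k)"
    if "\<phi> \<in> carrier (cocycles R C P dP F k)" for k \<phi>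
    unfolding Zq
  proof (intro conjI ballI)
    have \<phi>: "\<phi> \<in> nat_trans R C (P k) F"
      "\<And>x a. x \<in> Obj C \<Longrightarrow> a \<in> carrier (ob (P (Suc k)) x) \<Longrightarrow> \<phi> x (dP k x a) = \<zero>\<^bsub>ob F x\<^esub>"
      using that by (simp_all add: Zc)
    show "down (Q k) (\<beta> k) B \<phi> \<in> nat_trans R A (Q k) B" by (rule dn[OF \<phi>(1)])
    fix E q assume E: "E \<in> Obj A" and q: "q \<in> carrier (ob (Q (Suc k)) E)"
    show "down (Q k) (\<beta> k) B \<phi> E (dQ k E q) = \<zero>\<^bsub>ob B E\<^esub>"
    proof (cases "E \<in> S")
      case True
      then show ?thesis using E q dQc[OF E q]
        by (simp add: down_app \<beta>d' \<phi>(2) io \<beta>c restrictsD(1)[OF res])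
    qed (use E q dQc[OF E q] in \<open>simp add: down_app\<close>)
  qed
  let ?Z = "cocycles R C P dP F (Suc n)" and ?Z' = "cocycles R A Q dQ B (Suc n)"
  let ?h = "down (Q (Suc n)) (\<beta> (Suc n)) B"
  show ?thesis
  proof (rule quot_mod_iso'[OF mF coboundaries_submodule[OF R F Pe] mB coboundaries_submodule[OF R B Qe], of ?h])
    have eqs: "?Z = (hom_module R C (P (Suc n)) F)\<lparr>carrier := carrier ?Z\<rparr>"
      "?Z' = (hom_module R A (Q (Suc n)) B)\<lparr>carrier := carrier ?Z'\<rparr>"
      by (simp_all add: cocycles_def)
    have "?h \<in> mod_hom R ((hom_module R C (P (Suc n)) F)\<lparr>carrier := carrier ?Z\<rparr>)
      ((hom_module R A (Q (Suc n)) B)\<lparr>carrier := carrier ?Z'\<rparr>)"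
      by (rule mod_hom_carrier_update[OF down_hom[OF QD(1) PD(1) B F res \<beta>]])
        (use down_coc in \<open>auto simp: Zc\<close>)
    then show "?h \<in> mod_hom R ?Z ?Z'" using eqs by simp
  next
    fix \<phi> assume \<phi>Z: "\<phi> \<in> carrier ?Z"
    then have \<phi>: "\<phi> \<in> nat_trans R C (P (Suc n)) F"
      "\<And>x a. x \<in> Obj C \<Longrightarrow> a \<in> carrier (ob (P (Suc (Suc n))) x) \<Longrightarrow> \<phi> x (dP (Suc n) x a) = \<zero>\<^bsub>ob F x\<^esub>"
      by (simp_all add: Zc)
    show "?h \<phi> \<in> coboundaries R A Q dQ B (Suc n) \<longleftrightarrow> \<phi> \<in> coboundaries R C P dP F (Suc n)"
    proof
      assume "\<phi> \<in> coboundaries R C P dP F (Suc n)"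
      then obtain \<theta> where \<theta>: "\<theta> \<in> nat_trans R C (P n) F" "\<phi> = trans_comp C (P (Suc n)) \<theta> (dP n)"
        by (rule coboundariesE)
      show "?h \<phi> \<in> coboundaries R A Q dQ B (Suc n)"
      proof (rule coboundariesI[OF dn[OF \<theta>(1)] Qe dn[OF \<phi>(1)]])
        fix E q assume E: "E \<in> Obj A" and q: "q \<in> carrier (ob (Q (Suc n)) E)"
        show "?h \<phi> E q = down (Q n) (\<beta> n) B \<theta> E (dQ n E q)"
        proof (cases "E \<in> S")
          case True
          then show ?thesis using E q dQc[OF E q] by (simp add: down_app \<theta>(2) io \<beta>c \<beta>d')
        qed (use E q dQc[OF E q] in \<open>simp add: down_app\<close>)
      qed
    next
      assume "?h \<phi> \<in> coboundaries R A Q dQ B (Suc n)"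
      then obtain \<theta> where \<theta>: "\<theta> \<in> nat_trans R A (Q n) B" "?h \<phi> = trans_comp A (Q (Suc n)) \<theta> (dQ n)"
        by (rule coboundariesE)
      obtain \<tau> where \<tau>: "\<tau> \<in> nat_trans R C (P n) F"
        "\<And>x a. x \<in> Obj C \<Longrightarrow> a \<in> carrier (ob (P (Suc n)) x) \<Longrightarrow>
          \<phi> x (\<delta> (Suc n) x a) = \<phi> x a \<oplus>\<^bsub>ob F x\<^esub> \<tau> x (dP n x a)"
        using chain_endo_cocycle[OF R C KC F P \<delta> \<delta>0 \<delta>d \<phi>] by blast
      \<comment> \<open>if \<open>\<theta>\<close> bounds \<open>\<phi>\<close> after going down and \<open>\<tau>\<close> bounds \<open>\<phi> \<delta> - \<phi>\<close>, then \<open>up \<theta> - \<tau>\<close> bounds \<open>\<phi>\<close>\<close>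
      let ?u = "mk_trans C (P n) (\<lambda>x a. up (P n) (\<alpha> n) F \<theta> x a \<ominus>\<^bsub>ob F x\<^esub> \<tau> x a)"
      have u: "?u \<in> nat_trans R C (P n) F" by (rule nat_trans_diff[OF R PD(1) F un[OF \<theta>(1)] \<tau>(1)])
      show "\<phi> \<in> coboundaries R C P dP F (Suc n)"
      proof (rule coboundariesI[OF u Pe \<phi>(1)])
        fix s x assume s: "s \<in> Obj C" and x: "x \<in> carrier (ob (P (Suc n)) s)"
        interpret Fs: module R "ob F s" by (rule functorD(1)[OF F s])
        have "up (P n) (\<alpha> n) F \<theta> s (dP n s x) = up (P (Suc n)) (\<alpha> (Suc n)) F (?h \<phi>) s x"
          using s x dPc[OF s x] \<alpha>c[OF s x] S_Obj[OF ro[OF s]] by (simp add: up_app \<theta>(2) \<alpha>d')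
        also have "\<dots> = \<phi> s x \<oplus>\<^bsub>ob F s\<^esub> \<tau> s (dP n s x)" using ud[OF \<phi>(1) s x] \<tau>(2)[OF s x] by simp
        finally show "\<phi> s x = ?u s (dP n s x)"
          using s dPc[OF s x] nat_transD(2)[OF \<phi>(1) s x] nat_transD(2)[OF \<tau>(1) s dPc[OF s x]]
          by (simp add: a_minus_def Fs.M.a_assoc Fs.M.r_neg)
      qed
    qed
  next
    fix \<psi> assume \<psi>Z: "\<psi> \<in> carrier ?Z'"
    then have \<psi>: "\<psi> \<in> nat_trans R A (Q (Suc n)) B"
      "\<And>x a. x \<in> Obj A \<Longrightarrow> a \<in> carrier (ob (Q (Suc (Suc n))) x) \<Longrightarrow> \<psi> x (dQ (Suc n) x a) = \<zero>\<^bsub>ob B x\<^esub>"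
      by (simp_all add: Zq)
    let ?a = "up (P (Suc n)) (\<alpha> (Suc n)) F \<psi>"
    have a: "?a \<in> carrier ?Z" unfolding Zc
    proof (intro conjI ballI un[OF \<psi>(1)])
      fix s x assume s: "s \<in> Obj C" and x: "x \<in> carrier (ob (P (Suc (Suc n))) s)"
      show "?a s (dP (Suc n) s x) = \<zero>\<^bsub>ob F s\<^esub>"
        using s x dPc[OF s x] \<psi>(2)[OF S_Obj[OF ro[OF s]] \<alpha>c[OF s x]]
          mod_hom_zero[OF functorD(2)[OF F io[OF ro[OF s]] s cu[OF s]] functorD(1)[OF F io[OF ro[OF s]]] functorD(1)[OF F s]]
        by (simp add: up_app \<alpha>d' restrictsD(1)[OF res ro[OF s]])
    qed
    obtain \<tau> where \<tau>: "\<tau> \<in> nat_trans R A (Q n) B"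
      "\<And>x a. x \<in> Obj A \<Longrightarrow> a \<in> carrier (ob (Q (Suc n)) x) \<Longrightarrow>
        \<psi> x (\<gamma> (Suc n) x a) = \<psi> x a \<oplus>\<^bsub>ob B x\<^esub> \<tau> x (dQ n x a)"
      using chain_endo_cocycle[OF R A KA B Q \<gamma> \<gamma>0 \<gamma>d \<psi>] by blast
    let ?c = "trans_comp A (Q (Suc n)) \<tau> (dQ n)"
    have c: "?c \<in> coboundaries R A Q dQ B (Suc n)" using \<tau>(1) by (auto simp: coboundaries_def)
    have cZ: "?c \<in> carrier ?Z'" using submodule_simps(1)[OF mB coboundaries_submodule[OF R B Qe]] c by blast
    have sZ: "\<psi> \<oplus>\<^bsub>?Z'\<^esub> ?c \<in> carrier ?Z'"
      using mB[of "Suc n"] \<psi>Z cZ by (simp only: module_def abelian_group_def abelian_monoid.a_closed)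
    have "?h ?a = \<psi> \<oplus>\<^bsub>?Z'\<^esub> ?c"
    proof (rule nat_trans_eqI[OF dn[OF un[OF \<psi>(1)]]])
      show "\<psi> \<oplus>\<^bsub>?Z'\<^esub> ?c \<in> nat_trans R A (Q (Suc n)) B" using sZ unfolding Zq by blast
      fix E q assume "E \<in> Obj A" "q \<in> carrier (ob (Q (Suc n)) E)"
      then show "?h ?a E q = (\<psi> \<oplus>\<^bsub>?Z'\<^esub> ?c) E q" by (simp add: du[OF \<psi>(1)] \<tau>(2))
    qed
    then show "\<exists>a\<in>carrier ?Z. \<exists>c\<in>coboundaries R A Q dQ B (Suc n). ?h a = \<psi> \<oplus>\<^bsub>?Z'\<^esub> c"
      using a c by blast
  qed
qed

end


section \<open>Degrees zero and minus one\<close>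

lemma lim_module_carrier:
  "f \<in> carrier (lim_module C F) \<longleftrightarrow> f \<in> (\<Pi>\<^sub>E s\<in>Obj C. carrier (ob F s)) \<and>
    (\<forall>x\<in>Obj C. \<forall>y\<in>Obj C. \<forall>\<phi>\<in>Hom C x y. act F x y \<phi> (f x) = f y)"
  by (simp add: lim_module_def)

lemma lim_module_simps [simp]:
  "\<zero>\<^bsub>lim_module C F\<^esub> = (\<lambda>s\<in>Obj C. \<zero>\<^bsub>ob F s\<^esub>)"
  "f \<oplus>\<^bsub>lim_module C F\<^esub> g = (\<lambda>s\<in>Obj C. f s \<oplus>\<^bsub>ob F s\<^esub> g s)"
  "r \<odot>\<^bsub>lim_module C F\<^esub> f = (\<lambda>s\<in>Obj C. r \<odot>\<^bsub>ob F s\<^esub> f s)"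
  by (simp_all add: lim_module_def)

lemma lim_module_module:
  assumes R: "cring R" and F: "is_rmod_functor R C F"
  shows "module R (lim_module C F)"
proof -
  let ?P = "prod_module (Obj C) (ob F)"
  have m: "module R (ob F s)" if "s \<in> Obj C" for s by (rule functorD(1)[OF F that])
  have p: "module R ?P" by (rule prod_module_module[OF R m])
  have am: "abelian_monoid (ob F s)" if "s \<in> Obj C" for s
    using m[OF that] by (simp add: module_def abelian_group_def)
  have "submodule (carrier (lim_module C F)) R ?P"
  proof (rule submodule_crit[OF p])
    show "carrier (lim_module C F) \<subseteq> carrier ?P" by (auto simp: lim_module_def)
    have "act F x y \<phi> \<zero>\<^bsub>ob F x\<^esub> = \<zero>\<^bsub>ob F y\<^esub>" if "x \<in> Obj C" "y \<in> Obj C" "\<phi> \<in> Hom C x y" for x y \<phi>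
      using mod_hom_zero[OF functorD(2)[OF F that] m[OF that(1)] m[OF that(2)]] .
    then show "\<zero>\<^bsub>?P\<^esub> \<in> carrier (lim_module C F)"
      by (auto simp: lim_module_carrier abelian_monoid.zero_closed[OF am])
  next
    fix f g assume f: "f \<in> carrier (lim_module C F)" and g: "g \<in> carrier (lim_module C F)"
    then have c: "\<And>s. s \<in> Obj C \<Longrightarrow> f s \<in> carrier (ob F s)" "\<And>s. s \<in> Obj C \<Longrightarrow> g s \<in> carrier (ob F s)"
      by (auto simp: lim_module_carrier)
    then show "f \<oplus>\<^bsub>?P\<^esub> g \<in> carrier (lim_module C F)"
      using f g by (auto simp: lim_module_carrier abelian_monoid.a_closed[OF am] mod_homD(2)[OF functorD(2)[OF F]])
  next
    fix r f assume r: "r \<in> carrier R" and f: "f \<in> carrier (lim_module C F)"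
    then have c: "\<And>s. s \<in> Obj C \<Longrightarrow> f s \<in> carrier (ob F s)" by (auto simp: lim_module_carrier)
    then show "r \<odot>\<^bsub>?P\<^esub> f \<in> carrier (lim_module C F)"
      using r f by (auto simp: lim_module_carrier module.smult_closed[OF m] mod_homD(3)[OF functorD(2)[OF F]])
  qed
  moreover have "lim_module C F = ?P\<lparr>carrier := carrier (lim_module C F)\<rparr>" by (simp add: lim_module_def)
  ultimately show ?thesis using submodule.submodule_is_module[OF _ p] by metis
qed

text \<open>The object \<open>e\<close> is initial in \<open>A\<close>. The value of \<open>B\<close> there plays the role of the global value that maps
  to the limit of \<open>F\<close>.\<close>

locale pointed_coreflection = coreflection R A S C io im ro rm cu
  for R :: "'r ring" and A :: "('x, 'y) cat" and S :: "'x set" and C :: "('o, 'm) cat"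
    and io :: "'x \<Rightarrow> 'o" and im :: "'x \<Rightarrow> 'x \<Rightarrow> 'y \<Rightarrow> 'm"
    and ro :: "'o \<Rightarrow> 'x" and rm :: "'o \<Rightarrow> 'o \<Rightarrow> 'm \<Rightarrow> 'y" and cu :: "'o \<Rightarrow> 'm" +
  fixes e :: 'x and u :: "'x \<Rightarrow> 'y"
  assumes e: "e \<in> Obj A" and e_notin: "e \<notin> S"
    and u: "\<And>E. E \<in> Obj A \<Longrightarrow> u E \<in> Hom A e E"
    and u_unique: "\<And>E f. E \<in> Obj A \<Longrightarrow> f \<in> Hom A e E \<Longrightarrow> f = u E"
begin

abbreviation "KA' \<equiv> (const_functor R :: ('x, 'y, 'r, 'r) rmod_functor)"

text \<open>The map \<open>B e \<rightarrow> B (r s) = F (i r s) \<rightarrow> F s\<close> for each object \<open>s\<close> of \<open>C\<close>.\<close>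

definition to_limit :: "('x, 'y, 'r, 'a) rmod_functor \<Rightarrow> ('o, 'm, 'r, 'a) rmod_functor \<Rightarrow> 'a \<Rightarrow> 'o \<Rightarrow> 'a" where
  "to_limit B F a = (\<lambda>s\<in>Obj C. act F (io (ro s)) s (cu s) (act B e (ro s) (u (ro s)) a))"

text \<open>By the Yoneda lemma for the initial object \<open>e\<close>, the transformations from the constant functor to \<open>B\<close>
  correspond to the elements of \<open>B e\<close>.\<close>

definition from_const :: "('x, 'y, 'r, 'a) rmod_functor \<Rightarrow> 'a \<Rightarrow> 'x \<Rightarrow> 'r \<Rightarrow> 'a" where
  "from_const B a = mk_trans A KA' (\<lambda>E r. r \<odot>\<^bsub>ob B E\<^esub> act B e E (u E) a)"

lemma KA': "is_rmod_functor R A KA'" by (rule const_functor_functor[OF R])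

lemma KA'_simps [simp]: "ob KA' E = ring_module R" "act KA' E E' f r = r"
  by (simp_all add: const_functor_def)

lemma act_u_closed:
  assumes "is_rmod_functor R A B" "E \<in> Obj A" "a \<in> carrier (ob B e)"
  shows "act B e E (u E) a \<in> carrier (ob B E)"
  using functorD(3)[OF assms(1) e assms(2) u[OF assms(2)] assms(3)] .

lemma act_u_comp:
  assumes B: "is_rmod_functor R A B" and E: "E \<in> Obj A" "E' \<in> Obj A" "f \<in> Hom A E E'" and a: "a \<in> carrier (ob B e)"
  shows "act B E E' f (act B e E (u E) a) = act B e E' (u E') a"
  using functorD(5)[OF B e E(1,2) u[OF E(1)] E(3) a] u_unique[OF E(2) is_catD(2)[OF A e E(1,2) u[OF E(1)] E(3)]]
  by simp

lemma from_const_nat: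
  assumes B: "is_rmod_functor R A B" and a: "a \<in> carrier (ob B e)"
  shows "from_const B a \<in> nat_trans R A KA' B"
  unfolding from_const_def
proof (rule mk_trans_nat_trans[OF KA'])
  fix E assume E: "E \<in> Obj A"
  interpret BE: module R "ob B E" by (rule functorD(1)[OF B E])
  show "(\<lambda>r. r \<odot>\<^bsub>ob B E\<^esub> act B e E (u E) a) \<in> mod_hom R (ob KA' E) (ob B E)"
    by (rule mod_homI) (simp_all add: act_u_closed[OF B E a] BE.smult_l_distr BE.smult_assoc1)
next
  fix E E' f r assume E: "E \<in> Obj A" "E' \<in> Obj A" "f \<in> Hom A E E'" and r: "r \<in> carrier (ob KA' E)"
  then show "act KA' E E' f r \<odot>\<^bsub>ob B E'\<^esub> act B e E' (u E') a = act B E E' f (r \<odot>\<^bsub>ob B E\<^esub> act B e E (u E) a)"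
    using mod_homD(3)[OF functorD(2)[OF B E] _ act_u_closed[OF B E(1) a]] act_u_comp[OF B E a] by simp
qed

lemma nat_from_const:
  assumes B: "is_rmod_functor R A B" and \<eta>: "\<eta> \<in> nat_trans R A KA' B"
  shows "\<eta> = from_const B (\<eta> e \<one>\<^bsub>R\<^esub>)" and "\<eta> e \<one>\<^bsub>R\<^esub> \<in> carrier (ob B e)"
proof -
  interpret RR: cring R by (rule R)
  show c: "\<eta> e \<one>\<^bsub>R\<^esub> \<in> carrier (ob B e)" using nat_transD(2)[OF \<eta> e] by simp
  show "\<eta> = from_const B (\<eta> e \<one>\<^bsub>R\<^esub>)"
  proof (rule nat_trans_eqI[OF \<eta> from_const_nat[OF B c]])
    fix E r assume E: "E \<in> Obj A" and r: "r \<in> carrier (ob KA' E)"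
    have "\<eta> E (r \<odot>\<^bsub>ob KA' E\<^esub> \<one>\<^bsub>R\<^esub>) = r \<odot>\<^bsub>ob B E\<^esub> \<eta> E \<one>\<^bsub>R\<^esub>"
      by (rule mod_homD(3)[OF nat_transD(1)[OF \<eta> E]]) (use r in auto)
    moreover have "\<eta> E \<one>\<^bsub>R\<^esub> = act B e E (u E) (\<eta> e \<one>\<^bsub>R\<^esub>)"
      using nat_transD(3)[OF \<eta> e E u[OF E], of "\<one>\<^bsub>R\<^esub>"] by simp
    ultimately show "\<eta> E r = from_const B (\<eta> e \<one>\<^bsub>R\<^esub>) E r" using E r by (simp add: from_const_def)
  qed
qed

lemma from_const_hom:
  assumes B: "is_rmod_functor R A B"
  shows "from_const B \<in> mod_hom R (ob B e) (hom_module R A KA' B)"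
proof -
  interpret RR: cring R by (rule R)
  interpret H: module R "hom_module R A KA' B" by (rule hom_module_module[OF R KA' B])
  interpret Be: module R "ob B e" by (rule functorD(1)[OF B e])
  note fc = from_const_nat[OF B]
  have act: "act B e E (u E) \<in> mod_hom R (ob B e) (ob B E)" if "E \<in> Obj A" for E
    by (rule functorD(2)[OF B e that u[OF that]])
  show ?thesis
  proof (rule mod_homI)
    fix a b assume ab: "a \<in> carrier (ob B e)" "b \<in> carrier (ob B e)"
    have "from_const B a \<oplus>\<^bsub>hom_module R A KA' B\<^esub> from_const B b \<in> carrier (hom_module R A KA' B)"
      by (rule H.M.a_closed) (use ab fc in auto)
    then have "from_const B a \<oplus>\<^bsub>hom_module R A KA' B\<^esub> from_const B b \<in> nat_trans R A KA' B"
      unfolding hom_module_simps(1) .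
    with fc[OF Be.M.a_closed[OF ab]]
    show "from_const B (a \<oplus>\<^bsub>ob B e\<^esub> b) = from_const B a \<oplus>\<^bsub>hom_module R A KA' B\<^esub> from_const B b"
    proof (rule nat_trans_eqI)
      fix E r assume E: "E \<in> Obj A" and r: "r \<in> carrier (ob KA' E)"
      interpret BE: module R "ob B E" by (rule functorD(1)[OF B E])
      show "from_const B (a \<oplus>\<^bsub>ob B e\<^esub> b) E r = (from_const B a \<oplus>\<^bsub>hom_module R A KA' B\<^esub> from_const B b) E r"
        using E r ab act_u_closed[OF B E] by (simp add: from_const_def mod_homD[OF act[OF E]] BE.smult_r_distr)
    qed
  next
    fix s a assume s: "s \<in> carrier R" and a: "a \<in> carrier (ob B e)"
    have "s \<odot>\<^bsub>hom_module R A KA' B\<^esub> from_const B a \<in> carrier (hom_module R A KA' B)"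
      by (rule H.smult_closed) (use s a fc in auto)
    then have "s \<odot>\<^bsub>hom_module R A KA' B\<^esub> from_const B a \<in> nat_trans R A KA' B"
      unfolding hom_module_simps(1) .
    with fc[OF Be.smult_closed[OF s a]]
    show "from_const B (s \<odot>\<^bsub>ob B e\<^esub> a) = s \<odot>\<^bsub>hom_module R A KA' B\<^esub> from_const B a"
    proof (rule nat_trans_eqI)
      fix E r assume E: "E \<in> Obj A" and r: "r \<in> carrier (ob KA' E)"
      interpret BE: module R "ob B E" by (rule functorD(1)[OF B E])
      show "from_const B (s \<odot>\<^bsub>ob B e\<^esub> a) E r = (s \<odot>\<^bsub>hom_module R A KA' B\<^esub> from_const B a) E r"
        using E r s a act_u_closed[OF B E]
        by (simp add: from_const_def mod_homD[OF act[OF E]] BE.smult_assoc1[symmetric] RR.m_comm)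
    qed
  qed (use fc in simp)
qed

text \<open>A family on \<open>S\<close> extends to \<open>C\<close> along the counit, whose naturality makes the extension compatible. So the
  limit of \<open>F\<close> over \<open>C\<close> is the limit of \<open>B\<close> over \<open>S\<close>.\<close>

lemma cone_lim:
  assumes F: "is_rmod_functor R C F" and res: "restricts B F"
    and v: "\<And>E. E \<in> S \<Longrightarrow> v E \<in> carrier (ob B E)"
    and act: "\<And>E E' f. E \<in> S \<Longrightarrow> E' \<in> S \<Longrightarrow> f \<in> Hom A E E' \<Longrightarrow> act B E E' f (v E) = v E'"
  shows "(\<lambda>s\<in>Obj C. act F (io (ro s)) s (cu s) (v (ro s))) \<in> carrier (lim_module C F)"
  unfolding lim_module_carrier
proof (intro conjI ballI)
  have vF: "v (ro s) \<in> carrier (ob F (io (ro s)))" if "s \<in> Obj C" for s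
    using v[OF ro[OF that]] restrictsD(1)[OF res ro[OF that]] by simp
  show "(\<lambda>s\<in>Obj C. act F (io (ro s)) s (cu s) (v (ro s))) \<in> (\<Pi>\<^sub>E s\<in>Obj C. carrier (ob F s))"
    using functorD(3)[OF F io[OF ro] _ cu vF] by simp
  fix s t f assume s: "s \<in> Obj C" and t: "t \<in> Obj C" and f: "f \<in> Hom C s t"
  let ?m = "im (ro s) (ro t) (rm s t f)"
  have "act F s t f (act F (io (ro s)) s (cu s) (v (ro s))) =
      act F (io (ro s)) t (Comp C (io (ro s)) s t f (cu s)) (v (ro s))"
    by (rule functorD(5)[OF F io[OF ro[OF s]] s t cu[OF s] f vF[OF s], symmetric])
  also have "\<dots> = act F (io (ro t)) t (cu t) (act F (io (ro s)) (io (ro t)) ?m (v (ro s)))"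
    unfolding cu_nat[OF s t f]
    by (rule functorD(5)[OF F io[OF ro[OF s]] io[OF ro[OF t]] t im[OF ro[OF s] ro[OF t] rm[OF s t f]] cu[OF t] vF[OF s]])
  also have "act F (io (ro s)) (io (ro t)) ?m (v (ro s)) = v (ro t)"
    using restrictsD(2)[OF res ro[OF s] ro[OF t] rm[OF s t f] vF[OF s]] act[OF ro[OF s] ro[OF t] rm[OF s t f]] by simp
  finally show "act F s t f ((\<lambda>s\<in>Obj C. act F (io (ro s)) s (cu s) (v (ro s))) s) =
      (\<lambda>s\<in>Obj C. act F (io (ro s)) s (cu s) (v (ro s))) t"
    using s t by simp
qed

lemma to_limit_hom:
  assumes F: "is_rmod_functor R C F" and B: "is_rmod_functor R A B" and res: "restricts B F"
  shows "to_limit B F \<in> mod_hom R (ob B e) (lim_module C F)"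
proof -
  have cl: "act B e (ro s) (u (ro s)) a \<in> carrier (ob F (io (ro s)))" if "s \<in> Obj C" "a \<in> carrier (ob B e)" for s a
    using act_u_closed[OF B S_Obj[OF ro[OF that(1)]] that(2)] restrictsD(1)[OF res ro[OF that(1)]] by simp
  have h: "(\<lambda>a. act F (io (ro s)) s (cu s) (act B e (ro s) (u (ro s)) a)) \<in> mod_hom R (ob B e) (ob F s)"
    if s: "s \<in> Obj C" for s
    using mod_hom_comp[OF functorD(2)[OF B e S_Obj[OF ro[OF s]] u[OF S_Obj[OF ro[OF s]]]], of _ "ob F s"]
      functorD(2)[OF F io[OF ro[OF s]] s cu[OF s]] restrictsD(1)[OF res ro[OF s]] by simp
  show ?thesis
  proof (rule mod_homI)
    fix a assume a: "a \<in> carrier (ob B e)"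
    show "to_limit B F a \<in> carrier (lim_module C F)"
      unfolding to_limit_def
    proof (rule cone_lim[OF F res, where v = "\<lambda>E. act B e E (u E) a"])
      show "act B e E (u E) a \<in> carrier (ob B E)" if "E \<in> S" for E
        by (rule act_u_closed[OF B S_Obj[OF that] a])
      show "act B E E' f (act B e E (u E) a) = act B e E' (u E') a"
        if "E \<in> S" "E' \<in> S" "f \<in> Hom A E E'" for E E' f
        by (rule act_u_comp[OF B S_Obj[OF that(1)] S_Obj[OF that(2)] that(3) a])
    qed
  qed (auto simp: to_limit_def fun_eq_iff mod_homD(2)[OF h] mod_homD(3)[OF h])
qed

lemma eps_const:
  assumes Q: "is_rmod_functor R A Q" and \<epsilon>: "\<epsilon> \<in> nat_trans R A Q KA"
  shows "\<epsilon> \<in> nat_trans R A Q KA'"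
proof -
  interpret RR: cring R by (rule R)
  have "\<epsilon> x \<in> mod_hom R (ob Q x) (ob KA' x)" if "x \<in> Obj A" for x
    using nat_transD(1)[OF \<epsilon> that] unfolding mod_hom_def
    by (cases "x \<in> S") (auto simp: const_on_def const_functor_def Pi_def)
  then show ?thesis using \<epsilon> unfolding nat_trans_def by (simp add: const_on_def const_functor_def)
qed

text \<open>The augmentation is onto \<open>R\<close> at each object of \<open>S\<close> and zero at \<open>e\<close>. Composing it with the
  transformation of \<open>a\<close> therefore gives zero exactly if \<open>a\<close> maps to \<open>0\<close> in each \<open>B E\<close> with \<open>E\<close> in \<open>S\<close>, that
  is, if it maps to \<open>0\<close> in the limit.\<close>

theorem cohomology_iso_m1:
  fixes Q :: "nat \<Rightarrow> ('x, 'y, 'r, 'q) rmod_functor"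
    and F :: "('o, 'm, 'r, 'a) rmod_functor" and B :: "('x, 'y, 'r, 'a) rmod_functor"
  assumes F: "is_rmod_functor R C F" and B: "is_rmod_functor R A B" and res: "restricts B F"
    and Qe: "exact_complex R A KA Q dQ \<epsilon>Q" and Se: "Obj A = insert e S"
  shows "mod_iso R ((ob B e)\<lparr>carrier := {a \<in> carrier (ob B e). to_limit B F a = \<zero>\<^bsub>lim_module C F\<^esub>}\<rparr>)
    ((hom_module R A KA' B)\<lparr>carrier := {\<eta> \<in> nat_trans R A KA' B.
       trans_comp A (Q 0) \<eta> \<epsilon>Q = \<zero>\<^bsub>hom_module R A (Q 0) B\<^esub>}\<rparr>)"
proof -
  interpret RR: cring R by (rule R)
  note QD = exact_complexD[OF Qe]
  have \<epsilon>: "\<epsilon>Q \<in> nat_trans R A (Q 0) KA'" by (rule eps_const[OF QD(1,3)])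
  note fc = from_const_nat[OF B]
  have eq: "trans_comp A (Q 0) (from_const B a) \<epsilon>Q = \<zero>\<^bsub>hom_module R A (Q 0) B\<^esub> \<longleftrightarrow>
      to_limit B F a = \<zero>\<^bsub>lim_module C F\<^esub>" if a: "a \<in> carrier (ob B e)" for a
  proof -
    have "trans_comp A (Q 0) (from_const B a) \<epsilon>Q = \<zero>\<^bsub>hom_module R A (Q 0) B\<^esub> \<longleftrightarrow>
        (\<forall>E\<in>Obj A. \<forall>q\<in>carrier (ob (Q 0) E). \<epsilon>Q E q \<odot>\<^bsub>ob B E\<^esub> act B e E (u E) a = \<zero>\<^bsub>ob B E\<^esub>)"
      using nat_transD(2)[OF \<epsilon>]
      by (subst hom_module_eq_zero_iff[OF trans_comp_closed[OF QD(1) \<epsilon> fc[OF a]]]) (simp add: from_const_def)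
    also have "\<dots> \<longleftrightarrow> (\<forall>E\<in>S. act B e E (u E) a = \<zero>\<^bsub>ob B E\<^esub>)"
    proof (intro iffI ballI)
      fix E assume z: "\<forall>E\<in>Obj A. \<forall>q\<in>carrier (ob (Q 0) E). \<epsilon>Q E q \<odot>\<^bsub>ob B E\<^esub> act B e E (u E) a = \<zero>\<^bsub>ob B E\<^esub>"
        and E: "E \<in> S"
      interpret BE: module R "ob B E" by (rule functorD(1)[OF B S_Obj[OF E]])
      have "\<epsilon>Q E ` carrier (ob (Q 0) E) = carrier R"
        using QD(4) S_Obj[OF E] E by (simp add: epi_trans_def const_on_def)
      then obtain q where "q \<in> carrier (ob (Q 0) E)" "\<epsilon>Q E q = \<one>\<^bsub>R\<^esub>" using RR.one_closed by (metis imageE)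
      then show "act B e E (u E) a = \<zero>\<^bsub>ob B E\<^esub>"
        using z S_Obj[OF E] BE.smult_one[OF act_u_closed[OF B S_Obj[OF E] a]] by metis
    next
      fix E q assume z: "\<forall>E\<in>S. act B e E (u E) a = \<zero>\<^bsub>ob B E\<^esub>" and E: "E \<in> Obj A" and q: "q \<in> carrier (ob (Q 0) E)"
      interpret BE: module R "ob B E" by (rule functorD(1)[OF B E])
      show "\<epsilon>Q E q \<odot>\<^bsub>ob B E\<^esub> act B e E (u E) a = \<zero>\<^bsub>ob B E\<^esub>"
      proof (cases "E \<in> S")
        case True
        then show ?thesis using z nat_transD(2)[OF \<epsilon> E q] by simp
      next
        case False
        then have "\<epsilon>Q E q = \<zero>\<^bsub>R\<^esub>" using nat_transD(2)[OF QD(3) E q] by (simp add: const_on_def)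
        then show ?thesis using act_u_closed[OF B E a] by simp
      qed
    qed
    also have "\<dots> \<longleftrightarrow> to_limit B F a = \<zero>\<^bsub>lim_module C F\<^esub>"
    proof
      assume z: "\<forall>E\<in>S. act B e E (u E) a = \<zero>\<^bsub>ob B E\<^esub>"
      show "to_limit B F a = \<zero>\<^bsub>lim_module C F\<^esub>"
      proof
        fix s
        show "to_limit B F a s = \<zero>\<^bsub>lim_module C F\<^esub> s"
        proof (cases "s \<in> Obj C")
          case True
          then show ?thesis using z ro[OF True] restrictsD(1)[OF res ro[OF True]]
              mod_hom_zero[OF functorD(2)[OF F io[OF ro[OF True]] True cu[OF True]]
                functorD(1)[OF F io[OF ro[OF True]]] functorD(1)[OF F True]]
            by (simp add: to_limit_def)
        qed (simp add: to_limit_def)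
      qed
    next
      assume z: "to_limit B F a = \<zero>\<^bsub>lim_module C F\<^esub>"
      show "\<forall>E\<in>S. act B e E (u E) a = \<zero>\<^bsub>ob B E\<^esub>"
      proof
        fix E assume E: "E \<in> S"
        have "to_limit B F a (io E) = act B e E (u E) a"
          using functorD(4)[OF F io[OF E]] act_u_closed[OF B S_Obj[OF E] a] restrictsD(1)[OF res E]
          by (simp add: to_limit_def io E ro_io cu_io)
        then show "act B e E (u E) a = \<zero>\<^bsub>ob B E\<^esub>" using z io[OF E] restrictsD(1)[OF res E] by simp
      qed
    qed
    finally show ?thesis .
  qed
  let ?K = "{a \<in> carrier (ob B e). to_limit B F a = \<zero>\<^bsub>lim_module C F\<^esub>}"
  let ?L = "{\<eta> \<in> nat_trans R A KA' B. trans_comp A (Q 0) \<eta> \<epsilon>Q = \<zero>\<^bsub>hom_module R A (Q 0) B\<^esub>}"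
  have im: "from_const B ` ?K \<subseteq> ?L" using eq fc by blast
  have "from_const B \<in> mod_hom R ((ob B e)\<lparr>carrier := ?K\<rparr>) ((hom_module R A KA' B)\<lparr>carrier := ?L\<rparr>)"
    by (rule mod_hom_carrier_update[OF from_const_hom[OF B] _ im]) blast
  moreover have "bij_betw (from_const B) ?K ?L"
  proof (rule bij_betwI[where g = "\<lambda>\<eta>. \<eta> e \<one>\<^bsub>R\<^esub>"])
    show "from_const B \<in> ?K \<rightarrow> ?L" using im by blast
    show "(\<lambda>\<eta>. \<eta> e \<one>\<^bsub>R\<^esub>) \<in> ?L \<rightarrow> ?K"
    proof
      fix \<eta> assume \<eta>: "\<eta> \<in> ?L"
      then have \<eta>n: "\<eta> \<in> nat_trans R A KA' B" by blast
      note f = nat_from_const[OF B \<eta>n]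
      show "\<eta> e \<one>\<^bsub>R\<^esub> \<in> ?K" using eq[OF f(2)] f \<eta> by auto
    qed
    fix a assume "a \<in> ?K"
    then have a: "a \<in> carrier (ob B e)" by blast
    have "act B e e (u e) a = a" using functorD(4)[OF B e a] u_unique[OF e is_catD(1)[OF A e]] by simp
    then show "from_const B a e \<one>\<^bsub>R\<^esub> = a"
      using e a module.smult_one[OF functorD(1)[OF B e] a] by (simp add: from_const_def)
  next
    fix \<eta> assume "\<eta> \<in> ?L"
    then have \<eta>n: "\<eta> \<in> nat_trans R A KA' B" by blast
    show "from_const B (\<eta> e \<one>\<^bsub>R\<^esub>) = \<eta>" using nat_from_const(1)[OF B \<eta>n] by simp
  qed
  ultimately show ?thesis unfolding mod_iso_def by auto
qed

text \<open>A \<open>0\<close>-cocycle vanishes on the kernel of the augmentation, so at an object \<open>E\<close> of \<open>S\<close> it is a multiple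
  \<open>\<epsilon> q \<cdot> v E\<close>, with \<open>v E\<close> its value at any element \<open>w E\<close> of augmentation \<open>1\<close>; outside \<open>S\<close> it is zero. The
  \<open>v E\<close> form a compatible family on \<open>S\<close>, hence a point of the limit, and the map \<open>h\<close> is the inverse of this
  assignment. Under it the families coming from \<open>B e\<close> match the cocycles that extend to the constant
  functor.\<close>

theorem cohomology_iso_0:
  fixes Q :: "nat \<Rightarrow> ('x, 'y, 'r, 'q) rmod_functor"
    and F :: "('o, 'm, 'r, 'a) rmod_functor" and B :: "('x, 'y, 'r, 'a) rmod_functor"
  assumes F: "is_rmod_functor R C F" and B: "is_rmod_functor R A B" and res: "restricts B F"
    and Qe: "exact_complex R A KA Q dQ \<epsilon>Q"
  shows "mod_iso R (quot_module (lim_module C F) (to_limit B F ` carrier (ob B e)))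
    (quot_module (cocycles R A Q dQ B 0) ((\<lambda>\<eta>. trans_comp A (Q 0) \<eta> \<epsilon>Q) ` nat_trans R A KA' B))"
proof -
  interpret RR: cring R by (rule R)
  note QD = exact_complexD[OF Qe]
  have \<epsilon>: "\<epsilon>Q \<in> nat_trans R A (Q 0) KA'" by (rule eps_const[OF QD(1,3)])
  have \<epsilon>c: "\<epsilon>Q E q \<in> carrier R" if "E \<in> Obj A" "q \<in> carrier (ob (Q 0) E)" for E q
    using nat_transD(2)[OF \<epsilon> that] by simp
  have \<epsilon>act: "\<epsilon>Q E' (act (Q 0) E E' f q) = \<epsilon>Q E q"
    if "E \<in> Obj A" "E' \<in> Obj A" "f \<in> Hom A E E'" "q \<in> carrier (ob (Q 0) E)" for E E' f q
    using nat_transD(3)[OF \<epsilon> that] by simp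
  have \<epsilon>z: "\<epsilon>Q E q = \<zero>\<^bsub>R\<^esub>" if "E \<in> Obj A" "E \<notin> S" "q \<in> carrier (ob (Q 0) E)" for E q
    using nat_transD(2)[OF QD(3) that(1,3)] that(2) by (simp add: const_on_def)
  have \<epsilon>d: "\<epsilon>Q E (dQ 0 E q) = \<zero>\<^bsub>R\<^esub>" if "E \<in> Obj A" "q \<in> carrier (ob (Q (Suc 0)) E)" for E q
    using QD(7)[OF that] by (cases "E \<in> S") (simp_all add: const_on_def)
  have "\<exists>q\<in>carrier (ob (Q 0) E). \<epsilon>Q E q = \<one>\<^bsub>R\<^esub>" if E: "E \<in> S" for E
  proof -
    have "\<epsilon>Q E ` carrier (ob (Q 0) E) = carrier R"
      using QD(4) S_Obj[OF E] E by (simp add: epi_trans_def const_on_def)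
    then show ?thesis using RR.one_closed by (metis imageE)
  qed
  then obtain w where w: "\<And>E. E \<in> S \<Longrightarrow> w E \<in> carrier (ob (Q 0) E)" "\<And>E. E \<in> S \<Longrightarrow> \<epsilon>Q E (w E) = \<one>\<^bsub>R\<^esub>"
    by metis
  note Zq = cocycles_carrier[OF Qe]
  let ?Z' = "cocycles R A Q dQ B 0"
  let ?N' = "(\<lambda>\<eta>. trans_comp A (Q 0) \<eta> \<epsilon>Q) ` nat_trans R A KA' B"
  have mL: "module R (lim_module C F)" by (rule lim_module_module[OF R F])
  have mB: "module R ?Z'" by (rule cocycles_module[OF R B Qe])
  have mH: "module R (hom_module R A (Q 0) B)" by (rule hom_module_module[OF R QD(1) B])
  have eqZ: "?Z' = (hom_module R A (Q 0) B)\<lparr>carrier := carrier ?Z'\<rparr>" by (simp add: cocycles_def)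
  have N'Z: "?N' \<subseteq> carrier ?Z'"
  proof
    fix \<theta> assume "\<theta> \<in> ?N'"
    then obtain \<eta> where \<eta>: "\<eta> \<in> nat_trans R A KA' B" "\<theta> = trans_comp A (Q 0) \<eta> \<epsilon>Q" by blast
    show "\<theta> \<in> carrier ?Z'" unfolding Zq \<eta>(2)
    proof (intro conjI ballI)
      show "trans_comp A (Q 0) \<eta> \<epsilon>Q \<in> nat_trans R A (Q 0) B" by (rule trans_comp_closed[OF QD(1) \<epsilon> \<eta>(1)])
      fix E q assume "E \<in> Obj A" "q \<in> carrier (ob (Q (Suc 0)) E)"
      then show "trans_comp A (Q 0) \<eta> \<epsilon>Q E (dQ 0 E q) = \<zero>\<^bsub>ob B E\<^esub>"
        using nat_trans_zero[OF \<eta>(1) KA' B] \<epsilon>d nat_transD(2)[OF QD(2)] by simp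
    qed
  qed
  have "submodule ?N' R (hom_module R A (Q 0) B)"
    using mod_hom_image_submodule[OF precomp_hom[OF QD(1) KA' B R \<epsilon>] hom_module_module[OF R KA' B] mH] by simp
  then have sN': "submodule ?N' R ?Z'"
    using submodule_restrict[OF mH cocycles_submodule[OF R B Qe] _ N'Z] eqZ by metis
  have sN: "submodule (to_limit B F ` carrier (ob B e)) R (lim_module C F)"
    by (rule mod_hom_image_submodule[OF to_limit_hom[OF F B res] functorD(1)[OF B e] mL])
  define h where "h f = mk_trans A (Q 0) (\<lambda>E q. if E \<in> S then \<epsilon>Q E q \<odot>\<^bsub>ob B E\<^esub> f (io E) else \<zero>\<^bsub>ob B E\<^esub>)" for f
  have h_app: "h f E q = \<epsilon>Q E q \<odot>\<^bsub>ob B E\<^esub> f (io E)" if "E \<in> S" "q \<in> carrier (ob (Q 0) E)" for f E q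
    using that by (simp add: h_def S_Obj)
  have h_app': "h f E q = \<zero>\<^bsub>ob B E\<^esub>" if "E \<in> Obj A" "E \<notin> S" "q \<in> carrier (ob (Q 0) E)" for f E q
    using that by (simp add: h_def)
  have fc: "f (io E) \<in> carrier (ob B E)" if "f \<in> carrier (lim_module C F)" "E \<in> S" for f E
    using that io[OF that(2)] restrictsD(1)[OF res that(2)] by (auto simp: lim_module_carrier)
  have hn: "h f \<in> nat_trans R A (Q 0) B" if f: "f \<in> carrier (lim_module C F)" for f
    unfolding h_def
  proof (rule mk_trans_nat_trans[OF QD(1)])
    fix E assume E: "E \<in> Obj A"
    interpret BE: module R "ob B E" by (rule functorD(1)[OF B E])
    show "(\<lambda>q. if E \<in> S then \<epsilon>Q E q \<odot>\<^bsub>ob B E\<^esub> f (io E) else \<zero>\<^bsub>ob B E\<^esub>) \<in> mod_hom R (ob (Q 0) E) (ob B E)"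
    proof (cases "E \<in> S")
      case True
      note hh = mod_homD(2,3)[OF nat_transD(1)[OF \<epsilon> E], simplified]
      show ?thesis by (rule mod_homI) (simp_all add: True fc[OF f True] \<epsilon>c[OF E] hh BE.smult_l_distr BE.smult_assoc1)
    next
      case False
      then show ?thesis using mod_hom_into_zero[OF functorD(1)[OF QD(1) E] functorD(1)[OF B E]] by simp
    qed
  next
    fix E E' k q assume E: "E \<in> Obj A" "E' \<in> Obj A" "k \<in> Hom A E E'" and q: "q \<in> carrier (ob (Q 0) E)"
    interpret BE: module R "ob B E'" by (rule functorD(1)[OF B E(2)])
    show "(if E' \<in> S then \<epsilon>Q E' (act (Q 0) E E' k q) \<odot>\<^bsub>ob B E'\<^esub> f (io E') else \<zero>\<^bsub>ob B E'\<^esub>) =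
      act B E E' k (if E \<in> S then \<epsilon>Q E q \<odot>\<^bsub>ob B E\<^esub> f (io E) else \<zero>\<^bsub>ob B E\<^esub>)"
    proof (cases "E \<in> S")
      case True
      then have E': "E' \<in> S" using cosieve E by blast
      have "act B E E' k (f (io E)) = f (io E')"
        using restrictsD(2)[OF res True E' E(3)] fc[OF f True] restrictsD(1)[OF res True] f io True E' im[OF True E' E(3)]
        by (simp add: lim_module_carrier)
      then show ?thesis using True E' \<epsilon>act[OF E q] mod_homD(3)[OF functorD(2)[OF B E] \<epsilon>c[OF E(1) q] fc[OF f True]] by simp
    next
      case False
      have z: "act B E E' k \<zero>\<^bsub>ob B E\<^esub> = \<zero>\<^bsub>ob B E'\<^esub>"
        by (rule mod_hom_zero[OF functorD(2)[OF B E] functorD(1)[OF B E(1)] functorD(1)[OF B E(2)]])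
      show ?thesis using False \<epsilon>act[OF E q] \<epsilon>z[OF E(1) False q] z fc[OF f] by simp
    qed
  qed
  have hZ: "h f \<in> carrier ?Z'" if f: "f \<in> carrier (lim_module C F)" for f
    unfolding Zq
  proof (intro conjI ballI hn[OF f])
    fix E q assume E: "E \<in> Obj A" and q: "q \<in> carrier (ob (Q (Suc 0)) E)"
    show "h f E (dQ 0 E q) = \<zero>\<^bsub>ob B E\<^esub>"
    proof (cases "E \<in> S")
      case True
      then show ?thesis using h_app[OF True nat_transD(2)[OF QD(2) E q]] \<epsilon>d[OF E q]
          module.smult_l_null[OF functorD(1)[OF B E] fc[OF f True]] by simp
    qed (use h_app'[OF E _ nat_transD(2)[OF QD(2) E q]] in simp)
  qed
  show ?thesis
  proof (rule quot_mod_iso'[OF mL sN mB sN', of h])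
    interpret L: module R "lim_module C F" by (rule mL)
    interpret Z: module R ?Z' by (rule mB)
    show "h \<in> mod_hom R (lim_module C F) ?Z'"
    proof (rule mod_homI[OF hZ])
      fix f g assume f: "f \<in> carrier (lim_module C F)" and g: "g \<in> carrier (lim_module C F)"
      have "h f \<oplus>\<^bsub>?Z'\<^esub> h g \<in> nat_trans R A (Q 0) B" using Z.M.a_closed[OF hZ[OF f] hZ[OF g]] unfolding Zq by blast
      with hn[OF L.M.a_closed[OF f g]] show "h (f \<oplus>\<^bsub>lim_module C F\<^esub> g) = h f \<oplus>\<^bsub>?Z'\<^esub> h g"
      proof (rule nat_trans_eqI)
        fix E q assume E: "E \<in> Obj A" and q: "q \<in> carrier (ob (Q 0) E)"
        interpret BE: module R "ob B E" by (rule functorD(1)[OF B E])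
        show "h (f \<oplus>\<^bsub>lim_module C F\<^esub> g) E q = (h f \<oplus>\<^bsub>?Z'\<^esub> h g) E q"
        proof (cases "E \<in> S")
          case True
          then show ?thesis using E q fc[OF f True] fc[OF g True] \<epsilon>c[OF E q] io[OF True]
            by (simp add: h_app BE.smult_r_distr restrictsD(1)[OF res True, symmetric])
        qed (use E q in \<open>simp add: h_app'\<close>)
      qed
    next
      fix r f assume r: "r \<in> carrier R" and f: "f \<in> carrier (lim_module C F)"
      have "r \<odot>\<^bsub>?Z'\<^esub> h f \<in> nat_trans R A (Q 0) B" using Z.smult_closed[OF r hZ[OF f]] unfolding Zq by blast
      with hn[OF L.smult_closed[OF r f]] show "h (r \<odot>\<^bsub>lim_module C F\<^esub> f) = r \<odot>\<^bsub>?Z'\<^esub> h f"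
      proof (rule nat_trans_eqI)
        fix E q assume E: "E \<in> Obj A" and q: "q \<in> carrier (ob (Q 0) E)"
        interpret BE: module R "ob B E" by (rule functorD(1)[OF B E])
        show "h (r \<odot>\<^bsub>lim_module C F\<^esub> f) E q = (r \<odot>\<^bsub>?Z'\<^esub> h f) E q"
        proof (cases "E \<in> S")
          case True
          then show ?thesis using E q fc[OF f True] \<epsilon>c[OF E q] io[OF True] r
            by (simp add: h_app BE.smult_assoc1[symmetric] RR.m_comm restrictsD(1)[OF res True, symmetric])
        qed (use E q r in \<open>simp add: h_app'\<close>)
      qed
    qed
  next
    fix f assume f: "f \<in> carrier (lim_module C F)"
    show "h f \<in> ?N' \<longleftrightarrow> f \<in> to_limit B F ` carrier (ob B e)"
    proof
      assume "h f \<in> ?N'"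
      then obtain \<eta> where \<eta>: "\<eta> \<in> nat_trans R A KA' B" "h f = trans_comp A (Q 0) \<eta> \<epsilon>Q" by blast
      let ?a = "\<eta> e \<one>\<^bsub>R\<^esub>"
      note fcn = nat_from_const[OF B \<eta>(1)]
      have "f s = to_limit B F ?a s" if s: "s \<in> Obj C" for s
      proof -
        let ?E = "ro s"
        have E: "?E \<in> S" "?E \<in> Obj A" using ro[OF s] S_Obj by auto
        interpret BE: module R "ob B ?E" by (rule functorD(1)[OF B E(2)])
        have "f (io ?E) = h f ?E (w ?E)" using h_app[OF E(1) w(1)[OF E(1)]] w(2)[OF E(1)] fc[OF f E(1)] by simp
        also have "\<dots> = \<eta> ?E \<one>\<^bsub>R\<^esub>" using \<eta>(2) w E by simp
        also have "\<dots> = act B e ?E (u ?E) ?a" using nat_transD(3)[OF \<eta>(1) e E(2) u[OF E(2)], of "\<one>\<^bsub>R\<^esub>"] by simp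
        finally have "f (io ?E) = act B e ?E (u ?E) ?a" .
        moreover have "f s = act F (io ?E) s (cu s) (f (io ?E))"
          using f s io[OF E(1)] cu[OF s] by (simp add: lim_module_carrier)
        ultimately show ?thesis using s by (simp add: to_limit_def)
      qed
      moreover have "f \<in> extensional (Obj C)" using f by (auto simp: lim_module_carrier PiE_def)
      ultimately have "f = to_limit B F ?a"
        by (intro extensionalityI[of f "Obj C"]) (auto simp: to_limit_def)
      then show "f \<in> to_limit B F ` carrier (ob B e)" using fcn(2) by blast
    next
      assume "f \<in> to_limit B F ` carrier (ob B e)"
      then obtain a where a: "a \<in> carrier (ob B e)" "f = to_limit B F a" by blast
      have n: "trans_comp A (Q 0) (from_const B a) \<epsilon>Q \<in> nat_trans R A (Q 0) B"
        by (rule trans_comp_closed[OF QD(1) \<epsilon> from_const_nat[OF B a(1)]])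
      have "h f = trans_comp A (Q 0) (from_const B a) \<epsilon>Q"
      proof (rule nat_trans_eqI[OF hn[OF f] n])
        fix E q assume E: "E \<in> Obj A" and q: "q \<in> carrier (ob (Q 0) E)"
        show "h f E q = trans_comp A (Q 0) (from_const B a) \<epsilon>Q E q"
        proof (cases "E \<in> S")
          case True
          have "f (io E) = act B e E (u E) a"
            using functorD(4)[OF F io[OF True]] act_u_closed[OF B E a(1)] restrictsD(1)[OF res True]
            by (simp add: a(2) to_limit_def io True ro_io cu_io)
          then show ?thesis using E q True \<epsilon>c[OF E q] by (simp add: h_app from_const_def)
        next
          case False
          then show ?thesis using E q \<epsilon>z[OF E False q] act_u_closed[OF B E a(1)]
              module.smult_l_null[OF functorD(1)[OF B E]] by (simp add: h_app' from_const_def)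
        qed
      qed
      then show "h f \<in> ?N'" using from_const_nat[OF B a(1)] by blast
    qed
  next
    fix \<psi> assume "\<psi> \<in> carrier ?Z'"
    then have \<psi>: "\<psi> \<in> nat_trans R A (Q 0) B"
      "\<And>x a. x \<in> Obj A \<Longrightarrow> a \<in> carrier (ob (Q (Suc 0)) x) \<Longrightarrow> \<psi> x (dQ 0 x a) = \<zero>\<^bsub>ob B x\<^esub>"
      by (simp_all add: Zq)
    have ker: "\<psi> E q = \<zero>\<^bsub>ob B E\<^esub>" if E: "E \<in> Obj A" and q: "q \<in> carrier (ob (Q 0) E)" and z: "\<epsilon>Q E q = \<zero>\<^bsub>R\<^esub>" for E q
    proof -
      have "\<zero>\<^bsub>ob KA E\<^esub> = \<zero>\<^bsub>R\<^esub>" by (simp add: const_on_def)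
      then have "q \<in> {a \<in> carrier (ob (Q 0) E). \<epsilon>Q E a = \<zero>\<^bsub>ob KA E\<^esub>}" using q z by simp
      then obtain b where "b \<in> carrier (ob (Q (Suc 0)) E)" "q = dQ 0 E b" unfolding bspec[OF QD(5) E] by blast
      then show ?thesis using \<psi>(2)[OF E] by simp
    qed
    define v where "v E = \<psi> E (w E)" for E
    have vc: "v E \<in> carrier (ob B E)" if "E \<in> S" for E
      unfolding v_def by (rule nat_transD(2)[OF \<psi>(1) S_Obj[OF that] w(1)[OF that]])
    have \<psi>v: "\<psi> E q = \<epsilon>Q E q \<odot>\<^bsub>ob B E\<^esub> v E" if E: "E \<in> S" and q: "q \<in> carrier (ob (Q 0) E)" for E q
    proof -
      have EA: "E \<in> Obj A" by (rule S_Obj[OF E])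
      interpret QE: module R "ob (Q 0) E" by (rule functorD(1)[OF QD(1) EA])
      interpret BE: module R "ob B E" by (rule functorD(1)[OF B EA])
      let ?r = "\<epsilon>Q E q"
      let ?b = "?r \<odot>\<^bsub>ob (Q 0) E\<^esub> w E"
      have r: "?r \<in> carrier R" by (rule \<epsilon>c[OF EA q])
      have b: "?b \<in> carrier (ob (Q 0) E)" using r w(1)[OF E] by simp
      have "\<epsilon>Q E (q \<ominus>\<^bsub>ob (Q 0) E\<^esub> ?b) = ?r \<ominus>\<^bsub>ring_module R\<^esub> ?r"
        using mod_hom_diff[OF nat_transD(1)[OF \<epsilon> EA] functorD(1)[OF QD(1) EA] functorD(1)[OF KA' EA] q b]
          mod_homD(3)[OF nat_transD(1)[OF \<epsilon> EA] r w(1)[OF E]] w(2)[OF E] r by simp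
      also have "\<dots> = \<zero>\<^bsub>R\<^esub>"
      proof -
        interpret RM: module R "ring_module R" by (rule ring_module_module[OF R])
        show ?thesis using RM.M.r_neg[of ?r] r by (simp add: a_minus_def)
      qed
      finally have "\<psi> E (q \<ominus>\<^bsub>ob (Q 0) E\<^esub> ?b) = \<zero>\<^bsub>ob B E\<^esub>" by (intro ker[OF EA]) (use q b in auto)
      then have "\<psi> E q \<ominus>\<^bsub>ob B E\<^esub> \<psi> E ?b = \<zero>\<^bsub>ob B E\<^esub>"
        using mod_hom_diff[OF nat_transD(1)[OF \<psi>(1) EA] functorD(1)[OF QD(1) EA] functorD(1)[OF B EA] q b] by simp
      then have "\<psi> E q = \<psi> E ?b"
        using BE.M.diff_solve[OF nat_transD(2)[OF \<psi>(1) EA q] nat_transD(2)[OF \<psi>(1) EA b] BE.M.zero_closed]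
          nat_transD(2)[OF \<psi>(1) EA b] by simp
      then show ?thesis using mod_homD(3)[OF nat_transD(1)[OF \<psi>(1) EA] r w(1)[OF E]] by (simp add: v_def)
    qed
    have vact: "act B E E' k (v E) = v E'" if E: "E \<in> S" "E' \<in> S" "k \<in> Hom A E E'" for E E' k
    proof -
      have a: "act (Q 0) E E' k (w E) \<in> carrier (ob (Q 0) E')"
        by (rule functorD(3)[OF QD(1) S_Obj[OF E(1)] S_Obj[OF E(2)] E(3) w(1)[OF E(1)]])
      have "act B E E' k (v E) = \<psi> E' (act (Q 0) E E' k (w E))"
        using nat_transD(3)[OF \<psi>(1) S_Obj[OF E(1)] S_Obj[OF E(2)] E(3) w(1)[OF E(1)]] by (simp add: v_def)
      also have "\<dots> = v E'"
        using \<psi>v[OF E(2) a] \<epsilon>act[OF S_Obj[OF E(1)] S_Obj[OF E(2)] E(3) w(1)[OF E(1)]] w(2)[OF E(1)]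
          module.smult_one[OF functorD(1)[OF B S_Obj[OF E(2)]] vc[OF E(2)]] by simp
      finally show ?thesis .
    qed
    let ?f = "\<lambda>s\<in>Obj C. act F (io (ro s)) s (cu s) (v (ro s))"
    have f: "?f \<in> carrier (lim_module C F)" by (rule cone_lim[OF F res vc vact])
    have "h ?f = \<psi>"
    proof (rule nat_trans_eqI[OF hn[OF f] \<psi>(1)])
      fix E q assume E: "E \<in> Obj A" and q: "q \<in> carrier (ob (Q 0) E)"
      show "h ?f E q = \<psi> E q"
      proof (cases "E \<in> S")
        case True
        then show ?thesis using q functorD(4)[OF F io[OF True]] vc[OF True] restrictsD(1)[OF res True]
          by (simp add: h_app io ro_io cu_io \<psi>v)
      qed (use E q ker \<epsilon>z in \<open>simp add: h_app'\<close>)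
    qed
    moreover have "\<psi> \<oplus>\<^bsub>?Z'\<^esub> \<zero>\<^bsub>?Z'\<^esub> = \<psi>"
      by (rule abelian_monoid.r_zero[OF _ \<open>\<psi> \<in> carrier ?Z'\<close>]) (use mB in \<open>simp only: module_def abelian_group_def\<close>)
    ultimately have "h ?f = \<psi> \<oplus>\<^bsub>?Z'\<^esub> \<zero>\<^bsub>?Z'\<^esub>" by (simp only:)
    then show "\<exists>f\<in>carrier (lim_module C F). \<exists>c\<in>?N'. h f = \<psi> \<oplus>\<^bsub>?Z'\<^esub> c"
      by (rule bexI[OF bexI[OF _ submodule_simps(2)[OF mB sN']] f])
  qed
qed

end


section \<open>Fixed points of p-groups\<close>

text \<open>An orbit of moved points has more than one element, and its size divides the order of the \<open>p\<close>-group.\<close>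

lemma (in group_action) card_moved_points:
  assumes p: "prime p" and "order G = p ^ k" and fin: "finite E"
  shows "p dvd card {x \<in> E. \<exists>g\<in>carrier G. \<phi> g x \<noteq> x}"
proof -
  let ?M = "{x \<in> E. \<exists>g\<in>carrier G. \<phi> g x \<noteq> x}"
  define f :: "'c \<Rightarrow> nat" where "f x = (if x \<in> ?M then 1 else 0)" for x
  interpret G: group G using group_hom by (simp add: group_hom_def)
  have "p dvd (\<Sum>x\<in>orb. f x)" if "orb \<in> orbits G E \<phi>" for orb
  proof -
    obtain x where x: "x \<in> E" "orb = orbit G \<phi> x" using \<open>orb \<in> _\<close> by (auto simp: orbits_def)
    have sub: "orb \<subseteq> E" using x element_image by (auto simp: orbit_def)
    show ?thesis
    proof (cases "x \<in> ?M")
      case False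
      then have "orb = {x}" using x orbit_refl[OF x(1)] by (auto simp: orbit_def)
      moreover have "f x = 0" using False by (simp add: f_def)
      ultimately show ?thesis by simp
    next
      case True
      have "y \<in> ?M" if y: "y \<in> orb" for y
      proof (rule ccontr)
        assume "y \<notin> ?M"
        then have "orbit G \<phi> y = {y}" using y sub orbit_refl[of y] by (auto simp: orbit_def)
        moreover have "x \<in> orbit G \<phi> y" using orbit_sym x y sub by auto
        ultimately show False using True \<open>y \<notin> ?M\<close> by simp
      qed
      then have "(\<Sum>x\<in>orb. f x) = card orb" by (simp add: f_def)
      moreover have "card orb dvd p ^ k"
        using orbit_stabilizer_theorem[OF x(1)] assms(2) x(2) by (metis dvd_triv_left)
      moreover have "card orb \<noteq> 1"
      proof
        assume "card orb = 1"
        then obtain z where "orb = {z}" by (auto simp: card_1_singleton_iff)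
        moreover have "x \<in> orb" using orbit_refl[OF x(1)] x(2) by simp
        ultimately have "orb = {x}" by simp
        then show False using True x(2) by (auto simp: orbit_def)
      qed
      ultimately show ?thesis using divides_primepow_nat[OF p] by (metis dvd_refl dvd_power le_0_eq not_gr_zero power_0)
    qed
  qed
  then have "p dvd (\<Sum>orb\<in>orbits G E \<phi>. \<Sum>x\<in>orb. f x)" by (rule dvd_sum)
  also have "(\<Sum>orb\<in>orbits G E \<phi>. \<Sum>x\<in>orb. f x) = (\<Sum>x\<in>E. f x)" by (rule disjoint_sum[OF fin])
  also have "\<dots> = card ?M" using fin by (simp add: f_def sum.If_cases Int_def)
  finally show ?thesis .
qed

section \<open>The two categories of subgroups\<close>

text \<open>A copy of the locale of groups, so that the notions below do not become part of every group.\<close>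

locale plain_group = group G for G :: "'a monoid" (structure)
begin

lemma conj_set_image: "conj_set G g A = (\<lambda>x. g \<otimes> x \<otimes> inv g) ` A"
  unfolding conj_set_def l_coset_def r_coset_def by auto

lemma conj_closed: "g \<in> carrier G \<Longrightarrow> A \<subseteq> carrier G \<Longrightarrow> conj_set G g A \<subseteq> carrier G"
  by (auto simp: conj_set_image)

lemma conj_elem_comp:
  assumes "g \<in> carrier G" "h \<in> carrier G" "x \<in> carrier G"
  shows "h \<otimes> (g \<otimes> x \<otimes> inv g) \<otimes> inv h = (h \<otimes> g) \<otimes> x \<otimes> inv (h \<otimes> g)"
  using assms by (simp add: m_assoc inv_mult_group)

lemma conj_mult:
  assumes "g \<in> carrier G" "a \<in> carrier G" "b \<in> carrier G"
  shows "(g \<otimes> a \<otimes> inv g) \<otimes> (g \<otimes> b \<otimes> inv g) = g \<otimes> (a \<otimes> b) \<otimes> inv g"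
proof -
  have "(g \<otimes> a \<otimes> inv g) \<otimes> (g \<otimes> b \<otimes> inv g) = g \<otimes> a \<otimes> (inv g \<otimes> g) \<otimes> b \<otimes> inv g"
    using assms by (simp only: m_assoc m_closed inv_closed)
  then show ?thesis using assms by (simp add: m_assoc)
qed

lemma conj_elem_inv [simp]:
  assumes "g \<in> carrier G" "x \<in> carrier G"
  shows "inv g \<otimes> (g \<otimes> x \<otimes> inv g) \<otimes> g = x" "g \<otimes> (inv g \<otimes> x \<otimes> g) \<otimes> inv g = x"
proof -
  have "inv g \<otimes> (g \<otimes> y) = y" "g \<otimes> (inv g \<otimes> y) = y" if "y \<in> carrier G" for y
    using assms that by (simp_all add: m_assoc[symmetric])
  then show "inv g \<otimes> (g \<otimes> x \<otimes> inv g) \<otimes> g = x" "g \<otimes> (inv g \<otimes> x \<otimes> g) \<otimes> inv g = x"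
    using assms by (simp_all add: m_assoc)
qed

lemma conj_set_comp:
  assumes "g \<in> carrier G" "h \<in> carrier G" "A \<subseteq> carrier G"
  shows "conj_set G (h \<otimes> g) A = conj_set G h (conj_set G g A)"
  unfolding conj_set_image image_image
  by (rule image_cong) (use assms conj_elem_comp in auto)

lemma conj_set_one: "A \<subseteq> carrier G \<Longrightarrow> conj_set G \<one> A = A"
  by (auto simp: conj_set_image image_iff subset_iff)

lemma conj_set_mono: "A \<subseteq> B \<Longrightarrow> conj_set G g A \<subseteq> conj_set G g B"
  by (auto simp: conj_set_image)

lemma conj_set_inv:
  assumes "g \<in> carrier G" "A \<subseteq> carrier G"
  shows "conj_set G (inv g) (conj_set G g A) = A" "conj_set G g (conj_set G (inv g) A) = A"
  using assms by (simp_all add: conj_set_comp[symmetric] conj_set_one)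

lemma conj_pow:
  assumes "g \<in> carrier G" "x \<in> carrier G"
  shows "(g \<otimes> x \<otimes> inv g) [^] (n :: nat) = g \<otimes> x [^] n \<otimes> inv g"
proof (induct n)
  case (Suc n)
  have "(g \<otimes> x \<otimes> inv g) [^] Suc n = (g \<otimes> x [^] n \<otimes> inv g) \<otimes> (g \<otimes> x \<otimes> inv g)" using Suc by simp
  also have "\<dots> = g \<otimes> x [^] n \<otimes> (inv g \<otimes> g) \<otimes> x \<otimes> inv g"
    using assms by (simp only: m_assoc m_closed inv_closed nat_pow_closed)
  also have "\<dots> = g \<otimes> x [^] Suc n \<otimes> inv g" using assms by (simp add: m_assoc)
  finally show ?case .
qed (use assms in simp)

lemma coset_eq_iff:
  assumes M: "subgroup M G" and g: "g \<in> carrier G" and h: "h \<in> carrier G"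
  shows "M #> g = M #> h \<longleftrightarrow> (\<exists>m\<in>M. h = m \<otimes> g)"
proof
  assume "M #> g = M #> h"
  then have "h \<in> M #> g" using rcos_self[OF h M] by simp
  then show "\<exists>m\<in>M. h = m \<otimes> g" by (auto simp: r_coset_def)
next
  assume "\<exists>m\<in>M. h = m \<otimes> g"
  then have "h \<in> M #> g" by (auto simp: r_coset_def)
  then show "M #> g = M #> h" using repr_independence[OF _ g M] by blast
qed


subsection \<open>Sections\<close>

lemma sections_iff:
  "(U, V) \<in> sections G \<longleftrightarrow> subgroup U G \<and> subgroup V G \<and> V \<subseteq> U \<and> (\<forall>u\<in>U. \<forall>v\<in>V. u \<otimes> v \<otimes> inv u \<in> V)"
  (is "?L \<longleftrightarrow> ?R")
proof
  assume ?L
  then have U: "subgroup U G" and V: "V \<lhd> G\<lparr>carrier := U\<rparr>" by (simp_all add: sections_def)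
  interpret N: normal V "G\<lparr>carrier := U\<rparr>" by (rule V)
  have "subgroup V G" using incl_subgroup[OF U] N.subgroup_axioms by simp
  moreover have "V \<subseteq> U" using N.subset by simp
  moreover have "\<forall>u\<in>U. \<forall>v\<in>V. u \<otimes> v \<otimes> inv u \<in> V"
    using N.inv_op_closed2 m_inv_consistent[OF U] by simp
  ultimately show ?R using U by blast
next
  assume R: ?R
  then have U: "subgroup U G" by blast
  interpret H: group "G\<lparr>carrier := U\<rparr>" by (rule subgroup_imp_group[OF U])
  have "V \<lhd> G\<lparr>carrier := U\<rparr>"
    using R subgroup_incl[of V U] m_inv_consistent[OF U] by (intro H.normal_invI) auto
  then show ?L using U by (simp add: sections_def)
qed

lemma sectionsD:
  assumes "s \<in> sections G"
  shows "subgroup (fst s) G" "subgroup (snd s) G" "snd s \<subseteq> fst s" "fst s \<subseteq> carrier G" "snd s \<subseteq> carrier G"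
    and "\<And>u v. u \<in> fst s \<Longrightarrow> v \<in> snd s \<Longrightarrow> u \<otimes> v \<otimes> inv u \<in> snd s"
  using assms sections_iff[of "fst s" "snd s"] subgroup.subset by auto

text \<open>The coset \<open>M g\<close> with \<open>t = (M, L)\<close> is a morphism \<open>s \<rightarrow> t\<close> exactly if \<open>le_by g s t\<close>. The condition
  depends on \<open>g\<close> through this coset only.\<close>

definition le_by :: "'a \<Rightarrow> 'a sect \<Rightarrow> 'a sect \<Rightarrow> bool" where
  "le_by g s t \<longleftrightarrow> g \<in> carrier G \<and> sect_le (sect_conj G g s) t"

lemma le_by_iff:
  assumes "s \<in> sections G"
  shows "le_by g s t \<longleftrightarrow> g \<in> carrier G \<and> snd t \<subseteq> conj_set G g (snd s) \<and> conj_set G g (fst s) \<subseteq> fst t"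
  using conj_set_mono[OF sectionsD(3)[OF assms]] by (auto simp: le_by_def sect_le_def sect_conj_def)

lemma le_by_comp:
  assumes s: "s \<in> sections G" and t: "t \<in> sections G" and "le_by g s t" "le_by h t u"
  shows "le_by (h \<otimes> g) s u"
proof -
  have g: "g \<in> carrier G" "h \<in> carrier G" using assms by (auto simp: le_by_def)
  have "snd u \<subseteq> conj_set G h (snd t)" "snd t \<subseteq> conj_set G g (snd s)"
    "conj_set G g (fst s) \<subseteq> fst t" "conj_set G h (fst t) \<subseteq> fst u"
    using assms(3,4) le_by_iff[OF s] le_by_iff[OF t] by auto
  then show ?thesis
    using g sectionsD(4,5)[OF s] conj_set_mono[of _ _ h] by (simp add: le_by_iff[OF s] conj_set_comp) blast
qed

lemma le_by_one: "s \<in> sections G \<Longrightarrow> le_by \<one> s t \<longleftrightarrow> snd t \<subseteq> snd s \<and> fst s \<subseteq> fst t"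
  using sectionsD(4,5) by (simp add: le_by_iff conj_set_one)

lemma destr_cat_simps [simp]:
  "Obj (destr_cat G \<C>) = \<C>" "Id (destr_cat G \<C>) s = fst s #> \<one>"
  "Comp (destr_cat G \<C>) s t u \<psi> \<phi> = \<psi> <#> \<phi>"
  by (simp_all add: destr_cat_def)

lemma destr_hom_iff: "f \<in> Hom (destr_cat G \<C>) s t \<longleftrightarrow> (\<exists>g. le_by g s t \<and> f = fst t #> g)"
  by (auto simp: destr_cat_def le_by_def)

lemma le_by_mor: "le_by g s t \<Longrightarrow> fst t #> g \<in> Hom (destr_cat G \<C>) s t"
  by (auto simp: destr_hom_iff)

lemma mor_comp:
  assumes "t \<in> sections G" "u \<in> sections G" "g \<in> carrier G" "le_by h t u"
  shows "(fst u #> h) <#> (fst t #> g) = fst u #> (h \<otimes> g)"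
  by (rule destr_cat_comp[OF is_group sectionsD(1)[OF assms(1)] sectionsD(1)[OF assms(2)] assms(3)])
    (use assms le_by_iff in auto)

lemma destr_cat_is_cat:
  assumes \<C>: "\<C> \<subseteq> sections G"
  shows "is_cat (destr_cat G \<C>)"
proof -
  have s: "s \<in> sections G" if "s \<in> \<C>" for s using \<C> that by blast
  have c: "g \<in> carrier G" if "le_by g s t" for g s t using that by (simp add: le_by_def)
  have 1: "le_by \<one> s s" if "s \<in> \<C>" for s using le_by_one[OF s[OF that]] by simp
  show ?thesis unfolding is_cat_def
  proof (intro conjI ballI)
    fix s assume "s \<in> Obj (destr_cat G \<C>)"
    then show "Id (destr_cat G \<C>) s \<in> Hom (destr_cat G \<C>) s s" using le_by_mor[OF 1] by simp
  next
    fix x y z f g assume *: "x \<in> Obj (destr_cat G \<C>)" "y \<in> Obj (destr_cat G \<C>)" "z \<in> Obj (destr_cat G \<C>)"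
      "f \<in> Hom (destr_cat G \<C>) x y" "g \<in> Hom (destr_cat G \<C>) y z"
    then obtain a b where ab: "le_by a x y" "f = fst y #> a" "le_by b y z" "g = fst z #> b"
      by (auto simp: destr_hom_iff)
    then show "Comp (destr_cat G \<C>) x y z g f \<in> Hom (destr_cat G \<C>) x z"
      using * mor_comp[OF s s c[OF ab(1)] ab(3)] le_by_mor[OF le_by_comp[OF s s ab(1,3)]] by simp
  next
    fix x y f assume *: "x \<in> Obj (destr_cat G \<C>)" "y \<in> Obj (destr_cat G \<C>)" "f \<in> Hom (destr_cat G \<C>) x y"
    then obtain a where a: "le_by a x y" "f = fst y #> a" by (auto simp: destr_hom_iff)
    show "Comp (destr_cat G \<C>) x x y f (Id (destr_cat G \<C>) x) = f"
      using * a mor_comp[OF s s one_closed a(1)] c[OF a(1)] by simp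
    show "Comp (destr_cat G \<C>) x y y (Id (destr_cat G \<C>) y) f = f"
      using * a mor_comp[OF s s c[OF a(1)] 1] c[OF a(1)] by simp
  next
    fix w x y z f g h assume *: "w \<in> Obj (destr_cat G \<C>)" "x \<in> Obj (destr_cat G \<C>)" "y \<in> Obj (destr_cat G \<C>)"
      "z \<in> Obj (destr_cat G \<C>)" "f \<in> Hom (destr_cat G \<C>) w x" "g \<in> Hom (destr_cat G \<C>) x y" "h \<in> Hom (destr_cat G \<C>) y z"
    have "k \<subseteq> carrier G" if k: "k \<in> Hom (destr_cat G \<C>) u v" and v: "v \<in> \<C>" for k u v
    proof -
      obtain a where a: "le_by a u v" "k = fst v #> a" using k unfolding destr_hom_iff by blast
      then show ?thesis using r_coset_subset_G[OF sectionsD(4)[OF s[OF v]] c[OF a(1)]] by simp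
    qed
    note k = this
    have sub: "f \<subseteq> carrier G" "g \<subseteq> carrier G" "h \<subseteq> carrier G"
      using k[OF *(5)] k[OF *(6)] k[OF *(7)] * by simp_all
    show "Comp (destr_cat G \<C>) w x z (Comp (destr_cat G \<C>) x y z h g) f =
      Comp (destr_cat G \<C>) w y z h (Comp (destr_cat G \<C>) w x y g f)"
      using set_mult_assoc sub by simp
  qed
qed


subsection \<open>The Quillen category\<close>

lemma elem_abelianD:
  assumes "E \<in> elem_abelian G p"
  shows "subgroup E G" "E \<subseteq> carrier G" "\<And>x y. x \<in> E \<Longrightarrow> y \<in> E \<Longrightarrow> x \<otimes> y = y \<otimes> x"
    "\<And>x. x \<in> E \<Longrightarrow> x [^] p = \<one>"
  using assms subgroup.subset by (auto simp: elem_abelian_def)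

lemma commute_conj_iff:
  assumes "g \<in> carrier G" "x \<in> carrier G"
  shows "g \<otimes> x \<otimes> inv g = x \<longleftrightarrow> g \<otimes> x = x \<otimes> g"
  using assms inv_solve_right'[of x "g \<otimes> x" g] by (metis inv_solve_right m_closed)

lemma centralizer_subgroup:
  assumes E: "E \<subseteq> carrier G" shows "subgroup (centralizer G E) G"
proof (rule subgroupI)
  show "centralizer G E \<subseteq> carrier G" by (auto simp: centralizer_def)
  show "centralizer G E \<noteq> {}" using E by (auto simp: centralizer_def intro!: exI[of _ \<one>])
next
  fix a assume "a \<in> centralizer G E"
  then have a: "a \<in> carrier G" "\<And>x. x \<in> E \<Longrightarrow> a \<otimes> x = x \<otimes> a" by (auto simp: centralizer_def)
  have "inv a \<otimes> x = x \<otimes> inv a" if "x \<in> E" for x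
  proof -
    have x: "x \<in> carrier G" using E that by auto
    have "a \<otimes> x \<otimes> inv a = x" using commute_conj_iff[OF a(1) x] a(2)[OF that] by simp
    then show ?thesis using a(1) x
      by (metis inv_closed inv_solve_left m_assoc m_closed)
  qed
  then show "inv a \<in> centralizer G E" using a(1) by (auto simp: centralizer_def)
next
  fix a b assume "a \<in> centralizer G E" "b \<in> centralizer G E"
  then have a: "a \<in> carrier G" "\<And>x. x \<in> E \<Longrightarrow> a \<otimes> x = x \<otimes> a"
    and b: "b \<in> carrier G" "\<And>x. x \<in> E \<Longrightarrow> b \<otimes> x = x \<otimes> b" by (auto simp: centralizer_def)
  have "(a \<otimes> b) \<otimes> x = x \<otimes> (a \<otimes> b)" if "x \<in> E" for x
  proof -
    have x: "x \<in> carrier G" using E that by auto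
    have "(a \<otimes> b) \<otimes> x = a \<otimes> (x \<otimes> b)" using a b x that by (simp add: m_assoc)
    also have "\<dots> = (x \<otimes> a) \<otimes> b" using a(1) b(1) x a(2)[OF that] by (simp add: m_assoc[symmetric])
    finally show ?thesis using a b x by (simp add: m_assoc)
  qed
  then show "a \<otimes> b \<in> centralizer G E" using a b by (auto simp: centralizer_def)
qed

lemma cent_section:
  assumes E: "E \<in> elem_abelian G p" shows "(centralizer G E, E) \<in> sections G"
proof -
  note D = elem_abelianD[OF E]
  have "E \<subseteq> centralizer G E" using D by (auto simp: centralizer_def)
  moreover have "u \<otimes> v \<otimes> inv u \<in> E" if "u \<in> centralizer G E" "v \<in> E" for u v
    using that D(2) commute_conj_iff[of u v] by (auto simp: centralizer_def subset_iff)
  ultimately show ?thesis using D(1,2) centralizer_subgroup by (simp add: sections_iff)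
qed

lemma conj_map_comp:
  assumes "g \<in> carrier G" "h \<in> carrier G" "E \<subseteq> carrier G" "conj_set G g E \<subseteq> E'"
  shows "compose E (conj_map G E' h) (conj_map G E g) = conj_map G E (h \<otimes> g)"
proof
  fix x
  show "compose E (conj_map G E' h) (conj_map G E g) x = conj_map G E (h \<otimes> g) x"
  proof (cases "x \<in> E")
    case True
    then have "g \<otimes> x \<otimes> inv g \<in> E'" using assms(4) by (auto simp: conj_set_image)
    then show ?thesis using True assms(1-3) conj_elem_comp[of g h x] by (auto simp: compose_def conj_map_def)
  qed (simp add: compose_def conj_map_def)
qed

lemma conj_map_one: "E \<subseteq> carrier G \<Longrightarrow> conj_map G E \<one> = (\<lambda>x\<in>E. x)"
  by (auto simp: conj_map_def fun_eq_iff subset_iff)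

text \<open>This is what makes the covariant functor on elementary abelian subgroups well defined: a conjugation map
  determines the coset of \<open>g\<^sup>-\<^sup>1\<close> modulo the centraliser of its source, which is a morphism of sections.\<close>

lemma conj_map_eq_iff:
  assumes g: "g \<in> carrier G" and h: "h \<in> carrier G" and E: "E \<subseteq> carrier G"
  shows "conj_map G E g = conj_map G E h \<longleftrightarrow> centralizer G E #> inv g = centralizer G E #> inv h"
proof -
  have "conj_map G E g = conj_map G E h \<longleftrightarrow> (\<forall>x\<in>E. g \<otimes> x \<otimes> inv g = h \<otimes> x \<otimes> inv h)"
    by (auto simp: conj_map_def fun_eq_iff)
  also have "\<dots> \<longleftrightarrow> (\<forall>x\<in>E. (inv h \<otimes> g) \<otimes> x \<otimes> inv (inv h \<otimes> g) = x)"
  proof (rule ball_cong[OF refl])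
    fix x assume "x \<in> E"
    then have x: "x \<in> carrier G" using E by auto
    have e: "(inv h \<otimes> g) \<otimes> x \<otimes> inv (inv h \<otimes> g) = inv h \<otimes> (g \<otimes> x \<otimes> inv g) \<otimes> h"
      using conj_elem_comp[OF g inv_closed[OF h] x] h by simp
    show "g \<otimes> x \<otimes> inv g = h \<otimes> x \<otimes> inv h \<longleftrightarrow> (inv h \<otimes> g) \<otimes> x \<otimes> inv (inv h \<otimes> g) = x"
    proof
      assume "g \<otimes> x \<otimes> inv g = h \<otimes> x \<otimes> inv h"
      then show "(inv h \<otimes> g) \<otimes> x \<otimes> inv (inv h \<otimes> g) = x" using e conj_elem_inv(1)[OF h x] by simp
    next
      assume "(inv h \<otimes> g) \<otimes> x \<otimes> inv (inv h \<otimes> g) = x"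
      then show "g \<otimes> x \<otimes> inv g = h \<otimes> x \<otimes> inv h"
        using e conj_elem_inv(2)[OF h, of "g \<otimes> x \<otimes> inv g"] g x by simp
    qed
  qed
  also have "\<dots> \<longleftrightarrow> inv h \<otimes> g \<in> centralizer G E"
    using g h E commute_conj_iff by (auto simp: centralizer_def subset_iff)
  also have "\<dots> \<longleftrightarrow> (\<exists>m\<in>centralizer G E. inv h = m \<otimes> inv g)"
    using g h inv_solve_right[of _ "inv h" g] by (metis (no_types, lifting) centralizer_def inv_closed inv_inv inv_solve_right mem_Collect_eq)
  also have "\<dots> \<longleftrightarrow> centralizer G E #> inv g = centralizer G E #> inv h"
    using coset_eq_iff[OF centralizer_subgroup[OF E]] g h by simp
  finally show ?thesis .
qed

lemma quillen_simps [simp]: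
  "Obj (quillen_on G \<E>) = \<E>" "Id (quillen_on G \<E>) E = (\<lambda>x\<in>E. x)"
  "Comp (quillen_on G \<E>) E1 E2 E3 \<psi> \<phi> = compose E1 \<psi> \<phi>"
  by (simp_all add: quillen_on_def)

lemma quillen_hom_iff:
  "f \<in> Hom (quillen_on G \<E>) E1 E2 \<longleftrightarrow> (\<exists>g\<in>carrier G. conj_set G g E1 \<subseteq> E2 \<and> f = conj_map G E1 g)"
  by (auto simp: quillen_on_def)

lemma quillen_is_cat:
  assumes \<E>: "\<And>E. E \<in> \<E> \<Longrightarrow> E \<subseteq> carrier G"
  shows "is_cat (quillen_on G \<E>)"
  unfolding is_cat_def
proof (intro conjI ballI)
  fix E assume E: "E \<in> Obj (quillen_on G \<E>)"
  then show "Id (quillen_on G \<E>) E \<in> Hom (quillen_on G \<E>) E E"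
    using \<E>[of E] conj_map_one[of E] conj_set_one[of E] by (auto simp: quillen_hom_iff intro!: bexI[of _ \<one>])
next
  fix x y z f g assume *: "x \<in> Obj (quillen_on G \<E>)" "y \<in> Obj (quillen_on G \<E>)" "z \<in> Obj (quillen_on G \<E>)"
    "f \<in> Hom (quillen_on G \<E>) x y" "g \<in> Hom (quillen_on G \<E>) y z"
  then obtain a b where ab: "a \<in> carrier G" "conj_set G a x \<subseteq> y" "f = conj_map G x a"
    "b \<in> carrier G" "conj_set G b y \<subseteq> z" "g = conj_map G y b" by (auto simp: quillen_hom_iff)
  have "conj_set G (b \<otimes> a) x \<subseteq> z"
    using conj_set_comp[OF ab(1,4) \<E>] *(1) conj_set_mono[OF ab(2), of b] ab(5) by simp
  then show "Comp (quillen_on G \<E>) x y z g f \<in> Hom (quillen_on G \<E>) x z"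
    using ab conj_map_comp[OF ab(1,4) \<E> ab(2)] * by (auto simp: quillen_hom_iff)
next
  fix x y f assume *: "x \<in> Obj (quillen_on G \<E>)" "y \<in> Obj (quillen_on G \<E>)" "f \<in> Hom (quillen_on G \<E>) x y"
  then obtain a where a: "a \<in> carrier G" "conj_set G a x \<subseteq> y" "f = conj_map G x a" by (auto simp: quillen_hom_iff)
  have xy: "x \<subseteq> carrier G" "y \<subseteq> carrier G" using * \<E> by auto
  show "Comp (quillen_on G \<E>) x x y f (Id (quillen_on G \<E>) x) = f"
    using conj_map_comp[OF one_closed a(1) xy(1), of x] a xy by (simp add: conj_set_one conj_map_one)
  show "Comp (quillen_on G \<E>) x y y (Id (quillen_on G \<E>) y) f = f"
    using conj_map_comp[OF a(1) one_closed xy(1) a(2)] a xy by (simp add: conj_map_one)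
next
  fix w x y z f g h assume *: "w \<in> Obj (quillen_on G \<E>)" "x \<in> Obj (quillen_on G \<E>)" "y \<in> Obj (quillen_on G \<E>)"
    "z \<in> Obj (quillen_on G \<E>)" "f \<in> Hom (quillen_on G \<E>) w x" "g \<in> Hom (quillen_on G \<E>) x y" "h \<in> Hom (quillen_on G \<E>) y z"
  then have "f \<in> w \<rightarrow> x" by (auto simp: quillen_hom_iff conj_map_def conj_set_image)
  then show "Comp (quillen_on G \<E>) w x z (Comp (quillen_on G \<E>) x y z h g) f =
    Comp (quillen_on G \<E>) w y z h (Comp (quillen_on G \<E>) w x y g f)"
    by (auto simp: compose_def fun_eq_iff)
qed

subsection \<open>Central elements of order \<open>p\<close> in a section\<close>

text \<open>The subgroup \<open>\<Omega>\<^sub>1(V \<inter> Z(U))\<close> for the section \<open>(U, V)\<close>.\<close>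

definition core :: "nat \<Rightarrow> 'a sect \<Rightarrow> 'a set" where
  "core p s = {x \<in> snd s. x [^] p = \<one> \<and> (\<forall>u\<in>fst s. u \<otimes> x = x \<otimes> u)}"

lemma core_elem_abelian:
  assumes s: "s \<in> sections G"
  shows "core p s \<in> elem_abelian G p"
proof -
  note D = sectionsD[OF s]
  have c: "x \<in> carrier G" "x \<in> fst s" "x \<in> snd s" "x [^] p = \<one>" "\<And>u. u \<in> fst s \<Longrightarrow> u \<otimes> x = x \<otimes> u"
    if x: "x \<in> core p s" for x
  proof -
    show 1: "x \<in> snd s" "x [^] p = \<one>" "\<And>u. u \<in> fst s \<Longrightarrow> u \<otimes> x = x \<otimes> u"
      using x by (simp_all add: core_def)
    show "x \<in> carrier G" "x \<in> fst s" using subsetD[OF D(5) 1(1)] subsetD[OF D(3) 1(1)] by simp_all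
  qed
  have "subgroup (core p s) G"
  proof (rule subgroupI)
    show "core p s \<subseteq> carrier G" using c by blast
    have "\<one> \<in> core p s" using subgroup.one_closed[OF D(2)] D(4) by (auto simp: core_def subset_iff)
    then show "core p s \<noteq> {}" by blast
  next
    fix x assume x: "x \<in> core p s"
    have "(inv x) [^] p = \<one>" using c(1,4)[OF x] by (simp add: nat_pow_inv)
    moreover have "u \<otimes> inv x = inv x \<otimes> u" if u: "u \<in> fst s" for u
    proof -
      have "x \<in> centralizer G {u}" using c(1)[OF x] c(5)[OF x u] by (simp add: centralizer_def)
      then have "inv x \<in> centralizer G {u}"
        using subgroup.m_inv_closed[OF centralizer_subgroup] u D(4) by (simp add: subset_iff)
      then show ?thesis by (auto simp: centralizer_def)
    qed
    ultimately show "inv x \<in> core p s"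
      using subgroup.m_inv_closed[OF D(2) c(3)[OF x]] by (auto simp: core_def)
  next
    fix x y assume x: "x \<in> core p s" and y: "y \<in> core p s"
    have "(x \<otimes> y) [^] p = x [^] p \<otimes> y [^] p"
      by (rule pow_mult_distrib[OF c(5)[OF y c(2)[OF x]] c(1)[OF x] c(1)[OF y]])
    moreover have "u \<otimes> (x \<otimes> y) = (x \<otimes> y) \<otimes> u" if u: "u \<in> fst s" for u
    proof -
      have uc: "u \<in> carrier G" using u D(4) by auto
      have "u \<otimes> (x \<otimes> y) = (u \<otimes> x) \<otimes> y" using c(1)[OF x] c(1)[OF y] uc by (simp only: m_assoc)
      also have "\<dots> = x \<otimes> u \<otimes> y" using c(5)[OF x u] by (simp only:)
      also have "\<dots> = x \<otimes> (y \<otimes> u)" using c(1)[OF x] c(1)[OF y] c(5)[OF y u] uc by (simp add: m_assoc)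
      finally show ?thesis using c(1)[OF x] c(1)[OF y] uc by (simp add: m_assoc)
    qed
    ultimately show "x \<otimes> y \<in> core p s"
      using subgroup.m_closed[OF D(2) c(3)[OF x] c(3)[OF y]] c(4)[OF x] c(4)[OF y] by (auto simp: core_def)
  qed
  then show ?thesis using c by (auto simp: elem_abelian_def)
qed

text \<open>Since \<open>E\<close> is abelian it lies in the centre of its centraliser.\<close>

lemma core_cent:
  assumes "E \<in> elem_abelian G p" shows "core p (centralizer G E, E) = E"
  using elem_abelianD[OF assms] by (auto simp: core_def centralizer_def)

text \<open>A section below \<open>s\<close> has a larger bottom and a smaller top, so more elements are central in it.\<close>

lemma conj_core:
  assumes s: "s \<in> sections G" and t: "t \<in> sections G" and g: "le_by g t s"
  shows "conj_set G (inv g) (core p s) \<subseteq> core p t"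
proof
  fix y assume "y \<in> conj_set G (inv g) (core p s)"
  have gc: "g \<in> carrier G" using g by (simp add: le_by_def)
  then obtain x where x: "x \<in> core p s" "y = inv g \<otimes> x \<otimes> g" using \<open>y \<in> _\<close> by (auto simp: conj_set_image)
  note sd = sectionsD[OF s] and td = sectionsD[OF t]
  have xc: "x \<in> carrier G" "x \<in> snd s" "x [^] p = \<one>" "\<And>u. u \<in> fst s \<Longrightarrow> u \<otimes> x = x \<otimes> u"
    using x(1) sd(5) by (auto simp: core_def)
  have le: "snd s \<subseteq> conj_set G g (snd t)" "conj_set G g (fst t) \<subseteq> fst s" using g le_by_iff[OF t] by auto
  obtain v where v: "v \<in> snd t" "x = g \<otimes> v \<otimes> inv g" using le(1) xc(2) by (auto simp: conj_set_image)
  have vc: "v \<in> carrier G" using v td(5) by auto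
  have yv: "y = v" using x(2) v(2) gc vc by simp
  have "v [^] p = \<one>"
  proof -
    have "g \<otimes> v [^] p \<otimes> inv g = \<one>" using xc(3) conj_pow[OF gc vc] v(2) by simp
    then show ?thesis using gc vc by (metis conj_elem_inv(1) inv_closed l_inv nat_pow_closed r_one)
  qed
  moreover have "u \<otimes> v = v \<otimes> u" if u: "u \<in> fst t" for u
  proof -
    have uc: "u \<in> carrier G" using u td(4) by auto
    have "g \<otimes> u \<otimes> inv g \<in> fst s" using le(2) u by (auto simp: conj_set_image)
    then have "(g \<otimes> u \<otimes> inv g) \<otimes> (g \<otimes> v \<otimes> inv g) = (g \<otimes> v \<otimes> inv g) \<otimes> (g \<otimes> u \<otimes> inv g)" using xc(4) v(2) by simp
    then have "g \<otimes> (u \<otimes> v) \<otimes> inv g = g \<otimes> (v \<otimes> u) \<otimes> inv g" using uc vc conj_mult[OF gc] by simp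
    then show ?thesis using gc uc vc by (metis conj_elem_inv(1) m_closed)
  qed
  ultimately show "y \<in> core p t" using v yv by (auto simp: core_def)
qed

text \<open>\<open>U\<close> acts on \<open>V\<close> by conjugation with fixed point set \<open>V \<inter> Z(U)\<close>. The moved points and \<open>V\<close> both have a
  cardinality divisible by \<open>p\<close>, hence so do the fixed points. As \<open>1\<close> is one of them, there is a fixed point
  \<open>z \<noteq> 1\<close>, and the last nontrivial element among its iterated \<open>p\<close>-th powers has order \<open>p\<close>.\<close>

lemma core_nontrivial:
  assumes p: "prime p" and fin: "finite (carrier G)" and ord: "order G = p ^ k"
    and s: "s \<in> sections G" and ne: "snd s \<noteq> {\<one>}"
  shows "core p s \<noteq> {\<one>}"
proof -
  note D = sectionsD[OF s]
  let ?U = "fst s" and ?V = "snd s"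
  let ?H = "G\<lparr>carrier := ?U\<rparr>"
  interpret H: group ?H by (rule subgroup_imp_group[OF D(1)])
  have dvd: "card K dvd p ^ k" if "subgroup K G" for K
    using lagrange[OF that] ord by (metis dvd_triv_right)
  define \<phi> where "\<phi> u = (\<lambda>v\<in>?V. u \<otimes> v \<otimes> inv u)" for u
  have \<phi>B: "\<phi> u \<in> Bij ?V" if u: "u \<in> ?U" for u
  proof -
    have uc: "u \<in> carrier G" "inv u \<in> ?U" using u D(4) subgroup.m_inv_closed[OF D(1)] by auto
    have "bij_betw (\<phi> u) ?V ?V"
    proof (rule bij_betwI[where g = "\<phi> (inv u)"])
      show "\<phi> u \<in> ?V \<rightarrow> ?V" using D(6)[OF u] by (simp add: \<phi>_def)
      show "\<phi> (inv u) \<in> ?V \<rightarrow> ?V" using D(6)[OF uc(2)] by (simp add: \<phi>_def)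
      fix v assume v: "v \<in> ?V"
      then have vc: "v \<in> carrier G" using D(5) by auto
      show "\<phi> (inv u) (\<phi> u v) = v" using v D(6)[OF u v] uc vc by (simp add: \<phi>_def)
      show "\<phi> u (\<phi> (inv u) v) = v" using v D(6)[OF uc(2) v] uc vc by (simp add: \<phi>_def)
    qed
    then show ?thesis by (simp add: Bij_def \<phi>_def)
  qed
  have act: "group_action ?H ?V \<phi>"
  proof (unfold group_action_def group_hom_def group_hom_axioms_def, intro conjI)
    show "group ?H" ..
    show "group (BijGroup ?V)" by (rule group_BijGroup)
    show "\<phi> \<in> hom ?H (BijGroup ?V)"
    proof (rule homI)
      fix u assume "u \<in> carrier ?H"
      then show "\<phi> u \<in> carrier (BijGroup ?V)" using \<phi>B by (simp add: BijGroup_def)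
    next
      fix u w assume "u \<in> carrier ?H" "w \<in> carrier ?H"
      then have u: "u \<in> ?U" "w \<in> ?U" by auto
      have "\<phi> (u \<otimes> w) = compose ?V (\<phi> u) (\<phi> w)"
      proof
        fix v
        show "\<phi> (u \<otimes> w) v = compose ?V (\<phi> u) (\<phi> w) v"
        proof (cases "v \<in> ?V")
          case True
          have "w \<in> carrier G" "u \<in> carrier G" "v \<in> carrier G"
            using subsetD[OF D(4) u(2)] subsetD[OF D(4) u(1)] subsetD[OF D(5) True] .
          then show ?thesis using D(6)[OF u(2) True] conj_elem_comp[of w u v, symmetric] True
            by (simp add: \<phi>_def compose_def)
        qed (simp add: \<phi>_def compose_def)
      qed
      then show "\<phi> (u \<otimes>\<^bsub>?H\<^esub> w) = \<phi> u \<otimes>\<^bsub>BijGroup ?V\<^esub> \<phi> w" using \<phi>B u by (simp add: BijGroup_def)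
    qed
  qed
  interpret A: group_action ?H ?V \<phi> by (rule act)
  have finV: "finite ?V" using D(5) fin finite_subset by blast
  obtain j where j: "card ?U = p ^ j" using dvd[OF D(1)] divides_primepow_nat[OF p] by blast
  have ordH: "order ?H = p ^ j" using j by (simp add: order_def)
  let ?M = "{x \<in> ?V. \<exists>g\<in>carrier ?H. \<phi> g x \<noteq> x}"
  let ?Z = "?V - ?M"
  have pM: "p dvd card ?M" by (rule A.card_moved_points[OF p ordH finV])
  have oneV: "\<one> \<in> ?V" using subgroup.one_closed[OF D(2)] .
  have "card ?V \<noteq> 1"
  proof
    assume "card ?V = 1"
    then obtain z where "?V = {z}" by (auto simp: card_1_singleton_iff)
    then show False using oneV ne by auto
  qed
  then have "p dvd card ?V" using dvd[OF D(2)] divides_primepow_nat[OF p]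
    by (metis dvd_refl dvd_power le_0_eq not_gr_zero power_0)
  moreover have "card ?V = card ?M + card ?Z" using finV by (subst card_Un_disjoint[symmetric]) (auto intro: arg_cong[where f = card])
  ultimately have "p dvd card ?Z" using pM by (simp add: dvd_add_right_iff)
  moreover have oneZ: "\<one> \<in> ?Z" using oneV D(4) by (auto simp: \<phi>_def)
  ultimately have "card ?Z \<noteq> 1" using prime_gt_1_nat[OF p] by auto
  then have "?Z \<noteq> {\<one>}" by (metis card_1_singleton_iff One_nat_def)
  then obtain z where z: "z \<in> ?Z" "z \<noteq> \<one>" using oneZ by blast
  have zc: "z \<in> carrier G" "z \<in> ?V" using z D(5) by auto
  have zcom: "u \<otimes> z = z \<otimes> u" if "u \<in> ?U" for u
    using z that D(4) commute_conj_iff[of u z] zc by (auto simp: \<phi>_def)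
  have zz: "z \<in> ?V \<inter> centralizer G ?U" using zc zcom by (simp add: centralizer_def)
  let ?C = "G\<lparr>carrier := ?V \<inter> centralizer G ?U\<rparr>"
  have subC: "subgroup (?V \<inter> centralizer G ?U) G"
    by (rule subgroups_Inter_pair[OF D(2) centralizer_subgroup[OF D(4)]])
  interpret C: comm_group ?C
  proof (rule group.group_comm_groupI[OF subgroup_imp_group[OF subC]])
    fix x y assume "x \<in> carrier ?C" "y \<in> carrier ?C"
    then show "x \<otimes>\<^bsub>?C\<^esub> y = y \<otimes>\<^bsub>?C\<^esub> x" using D(3) by (auto simp: centralizer_def)
  qed
  obtain m where m: "card (?V \<inter> centralizer G ?U) = p ^ m"
    using dvd[OF subC] divides_primepow_nat[OF p] by blast
  have "finite (carrier ?C)" using finV by simp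
  then have "z [^]\<^bsub>?C\<^esub> card (carrier ?C) = \<one>\<^bsub>?C\<^esub>" by (rule C.power_order_eq_one) (use zz in simp)
  then have ex: "z [^] (p ^ m) = \<one>" using m by (simp add: nat_pow_def)
  define i where "i = (LEAST i. z [^] (p ^ i) = \<one>)"
  have zi: "z [^] (p ^ i) = \<one>" unfolding i_def by (rule LeastI[of _ m]) (rule ex)
  have "i \<noteq> 0" using z(2) zc(1) zi by (intro notI) simp
  then obtain i' where i': "i = Suc i'" by (cases i) auto
  let ?x = "z [^] (p ^ i')"
  have xne: "?x \<noteq> \<one>" using not_less_Least[of i' "\<lambda>i. z [^] (p ^ i) = \<one>"] i' by (simp add: i_def)
  have "?x [^] p = \<one>"
  proof -
    have "?x [^] p = z [^] (p ^ i)" using zc(1) i' by (simp add: nat_pow_pow mult.commute)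
    then show ?thesis using zi by simp
  qed
  moreover have "z [^] n \<in> ?V" for n :: nat
    using subgroup.m_closed[OF D(2)] zc(2) oneV by (induct n) auto
  moreover have "u \<otimes> ?x = ?x \<otimes> u" if u: "u \<in> ?U" for u
    using group_commutes_pow[OF zcom[OF u, symmetric] zc(1)] u D(4) by (simp add: subset_iff)
  ultimately have "?x \<in> core p s" by (auto simp: core_def)
  then show ?thesis using xne by auto
qed


section \<open>The adjunction between the two categories\<close>

definition cent_sect :: "'a set \<Rightarrow> 'a sect" where
  "cent_sect E = (centralizer G E, E)"

text \<open>The action of the bar functor on morphisms, with the same choice of representatives.\<close>

definition cent_mor :: "'a set \<Rightarrow> 'a set \<Rightarrow> ('a \<Rightarrow> 'a) \<Rightarrow> 'a set" where
  "cent_mor E1 E2 \<phi> = centralizer G E1 #>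
     inv (SOME g. g \<in> carrier G \<and> conj_set G g E1 \<subseteq> E2 \<and> \<phi> = conj_map G E1 g)"

definition core_mor :: "nat \<Rightarrow> 'a sect \<Rightarrow> 'a sect \<Rightarrow> 'a set \<Rightarrow> 'a \<Rightarrow> 'a" where
  "core_mor p s t f = conj_map G (core p s) (inv (SOME g. le_by g t s \<and> f = fst s #> g))"

lemma cent_sect_simps [simp]: "fst (cent_sect E) = centralizer G E" "snd (cent_sect E) = E"
  by (simp_all add: cent_sect_def)

lemma cent_sect_section: "E \<in> elem_abelian G p \<Longrightarrow> cent_sect E \<in> sections G"
  using cent_section by (simp add: cent_sect_def)

lemma bar_functor_simps:
  "ob (bar_functor G F) E = ob F (cent_sect E)"
  "act (bar_functor G F) E1 E2 \<phi> = act F (cent_sect E1) (cent_sect E2) (cent_mor E1 E2 \<phi>)"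
  by (simp_all add: bar_functor_def cent_sect_def cent_mor_def)

lemma cent_mor_eq:
  assumes E: "E1 \<subseteq> carrier G" and g: "g \<in> carrier G" "conj_set G g E1 \<subseteq> E2"
  shows "cent_mor E1 E2 (conj_map G E1 g) = centralizer G E1 #> inv g"
proof -
  let ?P = "\<lambda>h. h \<in> carrier G \<and> conj_set G h E1 \<subseteq> E2 \<and> conj_map G E1 g = conj_map G E1 h"
  define h where "h = (SOME h. ?P h)"
  have "?P h" unfolding h_def by (rule someI[of ?P g]) (use g in simp)
  then have "centralizer G E1 #> inv g = centralizer G E1 #> inv h" using conj_map_eq_iff[OF g(1) _ E] by blast
  then show ?thesis unfolding cent_mor_def h_def[symmetric] by simp
qed

lemma cent_le_by:
  assumes E: "E1 \<in> elem_abelian G p" "E2 \<in> elem_abelian G p" and g: "g \<in> carrier G" "conj_set G g E1 \<subseteq> E2"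
  shows "le_by (inv g) (cent_sect E2) (cent_sect E1)"
proof -
  have c: "E1 \<subseteq> carrier G" "E2 \<subseteq> carrier G" using elem_abelianD(2) E by auto
  have "E1 \<subseteq> conj_set G (inv g) E2" using conj_set_mono[OF g(2), of "inv g"] conj_set_inv(1)[OF g(1) c(1)] by simp
  moreover have "conj_set G (inv g) (centralizer G E2) \<subseteq> centralizer G E1"
  proof
    fix y assume "y \<in> conj_set G (inv g) (centralizer G E2)"
    then obtain z where z: "z \<in> centralizer G E2" "y = inv g \<otimes> z \<otimes> inv (inv g)" unfolding conj_set_image by blast
    have zc: "z \<in> carrier G" using z by (simp add: centralizer_def)
    have "y \<otimes> x = x \<otimes> y" if x: "x \<in> E1" for x
    proof -
      have xc: "x \<in> carrier G" using x c by auto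
      let ?w = "g \<otimes> x \<otimes> inv g"
      have w: "?w \<in> E2" using g(2) x by (auto simp: conj_set_image)
      then have comm: "z \<otimes> ?w = ?w \<otimes> z" using z(1) by (simp add: centralizer_def)
      have wc: "?w \<in> carrier G" using g xc by simp
      have x': "x = inv g \<otimes> ?w \<otimes> inv (inv g)" using g xc by simp
      have "y \<otimes> x = inv g \<otimes> (z \<otimes> ?w) \<otimes> inv (inv g)"
        using conj_mult[of "inv g" z ?w] g zc wc z(2) x' by simp
      also have "\<dots> = x \<otimes> y" using conj_mult[of "inv g" ?w z] g zc wc z(2) x' comm by simp
      finally show ?thesis .
    qed
    then show "y \<in> centralizer G E1" using z(2) zc g by (simp add: centralizer_def)
  qed
  ultimately show ?thesis using g by (simp add: le_by_iff[OF cent_sect_section[OF E(2)]])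
qed

lemma cent_mor_hom:
  assumes E: "E1 \<in> elem_abelian G p" "E2 \<in> elem_abelian G p" and f: "f \<in> Hom (quillen_on G \<E>) E1 E2"
  shows "cent_mor E1 E2 f \<in> Hom (destr_cat G \<C>) (cent_sect E2) (cent_sect E1)"
proof -
  obtain g where g: "g \<in> carrier G" "conj_set G g E1 \<subseteq> E2" "f = conj_map G E1 g"
    using f unfolding quillen_hom_iff by blast
  show ?thesis
    using le_by_mor[OF cent_le_by[OF E g(1,2)]] cent_mor_eq[OF elem_abelianD(2)[OF E(1)] g(1,2)] g(3) by simp
qed

lemma cent_mor_id:
  assumes "E \<in> elem_abelian G p" shows "cent_mor E E (\<lambda>x\<in>E. x) = centralizer G E #> \<one>"
  using cent_mor_eq[OF elem_abelianD(2)[OF assms] one_closed, of E] conj_map_one[OF elem_abelianD(2)[OF assms]]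
    conj_set_one[OF elem_abelianD(2)[OF assms]] by simp

lemma cent_mor_comp:
  assumes E: "E1 \<in> elem_abelian G p" "E2 \<in> elem_abelian G p" "E3 \<in> elem_abelian G p"
    and f: "f \<in> Hom (quillen_on G \<E>) E1 E2" and h: "h \<in> Hom (quillen_on G \<E>) E2 E3"
  shows "cent_mor E1 E3 (compose E1 h f) = cent_mor E1 E2 f <#> cent_mor E2 E3 h"
proof -
  have c: "E1 \<subseteq> carrier G" "E2 \<subseteq> carrier G" using elem_abelianD(2) E by auto
  obtain a where a: "a \<in> carrier G" "conj_set G a E1 \<subseteq> E2" "f = conj_map G E1 a"
    using f unfolding quillen_hom_iff by blast
  obtain b where b: "b \<in> carrier G" "conj_set G b E2 \<subseteq> E3" "h = conj_map G E2 b"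
    using h unfolding quillen_hom_iff by blast
  have ba: "conj_set G (b \<otimes> a) E1 \<subseteq> E3"
    using conj_set_comp[OF a(1) b(1) c(1)] conj_set_mono[OF a(2), of b] b(2) by simp
  have "cent_mor E1 E3 (compose E1 h f) = centralizer G E1 #> (inv a \<otimes> inv b)"
    using conj_map_comp[OF a(1) b(1) c(1) a(2)] cent_mor_eq[OF c(1) _ ba] a b by (simp add: inv_mult_group)
  also have "\<dots> = (centralizer G E1 #> inv a) <#> (centralizer G E2 #> inv b)"
    using mor_comp[OF cent_sect_section[OF E(2)] cent_sect_section[OF E(1)] inv_closed[OF b(1)] cent_le_by[OF E(1,2) a(1,2)]]
    by simp
  also have "\<dots> = cent_mor E1 E2 f <#> cent_mor E2 E3 h"
    using cent_mor_eq[OF c(1) a(1,2)] cent_mor_eq[OF c(2) b(1,2)] a(3) b(3) by simp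
  finally show ?thesis .
qed

lemma quillen_cat'_simps [simp]:
  "Obj (quillen_cat' G p) = elem_abelian G p" "Id (quillen_cat' G p) E = (\<lambda>x\<in>E. x)"
  "Comp (quillen_cat' G p) E1 E2 E3 \<psi> \<phi> = compose E1 \<psi> \<phi>"
  by (simp_all add: quillen_cat'_def)

lemma bar_functor_functor:
  assumes F: "is_rmod_functor R (op_cat (destr_cat G (sections G))) F"
  shows "is_rmod_functor R (quillen_cat' G p) (bar_functor G F)"
proof -
  note FD = functorD[OF F, simplified]
  have h: "cent_mor E1 E2 f \<in> Hom (destr_cat G (sections G)) (cent_sect E2) (cent_sect E1)"
    if "E1 \<in> elem_abelian G p" "E2 \<in> elem_abelian G p" "f \<in> Hom (quillen_cat' G p) E1 E2" for E1 E2 f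
    using cent_mor_hom[OF that(1,2)] that(3) by (simp add: quillen_cat'_def)
  have c: "cent_mor E1 E3 (compose E1 h f) = cent_mor E1 E2 f <#> cent_mor E2 E3 h"
    if "E1 \<in> elem_abelian G p" "E2 \<in> elem_abelian G p" "E3 \<in> elem_abelian G p"
      "f \<in> Hom (quillen_cat' G p) E1 E2" "h \<in> Hom (quillen_cat' G p) E2 E3" for E1 E2 E3 f h
    using cent_mor_comp[OF that(1-3)] that(4,5) by (simp add: quillen_cat'_def)
  show ?thesis unfolding is_rmod_functor_def quillen_cat'_simps bar_functor_simps
  proof (intro conjI ballI)
    fix E assume "E \<in> elem_abelian G p"
    then show "module R (ob F (cent_sect E))" using FD(1)[OF cent_sect_section] by simp
  next
    fix E1 E2 f assume "E1 \<in> elem_abelian G p" "E2 \<in> elem_abelian G p" "f \<in> Hom (quillen_cat' G p) E1 E2"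
    then show "act F (cent_sect E1) (cent_sect E2) (cent_mor E1 E2 f) \<in> mod_hom R (ob F (cent_sect E1)) (ob F (cent_sect E2))"
      using FD(2)[OF cent_sect_section cent_sect_section h] by simp
  next
    fix E a assume E: "E \<in> elem_abelian G p" and a: "a \<in> carrier (ob F (cent_sect E))"
    show "act F (cent_sect E) (cent_sect E) (cent_mor E E (\<lambda>x\<in>E. x)) a = a"
      using FD(4)[OF cent_sect_section[OF E] a] cent_mor_id[OF E] by simp
  next
    fix E1 E2 E3 f k a assume E: "E1 \<in> elem_abelian G p" "E2 \<in> elem_abelian G p" "E3 \<in> elem_abelian G p"
      and f: "f \<in> Hom (quillen_cat' G p) E1 E2" and k: "k \<in> Hom (quillen_cat' G p) E2 E3"
      and a: "a \<in> carrier (ob F (cent_sect E1))"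
    show "act F (cent_sect E1) (cent_sect E3) (cent_mor E1 E3 (compose E1 k f)) a =
      act F (cent_sect E2) (cent_sect E3) (cent_mor E2 E3 k) (act F (cent_sect E1) (cent_sect E2) (cent_mor E1 E2 f) a)"
      unfolding c[OF E f k]
      by (rule FD(5)[OF cent_sect_section[OF E(1)] cent_sect_section[OF E(2)] cent_sect_section[OF E(3)]
            h[OF E(1,2) f] h[OF E(2,3) k] a])
  qed
qed

lemma core_mor_eq:
  assumes s: "s \<in> sections G" and g: "le_by g t s"
  shows "core_mor p s t (fst s #> g) = conj_map G (core p s) (inv g)"
proof -
  let ?P = "\<lambda>h. le_by h t s \<and> fst s #> g = fst s #> h"
  define h where "h = (SOME h. ?P h)"
  have "?P h" unfolding h_def by (rule someI[of ?P g]) (use g in simp)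
  then have h: "h \<in> carrier G" "fst s #> g = fst s #> h" by (auto simp: le_by_def)
  have gc: "g \<in> carrier G" using g by (simp add: le_by_def)
  obtain m where m: "m \<in> fst s" "h = m \<otimes> g" using coset_eq_iff[OF sectionsD(1)[OF s] gc h(1)] h(2) by blast
  have mc: "m \<in> carrier G" using m sectionsD(4)[OF s] by auto
  have "inv h \<otimes> x \<otimes> inv (inv h) = inv g \<otimes> x \<otimes> inv (inv g)" if x: "x \<in> core p s" for x
  proof -
    have xc: "x \<in> carrier G" using x sectionsD(5)[OF s] by (auto simp: core_def)
    have im: "inv m \<in> fst s" using subgroup.m_inv_closed[OF sectionsD(1)[OF s] m(1)] .
    have "inv m \<otimes> x \<otimes> inv (inv m) = x"
      using commute_conj_iff[of "inv m" x] mc xc x im by (simp add: core_def)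
    then show ?thesis using conj_elem_comp[of "inv m" "inv g" x] mc gc xc m(2) by (simp add: inv_mult_group)
  qed
  then show ?thesis unfolding core_mor_def conj_map_def h_def[symmetric] by (intro restrict_ext) simp
qed

lemma core_counit:
  assumes "s \<in> sections G" shows "le_by \<one> s (cent_sect (core p s))"
proof -
  have "core p s \<subseteq> snd s" by (auto simp: core_def)
  moreover have "fst s \<subseteq> centralizer G (core p s)"
    using sectionsD(4)[OF assms] by (auto simp: core_def centralizer_def)
  ultimately show ?thesis by (simp add: le_by_one[OF assms])
qed

lemma sections_star_iff: "s \<in> sections_star G \<longleftrightarrow> s \<in> sections G \<and> snd s \<noteq> {\<one>}"
  by (cases s) (simp add: sections_star_def)

text \<open>The embedding and the coreflector are \<open>E \<mapsto> (C\<^sub>G(E), E)\<close> and \<open>(U, V) \<mapsto> \<Omega>\<^sub>1(V \<inter> Z(U))\<close>, as functors between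
  the nontrivial elementary abelian subgroups and the opposite of the category of sections. The counit at
  \<open>(U, V)\<close> is the coset of \<open>1\<close>, because \<open>(U, V)\<close> lies below \<open>(C\<^sub>G(E), E)\<close> for its core \<open>E\<close>. The trivial subgroup is
  initial among all elementary abelian subgroups and the nontrivial ones are closed under outgoing
  morphisms, because these are injective.\<close>

theorem sections_coreflection:
  fixes R :: "'r ring"
  assumes R: "cring R" and p: "prime p" and fin: "finite (carrier G)" and ord: "order G = p ^ k"
  shows "pointed_coreflection R (quillen_cat' G p) (elem_abelian G p - {{\<one>}}) (op_cat (destr_cat G (sections_star G)))
    cent_sect cent_mor (core p) (core_mor p) (\<lambda>s. centralizer G (core p s) #> \<one>) {\<one>} (\<lambda>E. conj_map G {\<one>} \<one>)"
proof -
  let ?D = "destr_cat G (sections_star G)" and ?A = "quillen_cat' G p" and ?S = "elem_abelian G p - {{\<one>}}"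
  have sub: "sections_star G \<subseteq> sections G" using sections_star_iff by blast
  have ea: "E \<subseteq> carrier G" if "E \<in> elem_abelian G p" for E using elem_abelianD(2)[OF that] .
  have sec: "s \<in> sections G" if "s \<in> sections_star G" for s using that sub by blast
  have hq: "\<And>f E E'. f \<in> Hom ?A E E' \<longleftrightarrow> f \<in> Hom (quillen_on G (elem_abelian G p)) E E'"
    by (simp add: quillen_cat'_def)
  have A: "is_cat ?A" unfolding quillen_cat'_def by (rule quillen_is_cat) (rule ea)
  have C: "is_cat (op_cat ?D)" by (rule is_cat_op[OF destr_cat_is_cat[OF sub]])
  have cos: "E' \<in> ?S" if E: "E \<in> ?S" "E' \<in> Obj ?A" and f: "f \<in> Hom ?A E E'" for E E' f
  proof -
    obtain g where g: "g \<in> carrier G" "conj_set G g E \<subseteq> E'"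
      using f unfolding hq quillen_hom_iff by blast
    have "E' \<noteq> {\<one>}"
    proof
      assume "E' = {\<one>}"
      then have "conj_set G (inv g) (conj_set G g E) \<subseteq> conj_set G (inv g) {\<one>}" using conj_set_mono[OF g(2)] by simp
      then have "E \<subseteq> {\<one>}" using conj_set_inv(1)[OF g(1) ea] E(1) g(1) by (simp add: conj_set_image)
      moreover have "\<one> \<in> E" using subgroup.one_closed[OF elem_abelianD(1)] E(1) by blast
      ultimately show False using E(1) by blast
    qed
    then show ?thesis using E(2) by simp
  qed
  have io: "cent_sect E \<in> sections_star G" if "E \<in> ?S" for E
    using cent_sect_section that by (auto simp: sections_star_iff)
  have ro: "core p s \<in> ?S" if "s \<in> sections_star G" for s
    using that core_nontrivial[OF p fin ord] core_elem_abelian by (simp add: sections_star_iff)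
  have rm_in: "conj_map G (core p s) (inv g) \<in> Hom ?A (core p s) (core p t)"
    if "s \<in> sections G" "t \<in> sections G" "le_by g t s" for s t g
    unfolding hq quillen_hom_iff using conj_core[OF that] that(3) by (auto simp: le_by_def)
  show ?thesis
  proof (intro pointed_coreflection.intro coreflection.intro pointed_coreflection_axioms.intro;
      (unfold op_cat_simps quillen_cat'_simps destr_cat_simps)?)
    show "cring R" by (rule R)
  next
    show "is_cat ?A" by (rule A)
  next
    show "is_cat (op_cat ?D)" by (rule C)
  next
    show "?S \<subseteq> elem_abelian G p" by blast
  next
    fix E E' f assume "E \<in> ?S" "E' \<in> elem_abelian G p" "f \<in> Hom ?A E E'"
    then show "E' \<in> ?S" using cos by simp
  next
    fix E assume "E \<in> ?S" then show "cent_sect E \<in> sections_star G" by (rule io)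
  next
    fix E E' f assume "E \<in> ?S" "E' \<in> ?S" "f \<in> Hom ?A E E'"
    then show "cent_mor E E' f \<in> Hom ?D (cent_sect E') (cent_sect E)" unfolding hq by (intro cent_mor_hom) auto
  next
    fix E assume "E \<in> ?S"
    then show "cent_mor E E (\<lambda>x\<in>E. x) = fst (cent_sect E) #> \<one>" using cent_mor_id[of E p] by simp
  next
    fix E E' E'' f g assume "E \<in> ?S" "E' \<in> ?S" "E'' \<in> ?S" "f \<in> Hom ?A E E'" "g \<in> Hom ?A E' E''"
    then show "cent_mor E E'' (compose E g f) = cent_mor E E' f <#> cent_mor E' E'' g"
      unfolding hq by (intro cent_mor_comp) auto
  next
    fix s assume "s \<in> sections_star G" then show "core p s \<in> ?S" by (rule ro)
  next
    fix s t f assume st: "s \<in> sections_star G" "t \<in> sections_star G" and f: "f \<in> Hom ?D t s"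
    obtain g where g: "le_by g t s" "f = fst s #> g" using f unfolding destr_hom_iff by blast
    then show "core_mor p s t f \<in> Hom ?A (core p s) (core p t)"
      using core_mor_eq[OF sec[OF st(1)] g(1)] rm_in[OF sec[OF st(1)] sec[OF st(2)] g(1)] by simp
  next
    fix s assume s: "s \<in> sections_star G"
    have "le_by \<one> s s" using le_by_one[OF sec[OF s]] by simp
    then show "core_mor p s s (fst s #> \<one>) = (\<lambda>x\<in>core p s. x)"
      using core_mor_eq[OF sec[OF s]] conj_map_one[OF ea[OF core_elem_abelian[OF sec[OF s]]]] by simp
  next
    fix s t u f h assume st: "s \<in> sections_star G" "t \<in> sections_star G" "u \<in> sections_star G"
      and f: "f \<in> Hom ?D t s" and h: "h \<in> Hom ?D u t"
    obtain a where a: "le_by a t s" "f = fst s #> a" using f unfolding destr_hom_iff by blast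
    obtain b where b: "le_by b u t" "h = fst t #> b" using h unfolding destr_hom_iff by blast
    have c: "a \<in> carrier G" "b \<in> carrier G" using a b by (simp_all add: le_by_def)
    have "f <#> h = fst s #> (a \<otimes> b)"
      using mor_comp[OF sec[OF st(2)] sec[OF st(1)] c(2) a(1)] a b by simp
    then have "core_mor p s u (f <#> h) = conj_map G (core p s) (inv b \<otimes> inv a)"
      using core_mor_eq[OF sec[OF st(1)] le_by_comp[OF sec[OF st(3)] sec[OF st(2)] b(1) a(1)]] c
      by (simp add: inv_mult_group)
    also have "\<dots> = compose (core p s) (conj_map G (core p t) (inv b)) (conj_map G (core p s) (inv a))"
      using conj_map_comp[OF inv_closed[OF c(1)] inv_closed[OF c(2)] ea[OF core_elem_abelian[OF sec[OF st(1)]]]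
          conj_core[OF sec[OF st(1)] sec[OF st(2)] a(1)]] by simp
    finally show "core_mor p s u (f <#> h) = compose (core p s) (core_mor p t u h) (core_mor p s t f)"
      using core_mor_eq[OF sec[OF st(1)] a(1)] core_mor_eq[OF sec[OF st(2)] b(1)] a b by simp
  next
    fix E assume "E \<in> ?S" then show "core p (cent_sect E) = E" using core_cent by (simp add: cent_sect_def)
  next
    fix E E' f assume E: "E \<in> ?S" "E' \<in> ?S" and f: "f \<in> Hom ?A E E'"
    obtain g where g: "g \<in> carrier G" "conj_set G g E \<subseteq> E'" "f = conj_map G E g"
      using f unfolding hq quillen_hom_iff by blast
    have ee: "E \<in> elem_abelian G p" "E' \<in> elem_abelian G p" using E by auto
    show "core_mor p (cent_sect E) (cent_sect E') (cent_mor E E' f) = f"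
      using core_mor_eq[OF cent_sect_section[OF ee(1)] cent_le_by[OF ee g(1,2)], of p] cent_mor_eq[OF ea[OF ee(1)] g(1,2)]
        core_cent[OF ee(1)] g by (simp add: cent_sect_def)
  next
    fix s assume s: "s \<in> sections_star G"
    show "centralizer G (core p s) #> \<one> \<in> Hom ?D s (cent_sect (core p s))"
      using le_by_mor[OF core_counit[OF sec[OF s]]] by simp
  next
    fix s t f assume st: "s \<in> sections_star G" "t \<in> sections_star G" and f: "f \<in> Hom ?D t s"
    obtain a where a: "le_by a t s" "f = fst s #> a" using f unfolding destr_hom_iff by blast
    have c: "a \<in> carrier G" using a by (simp add: le_by_def)
    note S = sec[OF st(1)] and T = sec[OF st(2)]
    note es = core_elem_abelian[OF S, of p] and et = core_elem_abelian[OF T, of p]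
    have cc: "conj_set G (inv a) (core p s) \<subseteq> core p t" by (rule conj_core[OF S T a(1)])
    have im: "cent_mor (core p s) (core p t) (core_mor p s t f) = centralizer G (core p s) #> a"
      using core_mor_eq[OF S a(1)] cent_mor_eq[OF ea[OF es] inv_closed[OF c] cc] a c by simp
    have "(centralizer G (core p s) #> \<one>) <#> f = centralizer G (core p s) #> a"
      using mor_comp[OF S cent_sect_section[OF es] c core_counit[OF S]] a(2) c by simp
    moreover have "(centralizer G (core p s) #> a) <#> (centralizer G (core p t) #> \<one>) = centralizer G (core p s) #> a"
      using mor_comp[OF cent_sect_section[OF et] cent_sect_section[OF es] one_closed cent_le_by[OF es et inv_closed[OF c] cc, simplified inv_inv[OF c]]]
        c by simp
    ultimately show "(centralizer G (core p s) #> \<one>) <#> f =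
        cent_mor (core p s) (core p t) (core_mor p s t f) <#> (centralizer G (core p t) #> \<one>)"
      using im by simp
  next
    fix E assume "E \<in> ?S"
    then show "centralizer G (core p (cent_sect E)) #> \<one> = fst (cent_sect E) #> \<one>"
      using core_cent by (simp add: cent_sect_def)
  next
    show "{\<one>} \<in> elem_abelian G p" using triv_subgroup by (auto simp: elem_abelian_def)
  next
    show "{\<one>} \<notin> ?S" by simp
  next
    fix E assume "E \<in> elem_abelian G p"
    then have "\<one> \<in> E" using subgroup.one_closed[OF elem_abelianD(1)] by blast
    then show "conj_map G {\<one>} \<one> \<in> Hom ?A {\<one>} E"
      unfolding hq quillen_hom_iff by (intro bexI[of _ \<one>]) (auto simp: conj_set_image)
  next
    fix E f assume "f \<in> Hom ?A {\<one>} E"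
    then obtain g where "g \<in> carrier G" "f = conj_map G {\<one>} g" unfolding hq quillen_hom_iff by blast
    then show "f = conj_map G {\<one>} \<one>" by (auto simp: conj_map_def fun_eq_iff)
  qed
qed


section \<open>Compatible families and gluing data\<close>

lemma destr_functor_restrict:
  assumes "is_rmod_functor R (op_cat (destr_cat G (sections G))) F" "\<C> \<subseteq> sections G"
  shows "is_rmod_functor R (op_cat (destr_cat G \<C>)) F"
proof -
  have h: "Hom (destr_cat G \<C>) = Hom (destr_cat G (sections G))" by (simp add: destr_cat_def)
  have "x \<in> sections G" if "x \<in> \<C>" for x using assms(2) that by blast
  then show ?thesis using assms(1) unfolding is_rmod_functor_def op_cat_simps destr_cat_simps h by blast
qed

lemma destr_act:
  assumes F: "is_rmod_functor R (op_cat (destr_cat G (sections G))) F"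
    and s: "s \<in> sections G" and t: "t \<in> sections G" and g: "le_by g s t"
  shows "act F t s (fst t #> g) \<in> mod_hom R (ob F t) (ob F s)"
    and "x \<in> carrier (ob F t) \<Longrightarrow> act F t s (fst t #> g) x \<in> carrier (ob F s)"
  using functorD(2,3)[OF F, of t s "fst t #> g"] s t le_by_mor[OF g] by simp_all

lemma destr_act_comp:
  assumes F: "is_rmod_functor R (op_cat (destr_cat G (sections G))) F"
    and s: "s \<in> sections G" and t: "t \<in> sections G" and u: "u \<in> sections G"
    and g: "le_by g s t" and h: "le_by h t u" and x: "x \<in> carrier (ob F u)"
  shows "act F t s (fst t #> g) (act F u t (fst u #> h) x) = act F u s (fst u #> (h \<otimes> g)) x"
  using functorD(5)[OF F, of u t s "fst u #> h" "fst t #> g" x] s t u x le_by_mor[OF g] le_by_mor[OF h]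
    mor_comp[OF t u _ h] g by (simp add: le_by_def)

lemma destr_act_one:
  assumes F: "is_rmod_functor R (op_cat (destr_cat G (sections G))) F"
    and s: "s \<in> sections G" and x: "x \<in> carrier (ob F s)"
  shows "act F s s (fst s #> \<one>) x = x"
  using functorD(4)[OF F] s x by simp

lemma top_section: "top_section G \<in> sections G"
  using subgroup_self triv_subgroup by (auto simp: top_section_def sections_iff)

lemma le_top: "s \<in> sections G \<Longrightarrow> le_by \<one> s (top_section G)"
  using le_by_one sectionsD(4) subgroup.one_closed[OF sectionsD(2)] by (simp add: top_section_def)


lemma conj_subgroup:
  assumes V: "subgroup V G" and g: "g \<in> carrier G"
  shows "subgroup (conj_set G g V) G"
proof (rule subgroupI)
  have c: "v \<in> carrier G" if "v \<in> V" for v using that subgroup.subset[OF V] by auto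
  show "conj_set G g V \<subseteq> carrier G" by (rule conj_closed[OF g subgroup.subset[OF V]])
  show "conj_set G g V \<noteq> {}" using subgroup.one_closed[OF V] by (auto simp: conj_set_image)
  fix a assume "a \<in> conj_set G g V"
  then obtain v where v: "v \<in> V" "a = g \<otimes> v \<otimes> inv g" by (auto simp: conj_set_image)
  have "inv a = g \<otimes> inv v \<otimes> inv g" using v c g by (simp add: inv_mult_group m_assoc)
  then show "inv a \<in> conj_set G g V" using subgroup.m_inv_closed[OF V v(1)] by (auto simp: conj_set_image)
next
  have c: "v \<in> carrier G" if "v \<in> V" for v using that subgroup.subset[OF V] by auto
  fix a b assume "a \<in> conj_set G g V" "b \<in> conj_set G g V"
  then obtain v w where v: "v \<in> V" "a = g \<otimes> v \<otimes> inv g" and w: "w \<in> V" "b = g \<otimes> w \<otimes> inv g"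
    unfolding conj_set_image by blast
  then show "a \<otimes> b \<in> conj_set G g V"
    using subgroup.m_closed[OF V v(1) w(1)] conj_mult[OF g c[OF v(1)] c[OF w(1)]] by (simp add: conj_set_image)
qed

lemma sect_conj_section:
  assumes s: "s \<in> sections G" and g: "g \<in> carrier G"
  shows "sect_conj G g s \<in> sections G"
proof -
  note D = sectionsD[OF s]
  have "u \<otimes> v \<otimes> inv u \<in> conj_set G g (snd s)" if uv: "u \<in> conj_set G g (fst s)" "v \<in> conj_set G g (snd s)" for u v
  proof -
    obtain a where a: "a \<in> fst s" "u = g \<otimes> a \<otimes> inv g" using uv(1) by (auto simp: conj_set_image)
    obtain b where b: "b \<in> snd s" "v = g \<otimes> b \<otimes> inv g" using uv(2) by (auto simp: conj_set_image)
    have c: "a \<in> carrier G" "b \<in> carrier G" using a b D(4,5) by auto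
    have "inv u = g \<otimes> inv a \<otimes> inv g" using a(2) c g by (simp add: inv_mult_group m_assoc)
    then have "u \<otimes> v \<otimes> inv u = g \<otimes> (a \<otimes> b \<otimes> inv a) \<otimes> inv g"
      using conj_mult[OF g c] conj_mult[OF g m_closed[OF c] inv_closed[OF c(1)]] a(2) b(2) by simp
    then show ?thesis using D(6)[OF a(1) b(1)] by (simp add: conj_set_image)
  qed
  then show ?thesis
    using conj_subgroup[OF D(1) g] conj_subgroup[OF D(2) g] conj_set_mono[OF D(3), of g]
    by (simp add: sect_conj_def sections_iff)
qed

lemma normalizer_iff:
  assumes "H \<subseteq> carrier G"
  shows "g \<in> normalizer G H \<longleftrightarrow> g \<in> carrier G \<and> conj_set G g H = H"
  using assms by (simp add: normalizer_def stabilizer_def conj_set_def)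

lemma norm_section_section:
  assumes H: "subgroup H G" shows "norm_section G H \<in> sections G"
proof -
  have c: "H \<subseteq> carrier G" by (rule subgroup.subset[OF H])
  have "g \<in> normalizer G H" if g: "g \<in> H" for g
  proof -
    have gc: "g \<in> carrier G" "inv g \<in> H" using g c subgroup.m_inv_closed[OF H g] by auto
    have 1: "conj_set G h H \<subseteq> H" if "h \<in> H" for h
      using that subgroup.m_closed[OF H] subgroup.m_inv_closed[OF H] by (auto simp: conj_set_image)
    have "H \<subseteq> conj_set G g H"
      using conj_set_mono[OF 1[OF gc(2)], of g] conj_set_inv(2)[OF gc(1) c] by simp
    then show ?thesis using 1[OF g] gc(1) by (auto simp: normalizer_iff[OF c])
  qed
  moreover have "u \<otimes> v \<otimes> inv u \<in> H" if "u \<in> normalizer G H" "v \<in> H" for u v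
    using that by (auto simp: normalizer_iff[OF c] conj_set_image)
  ultimately show ?thesis using H normalizer_imp_subgroup[OF c] by (auto simp: norm_section_def sections_iff)
qed

lemma norm_section_simps [simp]: "fst (norm_section G H) = normalizer G H" "snd (norm_section G H) = H"
  by (simp_all add: norm_section_def)

text \<open>Hence \<open>(N\<^sub>G(V), V)\<close> is the largest section with bottom \<open>V\<close>.\<close>

lemma section_normalizes:
  assumes s: "s \<in> sections G" shows "fst s \<subseteq> normalizer G (snd s)"
proof
  note D = sectionsD[OF s]
  fix u assume u: "u \<in> fst s"
  have uc: "u \<in> carrier G" "inv u \<in> fst s" using u D(4) subgroup.m_inv_closed[OF D(1) u] by auto
  have 1: "conj_set G h (snd s) \<subseteq> snd s" if "h \<in> fst s" for h
    using D(6)[OF that] by (auto simp: conj_set_image)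
  have "snd s \<subseteq> conj_set G u (snd s)"
    using conj_set_mono[OF 1[OF uc(2)], of u] conj_set_inv(2)[OF uc(1) D(5)] by simp
  then show "u \<in> normalizer G (snd s)" using 1[OF u] uc(1) by (auto simp: normalizer_iff[OF D(5)])
qed

lemma le_norm_section: "s \<in> sections G \<Longrightarrow> le_by \<one> s (norm_section G (snd s))"
  using section_normalizes by (simp add: le_by_one)

lemma norm_section_star: "H \<in> nontrivial_subgroups G \<Longrightarrow> norm_section G H \<in> sections_star G"
  using norm_section_section by (simp add: sections_star_iff nontrivial_subgroups_def)

lemma snd_nontrivial: "s \<in> sections_star G \<Longrightarrow> snd s \<in> nontrivial_subgroups G"
  using sectionsD(2) by (simp add: sections_star_iff nontrivial_subgroups_def)

lemma conj_nontrivial: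
  assumes H: "H \<in> nontrivial_subgroups G" and g: "g \<in> carrier G"
  shows "conj_set G g H \<in> nontrivial_subgroups G"
proof -
  have sH: "subgroup H G" "H \<noteq> {\<one>}" using H by (auto simp: nontrivial_subgroups_def)
  have "conj_set G g H \<noteq> {\<one>}"
  proof
    assume e: "conj_set G g H = {\<one>}"
    have "H = conj_set G (inv g) {\<one>}" using conj_set_inv(1)[OF g subgroup.subset[OF sH(1)]] e by simp
    then show False using sH(2) g by (simp add: conj_set_image)
  qed
  then show ?thesis using conj_subgroup[OF sH(1) g] by (simp add: nontrivial_subgroups_def)
qed

lemma conj_norm_le:
  assumes H: "subgroup H G" and g: "g \<in> carrier G"
  shows "le_by (inv g) (norm_section G (conj_set G g H)) (norm_section G H)"
proof -
  have c: "H \<subseteq> carrier G" by (rule subgroup.subset[OF H])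
  have "conj_set G (inv g) (normalizer G (conj_set G g H)) \<subseteq> normalizer G H"
  proof
    fix y assume "y \<in> conj_set G (inv g) (normalizer G (conj_set G g H))"
    then obtain z where z: "z \<in> normalizer G (conj_set G g H)" "y = inv g \<otimes> z \<otimes> g"
      using g by (auto simp: conj_set_image)
    have zc: "z \<in> carrier G" "conj_set G z (conj_set G g H) = conj_set G g H"
      using z(1) normalizer_iff[OF conj_closed[OF g c]] by auto
    have "conj_set G y H = conj_set G (inv g) (conj_set G z (conj_set G g H))"
      using z(2) zc(1) g c conj_closed[OF g c] by (simp add: conj_set_comp m_assoc)
    also have "\<dots> = H" using zc(2) conj_set_inv(1)[OF g c] by simp
    finally show "y \<in> normalizer G H" using z(2) zc(1) g by (simp add: normalizer_iff[OF c])
  qed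
  then show ?thesis
    using g conj_set_inv(1)[OF g c] by (simp add: le_by_iff[OF norm_section_section[OF conj_subgroup[OF H g]]])
qed

text \<open>A compatible family on the sections is determined by its values at the sections \<open>(N\<^sub>G(H), H)\<close>, from which
  the others arise by restriction. These two maps are inverse to each other between the limit and the
  gluing data.\<close>

definition gluing_family :: "('a sect \<Rightarrow> 'b) \<Rightarrow> 'a set \<Rightarrow> 'b" where
  "gluing_family f = (\<lambda>H\<in>nontrivial_subgroups G. f (norm_section G H))"

definition gluing_cone :: "('a sect, 'a set, 'r, 'b) rmod_functor \<Rightarrow> ('a set \<Rightarrow> 'b) \<Rightarrow> 'a sect \<Rightarrow> 'b" where
  "gluing_cone F g = (\<lambda>s\<in>sections_star G. defres G F (norm_section G (snd s)) s (g (snd s)))"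

lemma defres_mor: "defres G F t s = act F t s (fst t #> \<one>)"
  by (simp add: defres_def)

lemma gluing_carrier:
  "f \<in> carrier (gluing_module G F) \<longleftrightarrow>
     f \<in> (\<Pi>\<^sub>E H\<in>nontrivial_subgroups G. carrier (ob F (norm_section G H))) \<and>
     (\<forall>H\<in>nontrivial_subgroups G. \<forall>g\<in>carrier G.
       act F (norm_section G H) (norm_section G (conj_set G g H)) (normalizer G H #> inv g) (f H) = f (conj_set G g H)) \<and>
     (\<forall>H\<in>nontrivial_subgroups G. \<forall>K\<in>nontrivial_subgroups G. K \<lhd> G\<lparr>carrier := H\<rparr> \<longrightarrow>
       defres G F (norm_section G K) (normalizer G H \<inter> normalizer G K, H) (f K) =
       defres G F (norm_section G H) (normalizer G H \<inter> normalizer G K, H) (f H))"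
  by (simp add: gluing_module_def Let_def)

text \<open>The two conditions on a gluing data are instances of compatibility: the conjugation
  morphism between the two normaliser sections, and the restrictions of the sections of \<open>K\<close> and \<open>H\<close>
  to their common lower bound \<open>(N\<^sub>G(H) \<inter> N\<^sub>G(K), H)\<close>.\<close>

lemma gluing_family_gluing:
  assumes F: "is_rmod_functor R (op_cat (destr_cat G (sections G))) F"
    and f: "f \<in> carrier (lim_module (op_cat (destr_cat G (sections_star G))) F)"
  shows "gluing_family f \<in> carrier (gluing_module G F)"
proof -
  have fc: "f s \<in> carrier (ob F s)" if "s \<in> sections_star G" for s
    using f that by (auto simp: lim_module_carrier)
  have fa: "act F t s (fst t #> g) (f t) = f s" if "s \<in> sections_star G" "t \<in> sections_star G" "le_by g s t" for s t g
    using f that le_by_mor[OF that(3)] unfolding lim_module_carrier op_cat_simps destr_cat_simps by blast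
  show ?thesis unfolding gluing_carrier
  proof (intro conjI ballI impI)
    show "gluing_family f \<in> (\<Pi>\<^sub>E H\<in>nontrivial_subgroups G. carrier (ob F (norm_section G H)))"
      using fc[OF norm_section_star] by (simp add: gluing_family_def)
  next
    fix H g assume H: "H \<in> nontrivial_subgroups G" and g: "g \<in> carrier G"
    have "subgroup H G" using H by (simp add: nontrivial_subgroups_def)
    then show "act F (norm_section G H) (norm_section G (conj_set G g H)) (normalizer G H #> inv g) (gluing_family f H) =
        gluing_family f (conj_set G g H)"
      using fa[OF norm_section_star[OF conj_nontrivial[OF H g]] norm_section_star[OF H] conj_norm_le] H g
        conj_nontrivial[OF H g] by (simp add: gluing_family_def)
  next
    fix H K assume H: "H \<in> nontrivial_subgroups G" and K: "K \<in> nontrivial_subgroups G" and KH: "K \<lhd> G\<lparr>carrier := H\<rparr>"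
    have sH: "subgroup H G" "H \<noteq> {\<one>}" and sK: "subgroup K G" using H K by (auto simp: nontrivial_subgroups_def)
    have HK: "(H, K) \<in> sections G" using sH(1) KH by (simp add: sections_def)
    let ?s = "(normalizer G H \<inter> normalizer G K, H)"
    have "?s \<in> sections G"
      using sectionsD[OF norm_section_section[OF sH(1)]] section_normalizes[OF HK]
        subgroups_Inter_pair[OF sectionsD(1)[OF norm_section_section[OF sH(1)]] sectionsD(1)[OF norm_section_section[OF sK]]]
      by (simp add: sections_iff)
    then have s: "?s \<in> sections_star G" "?s \<in> sections G" using sH(2) by (simp_all add: sections_star_iff)
    have KsH: "K \<subseteq> H" using sectionsD(3)[OF HK] by simp
    have "f ?s = act F (norm_section G K) ?s (fst (norm_section G K) #> \<one>) (f (norm_section G K))"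
      by (rule fa[OF s(1) norm_section_star[OF K], symmetric]) (use KsH le_by_one[OF s(2)] in simp)
    moreover have "f ?s = act F (norm_section G H) ?s (fst (norm_section G H) #> \<one>) (f (norm_section G H))"
      by (rule fa[OF s(1) norm_section_star[OF H], symmetric]) (use le_by_one[OF s(2)] in simp)
    ultimately show "defres G F (norm_section G K) ?s (gluing_family f K) = defres G F (norm_section G H) ?s (gluing_family f H)"
      using H K by (simp add: gluing_family_def defres_mor)
  qed
qed

lemma gluing_cone_family:
  assumes f: "f \<in> carrier (lim_module (op_cat (destr_cat G (sections_star G))) F)"
  shows "gluing_cone F (gluing_family f) = f"
proof
  fix s
  show "gluing_cone F (gluing_family f) s = f s"
  proof (cases "s \<in> sections_star G")
    case True
    have "s \<in> sections G" using True by (simp add: sections_star_iff)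
    then have "act F (norm_section G (snd s)) s (fst (norm_section G (snd s)) #> \<one>) (f (norm_section G (snd s))) = f s"
      using f le_by_mor[OF le_norm_section] norm_section_star[OF snd_nontrivial[OF True]] True
      unfolding lim_module_carrier op_cat_simps destr_cat_simps by blast
    then show ?thesis using True snd_nontrivial[OF True] by (simp add: gluing_cone_def gluing_family_def defres_mor)
  next
    case False
    have ext: "f \<in> extensional (sections_star G)" using f by (auto simp: lim_module_carrier PiE_def)
    show ?thesis using extensional_arb[OF ext False] False by (simp add: gluing_cone_def)
  qed
qed

text \<open>A morphism given by \<open>a\<close> from \<open>t = (W, V)\<close> to \<open>s = (U, L)\<close> factors through the conjugate section
  \<open>t' = (W', V')\<close> of \<open>t\<close> by \<open>a\<close>, for which \<open>L \<le> V' \<le> W' \<le> U\<close>. Then \<open>L\<close> is normal in \<open>V'\<close>, and \<open>t'\<close> lies below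
  \<open>(N\<^sub>G(V') \<inter> N\<^sub>G(L), V')\<close>. On that section the gluing condition identifies the element that
  comes from \<open>L\<close> with the one that comes from \<open>V'\<close>, and the conjugation condition replaces \<open>V'\<close> by \<open>V\<close>.\<close>

lemma gluing_cone_lim:
  assumes F: "is_rmod_functor R (op_cat (destr_cat G (sections G))) F"
    and g: "g \<in> carrier (gluing_module G F)"
  shows "gluing_cone F g \<in> carrier (lim_module (op_cat (destr_cat G (sections_star G))) F)"
    and "gluing_family (gluing_cone F g) = g"
proof -
  have sec: "s \<in> sections G" if "s \<in> sections_star G" for s using that by (simp add: sections_star_iff)
  have ns: "norm_section G H \<in> sections G" if "H \<in> nontrivial_subgroups G" for H
    using sec[OF norm_section_star[OF that]] .
  have gc: "g H \<in> carrier (ob F (norm_section G H))" if "H \<in> nontrivial_subgroups G" for H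
    using g that by (auto simp: gluing_carrier)
  have gcone: "gluing_cone F g s = act F (norm_section G (snd s)) s (normalizer G (snd s) #> \<one>) (g (snd s))"
    if "s \<in> sections_star G" for s using that by (simp add: gluing_cone_def defres_mor)
  note g2 = g[unfolded gluing_carrier, THEN conjunct2, THEN conjunct1]
  note g3 = g[unfolded gluing_carrier, THEN conjunct2, THEN conjunct2]
  note ac = destr_act_comp[OF F]
  show fam: "gluing_family (gluing_cone F g) = g"
  proof
    fix H
    show "gluing_family (gluing_cone F g) H = g H"
    proof (cases "H \<in> nontrivial_subgroups G")
      case True
      then show ?thesis using gcone[OF norm_section_star[OF True]] destr_act_one[OF F ns[OF True] gc[OF True]]
        by (simp add: gluing_family_def)
    next
      case False
      have ext: "g \<in> extensional (nontrivial_subgroups G)" using g by (auto simp: gluing_carrier PiE_def)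
      show ?thesis using extensional_arb[OF ext False] False by (simp add: gluing_family_def)
    qed
  qed
  show "gluing_cone F g \<in> carrier (lim_module (op_cat (destr_cat G (sections_star G))) F)"
    unfolding lim_module_carrier op_cat_simps destr_cat_simps
  proof (intro conjI ballI)
    have "gluing_cone F g s \<in> carrier (ob F s)" if s: "s \<in> sections_star G" for s
      using destr_act(2)[OF F sec[OF s] ns[OF snd_nontrivial[OF s]] le_norm_section[OF sec[OF s]] gc[OF snd_nontrivial[OF s]]]
        gcone[OF s] by simp
    then show "gluing_cone F g \<in> (\<Pi>\<^sub>E s\<in>sections_star G. carrier (ob F s))"
      by (auto simp: PiE_def gluing_cone_def extensional_def)
  next
    fix s t f assume s: "s \<in> sections_star G" and t: "t \<in> sections_star G" and "f \<in> Hom (destr_cat G (sections_star G)) t s"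
    then obtain a where a: "le_by a t s" "f = fst s #> a" unfolding destr_hom_iff by blast
    note S = sec[OF s] and T = sec[OF t]
    have ac': "a \<in> carrier G" using a(1) by (simp add: le_by_def)
    define L where "L = snd s"
    define V where "V = snd t"
    define V' where "V' = conj_set G a V"
    define t' where "t' = sect_conj G a t"
    have L: "L \<in> nontrivial_subgroups G" and V: "V \<in> nontrivial_subgroups G"
      using snd_nontrivial s t by (auto simp: L_def V_def)
    have V': "V' \<in> nontrivial_subgroups G" unfolding V'_def by (rule conj_nontrivial[OF V ac'])
    have T': "t' \<in> sections G" unfolding t'_def by (rule sect_conj_section[OF T ac'])
    have t': "fst t' = conj_set G a (fst t)" "snd t' = V'" by (simp_all add: t'_def V'_def V_def sect_conj_def)
    have les: "L \<subseteq> V'" "fst t' \<subseteq> fst s" using a(1) by (auto simp: le_by_iff[OF T] t' L_def V'_def V_def)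
    have U'N: "fst t' \<subseteq> normalizer G L" using les(2) section_normalizes[OF S] by (auto simp: L_def)
    have U'N': "fst t' \<subseteq> normalizer G V'" using section_normalizes[OF T'] t'(2) by simp
    have VU': "V' \<subseteq> fst t'" using sectionsD(3)[OF T'] t'(2) by simp
    have sV': "subgroup V' G" and sL: "subgroup L G" and sV: "subgroup V G" and neV': "V' \<noteq> {\<one>}"
      using V' L V by (auto simp: nontrivial_subgroups_def)
    let ?NL = "norm_section G L" and ?NV = "norm_section G V" and ?NV' = "norm_section G V'"
    let ?w = "(normalizer G V' \<inter> normalizer G L, V')"
    have W: "?w \<in> sections G"
      using sectionsD[OF ns[OF V']] VU' U'N
        subgroups_Inter_pair[OF sectionsD(1)[OF ns[OF V']] sectionsD(1)[OF ns[OF L]]]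
      by (auto simp: sections_iff)
    have LV: "L \<lhd> G\<lparr>carrier := V'\<rparr>"
    proof -
      have "u \<otimes> v \<otimes> inv u \<in> L" if "u \<in> V'" "v \<in> L" for u v
        using sectionsD(6)[OF ns[OF L], of u v] that VU' U'N by auto
      then have "(V', L) \<in> sections G" using sV' sL les(1) by (simp add: sections_iff)
      then show ?thesis by (simp add: sections_def)
    qed
    have glue: "act F ?NL ?w (normalizer G L #> \<one>) (g L) = act F ?NV' ?w (normalizer G V' #> \<one>) (g V')"
      using bspec[OF bspec[OF g3 V'] L, THEN mp, OF LV] unfolding defres_mor norm_section_simps .
    have conj: "act F ?NV ?NV' (normalizer G V #> inv a) (g V) = g V'"
      unfolding V'_def by (rule bspec[OF bspec[OF g2 V] ac'])
    have le1: "le_by \<one> t' ?w" using les U'N U'N' by (simp add: le_by_one[OF T'] t')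
    have le2: "le_by \<one> ?w ?NL" using les by (simp add: le_by_one[OF W])
    have le3: "le_by \<one> ?w ?NV'" by (simp add: le_by_one[OF W])
    have le4: "le_by \<one> t' ?NV'" using U'N' by (simp add: le_by_one[OF T'] t')
    have le5: "le_by a t t'" using ac' by (simp add: le_by_iff[OF T] t' V'_def V_def)
    have le6: "le_by \<one> t' ?NL" using les U'N by (simp add: le_by_one[OF T'] t')
    have le7: "le_by (inv a) ?NV' ?NV" unfolding V'_def by (rule conj_norm_le[OF sV ac'])
    have le8: "le_by \<one> s ?NL" using le_norm_section[OF S] by (simp add: L_def)
    have le9: "le_by (inv a) t' ?NV" using le_by_comp[OF T' ns[OF V'] le4 le7] ac' by simp
    have A1: "act F ?NL t' (normalizer G L #> \<one>) (g L) = act F ?NV' t' (normalizer G V' #> \<one>) (g V')"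
      using ac[OF T' W ns[OF L] le1 le2 gc[OF L]] ac[OF T' W ns[OF V'] le1 le3 gc[OF V']] glue by simp
    have "act F s t f (gluing_cone F g s) = act F ?NL t (normalizer G L #> a) (g L)"
      using ac[OF T S ns[OF L] a(1) le8 gc[OF L]] gcone[OF s] a(2) ac' by (simp add: L_def)
    also have "\<dots> = act F t' t (fst t' #> a) (act F ?NL t' (normalizer G L #> \<one>) (g L))"
      using ac[OF T T' ns[OF L] le5 le6 gc[OF L]] ac' by simp
    also have "\<dots> = act F t' t (fst t' #> a) (act F ?NV' t' (normalizer G V' #> \<one>) (act F ?NV ?NV' (normalizer G V #> inv a) (g V)))"
      unfolding A1 conj ..
    also have "act F ?NV' t' (normalizer G V' #> \<one>) (act F ?NV ?NV' (normalizer G V #> inv a) (g V)) =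
        act F ?NV t' (normalizer G V #> inv a) (g V)"
      using ac[OF T' ns[OF V'] ns[OF V] le4 le7 gc[OF V]] ac' by simp
    also have "act F t' t (fst t' #> a) (act F ?NV t' (normalizer G V #> inv a) (g V)) = act F ?NV t (normalizer G V #> \<one>) (g V)"
      using ac[OF T T' ns[OF V] le5 le9 gc[OF V]] ac' by simp
    also have "\<dots> = gluing_cone F g t" using gcone[OF t] by (simp add: V_def)
    finally show "act F s t f (gluing_cone F g s) = gluing_cone F g t" .
  qed
qed

lemma to_lim_hom:
  assumes R: "cring R" and F: "is_rmod_functor R (op_cat (destr_cat G (sections G))) F"
  shows "to_lim G (sections_star G) F \<in> mod_hom R (ob F (top_section G)) (lim_module (op_cat (destr_cat G (sections_star G))) F)"
proof (rule mod_homI)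
  have sec: "s \<in> sections G" if "s \<in> sections_star G" for s using that by (simp add: sections_star_iff)
  note h = destr_act[OF F sec top_section le_top[OF sec]]
  fix x assume x: "x \<in> carrier (ob F (top_section G))"
  show "to_lim G (sections_star G) F x \<in> carrier (lim_module (op_cat (destr_cat G (sections_star G))) F)"
    unfolding lim_module_carrier op_cat_simps destr_cat_simps
  proof (intro conjI ballI)
    show "to_lim G (sections_star G) F x \<in> (\<Pi>\<^sub>E s\<in>sections_star G. carrier (ob F s))"
      using h(2)[OF _ _ x] by (simp add: to_lim_def defres_mor)
    fix s t f assume s: "s \<in> sections_star G" and t: "t \<in> sections_star G" and "f \<in> Hom (destr_cat G (sections_star G)) t s"
    then obtain a where a: "le_by a t s" "f = fst s #> a" unfolding destr_hom_iff by blast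
    have "a \<in> carrier G" using a(1) by (simp add: le_by_def)
    moreover from this have "carrier G #> a = carrier G #> \<one>"
      using coset_eq_iff[OF subgroup_self] by (metis inv_closed l_inv one_closed)
    ultimately show "act F s t f (to_lim G (sections_star G) F x s) = to_lim G (sections_star G) F x t"
      using destr_act_comp[OF F sec[OF t] sec[OF s] top_section a(1) le_top[OF sec[OF s]] x] a(2) s t
      by (simp add: to_lim_def defres_mor top_section_def)
  qed
next
  have sec: "s \<in> sections G" if "s \<in> sections_star G" for s using that by (simp add: sections_star_iff)
  note h = destr_act(1)[OF F sec top_section le_top[OF sec]]
  show "to_lim G (sections_star G) F (x \<oplus>\<^bsub>ob F (top_section G)\<^esub> y) =
    to_lim G (sections_star G) F x \<oplus>\<^bsub>lim_module (op_cat (destr_cat G (sections_star G))) F\<^esub> to_lim G (sections_star G) F y"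
    if "x \<in> carrier (ob F (top_section G))" "y \<in> carrier (ob F (top_section G))" for x y
    using that mod_homD(2)[OF h] by (auto simp: to_lim_def defres_mor fun_eq_iff)
  show "to_lim G (sections_star G) F (r \<odot>\<^bsub>ob F (top_section G)\<^esub> x) =
    r \<odot>\<^bsub>lim_module (op_cat (destr_cat G (sections_star G))) F\<^esub> to_lim G (sections_star G) F x"
    if "r \<in> carrier R" "x \<in> carrier (ob F (top_section G))" for r x
    using that mod_homD(3)[OF h] by (auto simp: to_lim_def defres_mor fun_eq_iff)
qed

theorem Obs_iso_cohom_0:
  assumes R: "cring R" and F: "is_rmod_functor R (op_cat (destr_cat G (sections G))) F"
  shows "mod_iso R (Obs G F) (destr_cohom_0 G (sections_star G) F)"
proof -
  let ?C = "op_cat (destr_cat G (sections_star G))" and ?T = "top_section G"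
  let ?L = "lim_module ?C F"
  let ?P = "prod_module (nontrivial_subgroups G) (\<lambda>H. ob F (norm_section G H))"
  let ?G = "gluing_module G F"
  let ?ev = "\<lambda>a. \<lambda>H\<in>nontrivial_subgroups G. defres G F ?T (norm_section G H) a"
  have sub: "sections_star G \<subseteq> sections G" using sections_star_iff by blast
  have FC: "is_rmod_functor R ?C F" by (rule destr_functor_restrict[OF F sub])
  have mL: "module R ?L" by (rule lim_module_module[OF R FC])
  have mT: "module R (ob F ?T)" using functorD(1)[OF F] top_section by simp
  have mP: "module R ?P"
  proof (rule prod_module_module[OF R])
    fix H assume "H \<in> nontrivial_subgroups G"
    then show "module R (ob F (norm_section G H))" using functorD(1)[OF FC] norm_section_star by simp
  qed
  have fam: "gluing_family \<in> mod_hom R ?L ?P"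
  proof (rule mod_homI)
    fix f assume "f \<in> carrier ?L"
    then show "gluing_family f \<in> carrier ?P" using gluing_family_gluing[OF F] by (auto simp: gluing_carrier)
  qed (auto simp: gluing_family_def fun_eq_iff norm_section_star)
  have tl: "to_lim G (sections_star G) F \<in> mod_hom R (ob F ?T) ?L" by (rule to_lim_hom[OF R F])
  have Gc: "carrier ?G = gluing_family ` carrier ?L"
  proof (intro equalityI subsetI)
    fix g assume g: "g \<in> carrier ?G"
    show "g \<in> gluing_family ` carrier ?L"
      using gluing_cone_lim[OF F g] by (metis imageI)
  qed (use gluing_family_gluing[OF F] in blast)
  have sG: "submodule (carrier ?G) R ?P" unfolding Gc by (rule mod_hom_image_submodule[OF fam mL mP])
  have eqG: "?G = ?P\<lparr>carrier := carrier ?G\<rparr>" by (simp add: gluing_module_def Let_def)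
  have mG: "module R ?G" by (subst eqG) (rule submodule.submodule_is_module[OF sG mP])
  have ev: "?ev a = gluing_family (to_lim G (sections_star G) F a)" for a
    by (auto simp: gluing_family_def to_lim_def norm_section_star fun_eq_iff)
  have tlc: "to_lim G (sections_star G) F a \<in> carrier ?L" if "a \<in> carrier (ob F ?T)" for a
    by (rule mod_homD(1)[OF tl that])
  have evh: "?ev \<in> mod_hom R (ob F ?T) ?P" unfolding ev by (rule mod_hom_comp[OF tl fam])
  have "?ev ` carrier (ob F ?T) \<subseteq> carrier ?G" unfolding ev Gc using tlc by blast
  then have sN: "submodule (?ev ` carrier (ob F ?T)) R ?G"
    using submodule_restrict[OF mP sG mod_hom_image_submodule[OF evh mT mP]] eqG by metis
  have sN': "submodule (to_lim G (sections_star G) F ` carrier (ob F ?T)) R ?L"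
    by (rule mod_hom_image_submodule[OF tl mT mL])
  have cone: "gluing_cone F (gluing_family f) = f" if "f \<in> carrier ?L" for f by (rule gluing_cone_family[OF that])
  have famh: "gluing_family f \<oplus>\<^bsub>?G\<^esub> gluing_family f' = gluing_family (f \<oplus>\<^bsub>?L\<^esub> f')"
    "r \<in> carrier R \<Longrightarrow> r \<odot>\<^bsub>?G\<^esub> gluing_family f = gluing_family (r \<odot>\<^bsub>?L\<^esub> f)"
    if "f \<in> carrier ?L" "f' \<in> carrier ?L" for f f' r
  proof -
    have "x \<oplus>\<^bsub>?G\<^esub> y = x \<oplus>\<^bsub>?P\<^esub> y" "r \<odot>\<^bsub>?G\<^esub> x = r \<odot>\<^bsub>?P\<^esub> x" for x y
      by (simp_all add: gluing_module_def Let_def)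
    then show "gluing_family f \<oplus>\<^bsub>?G\<^esub> gluing_family f' = gluing_family (f \<oplus>\<^bsub>?L\<^esub> f')"
      "r \<in> carrier R \<Longrightarrow> r \<odot>\<^bsub>?G\<^esub> gluing_family f = gluing_family (r \<odot>\<^bsub>?L\<^esub> f)"
      using mod_homD(2)[OF fam that] mod_homD(3)[OF fam _ that(1)] by (simp_all only:)
  qed
  interpret L: module R ?L by (rule mL)
  have conh: "gluing_cone F \<in> mod_hom R ?G ?L"
  proof (rule mod_homI)
    fix g assume "g \<in> carrier ?G" then show "gluing_cone F g \<in> carrier ?L" by (rule gluing_cone_lim[OF F])
  next
    fix g g' assume "g \<in> carrier ?G" "g' \<in> carrier ?G"
    then obtain f f' where f: "f \<in> carrier ?L" "g = gluing_family f" "f' \<in> carrier ?L" "g' = gluing_family f'"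
      unfolding Gc by blast
    show "gluing_cone F (g \<oplus>\<^bsub>?G\<^esub> g') = gluing_cone F g \<oplus>\<^bsub>?L\<^esub> gluing_cone F g'"
      unfolding f(2,4) famh(1)[OF f(1,3)] cone[OF f(1)] cone[OF f(3)] cone[OF L.M.a_closed[OF f(1,3)]] ..
  next
    fix r g assume r: "r \<in> carrier R" and "g \<in> carrier ?G"
    then obtain f where f: "f \<in> carrier ?L" "g = gluing_family f" unfolding Gc by blast
    show "gluing_cone F (r \<odot>\<^bsub>?G\<^esub> g) = r \<odot>\<^bsub>?L\<^esub> gluing_cone F g"
      unfolding f(2) famh(2)[OF f(1) f(1) r] cone[OF f(1)] cone[OF L.smult_closed[OF r f(1)]] ..
  qed
  show ?thesis unfolding Obs_def destr_cohom_0_def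
  proof (rule quot_mod_iso'[OF mG sN mL sN' conh])
    fix g assume "g \<in> carrier ?G"
    then obtain f where f: "f \<in> carrier ?L" "g = gluing_family f" unfolding Gc by blast
    show "gluing_cone F g \<in> to_lim G (sections_star G) F ` carrier (ob F ?T) \<longleftrightarrow> g \<in> ?ev ` carrier (ob F ?T)"
    proof
      assume "gluing_cone F g \<in> to_lim G (sections_star G) F ` carrier (ob F ?T)"
      then obtain a where "a \<in> carrier (ob F ?T)" "f = to_lim G (sections_star G) F a"
        unfolding f(2) cone[OF f(1)] by (rule imageE)
      then show "g \<in> ?ev ` carrier (ob F ?T)" unfolding ev f(2) by (intro image_eqI) simp_all
    next
      assume "g \<in> ?ev ` carrier (ob F ?T)"
      then obtain a where a: "a \<in> carrier (ob F ?T)" "g = gluing_family (to_lim G (sections_star G) F a)"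
        unfolding ev by (rule imageE)
      show "gluing_cone F g \<in> to_lim G (sections_star G) F ` carrier (ob F ?T)"
        unfolding a(2) cone[OF tlc[OF a(1)]] by (rule imageI[OF a(1)])
    qed
  next
    fix f assume f: "f \<in> carrier ?L"
    have "gluing_cone F (gluing_family f) = f \<oplus>\<^bsub>?L\<^esub> \<zero>\<^bsub>?L\<^esub>" unfolding cone[OF f] using f by (rule L.M.r_zero[symmetric])
    then show "\<exists>g\<in>carrier ?G. \<exists>c\<in>to_lim G (sections_star G) F ` carrier (ob F ?T). gluing_cone F g = f \<oplus>\<^bsub>?L\<^esub> c"
      using submodule_simps(2)[OF mL sN'] gluing_family_gluing[OF F f] by (intro bexI)
  qed
qed

end


section \<open>Bisets\<close>

lemma finite_bisetD:
  assumes "finite_biset K H X"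
  shows "finite (pts X)"
    and "\<And>k x. k \<in> carrier K \<Longrightarrow> x \<in> pts X \<Longrightarrow> lact X k x \<in> pts X"
    and "\<And>h x. h \<in> carrier H \<Longrightarrow> x \<in> pts X \<Longrightarrow> ract X x h \<in> pts X"
    and "\<And>x. x \<in> pts X \<Longrightarrow> lact X \<one>\<^bsub>K\<^esub> x = x" "\<And>x. x \<in> pts X \<Longrightarrow> ract X x \<one>\<^bsub>H\<^esub> = x"
    and "\<And>k k' x. k \<in> carrier K \<Longrightarrow> k' \<in> carrier K \<Longrightarrow> x \<in> pts X \<Longrightarrow> lact X (k \<otimes>\<^bsub>K\<^esub> k') x = lact X k (lact X k' x)"
    and "\<And>h h' x. h \<in> carrier H \<Longrightarrow> h' \<in> carrier H \<Longrightarrow> x \<in> pts X \<Longrightarrow> ract X x (h \<otimes>\<^bsub>H\<^esub> h') = ract X (ract X x h) h'"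
    and "\<And>k h x. k \<in> carrier K \<Longrightarrow> h \<in> carrier H \<Longrightarrow> x \<in> pts X \<Longrightarrow> ract X (lact X k x) h = lact X k (ract X x h)"
  using assms unfolding finite_biset_def by simp_all

lemma biset_isoI:
  assumes "bij_betw f (pts X) (pts Y)"
    and "\<And>k x. k \<in> carrier K \<Longrightarrow> x \<in> pts X \<Longrightarrow> f (lact X k x) = lact Y k (f x)"
    and "\<And>h x. h \<in> carrier H \<Longrightarrow> x \<in> pts X \<Longrightarrow> f (ract X x h) = ract Y (f x) h"
  shows "biset_iso K H X Y"
  unfolding biset_iso_def using assms by blast

definition biset_map :: "'k monoid \<Rightarrow> 'h monoid \<Rightarrow> ('k, 'h, 'x) biset \<Rightarrow> ('k, 'h, 'y) biset \<Rightarrow> ('x \<Rightarrow> 'y) \<Rightarrow> bool" where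
  "biset_map K H X Y f \<longleftrightarrow> bij_betw f (pts X) (pts Y) \<and>
     (\<forall>k\<in>carrier K. \<forall>x\<in>pts X. f (lact X k x) = lact Y k (f x)) \<and>
     (\<forall>h\<in>carrier H. \<forall>x\<in>pts X. f (ract X x h) = ract Y (f x) h)"

lemma biset_iso_iff: "biset_iso K H X Y \<longleftrightarrow> (\<exists>f. biset_map K H X Y f)"
  unfolding biset_iso_def biset_map_def by (rule refl)

lemma biset_mapD:
  assumes "biset_map K H X Y f"
  shows "bij_betw f (pts X) (pts Y)"
    "\<And>k x. k \<in> carrier K \<Longrightarrow> x \<in> pts X \<Longrightarrow> f (lact X k x) = lact Y k (f x)"
    "\<And>h x. h \<in> carrier H \<Longrightarrow> x \<in> pts X \<Longrightarrow> f (ract X x h) = ract Y (f x) h"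
  using assms unfolding biset_map_def by simp_all

lemma biset_iso_trans:
  assumes "biset_iso K H X Y" "biset_iso K H Y Z" shows "biset_iso K H X Z"
proof -
  obtain f where "biset_map K H X Y f" using assms(1) unfolding biset_iso_iff by (rule exE)
  note f = biset_mapD[OF this]
  obtain g where "biset_map K H Y Z g" using assms(2) unfolding biset_iso_iff by (rule exE)
  note g = biset_mapD[OF this]
  have fx: "f x \<in> pts Y" if "x \<in> pts X" for x by (rule bij_betwE[OF f(1), rule_format, OF that])
  show ?thesis
    by (rule biset_isoI[where f = "g \<circ> f"]) (simp_all add: bij_betw_trans[OF f(1) g(1)] f(2,3) g(2,3) fx)
qed

lemma biset_iso_sym:
  assumes X: "finite_biset K H X" and i: "biset_iso K H X Y" shows "biset_iso K H Y X"
proof -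
  obtain f where "biset_map K H X Y f" using i unfolding biset_iso_iff by (rule exE)
  note f = biset_mapD[OF this]
  let ?g = "inv_into (pts X) f"
  have g: "?g y \<in> pts X" "f (?g y) = y" if "y \<in> pts Y" for y
    using that f(1) by (auto simp: bij_betw_def inv_into_into f_inv_into_f)
  have gf: "?g (f x) = x" if "x \<in> pts X" for x using that f(1) by (simp add: bij_betw_def)
  show ?thesis
  proof (rule biset_isoI[where f = ?g])
    show "bij_betw ?g (pts Y) (pts X)" by (rule bij_betw_inv_into[OF f(1)])
    fix k y assume "k \<in> carrier K" "y \<in> pts Y"
    then show "?g (lact Y k y) = lact X k (?g y)"
      using f(2)[of k "?g y"] g[of y] gf[OF finite_bisetD(2)[OF X, of k "?g y"]] by simp
  next
    fix h y assume "h \<in> carrier H" "y \<in> pts Y"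
    then show "?g (ract Y y h) = ract X (?g y) h"
      using f(3)[of h "?g y"] g[of y] gf[OF finite_bisetD(3)[OF X, of h "?g y"]] by simp
  qed
qed

lemma biset_class_eq:
  assumes "finite_biset K H X" "biset_iso K H X Y" shows "biset_class K H X = biset_class K H Y"
  unfolding biset_class_def
proof (intro Collect_cong conj_cong refl iffI)
  show "biset_iso K H Y Z" if "biset_iso K H X Z" for Z :: "('a, 'b, nat) biset"
    by (rule biset_iso_trans[OF biset_iso_sym[OF assms] that])
  show "biset_iso K H X Z" if "biset_iso K H Y Z" for Z :: "('a, 'b, nat) biset"
    by (rule biset_iso_trans[OF assms(2) that])
qed

text \<open>Isomorphism classes consist of bisets of natural numbers; this provides the representatives.\<close>

lemma biset_nat_rep:
  fixes X :: "('k, 'h, 'x) biset"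
  assumes X: "finite_biset K H X"
  obtains X' :: "('k, 'h, nat) biset" where "finite_biset K H X'" "biset_iso K H X X'"
proof -
  obtain e :: "'x \<Rightarrow> nat" and n where e: "inj_on e (pts X)"
    using finite_imp_inj_to_nat_seg[OF finite_bisetD(1)[OF X]] by blast
  let ?d = "inv_into (pts X) e"
  let ?X' = "\<lparr>pts = e ` pts X, lact = (\<lambda>k n. e (lact X k (?d n))), ract = (\<lambda>n h. e (ract X (?d n) h))\<rparr>"
  have d: "?d (e x) = x" if "x \<in> pts X" for x using that e by simp
  have "finite_biset K H ?X'"
    unfolding finite_biset_def by (auto simp: finite_bisetD[OF X] d)
  moreover have "biset_iso K H X ?X'"
    by (rule biset_isoI[where f = e]) (use e d in \<open>simp_all add: bij_betw_def\<close>)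
  ultimately show ?thesis by (rule that)
qed

lemma biset_class_in_classes:
  fixes X :: "('k, 'h, 'x) biset"
  assumes "finite_biset K H X" shows "biset_class K H X \<in> biset_classes K H"
proof -
  obtain X' :: "('k, 'h, nat) biset" where X': "finite_biset K H X'" "biset_iso K H X X'"
    by (rule biset_nat_rep[OF assms])
  have "biset_class K H X = biset_class K H X'" by (rule biset_class_eq[OF assms X'(2)])
  then show ?thesis unfolding biset_classes_def using X'(1) by (intro CollectI exI conjI)
qed

lemma biset_class_some:
  fixes X :: "('k, 'h, 'x) biset"
  assumes X: "finite_biset K H X"
  shows "finite_biset K H (SOME Y. Y \<in> biset_class K H X)" "biset_iso K H X (SOME Y. Y \<in> biset_class K H X)"
proof -
  obtain X' :: "('k, 'h, nat) biset" where X': "finite_biset K H X'" "biset_iso K H X X'"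
    by (rule biset_nat_rep[OF X])
  then have "X' \<in> biset_class K H X" by (simp add: biset_class_def)
  then have "(SOME Y. Y \<in> biset_class K H X) \<in> biset_class K H X" by (rule someI)
  then show "finite_biset K H (SOME Y. Y \<in> biset_class K H X)" "biset_iso K H X (SOME Y. Y \<in> biset_class K H X)"
    by (simp_all add: biset_class_def)
qed

lemma biset_sum_finite:
  assumes X: "finite_biset K H X" and Y: "finite_biset K H Y"
  shows "finite_biset K H (biset_sum X Y)"
  unfolding finite_biset_def biset_sum_def by (auto simp: finite_bisetD[OF X] finite_bisetD[OF Y])

lemma biset_sum_iso:
  assumes "biset_iso K H X X'" "biset_iso K H Y Y'"
  shows "biset_iso K H (biset_sum X Y) (biset_sum X' Y')"
proof -
  obtain f where "biset_map K H X X' f" using assms(1) unfolding biset_iso_iff by (rule exE)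
  note f = biset_mapD[OF this]
  obtain g where "biset_map K H Y Y' g" using assms(2) unfolding biset_iso_iff by (rule exE)
  note g = biset_mapD[OF this]
  show ?thesis
  proof (rule biset_isoI[where f = "map_sum f g"])
    have fx: "f x = f x' \<longleftrightarrow> x = x'" if "x \<in> pts X" "x' \<in> pts X" for x x'
      by (rule inj_on_eq_iff[OF bij_betw_imp_inj_on[OF f(1)] that])
    have gy: "g x = g x' \<longleftrightarrow> x = x'" if "x \<in> pts Y" "x' \<in> pts Y" for x x'
      by (rule inj_on_eq_iff[OF bij_betw_imp_inj_on[OF g(1)] that])
    have "inj_on (map_sum f g) (Inl ` pts X \<union> Inr ` pts Y)"
    proof (rule inj_onI)
      fix z z' assume z: "z \<in> Inl ` pts X \<union> Inr ` pts Y" "z' \<in> Inl ` pts X \<union> Inr ` pts Y" "map_sum f g z = map_sum f g z'"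
      show "z = z'" using z fx gy by (cases z; cases z') (simp_all add: image_iff)
    qed
    moreover have "map_sum f g ` (Inl ` pts X \<union> Inr ` pts Y) = Inl ` pts X' \<union> Inr ` pts Y'"
      by (simp only: image_Un image_image map_sum.simps bij_betw_imp_surj_on[OF f(1), symmetric] bij_betw_imp_surj_on[OF g(1), symmetric])
    ultimately show "bij_betw (map_sum f g) (pts (biset_sum X Y)) (pts (biset_sum X' Y'))"
      by (simp add: bij_betw_def biset_sum_def)
  qed (auto simp: biset_sum_def f(2,3) g(2,3))
qed


subsection \<open>Tensor products of bisets\<close>

text \<open>The orbit of \<open>(x, y)\<close>, a point of the tensor product.\<close>

definition tensor_pt :: "'h monoid \<Rightarrow> ('k, 'h, 'x) biset \<Rightarrow> ('h, 'j, 'y) biset \<Rightarrow> 'x \<Rightarrow> 'y \<Rightarrow> ('x \<times> 'y) set" where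
  "tensor_pt H X Y x y = (\<lambda>h. (ract X x h, lact Y (inv\<^bsub>H\<^esub> h) y)) ` carrier H"

lemma tensor_pts: "pts (biset_tensor H X Y) = {tensor_pt H X Y x y | x y. x \<in> pts X \<and> y \<in> pts Y}"
  by (simp add: biset_tensor_def tensor_pt_def Setcompr_eq_image)

lemma tensor_ptsI: "x \<in> pts X \<Longrightarrow> y \<in> pts Y \<Longrightarrow> tensor_pt H X Y x y \<in> pts (biset_tensor H X Y)"
  unfolding tensor_pts by blast

lemma tensor_ptsE:
  assumes "T \<in> pts (biset_tensor H X Y)"
  obtains x y where "x \<in> pts X" "y \<in> pts Y" "T = tensor_pt H X Y x y"
  using assms unfolding tensor_pts by blast

lemma tensor_pt_lact:
  assumes "finite_biset K H X" "x \<in> pts X" "k \<in> carrier K"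
  shows "lact (biset_tensor H X Y) k (tensor_pt H X Y x y) = tensor_pt H X Y (lact X k x) y"
proof -
  have "(\<lambda>(x, y). (lact X k x, y)) ` tensor_pt H X Y x y = tensor_pt H X Y (lact X k x) y"
    unfolding tensor_pt_def image_image
    by (rule image_cong) (use finite_bisetD(8)[OF assms(1,3) _ assms(2)] in simp_all)
  then show ?thesis by (simp add: biset_tensor_def)
qed

lemma tensor_pt_ract:
  assumes "group H" "finite_biset H J Y" "y \<in> pts Y" "j \<in> carrier J"
  shows "ract (biset_tensor H X Y) (tensor_pt H X Y x y) j = tensor_pt H X Y x (ract Y y j)"
proof -
  interpret H: group H by fact
  have "(\<lambda>(x, y). (x, ract Y y j)) ` tensor_pt H X Y x y = tensor_pt H X Y x (ract Y y j)"
    unfolding tensor_pt_def image_image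
    by (rule image_cong) (use finite_bisetD(8)[OF assms(2) H.inv_closed assms(4,3)] in simp_all)
  then show ?thesis by (simp add: biset_tensor_def)
qed

lemma tensor_pt_balanced:
  assumes "group H" and X: "finite_biset K H X" and Y: "finite_biset H J Y" and x: "x \<in> pts X" and y: "y \<in> pts Y"
    and h: "h \<in> carrier H"
  shows "tensor_pt H X Y (ract X x h) y = tensor_pt H X Y x (lact Y h y)"
proof -
  interpret H: group H by fact
  have 1: "(ract X (ract X x h) a, lact Y (inv\<^bsub>H\<^esub> a) y) = (ract X x (h \<otimes>\<^bsub>H\<^esub> a), lact Y (inv\<^bsub>H\<^esub> (h \<otimes>\<^bsub>H\<^esub> a)) (lact Y h y))"
    if a: "a \<in> carrier H" for a
  proof -
    have "lact Y (inv\<^bsub>H\<^esub> (h \<otimes>\<^bsub>H\<^esub> a)) (lact Y h y) = lact Y (inv\<^bsub>H\<^esub> (h \<otimes>\<^bsub>H\<^esub> a) \<otimes>\<^bsub>H\<^esub> h) y"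
      using finite_bisetD(6)[OF Y _ h y] a h by simp
    also have "inv\<^bsub>H\<^esub> (h \<otimes>\<^bsub>H\<^esub> a) \<otimes>\<^bsub>H\<^esub> h = inv\<^bsub>H\<^esub> a" using a h by (simp add: H.inv_mult_group H.m_assoc)
    finally show ?thesis using finite_bisetD(7)[OF X h a x] by simp
  qed
  show ?thesis
  proof (rule equalityI; rule subsetI)
    fix z assume "z \<in> tensor_pt H X Y (ract X x h) y"
    then obtain a where "a \<in> carrier H" "z = (ract X (ract X x h) a, lact Y (inv\<^bsub>H\<^esub> a) y)" by (auto simp: tensor_pt_def)
    then have "z = (ract X x (h \<otimes>\<^bsub>H\<^esub> a), lact Y (inv\<^bsub>H\<^esub> (h \<otimes>\<^bsub>H\<^esub> a)) (lact Y h y))" "h \<otimes>\<^bsub>H\<^esub> a \<in> carrier H"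
      using 1[of a] h by simp_all
    then show "z \<in> tensor_pt H X Y x (lact Y h y)" unfolding tensor_pt_def by (rule image_eqI)
  next
    fix z assume "z \<in> tensor_pt H X Y x (lact Y h y)"
    then obtain b where b: "b \<in> carrier H" "z = (ract X x b, lact Y (inv\<^bsub>H\<^esub> b) (lact Y h y))" by (auto simp: tensor_pt_def)
    let ?a = "inv\<^bsub>H\<^esub> h \<otimes>\<^bsub>H\<^esub> b"
    have "?a \<in> carrier H" "h \<otimes>\<^bsub>H\<^esub> ?a = b" using b h by (simp_all add: H.m_assoc[symmetric])
    then have "?a \<in> carrier H" "z = (ract X (ract X x h) ?a, lact Y (inv\<^bsub>H\<^esub> ?a) y)" using 1[of ?a] b(2) by simp_all
    then show "z \<in> tensor_pt H X Y (ract X x h) y" unfolding tensor_pt_def by (intro image_eqI)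
  qed
qed

lemma tensor_pt_self:
  assumes "group H" "finite_biset K H X" "finite_biset H J Y" "x \<in> pts X" "y \<in> pts Y"
  shows "(x, y) \<in> tensor_pt H X Y x y"
proof -
  interpret H: group H by fact
  have "(x, y) = (ract X x \<one>\<^bsub>H\<^esub>, lact Y (inv\<^bsub>H\<^esub> \<one>\<^bsub>H\<^esub>) y)"
    using finite_bisetD(5)[OF assms(2,4)] finite_bisetD(4)[OF assms(3,5)] by simp
  then show ?thesis unfolding tensor_pt_def using H.one_closed by (rule image_eqI)
qed

lemma tensor_pt_eqD:
  assumes "group H" and X: "finite_biset K H X" and Y: "finite_biset H J Y"
    and xy: "x \<in> pts X" "y \<in> pts Y" "x' \<in> pts X" "y' \<in> pts Y" and eq: "tensor_pt H X Y x y = tensor_pt H X Y x' y'"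
  shows "\<exists>h\<in>carrier H. x' = ract X x h \<and> y = lact Y h y'"
proof -
  interpret H: group H by fact
  have "(x', y') \<in> tensor_pt H X Y x y" using tensor_pt_self[OF assms(1) X Y xy(3,4)] eq by simp
  then obtain h where h: "h \<in> carrier H" "x' = ract X x h" "y' = lact Y (inv\<^bsub>H\<^esub> h) y" by (auto simp: tensor_pt_def)
  have "lact Y h y' = y" using h finite_bisetD(6)[OF Y h(1) H.inv_closed[OF h(1)] xy(2)] finite_bisetD(4)[OF Y xy(2)] by simp
  then show ?thesis using h by blast
qed

lemma tensor_finite:
  assumes K: "group K" and H: "group H" and J: "group J" and X: "finite_biset K H X" and Y: "finite_biset H J Y"
  shows "finite_biset K J (biset_tensor H X Y)"
proof -
  interpret K: group K by (rule K)
  interpret J: group J by (rule J)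
  let ?T = "biset_tensor H X Y"
  note lac = tensor_pt_lact[OF X, where Y = Y] and rac = tensor_pt_ract[OF H Y, where X = X]
  note xc = finite_bisetD(2)[OF X] and yc = finite_bisetD(3)[OF Y]
  have el: "\<exists>x\<in>pts X. \<exists>y\<in>pts Y. T = tensor_pt H X Y x y" if "T \<in> pts ?T" for T
    using that unfolding tensor_pts by blast
  have inn: "tensor_pt H X Y x y \<in> pts ?T" if "x \<in> pts X" "y \<in> pts Y" for x y
    using that unfolding tensor_pts by blast
  have "finite ((\<lambda>(x, y). tensor_pt H X Y x y) ` (pts X \<times> pts Y))"
    using finite_bisetD(1)[OF X] finite_bisetD(1)[OF Y] by simp
  moreover have "pts ?T \<subseteq> (\<lambda>(x, y). tensor_pt H X Y x y) ` (pts X \<times> pts Y)"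
    unfolding tensor_pts by auto
  ultimately have fin: "finite (pts ?T)" by (rule finite_subset[rotated])
  have 1: "lact ?T k T \<in> pts ?T" if k: "k \<in> carrier K" and T: "T \<in> pts ?T" for k T
  proof -
    obtain x y where xy: "x \<in> pts X" "y \<in> pts Y" "T = tensor_pt H X Y x y" using el[OF T] by blast
    show ?thesis unfolding xy(3) lac[OF xy(1) k] by (rule inn[OF xc[OF k xy(1)] xy(2)])
  qed
  have 2: "ract ?T T j \<in> pts ?T" if j: "j \<in> carrier J" and T: "T \<in> pts ?T" for j T
  proof -
    obtain x y where xy: "x \<in> pts X" "y \<in> pts Y" "T = tensor_pt H X Y x y" using el[OF T] by blast
    show ?thesis unfolding xy(3) rac[OF xy(2) j] by (rule inn[OF xy(1) yc[OF j xy(2)]])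
  qed
  have 3: "lact ?T \<one>\<^bsub>K\<^esub> T = T \<and> ract ?T T \<one>\<^bsub>J\<^esub> = T" if T: "T \<in> pts ?T" for T
  proof -
    obtain x y where xy: "x \<in> pts X" "y \<in> pts Y" "T = tensor_pt H X Y x y" using el[OF T] by blast
    show ?thesis using lac[OF xy(1) K.one_closed] rac[OF xy(2) J.one_closed] finite_bisetD(4)[OF X xy(1)]
        finite_bisetD(5)[OF Y xy(2)] xy(3) by simp
  qed
  have 4: "lact ?T (k \<otimes>\<^bsub>K\<^esub> k') T = lact ?T k (lact ?T k' T)"
    if k: "k \<in> carrier K" and k': "k' \<in> carrier K" and T: "T \<in> pts ?T" for k k' T
  proof -
    obtain x y where xy: "x \<in> pts X" "y \<in> pts Y" "T = tensor_pt H X Y x y" using el[OF T] by blast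
    show ?thesis using lac[OF xy(1) K.m_closed[OF k k']] lac[OF xy(1) k'] lac[OF xc[OF k' xy(1)] k]
        finite_bisetD(6)[OF X k k' xy(1)] xy(3) by simp
  qed
  have 5: "ract ?T T (j \<otimes>\<^bsub>J\<^esub> j') = ract ?T (ract ?T T j) j'"
    if j: "j \<in> carrier J" and j': "j' \<in> carrier J" and T: "T \<in> pts ?T" for j j' T
  proof -
    obtain x y where xy: "x \<in> pts X" "y \<in> pts Y" "T = tensor_pt H X Y x y" using el[OF T] by blast
    show ?thesis using rac[OF xy(2) J.m_closed[OF j j']] rac[OF xy(2) j] rac[OF yc[OF j xy(2)] j']
        finite_bisetD(7)[OF Y j j' xy(2)] xy(3) by simp
  qed
  have 6: "ract ?T (lact ?T k T) j = lact ?T k (ract ?T T j)"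
    if k: "k \<in> carrier K" and j: "j \<in> carrier J" and T: "T \<in> pts ?T" for k j T
  proof -
    obtain x y where xy: "x \<in> pts X" "y \<in> pts Y" "T = tensor_pt H X Y x y" using el[OF T] by blast
    show ?thesis using lac[OF xy(1) k] rac[OF xy(2) j] xy(3) by simp
  qed
  show ?thesis unfolding finite_biset_def
    by (intro conjI ballI fin; (rule 1 2 4 5 6 conjunct1[OF 3] conjunct2[OF 3]; assumption))
qed

text \<open>The map \<open>F\<close> is constant on the orbits by \<open>bal\<close> and separates them by \<open>sep\<close>. All identifications of
  tensor products below are instances.\<close>

lemma tensor_iso:
  assumes H: "group H" and X: "finite_biset K H X" and Y: "finite_biset H J Y"
    and into: "\<And>x y. x \<in> pts X \<Longrightarrow> y \<in> pts Y \<Longrightarrow> F x y \<in> pts Z"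
    and bal: "\<And>x y h. x \<in> pts X \<Longrightarrow> y \<in> pts Y \<Longrightarrow> h \<in> carrier H \<Longrightarrow> F (ract X x h) y = F x (lact Y h y)"
    and sur: "\<And>z. z \<in> pts Z \<Longrightarrow> \<exists>x\<in>pts X. \<exists>y\<in>pts Y. z = F x y"
    and sep: "\<And>x y x' y'. x \<in> pts X \<Longrightarrow> y \<in> pts Y \<Longrightarrow> x' \<in> pts X \<Longrightarrow> y' \<in> pts Y \<Longrightarrow> F x y = F x' y' \<Longrightarrow>
      \<exists>h\<in>carrier H. x' = ract X x h \<and> y = lact Y h y'"
    and la: "\<And>x y k. x \<in> pts X \<Longrightarrow> y \<in> pts Y \<Longrightarrow> k \<in> carrier K \<Longrightarrow> F (lact X k x) y = lact Z k (F x y)"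
    and ra: "\<And>x y j. x \<in> pts X \<Longrightarrow> y \<in> pts Y \<Longrightarrow> j \<in> carrier J \<Longrightarrow> F x (ract Y y j) = ract Z (F x y) j"
  shows "biset_iso K J (biset_tensor H X Y) Z"
proof -
  interpret H: group H by (rule H)
  let ?T = "biset_tensor H X Y"
  \<comment> \<open>the common value of \<open>F\<close> on the orbit \<open>T\<close>\<close>
  define \<Phi> where "\<Phi> T = (THE z. \<forall>p\<in>T. F (fst p) (snd p) = z)" for T
  have \<Phi>: "\<Phi> (tensor_pt H X Y x y) = F x y" if x: "x \<in> pts X" and y: "y \<in> pts Y" for x y
  proof -
    have "F (ract X x h) (lact Y (inv\<^bsub>H\<^esub> h) y) = F x y" if h: "h \<in> carrier H" for h
    proof -
      have ih: "inv\<^bsub>H\<^esub> h \<in> carrier H" using h by simp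
      have "lact Y h (lact Y (inv\<^bsub>H\<^esub> h) y) = y"
        using finite_bisetD(6)[OF Y h ih y] finite_bisetD(4)[OF Y y] h by simp
      then show ?thesis using bal[OF x finite_bisetD(2)[OF Y ih y] h] by simp
    qed
    then have "\<forall>p\<in>tensor_pt H X Y x y. F (fst p) (snd p) = F x y" by (auto simp: tensor_pt_def)
    note const = this
    show ?thesis unfolding \<Phi>_def
    proof (rule the_equality[where P = "\<lambda>z. \<forall>p\<in>tensor_pt H X Y x y. F (fst p) (snd p) = z", OF const])
      fix z assume "\<forall>p\<in>tensor_pt H X Y x y. F (fst p) (snd p) = z"
      from bspec[OF this tensor_pt_self[OF H X Y x y]] show "z = F x y" by simp
    qed
  qed
  have el: "\<exists>x\<in>pts X. \<exists>y\<in>pts Y. T = tensor_pt H X Y x y" if "T \<in> pts ?T" for T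
    using that unfolding tensor_pts by blast
  have inn: "tensor_pt H X Y x y \<in> pts ?T" if "x \<in> pts X" "y \<in> pts Y" for x y
    using that unfolding tensor_pts by blast
  show ?thesis
  proof (rule biset_isoI[where f = \<Phi>])
    have "inj_on \<Phi> (pts ?T)"
    proof (rule inj_onI)
      fix T T' assume T: "T \<in> pts ?T" "T' \<in> pts ?T" and e: "\<Phi> T = \<Phi> T'"
      obtain x y where xy: "x \<in> pts X" "y \<in> pts Y" "T = tensor_pt H X Y x y" using el[OF T(1)] by blast
      obtain x' y' where xy': "x' \<in> pts X" "y' \<in> pts Y" "T' = tensor_pt H X Y x' y'" using el[OF T(2)] by blast
      have "F x y = F x' y'" using e xy xy' \<Phi> by simp
      then obtain h where h: "h \<in> carrier H" "x' = ract X x h" "y = lact Y h y'" using sep[OF xy(1,2) xy'(1,2)] by blast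
      show "T = T'" using tensor_pt_balanced[OF H X Y xy(1) xy'(2) h(1)] xy(3) xy'(3) h(2,3) by simp
    qed
    moreover have "\<Phi> ` pts ?T = pts Z"
    proof (intro equalityI subsetI)
      fix z assume "z \<in> \<Phi> ` pts ?T"
      then obtain T where T: "T \<in> pts ?T" "z = \<Phi> T" by (rule imageE) 
      obtain x y where xy: "x \<in> pts X" "y \<in> pts Y" "T = tensor_pt H X Y x y" using el[OF T(1)] by blast
      show "z \<in> pts Z" using T(2) xy(3) \<Phi>[OF xy(1,2)] into[OF xy(1,2)] by simp
    next
      fix z assume z: "z \<in> pts Z"
      obtain x y where xy: "x \<in> pts X" "y \<in> pts Y" "z = F x y" using sur[OF z] by blast
      show "z \<in> \<Phi> ` pts ?T" unfolding xy(3) \<Phi>[OF xy(1,2), symmetric] by (rule imageI[OF inn[OF xy(1,2)]])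
    qed
    ultimately show "bij_betw \<Phi> (pts ?T) (pts Z)" by (simp add: bij_betw_def)
  next
    fix k T assume k: "k \<in> carrier K" and T: "T \<in> pts ?T"
    obtain x y where xy: "x \<in> pts X" "y \<in> pts Y" "T = tensor_pt H X Y x y" using el[OF T] by blast
    show "\<Phi> (lact ?T k T) = lact Z k (\<Phi> T)"
      using tensor_pt_lact[OF X xy(1) k, where Y = Y] \<Phi>[OF xy(1,2)] \<Phi>[OF finite_bisetD(2)[OF X k xy(1)] xy(2)]
        la[OF xy(1,2) k] xy(3) by simp
  next
    fix j T assume j: "j \<in> carrier J" and T: "T \<in> pts ?T"
    obtain x y where xy: "x \<in> pts X" "y \<in> pts Y" "T = tensor_pt H X Y x y" using el[OF T] by blast
    show "\<Phi> (ract ?T T j) = ract Z (\<Phi> T) j"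
      using tensor_pt_ract[OF H Y xy(2) j, where X = X] \<Phi>[OF xy(1,2)] \<Phi>[OF xy(1) finite_bisetD(3)[OF Y j xy(2)]]
        ra[OF xy(1,2) j] xy(3) by simp
  qed
qed

lemma tensor_cong:
  assumes H: "group H" and X: "finite_biset K H X" and Y: "finite_biset H J Y"
    and X': "finite_biset K H X'" and Y': "finite_biset H J Y'"
    and iX: "biset_iso K H X X'" and iY: "biset_iso H J Y Y'"
  shows "biset_iso K J (biset_tensor H X Y) (biset_tensor H X' Y')"
proof -
  obtain f where "biset_map K H X X' f" using iX unfolding biset_iso_iff by (rule exE)
  note f = biset_mapD[OF this]
  obtain g where "biset_map H J Y Y' g" using iY unfolding biset_iso_iff by (rule exE)
  note g = biset_mapD[OF this]
  have fx: "f x \<in> pts X'" if "x \<in> pts X" for x by (rule bij_betwE[OF f(1), rule_format, OF that])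
  have gy: "g y \<in> pts Y'" if "y \<in> pts Y" for y by (rule bij_betwE[OF g(1), rule_format, OF that])
  have finj: "x = x'" if "f x = f x'" "x \<in> pts X" "x' \<in> pts X" for x x'
    using f(1) that unfolding bij_betw_def by (meson inj_onD)
  have ginj: "x = x'" if "g x = g x'" "x \<in> pts Y" "x' \<in> pts Y" for x x'
    using g(1) that unfolding bij_betw_def by (meson inj_onD)
  show ?thesis
  proof (rule tensor_iso[OF H X Y, where F = "\<lambda>x y. tensor_pt H X' Y' (f x) (g y)"])
    show "\<And>x y. x \<in> pts X \<Longrightarrow> y \<in> pts Y \<Longrightarrow> tensor_pt H X' Y' (f x) (g y) \<in> pts (biset_tensor H X' Y')"
      using fx gy unfolding tensor_pts by blast
    show "\<And>x y h. x \<in> pts X \<Longrightarrow> y \<in> pts Y \<Longrightarrow> h \<in> carrier H \<Longrightarrow>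
       tensor_pt H X' Y' (f (ract X x h)) (g y) = tensor_pt H X' Y' (f x) (g (lact Y h y))"
      by (simp only: tensor_pt_balanced[OF H X' Y' fx gy] f(3) g(2))
    show "\<exists>x\<in>pts X. \<exists>y\<in>pts Y. z = tensor_pt H X' Y' (f x) (g y)" if "z \<in> pts (biset_tensor H X' Y')" for z
    proof -
      obtain x' y' where z: "x' \<in> pts X'" "y' \<in> pts Y'" "z = tensor_pt H X' Y' x' y'"
        using \<open>z \<in> _\<close> unfolding tensor_pts by blast
      obtain x where "x \<in> pts X" "x' = f x" using z(1) f(1) unfolding bij_betw_def by blast
      moreover obtain y where "y \<in> pts Y" "y' = g y" using z(2) g(1) unfolding bij_betw_def by blast
      ultimately show ?thesis using z(3) by blast
    qed
    show "\<exists>h\<in>carrier H. x' = ract X x h \<and> y = lact Y h y'"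
      if xy: "x \<in> pts X" "y \<in> pts Y" "x' \<in> pts X" "y' \<in> pts Y"
        and e: "tensor_pt H X' Y' (f x) (g y) = tensor_pt H X' Y' (f x') (g y')" for x y x' y'
    proof -
      obtain h where h: "h \<in> carrier H" "f x' = ract X' (f x) h" "g y = lact Y' h (g y')"
        using tensor_pt_eqD[OF H X' Y' fx[OF xy(1)] gy[OF xy(2)] fx[OF xy(3)] gy[OF xy(4)] e] by blast
      have "x' = ract X x h" by (rule finj) (use h f(3) xy finite_bisetD(3)[OF X] in simp_all)
      moreover have "y = lact Y h y'" by (rule ginj) (use h g(2) xy finite_bisetD(2)[OF Y] in simp_all)
      ultimately show ?thesis using h(1) by blast
    qed
    show "\<And>x y k. x \<in> pts X \<Longrightarrow> y \<in> pts Y \<Longrightarrow> k \<in> carrier K \<Longrightarrow>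
       tensor_pt H X' Y' (f (lact X k x)) (g y) = lact (biset_tensor H X' Y') k (tensor_pt H X' Y' (f x) (g y))"
      by (simp only: tensor_pt_lact[OF X' fx] f(2))
    show "\<And>x y j. x \<in> pts X \<Longrightarrow> y \<in> pts Y \<Longrightarrow> j \<in> carrier J \<Longrightarrow>
       tensor_pt H X' Y' (f x) (g (ract Y y j)) = ract (biset_tensor H X' Y') (tensor_pt H X' Y' (f x) (g y)) j"
      by (simp only: tensor_pt_ract[OF H Y' gy] g(3))
  qed
qed

lemma biset_sum_simps [simp]:
  "pts (biset_sum X Y) = Inl ` pts X \<union> Inr ` pts Y"
  "lact (biset_sum X Y) k (Inl x) = Inl (lact X k x)" "lact (biset_sum X Y) k (Inr y) = Inr (lact Y k y)"
  "ract (biset_sum X Y) (Inl x) h = Inl (ract X x h)" "ract (biset_sum X Y) (Inr y) h = Inr (ract Y y h)"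
  by (simp_all add: biset_sum_def)

lemma biset_sum_cases:
  "z \<in> pts (biset_sum X Y) \<Longrightarrow> (\<exists>x\<in>pts X. z = Inl x) \<or> (\<exists>y\<in>pts Y. z = Inr y)"
  by (simp add: image_iff)

lemma biset_sum_mem [simp]: "Inl x \<in> pts (biset_sum X Y) \<longleftrightarrow> x \<in> pts X" "Inr y \<in> pts (biset_sum X Y) \<longleftrightarrow> y \<in> pts Y"
  by (simp_all add: image_iff)

declare biset_sum_simps(1) [simp del]

lemma tensor_sum_left:
  assumes H: "group H" and X: "finite_biset K H X" and X': "finite_biset K H X'" and Y: "finite_biset H J Y"
  shows "biset_iso K J (biset_tensor H (biset_sum X X') Y) (biset_sum (biset_tensor H X Y) (biset_tensor H X' Y))"
proof (rule tensor_iso[OF H biset_sum_finite[OF X X'] Y,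
      where F = "\<lambda>z y. case_sum (\<lambda>x. Inl (tensor_pt H X Y x y)) (\<lambda>x. Inr (tensor_pt H X' Y x y)) z"])
  let ?F = "\<lambda>z y. case_sum (\<lambda>x. Inl (tensor_pt H X Y x y)) (\<lambda>x. Inr (tensor_pt H X' Y x y)) z"
  let ?S = "biset_sum X X'" and ?T = "biset_sum (biset_tensor H X Y) (biset_tensor H X' Y)"
  note c = biset_sum_cases[where X = X and Y = X']
  show "?F x y \<in> pts ?T" if x: "x \<in> pts ?S" and y: "y \<in> pts Y" for x y
    using c[OF x] by (elim disjE bexE) (simp_all add: tensor_ptsI y)
  show "?F (ract ?S x h) y = ?F x (lact Y h y)" if x: "x \<in> pts ?S" and y: "y \<in> pts Y" and h: "h \<in> carrier H" for x y h
    using c[OF x] by (elim disjE bexE) (simp_all add: tensor_pt_balanced[OF H X Y _ y h] tensor_pt_balanced[OF H X' Y _ y h])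
  show "\<exists>x\<in>pts ?S. \<exists>y\<in>pts Y. z = ?F x y" if z: "z \<in> pts ?T" for z
    using biset_sum_cases[OF z]
  proof (elim disjE bexE)
    fix T assume T: "T \<in> pts (biset_tensor H X Y)" "z = Inl T"
    obtain x y where "x \<in> pts X" "y \<in> pts Y" "T = tensor_pt H X Y x y" by (rule tensor_ptsE[OF T(1)])
    then show ?thesis using T(2) by (intro bexI[of _ "Inl x"] bexI[of _ y]) simp_all
  next
    fix T assume T: "T \<in> pts (biset_tensor H X' Y)" "z = Inr T"
    obtain x y where "x \<in> pts X'" "y \<in> pts Y" "T = tensor_pt H X' Y x y" by (rule tensor_ptsE[OF T(1)])
    then show ?thesis using T(2) by (intro bexI[of _ "Inr x"] bexI[of _ y]) simp_all
  qed
  show "\<exists>h\<in>carrier H. x' = ract ?S x h \<and> y = lact Y h y'"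
    if x: "x \<in> pts ?S" and y: "y \<in> pts Y" and x': "x' \<in> pts ?S" and y': "y' \<in> pts Y" and e: "?F x y = ?F x' y'" for x y x' y'
    using c[OF x] c[OF x']
  proof (elim disjE bexE)
    fix a b assume "a \<in> pts X" "b \<in> pts X" "x = Inl a" "x' = Inl b"
    then show ?thesis using tensor_pt_eqD[OF H X Y _ y _ y', of a b] e by simp
  next
    fix a b assume "a \<in> pts X'" "b \<in> pts X'" "x = Inr a" "x' = Inr b"
    then show ?thesis using tensor_pt_eqD[OF H X' Y _ y _ y', of a b] e by simp
  qed (use e in simp_all)
  show "?F (lact ?S k x) y = lact ?T k (?F x y)" if x: "x \<in> pts ?S" and y: "y \<in> pts Y" and k: "k \<in> carrier K" for x y k
    using c[OF x] by (elim disjE bexE) (simp_all add: tensor_pt_lact[OF X _ k] tensor_pt_lact[OF X' _ k])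
  show "?F x (ract Y y j) = ract ?T (?F x y) j" if x: "x \<in> pts ?S" and y: "y \<in> pts Y" and j: "j \<in> carrier J" for x y j
    using c[OF x] by (elim disjE bexE) (simp_all add: tensor_pt_ract[OF H Y y j])
qed

lemma tensor_sum_right:
  assumes H: "group H" and X: "finite_biset K H X" and Y: "finite_biset H J Y" and Y': "finite_biset H J Y'"
  shows "biset_iso K J (biset_tensor H X (biset_sum Y Y')) (biset_sum (biset_tensor H X Y) (biset_tensor H X Y'))"
proof (rule tensor_iso[OF H X biset_sum_finite[OF Y Y'],
      where F = "\<lambda>x z. case_sum (\<lambda>y. Inl (tensor_pt H X Y x y)) (\<lambda>y. Inr (tensor_pt H X Y' x y)) z"])
  let ?F = "\<lambda>x z. case_sum (\<lambda>y. Inl (tensor_pt H X Y x y)) (\<lambda>y. Inr (tensor_pt H X Y' x y)) z"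
  let ?S = "biset_sum Y Y'" and ?T = "biset_sum (biset_tensor H X Y) (biset_tensor H X Y')"
  note c = biset_sum_cases[where X = Y and Y = Y']
  show "?F x y \<in> pts ?T" if x: "x \<in> pts X" and y: "y \<in> pts ?S" for x y
    using c[OF y] by (elim disjE bexE) (simp_all add: tensor_ptsI x)
  show "?F (ract X x h) y = ?F x (lact ?S h y)" if x: "x \<in> pts X" and y: "y \<in> pts ?S" and h: "h \<in> carrier H" for x y h
    using c[OF y] by (elim disjE bexE) (simp_all add: tensor_pt_balanced[OF H X Y x _ h] tensor_pt_balanced[OF H X Y' x _ h])
  show "\<exists>x\<in>pts X. \<exists>y\<in>pts ?S. z = ?F x y" if z: "z \<in> pts ?T" for z
    using biset_sum_cases[OF z]
  proof (elim disjE bexE)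
    fix T assume T: "T \<in> pts (biset_tensor H X Y)" "z = Inl T"
    obtain x y where "x \<in> pts X" "y \<in> pts Y" "T = tensor_pt H X Y x y" by (rule tensor_ptsE[OF T(1)])
    then show ?thesis using T(2) by (intro bexI[of _ x] bexI[of _ "Inl y"]) simp_all
  next
    fix T assume T: "T \<in> pts (biset_tensor H X Y')" "z = Inr T"
    obtain x y where "x \<in> pts X" "y \<in> pts Y'" "T = tensor_pt H X Y' x y" by (rule tensor_ptsE[OF T(1)])
    then show ?thesis using T(2) by (intro bexI[of _ x] bexI[of _ "Inr y"]) simp_all
  qed
  show "\<exists>h\<in>carrier H. x' = ract X x h \<and> y = lact ?S h y'"
    if x: "x \<in> pts X" and y: "y \<in> pts ?S" and x': "x' \<in> pts X" and y': "y' \<in> pts ?S" and e: "?F x y = ?F x' y'" for x y x' y'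
    using c[OF y] c[OF y']
  proof (elim disjE bexE)
    fix a b assume "a \<in> pts Y" "b \<in> pts Y" "y = Inl a" "y' = Inl b"
    then show ?thesis using tensor_pt_eqD[OF H X Y x _ x', of a b] e by simp
  next
    fix a b assume "a \<in> pts Y'" "b \<in> pts Y'" "y = Inr a" "y' = Inr b"
    then show ?thesis using tensor_pt_eqD[OF H X Y' x _ x', of a b] e by simp
  qed (use e in simp_all)
  show "?F (lact X k x) y = lact ?T k (?F x y)" if x: "x \<in> pts X" and y: "y \<in> pts ?S" and k: "k \<in> carrier K" for x y k
    using c[OF y] by (elim disjE bexE) (simp_all add: tensor_pt_lact[OF X x k])
  show "?F x (ract ?S y j) = ract ?T (?F x y) j" if x: "x \<in> pts X" and y: "y \<in> pts ?S" and j: "j \<in> carrier J" for x y j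
    using c[OF y] by (elim disjE bexE) (simp_all add: tensor_pt_ract[OF H Y _ j] tensor_pt_ract[OF H Y' _ j])
qed


section \<open>Composition of bisets in the Burnside modules\<close>

lemma span_props:
  assumes M: "module R M" and X: "X \<subseteq> carrier M"
  shows "submodule (submodule_span R M X) R M" and "X \<subseteq> submodule_span R M X"
    and "\<And>N. submodule N R M \<Longrightarrow> X \<subseteq> N \<Longrightarrow> submodule_span R M X \<subseteq> N"
proof -
  interpret M: module R M by (rule M)
  let ?S = "{N. submodule N R M \<and> X \<subseteq> N}"
  have c: "carrier M \<in> ?S" using M.carrier_is_submodule X by simp
  show "submodule (submodule_span R M X) R M" unfolding submodule_span_def
  proof (rule submodule_crit[OF M])
    show "\<Inter> ?S \<subseteq> carrier M" using c by blast
    show "\<zero>\<^bsub>M\<^esub> \<in> \<Inter> ?S" using submodule_simps(2)[OF M] by simp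
    show "a \<oplus>\<^bsub>M\<^esub> b \<in> \<Inter> ?S" if "a \<in> \<Inter> ?S" "b \<in> \<Inter> ?S" for a b
      using that submodule_simps(3)[OF M] by simp
    show "r \<odot>\<^bsub>M\<^esub> a \<in> \<Inter> ?S" if "r \<in> carrier R" "a \<in> \<Inter> ?S" for r a
      using that submodule_simps(4)[OF M] by simp
  qed
  show "X \<subseteq> submodule_span R M X" unfolding submodule_span_def by blast
  show "\<And>N. submodule N R M \<Longrightarrow> X \<subseteq> N \<Longrightarrow> submodule_span R M X \<subseteq> N" unfolding submodule_span_def by blast
qed

lemma mod_hom_preimage_submodule:
  assumes h: "h \<in> mod_hom R M N" and M: "module R M" and N: "module R N" and H: "submodule H R N"
  shows "submodule {a \<in> carrier M. h a \<in> H} R M"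
proof (rule submodule_crit[OF M])
  interpret M: module R M by (rule M)
  note S = submodule_simps[OF N H] and D = mod_homD[OF h]
  show "\<zero>\<^bsub>M\<^esub> \<in> {a \<in> carrier M. h a \<in> H}" using mod_hom_zero[OF h M N] S(2) by simp
  show "a \<oplus>\<^bsub>M\<^esub> b \<in> {a \<in> carrier M. h a \<in> H}" if "a \<in> {a \<in> carrier M. h a \<in> H}" "b \<in> {a \<in> carrier M. h a \<in> H}" for a b
    using that D(2) S(3) by simp
  show "r \<odot>\<^bsub>M\<^esub> a \<in> {a \<in> carrier M. h a \<in> H}" if "r \<in> carrier R" "a \<in> {a \<in> carrier M. h a \<in> H}" for r a
    using that D(3) S(4) by simp
qed auto

text \<open>Used for statements about all elements of a Burnside module, which can then be checked on bisets.\<close>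

lemma free_module_generated:
  assumes R: "cring R" and N: "submodule N R (free_module R S)" and gen: "\<And>s. s \<in> S \<Longrightarrow> free_gen R s \<in> N"
    and f: "f \<in> carrier (free_module R S)"
  shows "f \<in> N"
  using R f
proof (induct rule: free_module_induct)
  note S = submodule_simps[OF free_module_module[OF R] N]
  case zero
  show ?case using S(2) by simp
next
  note S = submodule_simps[OF free_module_module[OF R] N]
  case (add f r s)
  show ?case by (rule S(3)[OF add(2) S(4)[OF add(3) gen[OF add(4)]]])
qed

lemma mod_hom_add_smult:
  assumes h: "h \<in> mod_hom R M N" and k: "k \<in> mod_hom R M N" and M: "module R M" and N: "module R N" and r: "r \<in> carrier R"
  shows "(\<lambda>m. h m \<oplus>\<^bsub>N\<^esub> r \<odot>\<^bsub>N\<^esub> k m) \<in> mod_hom R M N"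
proof -
  interpret N: module R N by (rule N)
  note D = mod_homD[OF h] and E = mod_homD[OF k]
  show ?thesis
  proof (rule mod_homI)
    fix a b assume "a \<in> carrier M" "b \<in> carrier M"
    then show "h (a \<oplus>\<^bsub>M\<^esub> b) \<oplus>\<^bsub>N\<^esub> r \<odot>\<^bsub>N\<^esub> k (a \<oplus>\<^bsub>M\<^esub> b) = h a \<oplus>\<^bsub>N\<^esub> r \<odot>\<^bsub>N\<^esub> k a \<oplus>\<^bsub>N\<^esub> (h b \<oplus>\<^bsub>N\<^esub> r \<odot>\<^bsub>N\<^esub> k b)"
      using r by (simp add: D E N.smult_r_distr N.M.a_ac)
  next
    fix s a assume "s \<in> carrier R" "a \<in> carrier M"
    then show "h (s \<odot>\<^bsub>M\<^esub> a) \<oplus>\<^bsub>N\<^esub> r \<odot>\<^bsub>N\<^esub> k (s \<odot>\<^bsub>M\<^esub> a) = s \<odot>\<^bsub>N\<^esub> (h a \<oplus>\<^bsub>N\<^esub> r \<odot>\<^bsub>N\<^esub> k a)"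
      using r by (simp add: D E N.smult_r_distr N.smult_assoc1[symmetric] N.R.m_comm)
  qed (use r D E in simp)
qed

text \<open>Linearity in a parameter, for the second argument of a bilinear extension.\<close>

lemma lin_ext_param_hom:
  assumes R: "cring R" and M: "module R M" and N: "module R N"
    and \<phi>: "\<And>s. s \<in> S \<Longrightarrow> \<phi> s \<in> mod_hom R M N" and f: "f \<in> carrier (free_module R S)"
  shows "(\<lambda>m. lin_ext R N (\<lambda>s. \<phi> s m) f) \<in> mod_hom R M N"
  using R f
proof (induct rule: free_module_induct)
  case zero
  show ?case
    by (rule mod_hom_cong[OF mod_hom_into_zero[OF M N] _ M]) (use N in \<open>simp add: lin_ext_def module_def abelian_group_def abelian_monoid.finsum_empty\<close>)
next
  case (add f r s)
  have "lin_ext R N (\<lambda>s. \<phi> s m) (f \<oplus>\<^bsub>free_module R S\<^esub> r \<odot>\<^bsub>free_module R S\<^esub> free_gen R s) =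
      lin_ext R N (\<lambda>s. \<phi> s m) f \<oplus>\<^bsub>N\<^esub> r \<odot>\<^bsub>N\<^esub> \<phi> s m" if m: "m \<in> carrier M" for m
  proof -
    have pm: "(\<lambda>s. \<phi> s m) \<in> S \<rightarrow> carrier N" using mod_homD(1)[OF \<phi> m] by blast
    note h = lin_ext_hom[OF R N pm]
    have g: "free_gen R s \<in> carrier (free_module R S)" by (rule free_gen_closed[OF R add(4)])
    show ?thesis
      using mod_homD(2)[OF h add(1) module.smult_closed[OF free_module_module[OF R] add(3) g]]
        mod_homD(3)[OF h add(3) g] lin_ext_gen[OF R N pm add(4)] by simp
  qed
  then show ?case by (intro mod_hom_cong[OF mod_hom_add_smult[OF add(2) \<phi>[OF add(4)] M N add(3)] _ M])
qed

abbreviation biset_gen :: "'r ring \<Rightarrow> 'k monoid \<Rightarrow> 'h monoid \<Rightarrow> ('k, 'h, 'x) biset \<Rightarrow> ('k, 'h) biset_class \<Rightarrow> 'r" where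
  "biset_gen R K H X \<equiv> free_gen R (biset_class K H X)"

abbreviation biset_free :: "'r ring \<Rightarrow> 'k monoid \<Rightarrow> 'h monoid \<Rightarrow> ('r, ('k, 'h) biset_class \<Rightarrow> 'r) module" where
  "biset_free R K H \<equiv> free_module R (biset_classes K H)"

lemma biset_gen_closed: "cring R \<Longrightarrow> finite_biset K H X \<Longrightarrow> biset_gen R K H X \<in> carrier (biset_free R K H)"
  by (rule free_gen_closed[OF _ biset_class_in_classes])

text \<open>The generators of the Burnside relations, for bisets with points of an arbitrary type.\<close>

definition sum_relator :: "'r ring \<Rightarrow> 'k monoid \<Rightarrow> 'h monoid \<Rightarrow> ('k, 'h, 'x) biset \<Rightarrow> ('k, 'h, 'y) biset \<Rightarrow>
    ('k, 'h) biset_class \<Rightarrow> 'r" where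
  "sum_relator R K H X Y = biset_gen R K H (biset_sum X Y) \<ominus>\<^bsub>biset_free R K H\<^esub>
     (biset_gen R K H X \<oplus>\<^bsub>biset_free R K H\<^esub> biset_gen R K H Y)"

lemma sum_relator_closed:
  assumes R: "cring R" and X: "finite_biset K H X" and Y: "finite_biset K H Y"
  shows "sum_relator R K H X Y \<in> carrier (biset_free R K H)"
proof -
  interpret F: module R "biset_free R K H" by (rule free_module_module[OF R])
  show ?thesis unfolding sum_relator_def
    by (intro F.M.minus_closed F.M.a_closed biset_gen_closed[OF R] X Y biset_sum_finite)
qed

lemma relations_span: "burnside_relations R K H = submodule_span R (biset_free R K H)
    {sum_relator R K H X Y | (X :: ('k, 'h, nat) biset) (Y :: ('k, 'h, nat) biset). finite_biset K H X \<and> finite_biset K H Y}"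
  by (simp only: burnside_relations_def sum_relator_def Let_def)

lemma relations_submodule:
  assumes R: "cring R" shows "submodule (burnside_relations R K H) R (biset_free R K H)"
  unfolding relations_span
  by (rule span_props(1)[OF free_module_module[OF R]]) (use sum_relator_closed[OF R] in blast)

lemma sum_relator_in:
  fixes X :: "('k, 'h, 'x) biset" and Y :: "('k, 'h, 'y) biset"
  assumes R: "cring R" and X: "finite_biset K H X" and Y: "finite_biset K H Y"
  shows "sum_relator R K H X Y \<in> burnside_relations R K H"
proof -
  obtain X' :: "('k, 'h, nat) biset" where X': "finite_biset K H X'" "biset_iso K H X X'"
    by (rule biset_nat_rep[OF X])
  obtain Y' :: "('k, 'h, nat) biset" where Y': "finite_biset K H Y'" "biset_iso K H Y Y'"
    by (rule biset_nat_rep[OF Y])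
  have "sum_relator R K H X Y = sum_relator R K H X' Y'"
    unfolding sum_relator_def
    using biset_class_eq[OF X X'(2)] biset_class_eq[OF Y Y'(2)]
      biset_class_eq[OF biset_sum_finite[OF X Y] biset_sum_iso[OF X'(2) Y'(2)]] by simp
  moreover have "sum_relator R K H X' Y' \<in> burnside_relations R K H"
    unfolding relations_span
    by (rule subsetD[OF span_props(2)[OF free_module_module[OF R]]]) (use sum_relator_closed[OF R] X'(1) Y'(1) in blast)+
  ultimately show ?thesis by simp
qed

lemma relations_least:
  assumes R: "cring R" and N: "submodule N R (biset_free R K H)"
    and g: "\<And>(X :: ('k, 'h, nat) biset) (Y :: ('k, 'h, nat) biset). finite_biset K H X \<Longrightarrow> finite_biset K H Y \<Longrightarrow>
      sum_relator R K H X Y \<in> N"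
  shows "burnside_relations R K H \<subseteq> N"
  unfolding relations_span
  by (rule span_props(3)[OF free_module_module[OF R] _ N]) (use sum_relator_closed[OF R] g in blast)+

definition tensor_class :: "'k monoid \<Rightarrow> 'h monoid \<Rightarrow> 'j monoid \<Rightarrow> ('k, 'h) biset_class \<Rightarrow> ('h, 'j) biset_class \<Rightarrow>
    ('k, 'j) biset_class" where
  "tensor_class K H J A B = biset_class K J (biset_tensor H (SOME X. X \<in> A) (SOME Y. Y \<in> B))"

lemma tensor_class_class:
  assumes G: "group K" "group H" "group J" and X: "finite_biset K H X" and Y: "finite_biset H J Y"
  shows "tensor_class K H J (biset_class K H X) (biset_class H J Y) = biset_class K J (biset_tensor H X Y)"
  unfolding tensor_class_def
  by (rule biset_class_eq[symmetric, OF tensor_finite[OF G X Y]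
        tensor_cong[OF G(2) X Y biset_class_some(1)[OF X] biset_class_some(1)[OF Y] biset_class_some(2)[OF X] biset_class_some(2)[OF Y]]])

lemma tensor_class_in:
  fixes K :: "'k monoid" and H :: "'h monoid" and J :: "'j monoid"
  assumes G: "group K" "group H" "group J" and A: "A \<in> biset_classes K H" and B: "B \<in> biset_classes H J"
  shows "tensor_class K H J A B \<in> biset_classes K J"
proof -
  obtain X :: "('k, 'h, nat) biset" where X: "finite_biset K H X" "A = biset_class K H X" using A unfolding biset_classes_def by blast
  obtain Y :: "('h, 'j, nat) biset" where Y: "finite_biset H J Y" "B = biset_class H J Y" using B unfolding biset_classes_def by blast
  show ?thesis unfolding X(2) Y(2) tensor_class_class[OF G X(1) Y(1)]
    by (rule biset_class_in_classes[OF tensor_finite[OF G X(1) Y(1)]])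
qed

text \<open>The double sum over supports is the bilinear extension of the tensor product of classes.\<close>

lemma free_comp_lin_ext:
  assumes R: "cring R" and G: "group K" "group H" "group J"
    and f: "f \<in> carrier (biset_free R K H)" and g: "g \<in> carrier (biset_free R H J)"
  shows "free_comp R K H J f g = lin_ext R (biset_free R K J)
    (\<lambda>A. lin_ext R (biset_free R K J) (\<lambda>B. free_gen R (tensor_class K H J A B)) g) f"
proof -
  let ?M = "biset_free R K J"
  interpret M: module R ?M by (rule free_module_module[OF R])
  have gen: "free_gen R (tensor_class K H J A B) \<in> carrier ?M" if "f A \<noteq> \<zero>\<^bsub>R\<^esub>" "g B \<noteq> \<zero>\<^bsub>R\<^esub>" for A B
    by (rule free_gen_closed[OF R tensor_class_in[OF G]]) (use that f g in \<open>auto simp: free_module_carrier\<close>)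
  have fc: "f A \<in> carrier R" if "f A \<noteq> \<zero>\<^bsub>R\<^esub>" for A using f that by (cases "A \<in> biset_classes K H") (auto simp: free_module_carrier)
  have gc: "g B \<in> carrier R" if "g B \<noteq> \<zero>\<^bsub>R\<^esub>" for B using g that by (cases "B \<in> biset_classes H J") (auto simp: free_module_carrier)
  have fin: "finite {B. g B \<noteq> \<zero>\<^bsub>R\<^esub>}" using g by (simp add: free_module_carrier)
  have inner: "(\<Oplus>\<^bsub>?M\<^esub>B\<in>{B. g B \<noteq> \<zero>\<^bsub>R\<^esub>}. (f A \<otimes>\<^bsub>R\<^esub> g B) \<odot>\<^bsub>?M\<^esub> free_gen R (tensor_class K H J A B)) =
      f A \<odot>\<^bsub>?M\<^esub> (\<Oplus>\<^bsub>?M\<^esub>B\<in>{B. g B \<noteq> \<zero>\<^bsub>R\<^esub>}. g B \<odot>\<^bsub>?M\<^esub> free_gen R (tensor_class K H J A B))"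
    if A: "f A \<noteq> \<zero>\<^bsub>R\<^esub>" for A
  proof -
    have s: "g B \<odot>\<^bsub>?M\<^esub> free_gen R (tensor_class K H J A B) \<in> carrier ?M" if "g B \<noteq> \<zero>\<^bsub>R\<^esub>" for B
      by (rule M.smult_closed[OF gc[OF that] gen[OF A that]])
    have "(\<Oplus>\<^bsub>?M\<^esub>B\<in>{B. g B \<noteq> \<zero>\<^bsub>R\<^esub>}. (f A \<otimes>\<^bsub>R\<^esub> g B) \<odot>\<^bsub>?M\<^esub> free_gen R (tensor_class K H J A B)) =
        (\<Oplus>\<^bsub>?M\<^esub>B\<in>{B. g B \<noteq> \<zero>\<^bsub>R\<^esub>}. f A \<odot>\<^bsub>?M\<^esub> (g B \<odot>\<^bsub>?M\<^esub> free_gen R (tensor_class K H J A B)))"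
    proof (rule M.M.finsum_cong')
      show "(\<lambda>B. f A \<odot>\<^bsub>?M\<^esub> (g B \<odot>\<^bsub>?M\<^esub> free_gen R (tensor_class K H J A B))) \<in> {B. g B \<noteq> \<zero>\<^bsub>R\<^esub>} \<rightarrow> carrier ?M"
        by (rule Pi_I, rule M.smult_closed[OF fc[OF A]], rule s) simp
      fix B assume "B \<in> {B. g B \<noteq> \<zero>\<^bsub>R\<^esub>}"
      then have B: "g B \<noteq> \<zero>\<^bsub>R\<^esub>" by simp
      show "(f A \<otimes>\<^bsub>R\<^esub> g B) \<odot>\<^bsub>?M\<^esub> free_gen R (tensor_class K H J A B) =
          f A \<odot>\<^bsub>?M\<^esub> (g B \<odot>\<^bsub>?M\<^esub> free_gen R (tensor_class K H J A B))"
        by (rule M.smult_assoc1[OF fc[OF A] gc[OF B] gen[OF A B]])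
    qed (rule refl)
    also have "\<dots> = f A \<odot>\<^bsub>?M\<^esub> (\<Oplus>\<^bsub>?M\<^esub>B\<in>{B. g B \<noteq> \<zero>\<^bsub>R\<^esub>}. g B \<odot>\<^bsub>?M\<^esub> free_gen R (tensor_class K H J A B))"
      by (rule M.finsum_smult_ldistr[symmetric, OF fin fc[OF A]]) (use s in blast)
    finally show ?thesis .
  qed
  show ?thesis unfolding free_comp_def lin_ext_def Let_def tensor_class_def[symmetric]
  proof (rule M.M.finsum_cong')
    have "f A \<odot>\<^bsub>?M\<^esub> (\<Oplus>\<^bsub>?M\<^esub>B\<in>{B. g B \<noteq> \<zero>\<^bsub>R\<^esub>}. g B \<odot>\<^bsub>?M\<^esub> free_gen R (tensor_class K H J A B)) \<in> carrier ?M"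
      if "f A \<noteq> \<zero>\<^bsub>R\<^esub>" for A
      by (rule M.smult_closed[OF fc[OF that]], rule M.M.finsum_closed, rule Pi_I, rule M.smult_closed[OF gc gen[OF that]]) simp_all
    then show "(\<lambda>A. f A \<odot>\<^bsub>?M\<^esub> (\<Oplus>\<^bsub>?M\<^esub>B\<in>{B. g B \<noteq> \<zero>\<^bsub>R\<^esub>}. g B \<odot>\<^bsub>?M\<^esub> free_gen R (tensor_class K H J A B)))
      \<in> {A. f A \<noteq> \<zero>\<^bsub>R\<^esub>} \<rightarrow> carrier ?M" by blast
  qed (use inner in simp_all)
qed

lemma free_comp_hom:
  assumes R: "cring R" and G: "group K" "group H" "group J"
  shows "g \<in> carrier (biset_free R H J) \<Longrightarrow> (\<lambda>f. free_comp R K H J f g) \<in> mod_hom R (biset_free R K H) (biset_free R K J)"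
    and "f \<in> carrier (biset_free R K H) \<Longrightarrow> free_comp R K H J f \<in> mod_hom R (biset_free R H J) (biset_free R K J)"
proof -
  let ?M = "biset_free R K J"
  have M: "module R ?M" by (rule free_module_module[OF R])
  have in1: "lin_ext R ?M (\<lambda>B. free_gen R (tensor_class K H J A B)) \<in> mod_hom R (biset_free R H J) ?M"
    if A: "A \<in> biset_classes K H" for A
    by (rule lin_ext_hom[OF R M]) (use free_gen_closed[OF R tensor_class_in[OF G A]] in blast)
  {
    assume g: "g \<in> carrier (biset_free R H J)"
    have "(\<lambda>A. lin_ext R ?M (\<lambda>B. free_gen R (tensor_class K H J A B)) g) \<in> biset_classes K H \<rightarrow> carrier ?M"
      using mod_homD(1)[OF in1 g] by blast
    from mod_hom_cong[OF lin_ext_hom[OF R M this] free_comp_lin_ext[OF R G _ g] free_module_module[OF R]]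
    show "(\<lambda>f. free_comp R K H J f g) \<in> mod_hom R (biset_free R K H) ?M" .
  next
    assume f: "f \<in> carrier (biset_free R K H)"
    from mod_hom_cong[OF lin_ext_param_hom[OF R free_module_module[OF R] M in1 f] free_comp_lin_ext[OF R G f] free_module_module[OF R]]
    show "free_comp R K H J f \<in> mod_hom R (biset_free R H J) ?M" .
  }
qed

lemma free_comp_gen:
  assumes R: "cring R" and G: "group K" "group H" "group J" and X: "finite_biset K H X" and Y: "finite_biset H J Y"
  shows "free_comp R K H J (biset_gen R K H X) (biset_gen R H J Y) = biset_gen R K J (biset_tensor H X Y)"
proof -
  let ?M = "biset_free R K J"
  have M: "module R ?M" by (rule free_module_module[OF R])
  have in2: "(\<lambda>B. free_gen R (tensor_class K H J A B)) \<in> biset_classes H J \<rightarrow> carrier ?M" if "A \<in> biset_classes K H" for A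
    using free_gen_closed[OF R tensor_class_in[OF G that]] by blast
  have in1: "(\<lambda>A. lin_ext R ?M (\<lambda>B. free_gen R (tensor_class K H J A B)) (biset_gen R H J Y)) \<in> biset_classes K H \<rightarrow> carrier ?M"
    using mod_homD(1)[OF lin_ext_hom[OF R M in2] biset_gen_closed[OF R Y]] by blast
  show ?thesis
    unfolding free_comp_lin_ext[OF R G biset_gen_closed[OF R X] biset_gen_closed[OF R Y]]
      lin_ext_gen[OF R M in1 biset_class_in_classes[OF X]]
      lin_ext_gen[OF R M in2[OF biset_class_in_classes[OF X]] biset_class_in_classes[OF Y]]
      tensor_class_class[OF G X Y] ..
qed

text \<open>The tensor product distributes over disjoint unions on both sides, so the relations form an ideal for
  the bilinear composition. In each part the relation is first reduced to a generator, then the other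
  argument to a single biset.\<close>

lemma free_comp_relations:
  fixes K :: "'k monoid" and H :: "'h monoid" and J :: "'j monoid"
  assumes R: "cring R" and G: "group K" "group H" "group J"
  shows "f \<in> burnside_relations R K H \<Longrightarrow> g \<in> carrier (biset_free R H J) \<Longrightarrow>
      free_comp R K H J f g \<in> burnside_relations R K J"
    and "f \<in> carrier (biset_free R K H) \<Longrightarrow> g \<in> burnside_relations R H J \<Longrightarrow>
      free_comp R K H J f g \<in> burnside_relations R K J"
proof -
  note mod = free_module_module[OF R] and rs = relations_submodule[OF R]
  note h1 = free_comp_hom(1)[OF R G] and h2 = free_comp_hom(2)[OF R G]
  have dist: "h (sum_relator R K' H' X Y) = h (biset_gen R K' H' (biset_sum X Y)) \<ominus>\<^bsub>biset_free R K J\<^esub>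
      (h (biset_gen R K' H' X) \<oplus>\<^bsub>biset_free R K J\<^esub> h (biset_gen R K' H' Y))"
    if h: "h \<in> mod_hom R (biset_free R K' H') (biset_free R K J)" and X: "finite_biset K' H' X" and Y: "finite_biset K' H' Y"
    for h and K' :: "'x monoid" and H' :: "'y monoid" and X Y :: "('x, 'y, nat) biset"
  proof -
    interpret F: module R "biset_free R K' H'" by (rule mod)
    show ?thesis unfolding sum_relator_def
      using mod_hom_diff[OF h mod mod biset_gen_closed[OF R biset_sum_finite[OF X Y]] F.M.a_closed[OF biset_gen_closed[OF R X] biset_gen_closed[OF R Y]]]
        mod_homD(2)[OF h biset_gen_closed[OF R X] biset_gen_closed[OF R Y]] by simp
  qed
  {
    assume f: "f \<in> burnside_relations R K H" and g: "g \<in> carrier (biset_free R H J)"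
    have "sum_relator R K H X Y \<in> {f \<in> carrier (biset_free R K H). free_comp R K H J f g \<in> burnside_relations R K J}"
      if X: "finite_biset K H X" and Y: "finite_biset K H Y" for X Y :: "('k, 'h, nat) biset"
    proof -
      let ?d = "sum_relator R K H X Y"
      have d: "?d \<in> carrier (biset_free R K H)" by (rule sum_relator_closed[OF R X Y])
      have "g \<in> {g \<in> carrier (biset_free R H J). free_comp R K H J ?d g \<in> burnside_relations R K J}"
      proof (rule free_module_generated[OF R mod_hom_preimage_submodule[OF h2[OF d] mod mod rs] _ g])
        fix C assume C: "C \<in> biset_classes H J"
        then obtain Z :: "('h, 'j, nat) biset" where Z: "finite_biset H J Z" "C = biset_class H J Z"
          unfolding biset_classes_def by blast
        have "free_comp R K H J ?d (biset_gen R H J Z) = sum_relator R K J (biset_tensor H X Z) (biset_tensor H Y Z)"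
          unfolding dist[OF h1[OF biset_gen_closed[OF R Z(1)]] X Y] free_comp_gen[OF R G X Z(1)] free_comp_gen[OF R G Y Z(1)]
            free_comp_gen[OF R G biset_sum_finite[OF X Y] Z(1)]
          unfolding sum_relator_def biset_class_eq[OF tensor_finite[OF G biset_sum_finite[OF X Y] Z(1)] tensor_sum_left[OF G(2) X Y Z(1)]] ..
        then show "free_gen R C \<in> {g \<in> carrier (biset_free R H J). free_comp R K H J ?d g \<in> burnside_relations R K J}"
          using sum_relator_in[OF R tensor_finite[OF G X Z(1)] tensor_finite[OF G Y Z(1)]] free_gen_closed[OF R C] Z(2) by simp
      qed
      then show ?thesis using d by simp
    qed
    note rl = relations_least[OF R mod_hom_preimage_submodule[OF h1[OF g] mod mod rs] this]
    from subsetD[OF rl f] show "free_comp R K H J f g \<in> burnside_relations R K J" by simp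
  next
    assume f: "f \<in> carrier (biset_free R K H)" and g: "g \<in> burnside_relations R H J"
    have "sum_relator R H J X Y \<in> {g \<in> carrier (biset_free R H J). free_comp R K H J f g \<in> burnside_relations R K J}"
      if X: "finite_biset H J X" and Y: "finite_biset H J Y" for X Y :: "('h, 'j, nat) biset"
    proof -
      let ?d = "sum_relator R H J X Y"
      have d: "?d \<in> carrier (biset_free R H J)" by (rule sum_relator_closed[OF R X Y])
      have "f \<in> {f \<in> carrier (biset_free R K H). free_comp R K H J f ?d \<in> burnside_relations R K J}"
      proof (rule free_module_generated[OF R mod_hom_preimage_submodule[OF h1[OF d] mod mod rs] _ f])
        fix C assume C: "C \<in> biset_classes K H"
        then obtain Z :: "('k, 'h, nat) biset" where Z: "finite_biset K H Z" "C = biset_class K H Z"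
          unfolding biset_classes_def by blast
        have "free_comp R K H J (biset_gen R K H Z) ?d = sum_relator R K J (biset_tensor H Z X) (biset_tensor H Z Y)"
          unfolding dist[OF h2[OF biset_gen_closed[OF R Z(1)]] X Y] free_comp_gen[OF R G Z(1) X] free_comp_gen[OF R G Z(1) Y]
            free_comp_gen[OF R G Z(1) biset_sum_finite[OF X Y]]
          unfolding sum_relator_def biset_class_eq[OF tensor_finite[OF G Z(1) biset_sum_finite[OF X Y]] tensor_sum_right[OF G(2) Z(1) X Y]] ..
        then show "free_gen R C \<in> {f \<in> carrier (biset_free R K H). free_comp R K H J f ?d \<in> burnside_relations R K J}"
          using sum_relator_in[OF R tensor_finite[OF G Z(1) X] tensor_finite[OF G Z(1) Y]] free_gen_closed[OF R C] Z(2) by simp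
      qed
      then show ?thesis using d by simp
    qed
    note rl = relations_least[OF R mod_hom_preimage_submodule[OF h2[OF f] mod mod rs] this]
    from subsetD[OF rl g] show "free_comp R K H J f g \<in> burnside_relations R K J" by simp
  }
qed

lemma burnside_quotient: "cring R \<Longrightarrow> quotient R (biset_free R K H) (burnside_relations R K H)"
  by (rule quotientI[OF free_module_module relations_submodule])

lemma burnside_elem_closed:
  assumes R: "cring R" and X: "finite_biset K H X"
  shows "burnside_elem R K H X \<in> carrier (burnside_module R K H)"
  using quotient.cosets_iff[OF burnside_quotient[OF R]] biset_gen_closed[OF R X]
  unfolding burnside_elem_def burnside_coset_def burnside_module_def quot_module_simps by blast

lemma burnside_elem_iso:
  "finite_biset K H X \<Longrightarrow> biset_iso K H X Y \<Longrightarrow> burnside_elem R K H X = burnside_elem R K H Y"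
  unfolding burnside_elem_def by (simp add: biset_class_eq)

lemma burnside_comp_coset:
  assumes R: "cring R" and G: "group K" "group H" "group J"
    and f: "f \<in> carrier (biset_free R K H)" and g: "g \<in> carrier (biset_free R H J)"
  shows "burnside_comp R K H J (burnside_coset R K H f) (burnside_coset R H J g) =
    burnside_coset R K J (free_comp R K H J f g)"
proof -
  interpret KH: quotient R "biset_free R K H" "burnside_relations R K H" by (rule burnside_quotient[OF R])
  interpret HJ: quotient R "biset_free R H J" "burnside_relations R H J" by (rule burnside_quotient[OF R])
  interpret KJ: quotient R "biset_free R K J" "burnside_relations R K J" by (rule burnside_quotient[OF R])
  note mod = free_module_module[OF R]
  note h1 = free_comp_hom(1)[OF R G] and h2 = free_comp_hom(2)[OF R G]
  have same: "burnside_coset R K J (free_comp R K H J f' g') = burnside_coset R K J (free_comp R K H J f g)"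
    if f': "f' \<in> burnside_coset R K H f" and g': "g' \<in> burnside_coset R H J g" for f' g'
  proof -
    have f'c: "f' \<in> carrier (biset_free R K H)" "f' \<ominus>\<^bsub>biset_free R K H\<^esub> f \<in> burnside_relations R K H"
      using KH.coset_elem[OF f f'[unfolded burnside_coset_def]] KH.coset_eq_iff[OF _ f] by blast+
    have g'c: "g' \<in> carrier (biset_free R H J)" "g' \<ominus>\<^bsub>biset_free R H J\<^esub> g \<in> burnside_relations R H J"
      using HJ.coset_elem[OF g g'[unfolded burnside_coset_def]] HJ.coset_eq_iff[OF _ g] by blast+
    have c: "free_comp R K H J f' g' \<in> carrier (biset_free R K J)" "free_comp R K H J f g' \<in> carrier (biset_free R K J)"
      "free_comp R K H J f g \<in> carrier (biset_free R K J)"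
      using mod_homD(1)[OF h1[OF g'c(1)] f'c(1)] mod_homD(1)[OF h1[OF g'c(1)] f] mod_homD(1)[OF h1[OF g] f] by auto
    have "burnside_coset R K J (free_comp R K H J f' g') = burnside_coset R K J (free_comp R K H J f g')"
      unfolding burnside_coset_def KJ.coset_eq_iff[OF c(1,2)] mod_hom_diff[OF h1[OF g'c(1)] mod mod f'c(1) f, symmetric]
      by (rule free_comp_relations(1)[OF R G f'c(2) g'c(1)])
    also have "\<dots> = burnside_coset R K J (free_comp R K H J f g)"
      unfolding burnside_coset_def KJ.coset_eq_iff[OF c(2,3)] mod_hom_diff[OF h2[OF f] mod mod g'c(1) g, symmetric]
      by (rule free_comp_relations(2)[OF R G f g'c(2)])
    finally show ?thesis .
  qed
  have self: "f \<in> burnside_coset R K H f" "g \<in> burnside_coset R H J g"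
    unfolding burnside_coset_def by (rule KH.a_rcos_self[OF f], rule HJ.a_rcos_self[OF g])
  show ?thesis unfolding burnside_comp_def
  proof (intro equalityI UN_least)
    show "burnside_coset R K J (free_comp R K H J f' g') \<subseteq> burnside_coset R K J (free_comp R K H J f g)"
      if "f' \<in> burnside_coset R K H f" "g' \<in> burnside_coset R H J g" for f' g'
      by (rule equalityD1[OF same[OF that]])
    show "burnside_coset R K J (free_comp R K H J f g) \<subseteq>
        (\<Union>f\<in>burnside_coset R K H f. \<Union>g\<in>burnside_coset R H J g. burnside_coset R K J (free_comp R K H J f g))"
      by (rule order_trans[OF UN_upper[OF self(2)] UN_upper[OF self(1)]])
  qed
qed

theorem burnside_comp_elem:
  assumes R: "cring R" and G: "group K" "group H" "group J" and X: "finite_biset K H X" and Y: "finite_biset H J Y"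
  shows "burnside_comp R K H J (burnside_elem R K H X) (burnside_elem R H J Y) = burnside_elem R K J (biset_tensor H X Y)"
  unfolding burnside_elem_def burnside_comp_coset[OF R G biset_gen_closed[OF R X] biset_gen_closed[OF R Y]]
    free_comp_gen[OF R G X Y] ..


section \<open>Biset functors are destriction functors\<close>

context plain_group
begin

lemma sect_quot_simps:
  "carrier (sect_quot G s) = (\<lambda>u. snd s #> u) ` fst s"
  "monoid.mult (sect_quot G s) = (<#>)" "\<one>\<^bsub>sect_quot G s\<^esub> = snd s"
  by (auto simp: sect_quot_def FactGroup_def RCOSETS_def r_coset_def set_mult_def fun_eq_iff)

lemma sect_quot_group: "s \<in> sections G \<Longrightarrow> group (sect_quot G s)"
  unfolding sect_quot_def sections_def by (rule normal.factorgroup_is_group) auto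

text \<open>The coset \<open>a\<^sup>-\<^sup>1 M\<close> for \<open>t = (M, L)\<close>.\<close>

definition sbiset_reps :: "'a \<Rightarrow> 'a sect \<Rightarrow> 'a set" where
  "sbiset_reps a t = {x \<in> carrier G. a \<otimes> x \<in> fst t}"

text \<open>For \<open>s = (U, V)\<close> and \<open>t = (M, L)\<close>, the \<open>(U/V, M/L)\<close>-biset of all cosets \<open>V x\<close> with \<open>x \<in> a\<^sup>-\<^sup>1 M\<close>, on which both
  quotient groups act by multiplication of cosets. It is the composite of conjugation, deflation and
  restriction that belongs to the morphism \<open>M a\<close>.\<close>

definition sbiset :: "'a sect \<Rightarrow> 'a sect \<Rightarrow> 'a \<Rightarrow> ('a set, 'a set, 'a set) biset" where
  "sbiset s t a = \<lparr>pts = (\<lambda>x. snd s #> x) ` sbiset_reps a t, lact = (<#>), ract = (<#>)\<rparr>"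

lemma sbiset_simps [simp]:
  "pts (sbiset s t a) = (\<lambda>x. snd s #> x) ` sbiset_reps a t" "lact (sbiset s t a) = (<#>)" "ract (sbiset s t a) = (<#>)"
  by (simp_all add: sbiset_def)

lemma inv_cancel [simp]:
  "x \<in> carrier G \<Longrightarrow> y \<in> carrier G \<Longrightarrow> inv x \<otimes> (x \<otimes> y) = y"
  "x \<in> carrier G \<Longrightarrow> y \<in> carrier G \<Longrightarrow> x \<otimes> (inv x \<otimes> y) = y"
  by (simp_all add: m_assoc[symmetric])

lemma sbiset_reps_lmult:
  assumes s: "s \<in> sections G" and t: "t \<in> sections G" and a: "le_by a s t" and u: "u \<in> fst s" and x: "x \<in> sbiset_reps a t"
  shows "u \<otimes> x \<in> sbiset_reps a t"
proof -
  have c: "a \<in> carrier G" "u \<in> carrier G" "x \<in> carrier G" "a \<otimes> x \<in> fst t"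
    using a u x sectionsD(4)[OF s] by (auto simp: le_by_def sbiset_reps_def)
  have "a \<otimes> u \<otimes> inv a \<in> fst t" using a u le_by_iff[OF s] by (auto simp: conj_set_image)
  then have "(a \<otimes> u \<otimes> inv a) \<otimes> (a \<otimes> x) \<in> fst t" using subgroup.m_closed[OF sectionsD(1)[OF t]] c(4) by blast
  moreover have "(a \<otimes> u \<otimes> inv a) \<otimes> (a \<otimes> x) = a \<otimes> (u \<otimes> x)" using c by (simp add: m_assoc)
  ultimately show ?thesis using c by (simp add: sbiset_reps_def)
qed

lemma sbiset_reps_mult:
  assumes t: "t \<in> sections G" and u: "u \<in> sections G" and a: "a \<in> carrier G" and b: "le_by b t u"
    and x: "x \<in> sbiset_reps a t" and y: "y \<in> sbiset_reps b u"
  shows "x \<otimes> y \<in> sbiset_reps (b \<otimes> a) u"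
proof -
  have c: "b \<in> carrier G" "x \<in> carrier G" "y \<in> carrier G" using b x y by (auto simp: le_by_def sbiset_reps_def)
  have "(a \<otimes> x) \<otimes> y \<in> sbiset_reps b u" using sbiset_reps_lmult[OF t u b _ y] x by (simp add: sbiset_reps_def)
  then show ?thesis using a c by (simp add: sbiset_reps_def m_assoc)
qed

text \<open>If \<open>x = a\<^sup>-\<^sup>1 m\<close> then \<open>x\<close> conjugates \<open>L\<close> into \<open>a\<^sup>-\<^sup>1 L a\<close>, which lies in \<open>V\<close>. Hence
  \<open>V x \<cdot> L = V x\<close>, which makes the multiplication of cosets in the next lemma work.\<close>

lemma sbiset_reps_conj:
  assumes s: "s \<in> sections G" and t: "t \<in> sections G" and a: "le_by a s t" and x: "x \<in> sbiset_reps a t"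
  shows "conj_set G x (snd t) \<subseteq> snd s"
proof -
  have c: "a \<in> carrier G" "x \<in> carrier G" "a \<otimes> x \<in> fst t" using a x by (auto simp: le_by_def sbiset_reps_def)
  have "conj_set G a (conj_set G x (snd t)) = conj_set G (a \<otimes> x) (snd t)"
    by (rule conj_set_comp[symmetric]) (use c sectionsD(5)[OF t] in auto)
  also have "\<dots> \<subseteq> snd t" using sectionsD(6)[OF t c(3)] by (auto simp: conj_set_image)
  also have "\<dots> \<subseteq> conj_set G a (snd s)" using a le_by_iff[OF s] by blast
  finally have "conj_set G (inv a) (conj_set G a (conj_set G x (snd t))) \<subseteq> conj_set G (inv a) (conj_set G a (snd s))"
    by (rule conj_set_mono)
  then show ?thesis using conj_set_inv(1)[OF c(1)] sectionsD(5)[OF s] conj_closed[OF c(2) sectionsD(5)[OF t]] by simp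
qed

lemma sbiset_coset_mult:
  assumes s: "s \<in> sections G" and t: "t \<in> sections G" and a: "le_by a s t" and x: "x \<in> sbiset_reps a t" and y: "y \<in> carrier G"
  shows "(snd s #> x) <#> (snd t #> y) = snd s #> (x \<otimes> y)"
  by (rule destr_cat_comp[OF is_group sectionsD(2)[OF t] sectionsD(2)[OF s] y _ sbiset_reps_conj[OF s t a x]])
    (use x in \<open>simp add: sbiset_reps_def\<close>)

lemma le_by_refl: "s \<in> sections G \<Longrightarrow> le_by \<one> s s"
  by (simp add: le_by_one)

lemma sbiset_reps_one: "t \<in> sections G \<Longrightarrow> sbiset_reps \<one> t = fst t"
  using sectionsD(4)[of t] by (auto simp: sbiset_reps_def)

lemma quot_mult:
  assumes s: "s \<in> sections G" and u: "u \<in> fst s" and x: "x \<in> carrier G"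
  shows "(snd s #> u) <#> (snd s #> x) = snd s #> (u \<otimes> x)"
  by (rule sbiset_coset_mult[OF s s le_by_refl[OF s] _ x]) (use u sbiset_reps_one[OF s] in simp)

lemma reps_closed: "x \<in> sbiset_reps a t \<Longrightarrow> x \<in> carrier G"
  by (simp add: sbiset_reps_def)

lemma sbiset_finite:
  assumes fin: "finite (carrier G)" and s: "s \<in> sections G" and t: "t \<in> sections G" and a: "le_by a s t"
  shows "finite_biset (sect_quot G s) (sect_quot G t) (sbiset s t a)"
proof -
  let ?D = "sbiset_reps a t"
  note mc = subgroup.m_closed[OF sectionsD(1)[OF s]] subgroup.m_closed[OF sectionsD(1)[OF t]]
  have ac: "a \<in> carrier G" using a by (simp add: le_by_def)
  have us: "u \<in> carrier G" if "u \<in> fst s" for u using that sectionsD(4)[OF s] by blast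
  have mt: "m \<in> carrier G" if "m \<in> fst t" for m using that sectionsD(4)[OF t] by blast
  have l: "(snd s #> u) <#> (snd s #> x) = snd s #> (u \<otimes> x)" "u \<otimes> x \<in> ?D" if "u \<in> fst s" "x \<in> ?D" for u x
    by (rule quot_mult[OF s that(1) reps_closed[OF that(2)]], rule sbiset_reps_lmult[OF s t a that])
  have r: "(snd s #> x) <#> (snd t #> m) = snd s #> (x \<otimes> m)" if "x \<in> ?D" "m \<in> fst t" for x m
    by (rule sbiset_coset_mult[OF s t a that(1) mt[OF that(2)]])
  have r': "x \<otimes> m \<in> ?D" if "x \<in> ?D" "m \<in> fst t" for x m
    using sbiset_reps_mult[OF t t ac le_by_refl[OF t] that(1)] that(2) sbiset_reps_one[OF t] ac by simp
  have one: "\<one> \<in> fst s" "\<one> \<in> fst t" using subgroup.one_closed[OF sectionsD(1)] s t by auto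
  have so: "snd s #> \<one> = snd s" "snd t #> \<one> = snd t" using coset_mult_one[OF sectionsD(5)] s t by auto
  have "finite ((\<lambda>x. snd s #> x) ` ?D)" using fin by (simp add: sbiset_reps_def)
  then show ?thesis
    unfolding finite_biset_def sbiset_simps sect_quot_simps
  proof (intro conjI ballI; (elim imageE)?; (simp only:)?)
    show "(snd s #> u) <#> (snd s #> x) \<in> (\<lambda>x. snd s #> x) ` ?D" if "u \<in> fst s" "x \<in> ?D" for u x
      unfolding l(1)[OF that] by (rule imageI[OF l(2)[OF that]])
    show "(snd s #> x) <#> (snd t #> m) \<in> (\<lambda>x. snd s #> x) ` ?D" if "m \<in> fst t" "x \<in> ?D" for m x
      unfolding r[OF that(2,1)] by (rule imageI[OF r'[OF that(2,1)]])
    show "snd s <#> (snd s #> x) = snd s #> x" if "x \<in> ?D" for x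
      using l(1)[OF one(1) that] reps_closed[OF that] so by simp
    show "(snd s #> x) <#> snd t = snd s #> x" if "x \<in> ?D" for x
      using r[OF that one(2)] reps_closed[OF that] so by simp
    show "(snd s #> u) <#> (snd s #> v) <#> (snd s #> x) = (snd s #> u) <#> ((snd s #> v) <#> (snd s #> x))"
      if "u \<in> fst s" "v \<in> fst s" "x \<in> ?D" for u v x
      by (simp only: l that quot_mult[OF s] us mc m_assoc reps_closed[OF that(3)])
    show "(snd s #> x) <#> ((snd t #> m) <#> (snd t #> n)) = (snd s #> x) <#> (snd t #> m) <#> (snd t #> n)"
      if "m \<in> fst t" "n \<in> fst t" "x \<in> ?D" for m n x
      by (simp only: r r' that quot_mult[OF t] mt mc m_assoc reps_closed[OF that(3)])
    show "(snd s #> u) <#> (snd s #> x) <#> (snd t #> m) = (snd s #> u) <#> ((snd s #> x) <#> (snd t #> m))"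
      if "u \<in> fst s" "m \<in> fst t" "x \<in> ?D" for u m x
      by (simp only: l r r' that us mt m_assoc reps_closed[OF that(3)])
  qed
qed

text \<open>Multiplication \<open>(V x, L y) \<mapsto> V x y\<close> identifies the tensor product. It is onto because \<open>a\<^sup>-\<^sup>1\<close> can be
  split off on the left.\<close>

lemma sbiset_tensor:
  assumes fin: "finite (carrier G)" and s: "s \<in> sections G" and t: "t \<in> sections G" and u: "u \<in> sections G"
    and a: "le_by a s t" and b: "le_by b t u"
  shows "biset_iso (sect_quot G s) (sect_quot G u)
    (biset_tensor (sect_quot G t) (sbiset s t a) (sbiset t u b)) (sbiset s u (b \<otimes> a))"
proof -
  note X = sbiset_finite[OF fin s t a] and Y = sbiset_finite[OF fin t u b] and Z = sbiset_finite[OF fin s u le_by_comp[OF s t a b]]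
  have c: "a \<in> carrier G" "b \<in> carrier G" using a b by (auto simp: le_by_def)
  let ?X = "sbiset s t a" and ?Y = "sbiset t u b" and ?Z = "sbiset s u (b \<otimes> a)"
  have xy: "(snd s #> x) <#> (snd t #> y) = snd s #> (x \<otimes> y)" if "x \<in> sbiset_reps a t" "y \<in> sbiset_reps b u" for x y
    by (rule sbiset_coset_mult[OF s t a that(1) reps_closed[OF that(2)]])
  have sub: "A \<subseteq> carrier G" if "A \<in> (\<lambda>x. snd v #> x) ` D" "D \<subseteq> carrier G" "v \<in> sections G" for A v D
    using that r_coset_subset_G[OF sectionsD(5)[OF that(3)]] by blast
  have D: "sbiset_reps g v \<subseteq> carrier G" for g v by (auto simp: sbiset_reps_def)
  note px = sub[OF _ D s] and py = sub[OF _ D t] and ps = sub[OF _ sectionsD(4)[OF s] s]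
    and pt = sub[OF _ sectionsD(4)[OF t] t] and pu = sub[OF _ sectionsD(4)[OF u] u]
  show ?thesis
  proof (rule tensor_iso[OF sect_quot_group[OF t] X Y, where F = "(<#>)"]; unfold sbiset_simps sect_quot_simps)
    fix A B assume A: "A \<in> (\<lambda>x. snd s #> x) ` sbiset_reps a t" and B: "B \<in> (\<lambda>x. snd t #> x) ` sbiset_reps b u"
    obtain x where x: "A = snd s #> x" "x \<in> sbiset_reps a t" using A by (rule imageE)
    obtain y where y: "B = snd t #> y" "y \<in> sbiset_reps b u" using B by (rule imageE)
    show "A <#> B \<in> (\<lambda>x. snd s #> x) ` sbiset_reps (b \<otimes> a) u"
      unfolding x(1) y(1) xy[OF x(2) y(2)] by (rule imageI[OF sbiset_reps_mult[OF t u c(1) b x(2) y(2)]])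
    show "A <#> M <#> B = A <#> (M <#> B)" if "M \<in> (\<lambda>x. snd t #> x) ` fst t" for M
      by (rule set_mult_assoc[OF px[OF A] pt[OF that] py[OF B]])
    show "M <#> A <#> B = M <#> (A <#> B)" if "M \<in> (\<lambda>x. snd s #> x) ` fst s" for M
      by (rule set_mult_assoc[OF ps[OF that] px[OF A] py[OF B]])
    show "A <#> (B <#> M) = A <#> B <#> M" if "M \<in> (\<lambda>x. snd u #> x) ` fst u" for M
      by (rule set_mult_assoc[OF px[OF A] py[OF B] pu[OF that], symmetric])
    fix A' B' assume A': "A' \<in> (\<lambda>x. snd s #> x) ` sbiset_reps a t" and B': "B' \<in> (\<lambda>x. snd t #> x) ` sbiset_reps b u"
      and e: "A <#> B = A' <#> B'"
    obtain x' where x': "A' = snd s #> x'" "x' \<in> sbiset_reps a t" using A' by (rule imageE)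
    obtain y' where y': "B' = snd t #> y'" "y' \<in> sbiset_reps b u" using B' by (rule imageE)
    note cl = reps_closed[OF x(2)] reps_closed[OF y(2)] reps_closed[OF x'(2)] reps_closed[OF y'(2)]
    have "snd s #> (x \<otimes> y) = snd s #> (x' \<otimes> y')" using e x y x' y' xy by simp
    then obtain v where v: "v \<in> snd s" "x' \<otimes> y' = v \<otimes> (x \<otimes> y)"
      using coset_eq_iff[OF sectionsD(2)[OF s]] cl by (metis m_closed)
    have vc: "v \<in> carrier G" "inv v \<in> snd s" "inv v \<in> fst s"
      using v(1) sectionsD(3,5)[OF s] subgroup.m_inv_closed[OF sectionsD(2)[OF s] v(1)] by auto
    \<comment> \<open>From \<open>x' y' = v x y\<close> the two factorisations differ by \<open>m = x\<^sup>-\<^sup>1 v\<^sup>-\<^sup>1 x'\<close>.\<close>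
    let ?m = "inv x \<otimes> (inv v \<otimes> x')"
    have "inv v \<otimes> x' \<in> sbiset_reps a t" by (rule sbiset_reps_lmult[OF s t a vc(3) x'(2)])
    then have "inv (a \<otimes> x) \<otimes> (a \<otimes> (inv v \<otimes> x')) \<in> fst t"
      using x(2) subgroup.m_closed[OF sectionsD(1)[OF t]] subgroup.m_inv_closed[OF sectionsD(1)[OF t]] by (simp add: sbiset_reps_def)
    moreover have "inv (a \<otimes> x) \<otimes> (a \<otimes> (inv v \<otimes> x')) = ?m" using c cl vc by (simp add: inv_mult_group m_assoc)
    ultimately have m: "?m \<in> fst t" by simp
    have mc: "?m \<in> carrier G" using cl vc by simp
    have 1: "snd s #> x' = snd s #> (x \<otimes> ?m)"
      using coset_eq_iff[OF sectionsD(2)[OF s], of x' "x \<otimes> ?m"] cl vc by auto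
    have "?m \<otimes> y' = inv x \<otimes> (inv v \<otimes> (x' \<otimes> y'))" using cl vc by (simp add: m_assoc)
    then have 2: "?m \<otimes> y' = y" unfolding v(2) using cl vc by simp
    show "\<exists>M\<in>(\<lambda>x. snd t #> x) ` fst t. A' = A <#> M \<and> B = M <#> B'"
    proof (rule bexI[where x = "snd t #> ?m"])
      show "A' = A <#> (snd t #> ?m) \<and> B = (snd t #> ?m) <#> B'"
        unfolding x(1) y(1) x'(1) y'(1) sbiset_coset_mult[OF s t a x(2) mc] quot_mult[OF t m cl(4)] 1 2 by (intro conjI refl)
      show "snd t #> ?m \<in> (\<lambda>x. snd t #> x) ` fst t" by (rule imageI[OF m])
    qed
  next
    fix C assume "C \<in> (\<lambda>x. snd s #> x) ` sbiset_reps (b \<otimes> a) u"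
    then obtain z where z: "C = snd s #> z" "z \<in> sbiset_reps (b \<otimes> a) u" by (rule imageE)
    have zc: "z \<in> carrier G" by (rule reps_closed[OF z(2)])
    have D: "inv a \<in> sbiset_reps a t" "a \<otimes> z \<in> sbiset_reps b u"
      using c z(2) zc subgroup.one_closed[OF sectionsD(1)[OF t]] by (simp_all add: sbiset_reps_def m_assoc)
    show "\<exists>A\<in>(\<lambda>x. snd s #> x) ` sbiset_reps a t. \<exists>B\<in>(\<lambda>x. snd t #> x) ` sbiset_reps b u. C = A <#> B"
    proof (rule bexI[where x = "snd s #> inv a"], rule bexI[where x = "snd t #> (a \<otimes> z)"])
      show "C = (snd s #> inv a) <#> (snd t #> (a \<otimes> z))" using xy[OF D] z(1) c zc by simp
    qed (rule imageI[OF D(2)], rule imageI[OF D(1)])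
  qed
qed

lemma sbiset_coset:
  assumes t: "t \<in> sections G" and a: "a \<in> carrier G" and b: "b \<in> carrier G" and e: "fst t #> a = fst t #> b"
  shows "sbiset s t a = sbiset s t b"
proof -
  obtain m where m: "m \<in> fst t" "b = m \<otimes> a" using e coset_eq_iff[OF sectionsD(1)[OF t] a b] by blast
  have mc: "m \<in> carrier G" "inv m \<in> fst t" using m sectionsD(4)[OF t] subgroup.m_inv_closed[OF sectionsD(1)[OF t]] by auto
  note cl = subgroup.m_closed[OF sectionsD(1)[OF t]]
  have "b \<otimes> x \<in> fst t \<longleftrightarrow> a \<otimes> x \<in> fst t" if x: "x \<in> carrier G" for x
  proof -
    have "b \<otimes> x = m \<otimes> (a \<otimes> x)" "a \<otimes> x = inv m \<otimes> (b \<otimes> x)" using x a m mc by (simp_all add: m_assoc)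
    then show ?thesis using cl[OF m(1), of "a \<otimes> x"] cl[OF mc(2), of "b \<otimes> x"] by metis
  qed
  then have "sbiset_reps a t = sbiset_reps b t" unfolding sbiset_reps_def by (intro Collect_cong conj_cong refl) simp
  then show ?thesis by (simp add: sbiset_def)
qed

lemma hom_biset_id: "s \<in> sections G \<Longrightarrow> hom_biset (sect_quot G s) (\<lambda>x. x) = sbiset s s \<one>"
  by (simp add: hom_biset_def sbiset_def sect_quot_simps sbiset_reps_one fun_eq_iff)

lemma res_biset_sbiset: "t \<in> sections G \<Longrightarrow> res_biset (sect_quot G t) = sbiset (U, snd t) t \<one>"
  by (simp add: res_biset_def sbiset_def sect_quot_simps sbiset_reps_one)

text \<open>In \<open>U/V\<close> the deflated coset \<open>V (L m)\<close> acts from the right as \<open>L m\<close> does.\<close>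

lemma deflation_sbiset:
  assumes s: "s \<in> sections G" and r: "r \<in> sections G" and f: "fst r = fst s" and d: "snd r \<subseteq> snd s"
  shows "biset_iso (sect_quot G s) (sect_quot G r) (sbiset s r \<one>) (hom_biset (sect_quot G s) (\<lambda>A. snd s <#> A))"
proof (rule biset_isoI[where f = "\<lambda>A. A"])
  let ?H = "hom_biset (sect_quot G s) (\<lambda>A. snd s <#> A)"
  have le: "le_by \<one> s r" using s f d by (simp add: le_by_one)
  have so: "snd s #> \<one> = snd s" by (rule coset_mult_one[OF sectionsD(5)[OF s]])
  have r1: "sbiset_reps \<one> r = fst s" using sbiset_reps_one[OF r] f by simp
  show "bij_betw (\<lambda>A. A) (pts (sbiset s r \<one>)) (pts ?H)"
    by (simp add: bij_betw_def hom_biset_def sect_quot_simps r1)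
  show "lact (sbiset s r \<one>) k x = lact ?H k x" for k x
    by (simp add: hom_biset_def sect_quot_simps)
  fix H X assume H: "H \<in> carrier (sect_quot G r)" and X: "X \<in> pts (sbiset s r \<one>)"
  obtain m where m: "H = snd r #> m" "m \<in> fst s" using H unfolding sect_quot_simps f by (rule imageE)
  obtain u where u: "X = snd s #> u" "u \<in> fst s" using X unfolding sbiset_simps r1 by (rule imageE)
  have mc: "m \<in> carrier G" "u \<in> carrier G" "\<one> \<in> fst s"
    using m u sectionsD(4)[OF s] subgroup.one_closed[OF sectionsD(1)[OF s]] by auto
  have "snd s <#> H = snd s #> m"
    using sbiset_coset_mult[OF s r le, of \<one> m] r1 mc so m by simp
  then show "ract (sbiset s r \<one>) X H = ract ?H X H"
    using quot_mult[OF s u(2) mc(1)] sbiset_coset_mult[OF s r le _ mc(1), of u] r1 m u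
    by (simp add: hom_biset_def sect_quot_simps)
qed

text \<open>The map is \<open>V u g\<^sup>-\<^sup>1 \<mapsto> V u\<close>.\<close>

lemma conjugation_sbiset:
  assumes s: "s \<in> sections G" and g: "g \<in> carrier G"
  shows "biset_iso (sect_quot G s) (sect_quot G (sect_conj G g s)) (sbiset s (sect_conj G g s) g)
    (hom_biset (sect_quot G s) (conj_set G (inv g)))"
proof (rule biset_isoI[where f = "\<lambda>A. A #> g"])
  let ?s = "sect_conj G g s" and ?H = "hom_biset (sect_quot G s) (conj_set G (inv g))"
  let ?S = "sbiset s ?s g"
  have s': "?s \<in> sections G" by (rule sect_conj_section[OF s g])
  have le: "le_by g s ?s" using g sectionsD(3)[OF s'] by (simp add: le_by_def sect_le_def)
  have uc: "u \<in> carrier G" if "u \<in> fst s" for u using that sectionsD(4)[OF s] by blast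
  have co: "(snd s #> u) #> h = snd s #> (u \<otimes> h)" if "u \<in> carrier G" "h \<in> carrier G" for u h
    by (rule coset_mult_assoc[OF sectionsD(5)[OF s] that])
  have pH: "pts ?H = (\<lambda>u. snd s #> u) ` fst s" by (simp add: hom_biset_def sect_quot_simps)
  have reps: "sbiset_reps g ?s = (\<lambda>u. u \<otimes> inv g) ` fst s"
  proof (intro equalityI subsetI)
    fix x assume "x \<in> sbiset_reps g ?s"
    then obtain u where u: "x \<in> carrier G" "u \<in> fst s" "g \<otimes> x = g \<otimes> u \<otimes> inv g"
      by (auto simp: sbiset_reps_def sect_conj_def conj_set_image)
    then have "x = u \<otimes> inv g" using g uc[OF u(2)] by (simp add: m_assoc)
    then show "x \<in> (\<lambda>u. u \<otimes> inv g) ` fst s" using u(2) by blast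
  next
    fix x assume "x \<in> (\<lambda>u. u \<otimes> inv g) ` fst s"
    then show "x \<in> sbiset_reps g ?s"
      using g uc by (auto simp: sbiset_reps_def sect_conj_def conj_set_image m_assoc)
  qed
  have pS: "pts ?S = (\<lambda>u. snd s #> (u \<otimes> inv g)) ` fst s" by (simp only: sbiset_simps reps image_image)
  have app: "(snd s #> (u \<otimes> inv g)) #> g = snd s #> u" if "u \<in> fst s" for u
    using co[of "u \<otimes> inv g" g] g uc[OF that] by (simp add: m_assoc)
  have "inj_on (\<lambda>A. A #> g) (pts ?S)"
  proof (rule inj_on_inverseI[where g = "\<lambda>A. A #> inv g"])
    fix A assume "A \<in> pts ?S"
    then obtain u where u: "A = snd s #> (u \<otimes> inv g)" "u \<in> fst s" unfolding pS by (rule imageE)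
    then show "A #> g #> inv g = A" using app[OF u(2)] co[OF uc[OF u(2)], of "inv g"] g by simp
  qed
  moreover have "(\<lambda>A. A #> g) ` pts ?S = pts ?H"
    unfolding pH pS image_image by (rule image_cong) (use app in simp_all)
  ultimately show "bij_betw (\<lambda>A. A #> g) (pts ?S) (pts ?H)" by (simp add: bij_betw_def)
  fix A X assume X: "X \<in> pts ?S"
  obtain u where u: "X = snd s #> (u \<otimes> inv g)" "u \<in> fst s" using X unfolding pS by (rule imageE)
  have ug: "u \<in> carrier G" "u \<otimes> inv g \<in> carrier G" "u \<otimes> inv g \<in> sbiset_reps g ?s" using uc[OF u(2)] u(2) g reps by auto
  {
    assume "A \<in> carrier (sect_quot G s)"
    then obtain w where w: "A = snd s #> w" "w \<in> fst s" unfolding sect_quot_simps by (rule imageE)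
    have "A <#> X = snd s #> ((w \<otimes> u) \<otimes> inv g)"
      using quot_mult[OF s w(2) ug(2)] u w uc[OF w(2)] ug g by (simp add: m_assoc)
    moreover have "w \<otimes> u \<in> fst s" by (rule subgroup.m_closed[OF sectionsD(1)[OF s] w(2) u(2)])
    ultimately have "(A <#> X) #> g = snd s #> (w \<otimes> u)" using app by simp
    then show "lact ?S A X #> g = lact ?H A (X #> g)"
      using quot_mult[OF s w(2) ug(1)] app[OF u(2)] u w by (simp add: hom_biset_def sect_quot_simps)
  next
    assume "A \<in> carrier (sect_quot G ?s)"
    then obtain w' where w': "A = snd ?s #> w'" "w' \<in> fst ?s" unfolding sect_quot_simps by (rule imageE)
    then obtain w where w: "w' = g \<otimes> w \<otimes> inv g" "w \<in> fst s" by (auto simp: sect_conj_def conj_set_image)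
    have wc: "w \<in> carrier G" "w' \<in> carrier G" using w uc g by auto
    have "A = (\<lambda>v. (g \<otimes> v \<otimes> inv g) \<otimes> (g \<otimes> w \<otimes> inv g)) ` snd s"
      unfolding w'(1) w(1) sect_conj_def snd_conv conj_set_image r_coset_def by auto
    also have "\<dots> = (\<lambda>v. g \<otimes> (v \<otimes> w) \<otimes> inv g) ` snd s"
      by (rule image_cong) (use g wc sectionsD(5)[OF s] in \<open>auto simp: m_assoc\<close>)
    also have "\<dots> = conj_set G g (snd s #> w)" unfolding conj_set_image r_coset_def by auto
    finally have "conj_set G (inv g) A = snd s #> w"
      using conj_set_inv(1)[OF g r_coset_subset_G[OF sectionsD(5)[OF s] wc(1)]] by simp
    then have 1: "ract ?H (X #> g) A = snd s #> (u \<otimes> w)"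
      using quot_mult[OF s u(2) wc(1)] app[OF u(2)] u by (simp add: hom_biset_def sect_quot_simps)
    have "X <#> A = snd s #> ((u \<otimes> inv g) \<otimes> w')"
      unfolding u(1) w'(1) by (rule sbiset_coset_mult[OF s s' le ug(3) wc(2)])
    moreover have "(u \<otimes> inv g) \<otimes> w' = (u \<otimes> w) \<otimes> inv g" using w ug wc g by (simp add: m_assoc)
    moreover have "u \<otimes> w \<in> fst s" by (rule subgroup.m_closed[OF sectionsD(1)[OF s] u(2) w(2)])
    ultimately have "(X <#> A) #> g = snd s #> (u \<otimes> w)" using app by simp
    then show "ract ?S X A #> g = ract ?H (X #> g) A" using 1 by simp
  }
qed

abbreviation sbiset_elem :: "'r ring \<Rightarrow> 'a sect \<Rightarrow> 'a sect \<Rightarrow> 'a \<Rightarrow> ('a, 'r) biset_mor" where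
  "sbiset_elem R s t a \<equiv> burnside_elem R (sect_quot G s) (sect_quot G t) (sbiset s t a)"

lemma biset_cat_simps:
  "Obj (biset_cat R G) = sections G"
  "Hom (biset_cat R G) s t = carrier (burnside_module R (sect_quot G t) (sect_quot G s))"
  "Id (biset_cat R G) s = burnside_elem R (sect_quot G s) (sect_quot G s) (hom_biset (sect_quot G s) (\<lambda>x. x))"
  "Comp (biset_cat R G) s t u = burnside_comp R (sect_quot G u) (sect_quot G t) (sect_quot G s)"
  by (simp_all add: biset_cat_def)

context
  fixes R :: "'r ring" and B :: "('a sect, ('a, 'r) biset_mor, 'r, 'b) rmod_functor"
  assumes R: "cring R" and fin: "finite (carrier G)" and B: "is_rmod_functor R (biset_cat R G) B"
begin

lemma sbiset_act_hom:
  assumes s: "s \<in> sections G" and t: "t \<in> sections G" and a: "le_by a s t"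
  shows "act B t s (sbiset_elem R s t a) \<in> mod_hom R (ob B t) (ob B s)"
  using functorD(2)[OF B, of t s] s t burnside_elem_closed[OF R sbiset_finite[OF fin s t a]]
  by (simp add: biset_cat_simps)

lemma sbiset_act_comp:
  assumes s: "s \<in> sections G" and t: "t \<in> sections G" and u: "u \<in> sections G" and a: "le_by a s t" and b: "le_by b t u"
    and x: "x \<in> carrier (ob B u)"
  shows "act B t s (sbiset_elem R s t a) (act B u t (sbiset_elem R t u b) x) = act B u s (sbiset_elem R s u (b \<otimes> a)) x"
proof -
  note X = sbiset_finite[OF fin s t a] and Y = sbiset_finite[OF fin t u b]
  note grp = sect_quot_group[OF s] sect_quot_group[OF t] sect_quot_group[OF u]
  have "act B t s (sbiset_elem R s t a) (act B u t (sbiset_elem R t u b) x) =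
      act B u s (burnside_comp R (sect_quot G s) (sect_quot G t) (sect_quot G u) (sbiset_elem R s t a) (sbiset_elem R t u b)) x"
    using functorD(5)[OF B, of u t s, symmetric] s t u x burnside_elem_closed[OF R X] burnside_elem_closed[OF R Y]
    by (simp add: biset_cat_simps)
  also have "\<dots> = act B u s (sbiset_elem R s u (b \<otimes> a)) x"
    unfolding burnside_comp_elem[OF R grp X Y]
      burnside_elem_iso[OF tensor_finite[OF grp X Y] sbiset_tensor[OF fin s t u a b]] ..
  finally show ?thesis .
qed

text \<open>The restriction, the deflation and the conjugation are the bisets with labels \<open>1\<close>, \<open>1\<close> and \<open>g\<close>, so their
  composite has label \<open>g\<close>.\<close>

lemma biset_act_sbiset:
  assumes s: "s \<in> sections G" and t: "t \<in> sections G" and g: "le_by g s t" and x: "x \<in> carrier (ob B t)"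
  shows "biset_act R G B t s g x = act B t s (sbiset_elem R s t g) x"
proof -
  have gc: "g \<in> carrier G" using g by (simp add: le_by_def)
  define s' where "s' = sect_conj G g s"
  define r where "r = (fst s', snd t)"
  have s': "s' \<in> sections G" unfolding s'_def by (rule sect_conj_section[OF s gc])
  have inc: "snd t \<subseteq> snd s'" "fst s' \<subseteq> fst t" using g by (auto simp: le_by_def sect_le_def s'_def)
  have r: "r \<in> sections G"
    unfolding r_def sections_iff
  proof (intro conjI ballI)
    show "snd t \<subseteq> fst s'" by (rule order_trans[OF inc(1) sectionsD(3)[OF s']])
    show "w \<otimes> v \<otimes> inv w \<in> snd t" if "w \<in> fst s'" "v \<in> snd t" for w v
      by (rule sectionsD(6)[OF t subsetD[OF inc(2) that(1)] that(2)])
  qed (rule sectionsD(1)[OF s'], rule sectionsD(2)[OF t])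
  have le: "le_by \<one> r t" "le_by \<one> s' r" "le_by g s s'"
    using inc le_by_one[OF r] le_by_one[OF s'] gc sectionsD(3)[OF s'] by (simp_all add: r_def le_by_def[of g] sect_le_def s'_def)
  have e1: "burnside_elem R (sect_quot G r) (sect_quot G t) (res_biset (sect_quot G t)) = sbiset_elem R r t \<one>"
    using res_biset_sbiset[OF t, of "fst r"] by (simp add: r_def)
  have e2: "burnside_elem R (sect_quot G s') (sect_quot G r) (hom_biset (sect_quot G s') (\<lambda>A. snd s' <#> A)) = sbiset_elem R s' r \<one>"
    by (rule burnside_elem_iso[symmetric, OF sbiset_finite[OF fin s' r le(2)] deflation_sbiset[OF s' r]])
      (use inc in \<open>simp_all add: r_def\<close>)
  have e3: "burnside_elem R (sect_quot G s) (sect_quot G s') (hom_biset (sect_quot G s) (conj_set G (inv g))) = sbiset_elem R s s' g"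
    by (rule burnside_elem_iso[symmetric, OF sbiset_finite[OF fin s s' le(3)] conjugation_sbiset[OF s gc, folded s'_def]])
  have 1: "le_by \<one> s' t" using le_by_comp[OF s' r le(2,1)] by simp
  have "biset_act R G B t s g x = act B s' s (sbiset_elem R s s' g)
      (act B r s' (sbiset_elem R s' r \<one>) (act B t r (sbiset_elem R r t \<one>) x))"
    unfolding biset_act_def Let_def s'_def[symmetric] r_def[symmetric] e1 e2 e3 by simp
  also have "\<dots> = act B s' s (sbiset_elem R s s' g) (act B t s' (sbiset_elem R s' t \<one>) x)"
    using sbiset_act_comp[OF s' r t le(2,1) x] by simp
  also have "\<dots> = act B t s (sbiset_elem R s t g) x"
    using sbiset_act_comp[OF s s' t le(3) 1 x] gc by simp
  finally show ?thesis .
qed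

text \<open>A coset has many representatives \<open>g\<close>, but the biset of \<open>g\<close> depends on the coset only, so the choice in
  the definition of the action is harmless.\<close>

theorem biset_to_destriction_functor:
  "is_rmod_functor R (op_cat (destr_cat G (sections G))) (biset_to_destriction R G B)"
proof -
  let ?F = "biset_to_destriction R G B"
  have ob: "ob ?F = ob B" by (simp add: biset_to_destriction_def)
  have act: "act ?F t s (fst t #> g) x = act B t s (sbiset_elem R s t g) x"
    if s: "s \<in> sections G" and t: "t \<in> sections G" and g: "le_by g s t" and x: "x \<in> carrier (ob B t)" for s t g x
  proof -
    let ?P = "\<lambda>h. h \<in> carrier G \<and> sect_le (sect_conj G h s) t \<and> fst t #> g = fst t #> h"
    have "?P (SOME h. ?P h)" by (rule someI[where P = ?P and x = g]) (use g in \<open>simp add: le_by_def\<close>)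
    then have h: "le_by (SOME h. ?P h) s t" "fst t #> g = fst t #> (SOME h. ?P h)" by (simp_all add: le_by_def)
    have gc: "g \<in> carrier G" "(SOME h. ?P h) \<in> carrier G" using g h(1) by (simp_all add: le_by_def)
    have "act ?F t s (fst t #> g) x = biset_act R G B t s (SOME h. ?P h) x"
      by (simp add: biset_to_destriction_def)
    also have "\<dots> = act B t s (sbiset_elem R s t g) x"
      unfolding biset_act_sbiset[OF s t h(1) x] sbiset_coset[OF t gc h(2)] ..
    finally show ?thesis .
  qed
  have mor: "\<exists>g. le_by g s t \<and> f = fst t #> g" if "f \<in> Hom (destr_cat G (sections G)) s t" for f s t
    using that destr_hom_iff by blast
  have B1: "module R (ob B s)" if "s \<in> sections G" for s
    using functorD(1)[OF B, of s] that by (simp add: biset_cat_simps)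
  show ?thesis unfolding is_rmod_functor_def op_cat_simps destr_cat_simps ob
  proof (intro conjI ballI)
    show "module R (ob B s)" if "s \<in> sections G" for s by (rule B1[OF that])
    show "act ?F t s f \<in> mod_hom R (ob B t) (ob B s)"
      if t: "t \<in> sections G" and s: "s \<in> sections G" and f: "f \<in> Hom (destr_cat G (sections G)) s t" for t s f
    proof -
      obtain g where g: "le_by g s t" "f = fst t #> g" using mor[OF f] by blast
      show ?thesis unfolding g(2)
        by (rule mod_hom_cong[OF sbiset_act_hom[OF s t g(1)] _ B1[OF t]]) (rule act[OF s t g(1)])
    qed
    show "act ?F s s (fst s #> \<one>) x = x" if s: "s \<in> sections G" and x: "x \<in> carrier (ob B s)" for s x
      unfolding act[OF s s le_by_refl[OF s] x] hom_biset_id[OF s, symmetric]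
      using functorD(4)[OF B, of s x] s x by (simp add: biset_cat_simps)
    show "act ?F u s (f <#> h) x = act ?F t s h (act ?F u t f x)"
      if u: "u \<in> sections G" and t: "t \<in> sections G" and s: "s \<in> sections G"
        and f: "f \<in> Hom (destr_cat G (sections G)) t u" and h: "h \<in> Hom (destr_cat G (sections G)) s t"
        and x: "x \<in> carrier (ob B u)" for u t s f h x
    proof -
      obtain b where b: "le_by b t u" "f = fst u #> b" using mor[OF f] by blast
      obtain a where a: "le_by a s t" "h = fst t #> a" using mor[OF h] by blast
      have ac: "a \<in> carrier G" using a by (simp add: le_by_def)
      have y: "act B u t (sbiset_elem R t u b) x \<in> carrier (ob B t)"
        by (rule mod_homD(1)[OF sbiset_act_hom[OF t u b(1)] x])
      show ?thesis
        unfolding a(2) b(2) mor_comp[OF t u ac b(1)] act[OF s u le_by_comp[OF s t a(1) b(1)] x] act[OF t u b(1) x]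
          act[OF s t a(1) y] sbiset_act_comp[OF s t u a(1) b(1) x] ..
    qed
  qed
qed

end

end


section \<open>The comparison of cohomology\<close>

context plain_group
begin

lemma one_elem_abelian: "{\<one>} \<in> elem_abelian G p"
  by (simp add: elem_abelian_def triv_subgroup)

lemma cent_sect_one: "cent_sect {\<one>} = top_section G"
  by (auto simp: cent_sect_def top_section_def centralizer_def)

text \<open>The unique morphism out of the trivial subgroup becomes a restriction from the whole group.\<close>

lemma cent_mor_one:
  assumes E: "E \<in> elem_abelian G p"
  shows "cent_mor {\<one>} E (conj_map G {\<one>} \<one>) = fst (top_section G) #> \<one>"
proof -
  have "conj_set G \<one> {\<one>} \<subseteq> E"
    using E subgroup.one_closed by (auto simp: conj_set_image elem_abelian_def)
  then have "cent_mor {\<one>} E (conj_map G {\<one>} \<one>) = centralizer G {\<one>} #> inv \<one>"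
    by (intro cent_mor_eq) (simp_all add: one_elem_abelian)
  moreover have "centralizer G {\<one>} = fst (top_section G)" using arg_cong[OF cent_sect_one, of fst] by simp
  ultimately show ?thesis by simp
qed

end

theorem theorem1p4:
  fixes R :: "'r ring" and G :: "'g monoid" and p k :: nat
    and F :: "('g sect, 'g set, 'r, 'a) rmod_functor"
    and P :: "nat \<Rightarrow> ('g sect, 'g set, 'r, 'p) rmod_functor"
    and Q :: "nat \<Rightarrow> ('g set, 'g \<Rightarrow> 'g, 'r, 'q) rmod_functor"
  assumes "cring R" and "prime p"
    and "group G" and "finite (carrier G)" and "order G = p ^ k"
    and "destriction_functor R G F \<or>
         (\<exists>B. biset_functor R G B \<and> F = biset_to_destriction R G B)"
    and "projective_resolution R (op_cat (destr_cat G (sections_star G))) (const_functor R) P dP \<epsilon>P"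
    and "projective_resolution R (quillen_cat' G p) (const_ext_zero R G p) Q dQ \<epsilon>Q"
  shows "mod_iso R (destr_cohom_m1 G (sections_star G) F)
                   (quillen_cohom_m1 R G p Q \<epsilon>Q (bar_functor G F)) \<and>
         mod_iso R (destr_cohom_0 G (sections_star G) F)
                   (quillen_cohom R G p Q dQ \<epsilon>Q (bar_functor G F) 0) \<and>
         (\<forall>n\<ge>1. mod_iso R (destr_cohom R G (sections_star G) P dP F n)
                   (quillen_cohom R G p Q dQ \<epsilon>Q (bar_functor G F) n)) \<and>
         mod_iso R (Obs G F) (quillen_cohom R G p Q dQ \<epsilon>Q (bar_functor G F) 0)"
proof -
  interpret G: plain_group G using assms(3) by (simp add: plain_group_def)
  let ?C = "op_cat (destr_cat G (sections_star G))" and ?A = "quillen_cat' G p" and ?B = "bar_functor G F"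
  let ?S = "elem_abelian G p - {{\<one>\<^bsub>G\<^esub>}}"
  have F: "is_rmod_functor R (op_cat (destr_cat G (sections G))) F"
    using assms(6)
  proof
    assume "destriction_functor R G F"
    then show ?thesis by (simp add: destriction_functor_def)
  next
    assume "\<exists>B. biset_functor R G B \<and> F = biset_to_destriction R G B"
    then obtain B where "is_rmod_functor R (biset_cat R G) B" "F = biset_to_destriction R G B"
      unfolding biset_functor_def by blast
    then show ?thesis using G.biset_to_destriction_functor[OF assms(1,4)] by simp
  qed
  interpret pointed_coreflection R ?A ?S ?C G.cent_sect G.cent_mor "G.core p" "G.core_mor p"
      "\<lambda>s. centralizer G (G.core p s) #>\<^bsub>G\<^esub> \<one>\<^bsub>G\<^esub>" "{\<one>\<^bsub>G\<^esub>}" "\<lambda>E. conj_map G {\<one>\<^bsub>G\<^esub>} \<one>\<^bsub>G\<^esub>"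
    by (rule G.sections_coreflection[OF assms(1,2,4,5)])
  have FC: "is_rmod_functor R ?C F"
    by (rule G.destr_functor_restrict[OF F]) (simp add: subset_iff G.sections_star_iff)
  have B: "is_rmod_functor R ?A ?B" by (rule G.bar_functor_functor[OF F])
  have res: "restricts ?B F" by (simp add: restricts_def G.bar_functor_simps)
  have K: "const_ext_zero R G p = const_on R ?S"
    by (simp add: const_ext_zero_def const_on_def quillen_cat_def quillen_on_def)
  note Q = assms(8)[unfolded K]
  then have Qe: "exact_complex R ?A (const_on R ?S) Q dQ \<epsilon>Q" by (simp only: projective_resolution_iff)
  have obe: "ob ?B {\<one>\<^bsub>G\<^esub>} = ob F (top_section G)" by (simp add: G.bar_functor_simps G.cent_sect_one)
  \<comment> \<open>restricting from \<open>G\<close> to a section may be done in two steps, through \<open>(C\<^sub>G(E), E)\<close> for the core \<open>E\<close>\<close>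
  have lim: "to_limit ?B F a = to_lim G (sections_star G) F a" if a: "a \<in> carrier (ob F (top_section G))" for a
  proof -
    have "act F (G.cent_sect (G.core p s)) s (centralizer G (G.core p s) #>\<^bsub>G\<^esub> \<one>\<^bsub>G\<^esub>)
        (act ?B {\<one>\<^bsub>G\<^esub>} (G.core p s) (conj_map G {\<one>\<^bsub>G\<^esub>} \<one>\<^bsub>G\<^esub>) a) = defres G F (top_section G) s a"
      if s: "s \<in> sections_star G" for s
    proof -
      have s': "s \<in> sections G" using s by (simp add: G.sections_star_iff)
      note E = G.core_elem_abelian[OF s', of p]
      note c = G.cent_sect_section[OF E]
      show ?thesis
        using G.destr_act_comp[OF F s' c G.top_section G.core_counit[OF s'] G.le_top[OF c] a]
        unfolding G.bar_functor_simps G.cent_sect_one G.cent_mor_one[OF E] defres_def G.cent_sect_simps by simp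
    qed
    then show ?thesis unfolding to_limit_def to_lim_def by (intro restrict_cong) simp_all
  qed
  have m1: "mod_iso R (destr_cohom_m1 G (sections_star G) F) (quillen_cohom_m1 R G p Q \<epsilon>Q ?B)"
  proof -
    have "Obj ?A = insert {\<one>\<^bsub>G\<^esub>} ?S" using G.one_elem_abelian[of p] by auto
    note iso = cohomology_iso_m1[OF FC B res Qe this]
    have "{a \<in> carrier (ob F (top_section G)). to_limit ?B F a = \<zero>\<^bsub>lim_module ?C F\<^esub>} =
        {a \<in> carrier (ob F (top_section G)). to_lim G (sections_star G) F a = \<zero>\<^bsub>lim_module ?C F\<^esub>}"
      using lim by (intro Collect_cong conj_cong refl) simp
    then show ?thesis using iso unfolding destr_cohom_m1_def quillen_cohom_m1_def Let_def obe by simp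
  qed
  have c0: "mod_iso R (destr_cohom_0 G (sections_star G) F) (quillen_cohom R G p Q dQ \<epsilon>Q ?B 0)"
  proof -
    have "to_limit ?B F ` carrier (ob ?B {\<one>\<^bsub>G\<^esub>}) = to_lim G (sections_star G) F ` carrier (ob F (top_section G))"
      unfolding obe by (rule image_cong[OF refl lim])
    then show ?thesis using cohomology_iso_0[OF FC B res Qe]
      unfolding destr_cohom_0_def quillen_cohom_def Let_def by simp
  qed
  have "mod_iso R (destr_cohom R G (sections_star G) P dP F n) (quillen_cohom R G p Q dQ \<epsilon>Q ?B n)" if n: "n \<ge> 1" for n
  proof -
    obtain j where "n = Suc j" using n by (cases n) auto
    then show ?thesis using cohomology_iso_pos[OF FC B res assms(7) Q, of j]
      unfolding destr_cohom_def Ext_module_def quillen_cohom_def Let_def by simp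
  qed
  then show ?thesis using m1 c0 mod_iso_trans[OF G.Obs_iso_cohom_0[OF assms(1) F] c0] by blast
qed

end
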